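(* Let $q\in(0,1)$ and $n\ge 1$, and identify $C(\mathbb{C}P^n_q)$ with $C^*(F_n)$ (canonical generators $P_{w_i}$, $1\le i\le n+1$, and $S_{f^m_{ij}}$, $1\le i<j\le n+1$, $m\in\mathbb{N}$) and $C(\mathbb{C}P^{n-1}_q)$ with $C^*(F_{n-1})$ (canonical generators $P_{v_i}$, $1\le i\le n$, and $S_{e^m_{ij}}$, $1\le i<j\le n$, $m\in\mathbb{N}$). The map $s_n: C(\mathbb{C}P^{n-1}_q)\to C(\mathbb{C}P^n_q)$ defined on generators by $$P_{v_i}\mapsto P_{w_i}\quad (i=1,\dots,n-1),\qquad P_{v_n}\mapsto P_{w_n}+P_{w_{n+1}},$$ $$S_{e^m_{ij}}\mapsto S_{f^m_{ij}}\quad (j\ne n),\qquad S_{e^m_{i,n}}\mapsto S_{f^m_{i,n}}+S_{f^m_{i,n+1}}\quad (i=1,\dots,n-1)$$ is a splitting of the short exact sequence $$0\to \mathcal{K}\xrightarrow{\,j_n\,} C(\mathbb{C}P^n_q)\xrightarrow{\,q_n\,} C(\mathbb{C}P^{n-1}_q)\to 0,$$ that is, $s_n$ is a well-defined $*$-homomorphism and $q_n\circ s_n=\mathrm{id}$.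
   Context: Graph $C^*$-algebras: for a directed graph $E=(E^0,E^1,r,s)$ with countable vertex set $E^0$, countable edge set $E^1$, range map $r$ and source map $s$, $C^*(E)$ is the universal $C^*$-algebra generated by projections $\{P_v: v\in E^0\}$ and partial isometries $\{S_e: e\in E^1\}$ subject to: $P_vP_w=0$ for $v\ne w$; $S_e^*S_f=0$ for $e\neq f$; $S_e^*S_e=P_{r(e)}$; $S_eS_e^*\le P_{s(e)}$; and $P_v=\sum_{s(e)=v}S_eS_e^*$ for every vertex $v$ with $s^{-1}(v)$ finite and non-empty. The graph $F_n$ has vertices $w_1,\dots,w_{n+1}$ and, for each $1\le i<j\le n+1$, countably infinitely many edges $f^m_{ij}$, $m\in\mathbb{N}$, from $w_i$ to $w_j$ (and no other edges). For $F_{n-1}$ one uses the labels $v_1,\dots,v_n$ for the vertices and $e^m_{ij}$, $1\le i<j\le n$, $m\in\mathbb{N}$, for the edges. In particular $C^*(F_0)=\mathbb{C}$. Quantum projective space: $C(S^{2n+1}_q)$ is the universal $C^*$-algebra generated by $z_0,\dots,z_n$ with relations $z_iz_j=q^{-1}z_jz_i$ for $i<j$, $z_iz_j^*=q^{-1}z_j^*z_i$ for $i\ne j$, $z_i^*z_i=z_iz_i^*+(1-q^2)\sum_{j=i+1}^n z_jz_j^*$ for $0\le i\le n$, and $\sum_{j=0}^n z_jz_j^*=1$; $C(\mathbb{C}P^n_q)$ is the fixed point algebra of the $U(1)$-action $z_i\mapsto wz_i$. It is known (Hong–Szymański) that $C(\mathbb{C}P^n_q)\cong C^*(F_n)$,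 and throughout $C(\mathbb{C}P^n_q)$ is identified with $C^*(F_n)$. The maps in the exact sequence: $\mathcal{K}$ denotes the compact operators; $j_n$ is the inclusion of the closed two-sided ideal $I_{\{w_{n+1}\}}$ generated by $P_{w_{n+1}}$, which is isomorphic to $\mathcal{K}(\ell^2(\{\alpha \text{ a finite path in } F_n: r(\alpha)=w_{n+1}\}))$ via the matrix units $S_\alpha S_\beta^*$. The quotient map $q_n$ is given by $P_{w_{n+1}}\mapsto 0$, $P_{w_i}\mapsto P_{v_i}$ for $1\le i\le n$, $S_{f^m_{i,n+1}}\mapsto 0$ for $1\le i\le n$, and $S_{f^m_{ij}}\mapsto S_{e^m_{ij}}$ for $1\le i<j\le n$. *)

theory Defs
  imports "HOL-Analysis.Analysis" "HOL-Algebra.Module" "Graph_Theory.Arc_Walk"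
begin

section \<open>C*-algebras\<close>

text \<open>
  A (not necessarily unital) complex C*-algebra is a structure with an explicit carrier, extending
  the module record of HOL-Algebra by an involution and a norm. The field \<open>one\<close>
  carries no information unless the algebra is unital in the sense of \<open>unital\<close> below.
\<close>

definition complex_field :: "complex ring" where
  "complex_field = \<lparr>carrier = UNIV, mult = (*), one = 1, zero = 0, add = (+)\<rparr>"

record 'a cstar = "(complex, 'a) module" +
  adj :: "'a \<Rightarrow> 'a"
  nrm :: "'a \<Rightarrow> real"

definition tends_to :: "'a cstar \<Rightarrow> (nat \<Rightarrow> 'a) \<Rightarrow> 'a \<Rightarrow> bool" where
  "tends_to A \<sigma> x \<longleftrightarrow> (\<lambda>k. nrm A (\<sigma> k \<ominus>\<^bsub>A\<^esub> x)) \<longlonglongrightarrow> 0"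

locale cstar_algebra = Module.module complex_field A for A :: "'a cstar" (structure) +
  assumes mult_closed: "\<lbrakk>x \<in> carrier A; y \<in> carrier A\<rbrakk> \<Longrightarrow> x \<otimes> y \<in> carrier A"
    and mult_assoc: "\<lbrakk>x \<in> carrier A; y \<in> carrier A; z \<in> carrier A\<rbrakk>
          \<Longrightarrow> (x \<otimes> y) \<otimes> z = x \<otimes> (y \<otimes> z)"
    and mult_distr_left: "\<lbrakk>x \<in> carrier A; y \<in> carrier A; z \<in> carrier A\<rbrakk>
          \<Longrightarrow> (x \<oplus> y) \<otimes> z = x \<otimes> z \<oplus> y \<otimes> z"
    and mult_distr_right: "\<lbrakk>x \<in> carrier A; y \<in> carrier A; z \<in> carrier A\<rbrakk>
          \<Longrightarrow> z \<otimes> (x \<oplus> y) = z \<otimes> x \<oplus> z \<otimes> y"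
    and smult_mult_left: "\<lbrakk>x \<in> carrier A; y \<in> carrier A\<rbrakk> \<Longrightarrow> (c \<odot> x) \<otimes> y = c \<odot> (x \<otimes> y)"
    and smult_mult_right: "\<lbrakk>x \<in> carrier A; y \<in> carrier A\<rbrakk> \<Longrightarrow> x \<otimes> (c \<odot> y) = c \<odot> (x \<otimes> y)"
    and adj_closed: "x \<in> carrier A \<Longrightarrow> adj A x \<in> carrier A"
    and adj_adj: "x \<in> carrier A \<Longrightarrow> adj A (adj A x) = x"
    and adj_add: "\<lbrakk>x \<in> carrier A; y \<in> carrier A\<rbrakk> \<Longrightarrow> adj A (x \<oplus> y) = adj A x \<oplus> adj A y"
    and adj_smult: "x \<in> carrier A \<Longrightarrow> adj A (c \<odot> x) = cnj c \<odot> adj A x"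
    and adj_mult: "\<lbrakk>x \<in> carrier A; y \<in> carrier A\<rbrakk> \<Longrightarrow> adj A (x \<otimes> y) = adj A y \<otimes> adj A x"
    and nrm_nonneg: "x \<in> carrier A \<Longrightarrow> 0 \<le> nrm A x"
    and nrm_eq_zero: "x \<in> carrier A \<Longrightarrow> nrm A x = 0 \<longleftrightarrow> x = \<zero>"
    and nrm_triangle: "\<lbrakk>x \<in> carrier A; y \<in> carrier A\<rbrakk> \<Longrightarrow> nrm A (x \<oplus> y) \<le> nrm A x + nrm A y"
    and nrm_smult: "x \<in> carrier A \<Longrightarrow> nrm A (c \<odot> x) = cmod c * nrm A x"
    and nrm_mult: "\<lbrakk>x \<in> carrier A; y \<in> carrier A\<rbrakk> \<Longrightarrow> nrm A (x \<otimes> y) \<le> nrm A x * nrm A y"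
    and cstar_identity: "x \<in> carrier A \<Longrightarrow> nrm A (adj A x \<otimes> x) = (nrm A x)\<^sup>2"
    and complete: "\<lbrakk>\<And>k. \<sigma> k \<in> carrier A;
          \<forall>e>0. \<exists>N. \<forall>k\<ge>N. \<forall>l\<ge>N. nrm A (\<sigma> k \<ominus> \<sigma> l) < e\<rbrakk>
          \<Longrightarrow> \<exists>x\<in>carrier A. tends_to A \<sigma> x"

definition unital :: "'a cstar \<Rightarrow> bool" where
  "unital A \<longleftrightarrow> \<one>\<^bsub>A\<^esub> \<in> carrier A \<and>
    (\<forall>x\<in>carrier A. \<one>\<^bsub>A\<^esub> \<otimes>\<^bsub>A\<^esub> x = x \<and> x \<otimes>\<^bsub>A\<^esub> \<one>\<^bsub>A\<^esub> = x)"

definition projection :: "'a cstar \<Rightarrow> 'a \<Rightarrow> bool" where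
  "projection A p \<longleftrightarrow> p \<in> carrier A \<and> adj A p = p \<and> p \<otimes>\<^bsub>A\<^esub> p = p"

definition partial_isometry :: "'a cstar \<Rightarrow> 'a \<Rightarrow> bool" where
  "partial_isometry A s \<longleftrightarrow> s \<in> carrier A \<and> s \<otimes>\<^bsub>A\<^esub> adj A s \<otimes>\<^bsub>A\<^esub> s = s"

definition cstar_le :: "'a cstar \<Rightarrow> 'a \<Rightarrow> 'a \<Rightarrow> bool" where
  "cstar_le A x y \<longleftrightarrow> x \<in> carrier A \<and> y \<in> carrier A \<and> adj A x = x \<and> adj A y = y \<and>
    (\<exists>c\<in>carrier A. y \<ominus>\<^bsub>A\<^esub> x = adj A c \<otimes>\<^bsub>A\<^esub> c)"

definition closed_star_subalgebra :: "'a set \<Rightarrow> 'a cstar \<Rightarrow> bool" where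
  "closed_star_subalgebra B A \<longleftrightarrow> B \<subseteq> carrier A \<and> \<zero>\<^bsub>A\<^esub> \<in> B \<and>
    (\<forall>x\<in>B. \<forall>y\<in>B. x \<oplus>\<^bsub>A\<^esub> y \<in> B \<and> x \<otimes>\<^bsub>A\<^esub> y \<in> B) \<and>
    (\<forall>c. \<forall>x\<in>B. c \<odot>\<^bsub>A\<^esub> x \<in> B) \<and> (\<forall>x\<in>B. adj A x \<in> B) \<and>
    (\<forall>\<sigma> x. (\<forall>k. \<sigma> k \<in> B) \<and> x \<in> carrier A \<and> tends_to A \<sigma> x \<longrightarrow> x \<in> B)"

definition generated_by :: "'a cstar \<Rightarrow> 'a set \<Rightarrow> bool" where
  "generated_by A G \<longleftrightarrow> G \<subseteq> carrier A \<and>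
    (\<forall>B. closed_star_subalgebra B A \<and> G \<subseteq> B \<longrightarrow> B = carrier A)"

definition closed_ideal :: "'a set \<Rightarrow> 'a cstar \<Rightarrow> bool" where
  "closed_ideal I A \<longleftrightarrow> I \<subseteq> carrier A \<and> \<zero>\<^bsub>A\<^esub> \<in> I \<and>
    (\<forall>x\<in>I. \<forall>y\<in>I. x \<oplus>\<^bsub>A\<^esub> y \<in> I) \<and> (\<forall>c. \<forall>x\<in>I. c \<odot>\<^bsub>A\<^esub> x \<in> I) \<and>
    (\<forall>a\<in>carrier A. \<forall>x\<in>I. a \<otimes>\<^bsub>A\<^esub> x \<in> I \<and> x \<otimes>\<^bsub>A\<^esub> a \<in> I) \<and>
    (\<forall>\<sigma> x. (\<forall>k. \<sigma> k \<in> I) \<and> x \<in> carrier A \<and> tends_to A \<sigma> x \<longrightarrow> x \<in> I)"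

definition ideal_generated :: "'a cstar \<Rightarrow> 'a set \<Rightarrow> 'a set" where
  "ideal_generated A G = \<Inter>{I. closed_ideal I A \<and> G \<subseteq> I}"

definition star_hom :: "'a cstar \<Rightarrow> 'b cstar \<Rightarrow> ('a \<Rightarrow> 'b) \<Rightarrow> bool" where
  "star_hom A B \<phi> \<longleftrightarrow> \<phi> \<in> carrier A \<rightarrow> carrier B \<and>
    (\<forall>x\<in>carrier A. \<forall>y\<in>carrier A. \<phi> (x \<oplus>\<^bsub>A\<^esub> y) = \<phi> x \<oplus>\<^bsub>B\<^esub> \<phi> y \<and>
                              \<phi> (x \<otimes>\<^bsub>A\<^esub> y) = \<phi> x \<otimes>\<^bsub>B\<^esub> \<phi> y) \<and>
    (\<forall>c. \<forall>x\<in>carrier A. \<phi> (c \<odot>\<^bsub>A\<^esub> x) = c \<odot>\<^bsub>B\<^esub> \<phi> x) \<and>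
    (\<forall>x\<in>carrier A. \<phi> (adj A x) = adj B (\<phi> x))"

text \<open>\<open>\<phi>\<close> is the one and only *-homomorphism \<open>A \<rightarrow> B\<close> (as a map on the carrier of \<open>A\<close>)
  satisfying \<open>Q\<close>.\<close>

definition unique_star_hom ::
  "'a cstar \<Rightarrow> 'b cstar \<Rightarrow> (('a \<Rightarrow> 'b) \<Rightarrow> bool) \<Rightarrow> ('a \<Rightarrow> 'b) \<Rightarrow> bool" where
  "unique_star_hom A B Q \<phi> \<longleftrightarrow> star_hom A B \<phi> \<and> Q \<phi> \<and>
    (\<forall>\<psi>. star_hom A B \<psi> \<and> Q \<psi> \<longrightarrow> (\<forall>x\<in>carrier A. \<psi> x = \<phi> x))"

definition short_exact ::
  "'k cstar \<Rightarrow> ('k \<Rightarrow> 'a) \<Rightarrow> 'a cstar \<Rightarrow> ('a \<Rightarrow> 'b) \<Rightarrow> 'b cstar \<Rightarrow> bool" where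
  "short_exact K j A p B \<longleftrightarrow> star_hom K A j \<and> star_hom A B p \<and> inj_on j (carrier K) \<and>
    j ` carrier K = {x \<in> carrier A. p x = \<zero>\<^bsub>B\<^esub>} \<and> p ` carrier A = carrier B"


section \<open>Universal C*-algebras\<close>

text \<open>
  \<open>universal_cstar G R A g\<close>: \<open>A\<close> is the universal C*-algebra generated by elements
  \<open>g x\<close> (\<open>x \<in> G\<close>) subject to the relations \<open>R\<close>. HOL cannot quantify over types inside a formula,
  so the test algebras \<open>D\<close> range over all C*-algebras carried by a subset of the type \<open>'u\<close>.
  For countable \<open>G\<close>, any family of elements lies in a separable C*-subalgebra, which
  has at most continuum many elements. Hence as soon as the reals inject into
  \<open>'u\<close>, every separable C*-algebra has a copy carried by \<open>'u\<close>, and this is the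
  universal property against arbitrary C*-algebras.
\<close>

definition universal_cstar ::
  "'g set \<Rightarrow> ('u cstar \<Rightarrow> ('g \<Rightarrow> 'u) \<Rightarrow> bool) \<Rightarrow> 'u cstar \<Rightarrow> ('g \<Rightarrow> 'u) \<Rightarrow> bool" where
  "universal_cstar G R A g \<longleftrightarrow>
    cstar_algebra A \<and> R A g \<and> generated_by A (g ` G) \<and>
    (\<forall>D h. cstar_algebra D \<and> h ` G \<subseteq> carrier D \<and> R D h \<longrightarrow>
      (\<exists>\<phi>. unique_star_hom A D (\<lambda>\<phi>. \<forall>x\<in>G. \<phi> (g x) = h x) \<phi>))"


section \<open>Graph C*-algebras\<close>

text \<open>For an arc \<open>e\<close>, the source \<open>s(e)\<close> is \<open>tail E e\<close> and the range \<open>r(e)\<close> is \<open>head E e\<close>.\<close>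

definition ck_family ::
  "('v, 'e) pre_digraph \<Rightarrow> 'a cstar \<Rightarrow> ('v \<Rightarrow> 'a) \<Rightarrow> ('e \<Rightarrow> 'a) \<Rightarrow> bool" where
  "ck_family E A P S \<longleftrightarrow>
    (\<forall>v\<in>verts E. projection A (P v)) \<and>
    (\<forall>e\<in>arcs E. partial_isometry A (S e)) \<and>
    (\<forall>v\<in>verts E. \<forall>w\<in>verts E. v \<noteq> w \<longrightarrow> P v \<otimes>\<^bsub>A\<^esub> P w = \<zero>\<^bsub>A\<^esub>) \<and>
    (\<forall>e\<in>arcs E. \<forall>f\<in>arcs E. e \<noteq> f \<longrightarrow> adj A (S e) \<otimes>\<^bsub>A\<^esub> S f = \<zero>\<^bsub>A\<^esub>) \<and>
    (\<forall>e\<in>arcs E. adj A (S e) \<otimes>\<^bsub>A\<^esub> S e = P (head E e)) \<and>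
    (\<forall>e\<in>arcs E. cstar_le A (S e \<otimes>\<^bsub>A\<^esub> adj A (S e)) (P (tail E e))) \<and>
    (\<forall>v\<in>verts E. finite (out_arcs E v) \<and> out_arcs E v \<noteq> {} \<longrightarrow>
      P v = (\<Oplus>\<^bsub>A\<^esub>e\<in>out_arcs E v. S e \<otimes>\<^bsub>A\<^esub> adj A (S e)))"

text \<open>\<open>A\<close> is \<open>C*(E)\<close> with canonical generators \<open>P\<close>, \<open>S\<close>; meant for directed
  graphs with countably many vertices and arcs.\<close>

definition graph_cstar ::
  "('v, 'e) pre_digraph \<Rightarrow> 'u cstar \<Rightarrow> ('v \<Rightarrow> 'u) \<Rightarrow> ('e \<Rightarrow> 'u) \<Rightarrow> bool" where
  "graph_cstar E A P S \<longleftrightarrow>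
    universal_cstar (verts E <+> arcs E)
      (\<lambda>D g. ck_family E D (\<lambda>v. g (Inl v)) (\<lambda>e. g (Inr e))) A (case_sum P S)"

text \<open>The arc \<open>(i, j, m)\<close> is the edge \<open>f^m_{ij}\<close> from \<open>w_i\<close> to \<open>w_j\<close>.\<close>

definition F :: "nat \<Rightarrow> (nat, nat \<times> nat \<times> nat) pre_digraph" where
  "F n = \<lparr>verts = {1..n+1},
          arcs = {(i, j, m). 1 \<le> i \<and> i < j \<and> j \<le> n + 1},
          tail = (\<lambda>(i, j, m). i),
          head = (\<lambda>(i, j, m). j)\<rparr>"

lemma wf_digraph_F: "wf_digraph (F n)"
  by unfold_locales (auto simp: F_def)

lemma countable_F: "countable (verts (F n))" "countable (arcs (F n))"
  by simp_all

text \<open>Finite paths ending in \<open>w\<close>. A path is the list of its arcs; since its end is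
  fixed, the empty list unambiguously is the path of length zero at \<open>w\<close>.\<close>

definition paths_to :: "('v, 'e) pre_digraph \<Rightarrow> 'v \<Rightarrow> 'e list set" where
  "paths_to E w = {\<alpha>. \<exists>u. pre_digraph.awalk E u \<alpha> w}"

text \<open>\<open>S_\<alpha>\<close> for a path \<open>\<alpha>\<close> ending in \<open>w\<close>.\<close>

fun path_elt :: "'a cstar \<Rightarrow> ('v \<Rightarrow> 'a) \<Rightarrow> ('e \<Rightarrow> 'a) \<Rightarrow> 'v \<Rightarrow> 'e list \<Rightarrow> 'a" where
  "path_elt A P S w [] = P w"
| "path_elt A P S w [e] = S e"
| "path_elt A P S w (e # f # es) = S e \<otimes>\<^bsub>A\<^esub> path_elt A P S w (f # es)"


section \<open>Quantum projective spaces\<close>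

definition sphere_relations :: "real \<Rightarrow> nat \<Rightarrow> 'a cstar \<Rightarrow> (nat \<Rightarrow> 'a) \<Rightarrow> bool" where
  "sphere_relations q n A z \<longleftrightarrow> unital A \<and>
    (\<forall>i\<le>n. z i \<in> carrier A) \<and>
    (\<forall>i j. i < j \<and> j \<le> n \<longrightarrow>
      z i \<otimes>\<^bsub>A\<^esub> z j = complex_of_real (inverse q) \<odot>\<^bsub>A\<^esub> (z j \<otimes>\<^bsub>A\<^esub> z i)) \<and>
    (\<forall>i\<le>n. \<forall>j\<le>n. i \<noteq> j \<longrightarrow>
      z i \<otimes>\<^bsub>A\<^esub> adj A (z j) = complex_of_real (inverse q) \<odot>\<^bsub>A\<^esub> (adj A (z j) \<otimes>\<^bsub>A\<^esub> z i)) \<and>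
    (\<forall>i\<le>n. adj A (z i) \<otimes>\<^bsub>A\<^esub> z i =
      z i \<otimes>\<^bsub>A\<^esub> adj A (z i) \<oplus>\<^bsub>A\<^esub>
        complex_of_real (1 - q\<^sup>2) \<odot>\<^bsub>A\<^esub> (\<Oplus>\<^bsub>A\<^esub>j\<in>{i+1..n}. z j \<otimes>\<^bsub>A\<^esub> adj A (z j))) \<and>
    (\<Oplus>\<^bsub>A\<^esub>j\<in>{0..n}. z j \<otimes>\<^bsub>A\<^esub> adj A (z j)) = \<one>\<^bsub>A\<^esub>"

definition quantum_sphere :: "real \<Rightarrow> nat \<Rightarrow> 'u cstar \<Rightarrow> (nat \<Rightarrow> 'u) \<Rightarrow> bool" where
  "quantum_sphere q n X z \<longleftrightarrow> universal_cstar {0..n} (sphere_relations q n) X z"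

text \<open>The fixed point algebra of the circle action \<open>z i \<mapsto> w z i\<close>.\<close>

definition circle_fixed :: "nat \<Rightarrow> 'u cstar \<Rightarrow> (nat \<Rightarrow> 'u) \<Rightarrow> 'u cstar" where
  "circle_fixed n X z = X\<lparr>carrier := {x \<in> carrier X. \<forall>w \<gamma>. cmod w = 1 \<and>
     unique_star_hom X X (\<lambda>\<gamma>. \<forall>i\<in>{0..n}. \<gamma> (z i) = w \<odot>\<^bsub>X\<^esub> z i) \<gamma> \<longrightarrow> \<gamma> x = x}\<rparr>"

definition quantum_projective_space :: "real \<Rightarrow> nat \<Rightarrow> 'u cstar \<Rightarrow> bool" where
  "quantum_projective_space q n A \<longleftrightarrow>
    (\<exists>X z. quantum_sphere q n X z \<and> A = circle_fixed n X z)"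


section \<open>Compact operators\<close>

text \<open>\<open>\<ell>\<^sup>2(X)\<close> as the square-summable functions vanishing outside \<open>X\<close>.\<close>

definition ell2 :: "'x set \<Rightarrow> ('x \<Rightarrow> complex) set" where
  "ell2 X = {f. (\<forall>x. x \<notin> X \<longrightarrow> f x = 0) \<and> (\<lambda>x. (cmod (f x))\<^sup>2) summable_on X}"

definition ell2_inner :: "'x set \<Rightarrow> ('x \<Rightarrow> complex) \<Rightarrow> ('x \<Rightarrow> complex) \<Rightarrow> complex" where
  "ell2_inner X f g = (\<Sum>\<^sub>\<infinity>x\<in>X. cnj (f x) * g x)"

definition ell2_norm :: "'x set \<Rightarrow> ('x \<Rightarrow> complex) \<Rightarrow> real" where
  "ell2_norm X f = sqrt (\<Sum>\<^sub>\<infinity>x\<in>X. (cmod (f x))\<^sup>2)"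

text \<open>Operators on \<open>\<ell>\<^sup>2(X)\<close> are extensional functions, so that equality of
  operators is equality of functions.\<close>

type_synonym 'x operator = "('x \<Rightarrow> complex) \<Rightarrow> ('x \<Rightarrow> complex)"

definition bounded_operators :: "'x set \<Rightarrow> 'x operator set" where
  "bounded_operators X = {T \<in> ell2 X \<rightarrow>\<^sub>E ell2 X.
    (\<forall>f\<in>ell2 X. \<forall>g\<in>ell2 X. T (\<lambda>x. f x + g x) = (\<lambda>x. T f x + T g x)) \<and>
    (\<forall>c. \<forall>f\<in>ell2 X. T (\<lambda>x. c * f x) = (\<lambda>x. c * T f x)) \<and>
    (\<exists>b. \<forall>f\<in>ell2 X. ell2_norm X (T f) \<le> b * ell2_norm X f)}"

definition compact_operators :: "'x set \<Rightarrow> 'x operator set" where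
  "compact_operators X = {T \<in> bounded_operators X.
    \<forall>f. (\<forall>k. f k \<in> ell2 X \<and> ell2_norm X (f k) \<le> 1) \<longrightarrow>
      (\<exists>(r :: nat \<Rightarrow> nat) g. strict_mono r \<and> g \<in> ell2 X \<and>
        (\<lambda>k. ell2_norm X (\<lambda>x. T (f (r k)) x - g x)) \<longlonglongrightarrow> 0)}"

definition compact_algebra :: "'x set \<Rightarrow> 'x operator cstar" where
  "compact_algebra X = \<lparr>
    carrier = compact_operators X,
    mult = (\<lambda>T U. compose (ell2 X) T U),
    one = (\<lambda>f\<in>ell2 X. f),
    zero = (\<lambda>f\<in>ell2 X. (\<lambda>x. 0)),
    add = (\<lambda>T U. \<lambda>f\<in>ell2 X. (\<lambda>x. T f x + U f x)),
    smult = (\<lambda>c T. \<lambda>f\<in>ell2 X. (\<lambda>x. c * T f x)),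
    adj = (\<lambda>T. THE U. U \<in> bounded_operators X \<and>
      (\<forall>f\<in>ell2 X. \<forall>g\<in>ell2 X. ell2_inner X (U f) g = ell2_inner X f (T g))),
    nrm = (\<lambda>T. SUP f\<in>{f \<in> ell2 X. ell2_norm X f \<le> 1}. ell2_norm X (T f))\<rparr>"

text \<open>The rank one operator taking the basis vector at \<open>\<beta>\<close> to the one at \<open>\<alpha>\<close>.\<close>

definition matrix_unit :: "'x set \<Rightarrow> 'x \<Rightarrow> 'x \<Rightarrow> 'x operator" where
  "matrix_unit X \<alpha> \<beta> = (\<lambda>f\<in>ell2 X. (\<lambda>x. if x = \<alpha> then f \<beta> else 0))"


section \<open>The maps of the exact sequence\<close>

text \<open>In all three, \<open>P\<close>, \<open>S\<close> are the generators of \<open>C*(F n)\<close> and \<open>P'\<close>, \<open>S'\<close> those of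
  \<open>C*(F (n - 1))\<close>.\<close>

definition j_values ::
  "nat \<Rightarrow> 'u cstar \<Rightarrow> (nat \<Rightarrow> 'u) \<Rightarrow> (nat \<times> nat \<times> nat \<Rightarrow> 'u) \<Rightarrow>
   ((nat \<times> nat \<times> nat) list operator \<Rightarrow> 'u) \<Rightarrow> bool" where
  "j_values n A P S j \<longleftrightarrow>
    (\<forall>\<alpha>\<in>paths_to (F n) (n + 1). \<forall>\<beta>\<in>paths_to (F n) (n + 1).
      j (matrix_unit (paths_to (F n) (n + 1)) \<alpha> \<beta>) =
        path_elt A P S (n + 1) \<alpha> \<otimes>\<^bsub>A\<^esub> adj A (path_elt A P S (n + 1) \<beta>))"

definition q_values ::
  "nat \<Rightarrow> (nat \<Rightarrow> 'u) \<Rightarrow> (nat \<times> nat \<times> nat \<Rightarrow> 'u) \<Rightarrow>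
   'u cstar \<Rightarrow> (nat \<Rightarrow> 'u) \<Rightarrow> (nat \<times> nat \<times> nat \<Rightarrow> 'u) \<Rightarrow> ('u \<Rightarrow> 'u) \<Rightarrow> bool" where
  "q_values n P S B P' S' p \<longleftrightarrow>
    p (P (n + 1)) = \<zero>\<^bsub>B\<^esub> \<and>
    (\<forall>i. 1 \<le> i \<and> i \<le> n \<longrightarrow> p (P i) = P' i) \<and>
    (\<forall>i m. 1 \<le> i \<and> i \<le> n \<longrightarrow> p (S (i, n + 1, m)) = \<zero>\<^bsub>B\<^esub>) \<and>
    (\<forall>i j m. 1 \<le> i \<and> i < j \<and> j \<le> n \<longrightarrow> p (S (i, j, m)) = S' (i, j, m))"

definition s_values ::
  "nat \<Rightarrow> (nat \<Rightarrow> 'u) \<Rightarrow> (nat \<times> nat \<times> nat \<Rightarrow> 'u) \<Rightarrow>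
   'u cstar \<Rightarrow> (nat \<Rightarrow> 'u) \<Rightarrow> (nat \<times> nat \<times> nat \<Rightarrow> 'u) \<Rightarrow> ('u \<Rightarrow> 'u) \<Rightarrow> bool" where
  "s_values n P' S' A P S s \<longleftrightarrow>
    (\<forall>i. 1 \<le> i \<and> i \<le> n - 1 \<longrightarrow> s (P' i) = P i) \<and>
    s (P' n) = P n \<oplus>\<^bsub>A\<^esub> P (n + 1) \<and>
    (\<forall>i j m. 1 \<le> i \<and> i < j \<and> j \<le> n \<and> j \<noteq> n \<longrightarrow> s (S' (i, j, m)) = S (i, j, m)) \<and>
    (\<forall>i m. 1 \<le> i \<and> i \<le> n - 1 \<longrightarrow> s (S' (i, n, m)) = S (i, n, m) \<oplus>\<^bsub>A\<^esub> S (i, n + 1, m))"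

end

theory Submission
  imports Defs
begin

text \<open>
  The maps \<open>p\<close> and \<open>s\<close> come from the universal properties: the prescribed images form Cuntz--Krieger
  families. For \<open>s\<close> this uses \<open>P\<^sub>v S\<^sub>e = S\<^sub>e\<close> for \<open>v\<close> the source of \<open>e\<close>, which follows from
  \<open>S\<^sub>e S\<^sub>e\<^sup>* \<le> P\<^sub>v\<close> by a positivity argument. Since \<open>p \<circ> s\<close> fixes the generators, it is the identity,
  and no quotient algebra is needed for exactness: the elements \<open>x\<close> with \<open>x - s (p x)\<close> in the ideal
  generated by the projection at the sink form a closed *-subalgebra containing the generators, so
  the ideal is the kernel of \<open>p\<close>.

  The elements \<open>S\<^sub>\<alpha> S\<^sub>\<beta>\<^sup>*\<close>, for paths ending at the sink, are matrix units spanning a dense subspace of the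
  ideal. *-homomorphisms are contractive, so the map on finite matrices extends to the compact
  operators. It is isometric because the graph acts on \<open>\<ell>\<^sup>2\<close> of the paths by shifts: the bounded operators
  have a copy carried by a type into which the reals inject, and the resulting representation is a
  left inverse on the compacts.
\<close>

section \<open>C*-algebras\<close>

text \<open>The quantum projective spaces supply one fact: \<open>A\<close> and \<open>B\<close>
  have a unit, because the sum that expresses the unit of the sphere algebra is fixed by the circle
  action. The norm estimates behind contractivity and positivity are carried out with this unit. The
  obstacle is that the order is given by elements \<open>c*c\<close>, while the proof works without
  spectra. Positivity is replaced by a norm condition under which sums and squares are easy to
  handle; what then has to be recovered is that \<open>- c*c\<close> satisfies it only for
  \<open>c = 0\<close>. No vertex of \<open>F n\<close> emits a finite nonzero number of edges, so
  the summation relation is vacuous for every family built here, and the remaining relations are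
  checked edge by edge. Compactness is defined by convergent subsequences. It is first turned into
  approximability in norm by finite matrices, after which closure under the operations, completeness
  and the construction of maps out of the compacts all follow from density arguments.\<close>

lemma complex_field_simps [simp]:
  "carrier complex_field = UNIV" "mult complex_field = (*)" "one complex_field = 1"
  "zero complex_field = 0" "add complex_field = (+)"
  by (simp_all add: complex_field_def)

lemma cring_complex_field: "cring complex_field"
proof (rule cringI)
  show "abelian_group complex_field"
    by (rule abelian_groupI) (auto intro: exI[of _ "- x" for x])
  show "comm_monoid complex_field"
    by (rule comm_monoidI) auto
qed (auto simp: algebra_simps)

text \<open>One flat list of laws serves the bounded operators, their subalgebras and transported
  copies. Additive inverses are not supplied: \<open>(-1) \<odot> x\<close> is one, by
  \<open>one_smult\<close> and \<open>zero_smult\<close>. Completeness is therefore stated with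
  \<open>(-1) \<odot>\<close>, since \<open>\<ominus>\<close> can be handled only once inverses are
  known.\<close>

lemma cstar_algebraI:
  fixes A :: "'a cstar" (structure)
  assumes add: "\<And>x y. \<lbrakk>x \<in> carrier A; y \<in> carrier A\<rbrakk> \<Longrightarrow> x \<oplus> y \<in> carrier A"
    and zero: "\<zero> \<in> carrier A"
    and add_assoc: "\<And>x y z. \<lbrakk>x \<in> carrier A; y \<in> carrier A; z \<in> carrier A\<rbrakk>
          \<Longrightarrow> (x \<oplus> y) \<oplus> z = x \<oplus> (y \<oplus> z)"
    and add_comm: "\<And>x y. \<lbrakk>x \<in> carrier A; y \<in> carrier A\<rbrakk> \<Longrightarrow> x \<oplus> y = y \<oplus> x"
    and add_zero: "\<And>x. x \<in> carrier A \<Longrightarrow> \<zero> \<oplus> x = x"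
    and smult: "\<And>c x. x \<in> carrier A \<Longrightarrow> c \<odot> x \<in> carrier A"
    and smult_add_left: "\<And>c d x. x \<in> carrier A \<Longrightarrow> (c + d) \<odot> x = c \<odot> x \<oplus> d \<odot> x"
    and smult_add_right: "\<And>c x y. \<lbrakk>x \<in> carrier A; y \<in> carrier A\<rbrakk>
          \<Longrightarrow> c \<odot> (x \<oplus> y) = c \<odot> x \<oplus> c \<odot> y"
    and smult_smult: "\<And>c d x. x \<in> carrier A \<Longrightarrow> (c * d) \<odot> x = c \<odot> (d \<odot> x)"
    and one_smult: "\<And>x. x \<in> carrier A \<Longrightarrow> 1 \<odot> x = x"
    and zero_smult: "\<And>x. x \<in> carrier A \<Longrightarrow> 0 \<odot> x = \<zero>"
    and mult: "\<And>x y. \<lbrakk>x \<in> carrier A; y \<in> carrier A\<rbrakk> \<Longrightarrow> x \<otimes> y \<in> carrier A"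
    and mult_assoc: "\<And>x y z. \<lbrakk>x \<in> carrier A; y \<in> carrier A; z \<in> carrier A\<rbrakk>
          \<Longrightarrow> (x \<otimes> y) \<otimes> z = x \<otimes> (y \<otimes> z)"
    and distr_left: "\<And>x y z. \<lbrakk>x \<in> carrier A; y \<in> carrier A; z \<in> carrier A\<rbrakk>
          \<Longrightarrow> (x \<oplus> y) \<otimes> z = x \<otimes> z \<oplus> y \<otimes> z"
    and distr_right: "\<And>x y z. \<lbrakk>x \<in> carrier A; y \<in> carrier A; z \<in> carrier A\<rbrakk>
          \<Longrightarrow> z \<otimes> (x \<oplus> y) = z \<otimes> x \<oplus> z \<otimes> y"
    and smult_mult_left: "\<And>c x y. \<lbrakk>x \<in> carrier A; y \<in> carrier A\<rbrakk> \<Longrightarrow> (c \<odot> x) \<otimes> y = c \<odot> (x \<otimes> y)"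
    and smult_mult_right: "\<And>c x y. \<lbrakk>x \<in> carrier A; y \<in> carrier A\<rbrakk> \<Longrightarrow> x \<otimes> (c \<odot> y) = c \<odot> (x \<otimes> y)"
    and adj: "\<And>x. x \<in> carrier A \<Longrightarrow> adj A x \<in> carrier A"
    and adj_adj: "\<And>x. x \<in> carrier A \<Longrightarrow> adj A (adj A x) = x"
    and adj_add: "\<And>x y. \<lbrakk>x \<in> carrier A; y \<in> carrier A\<rbrakk> \<Longrightarrow> adj A (x \<oplus> y) = adj A x \<oplus> adj A y"
    and adj_smult: "\<And>c x. x \<in> carrier A \<Longrightarrow> adj A (c \<odot> x) = cnj c \<odot> adj A x"
    and adj_mult: "\<And>x y. \<lbrakk>x \<in> carrier A; y \<in> carrier A\<rbrakk> \<Longrightarrow> adj A (x \<otimes> y) = adj A y \<otimes> adj A x"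
    and nrm_nonneg: "\<And>x. x \<in> carrier A \<Longrightarrow> 0 \<le> nrm A x"
    and nrm_eq_zero: "\<And>x. x \<in> carrier A \<Longrightarrow> nrm A x = 0 \<longleftrightarrow> x = \<zero>"
    and nrm_triangle: "\<And>x y. \<lbrakk>x \<in> carrier A; y \<in> carrier A\<rbrakk> \<Longrightarrow> nrm A (x \<oplus> y) \<le> nrm A x + nrm A y"
    and nrm_smult: "\<And>c x. x \<in> carrier A \<Longrightarrow> nrm A (c \<odot> x) = cmod c * nrm A x"
    and nrm_mult: "\<And>x y. \<lbrakk>x \<in> carrier A; y \<in> carrier A\<rbrakk> \<Longrightarrow> nrm A (x \<otimes> y) \<le> nrm A x * nrm A y"
    and cstar_identity: "\<And>x. x \<in> carrier A \<Longrightarrow> nrm A (adj A x \<otimes> x) = (nrm A x)\<^sup>2"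
    and complete: "\<And>\<sigma>. \<lbrakk>\<And>k. \<sigma> k \<in> carrier A;
          \<And>e. e > 0 \<Longrightarrow> \<exists>N. \<forall>k\<ge>N. \<forall>l\<ge>N. nrm A (\<sigma> k \<oplus> (-1) \<odot> \<sigma> l) < e\<rbrakk>
          \<Longrightarrow> \<exists>x\<in>carrier A. (\<lambda>k. nrm A (\<sigma> k \<oplus> (-1) \<odot> x)) \<longlonglongrightarrow> 0"
  shows "cstar_algebra A"
proof -
  have minus: "(-1) \<odot> x \<oplus> x = \<zero>" if "x \<in> carrier A" for x
    using smult_add_left[of x "-1" 1] that by (simp add: one_smult zero_smult)
  interpret G: abelian_group A
  proof (rule abelian_groupI)
    show "\<exists>y\<in>carrier A. y \<oplus> x = \<zero>" if "x \<in> carrier A" for x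
      using minus[OF that] smult[OF that] by blast
  qed (fact add zero add_assoc add_comm add_zero)+
  interpret M: Module.module complex_field A
    by (rule moduleI[OF cring_complex_field G.abelian_group_axioms])
      (simp_all add: smult smult_add_left smult_add_right smult_smult one_smult)
  have minus_eq: "x \<ominus> y = x \<oplus> (-1) \<odot> y" if "x \<in> carrier A" "y \<in> carrier A" for x y
    using G.minus_equality[OF minus[of y]] that by (simp add: G.minus_eq smult)
  show ?thesis
  proof (unfold_locales, goal_cases)
    case (18 \<sigma>)
    then have "\<exists>x\<in>carrier A. (\<lambda>k. nrm A (\<sigma> k \<oplus> (-1) \<odot> x)) \<longlonglongrightarrow> 0"
      by (intro complete) (auto simp: minus_eq)
    with 18(1) show ?case by (auto simp: tends_to_def minus_eq)
  qed (simp_all add: assms)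
qed

context cstar_algebra begin

lemma smult_in [simp, intro]: "x \<in> carrier A \<Longrightarrow> c \<odot> x \<in> carrier A"
  using smult_closed[of c x] by simp

lemma smult_add_left: "x \<in> carrier A \<Longrightarrow> (c + d) \<odot> x = c \<odot> x \<oplus> d \<odot> x"
  using smult_l_distr[of c d x] by simp

lemma smult_add_right: "\<lbrakk>x \<in> carrier A; y \<in> carrier A\<rbrakk> \<Longrightarrow> c \<odot> (x \<oplus> y) = c \<odot> x \<oplus> c \<odot> y"
  using smult_r_distr[of c x y] by simp

lemma smult_smult [simp]: "x \<in> carrier A \<Longrightarrow> c \<odot> (d \<odot> x) = (c * d) \<odot> x"
  using smult_assoc1[of c d x] by simp

lemma one_smult [simp]: "x \<in> carrier A \<Longrightarrow> 1 \<odot> x = x"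
  using smult_one[of x] by simp

lemma zero_smult [simp]: "x \<in> carrier A \<Longrightarrow> 0 \<odot> x = \<zero>"
  using smult_l_null[of x] by simp

lemma smult_zero [simp]: "c \<odot> \<zero> = \<zero>"
  using smult_r_null[of c] by simp

declare mult_closed [simp, intro] adj_closed [simp, intro] adj_adj [simp]

lemma uminus_eq_smult: assumes "x \<in> carrier A" shows "\<ominus> x = (-1) \<odot> x"
  using M.minus_equality[of "(-1) \<odot> x" x] smult_add_left[of x "-1" 1] assms by simp

lemma minus_eq_smult: "\<lbrakk>x \<in> carrier A; y \<in> carrier A\<rbrakk> \<Longrightarrow> x \<ominus> y = x \<oplus> (-1) \<odot> y"
  by (simp add: M.minus_eq uminus_eq_smult)

lemma mult_zero [simp]: assumes "x \<in> carrier A" shows "x \<otimes> \<zero> = \<zero>" "\<zero> \<otimes> x = \<zero>"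
  using smult_mult_right[of x \<zero> 0] smult_mult_left[of \<zero> x 0] assms by simp_all

lemma adj_zero [simp]: "adj A \<zero> = \<zero>"
  using adj_smult[of \<zero> 0] by simp

lemma adj_minus: "\<lbrakk>x \<in> carrier A; y \<in> carrier A\<rbrakk> \<Longrightarrow> adj A (x \<ominus> y) = adj A x \<ominus> adj A y"
  by (simp add: minus_eq_smult adj_add adj_smult)

lemma smult_minus: "\<lbrakk>x \<in> carrier A; y \<in> carrier A\<rbrakk> \<Longrightarrow> c \<odot> (x \<ominus> y) = c \<odot> x \<ominus> c \<odot> y"
  by (simp add: minus_eq_smult smult_add_right)

lemma minus_mult: "\<lbrakk>x \<in> carrier A; y \<in> carrier A; z \<in> carrier A\<rbrakk> \<Longrightarrow> (x \<ominus> y) \<otimes> z = x \<otimes> z \<ominus> y \<otimes> z"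
  by (simp add: minus_eq_smult mult_distr_left smult_mult_left)

lemma mult_minus: "\<lbrakk>x \<in> carrier A; y \<in> carrier A; z \<in> carrier A\<rbrakk> \<Longrightarrow> z \<otimes> (x \<ominus> y) = z \<otimes> x \<ominus> z \<otimes> y"
  by (simp add: minus_eq_smult mult_distr_right smult_mult_right)

lemma minus_add_cancel: "\<lbrakk>x \<in> carrier A; y \<in> carrier A\<rbrakk> \<Longrightarrow> (x \<ominus> y) \<oplus> y = x"
  by (simp add: M.minus_eq M.a_assoc M.l_neg)

lemma minus_eq_zero_iff: "\<lbrakk>x \<in> carrier A; y \<in> carrier A\<rbrakk> \<Longrightarrow> x \<ominus> y = \<zero> \<longleftrightarrow> x = y"
  by (metis M.l_zero M.minus_eq M.r_neg minus_add_cancel)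

lemma minus_split: "\<lbrakk>x \<in> carrier A; y \<in> carrier A; z \<in> carrier A\<rbrakk> \<Longrightarrow> x \<ominus> z = (x \<ominus> y) \<oplus> (y \<ominus> z)"
  by (simp add: M.minus_eq M.a_assoc M.r_neg1)

lemma add_minus_add:
  "\<lbrakk>a \<in> carrier A; b \<in> carrier A; c \<in> carrier A; d \<in> carrier A\<rbrakk>
    \<Longrightarrow> (a \<oplus> b) \<ominus> (c \<oplus> d) = (a \<ominus> c) \<oplus> (b \<ominus> d)"
  by (simp add: M.minus_eq M.minus_add M.a_ac)

text \<open>The Leibniz splitting of a difference of products. It drives continuity of
  multiplication, the contraction estimate in \<open>square_root\<close> and, in the main theorem,
  closure under products of the set of all \<open>x\<close> for which \<open>x - s (p x)\<close>
  lies in the ideal.\<close>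

lemma mult_minus_mult:
  assumes "a \<in> carrier A" "b \<in> carrier A" "c \<in> carrier A" "d \<in> carrier A"
  shows "a \<otimes> b \<ominus> c \<otimes> d = (a \<ominus> c) \<otimes> b \<oplus> c \<otimes> (b \<ominus> d)"
  using assms minus_split[of "a \<otimes> b" "c \<otimes> b" "c \<otimes> d"] by (simp add: minus_mult mult_minus)

declare nrm_nonneg [simp, intro]

lemma nrm_zero [simp]: "nrm A \<zero> = 0"
  using nrm_eq_zero by simp

lemma nrm_minus_commute: assumes "x \<in> carrier A" "y \<in> carrier A" shows "nrm A (x \<ominus> y) = nrm A (y \<ominus> x)"
proof -
  have "x \<ominus> y = (-1) \<odot> (y \<ominus> x)"
    using assms by (simp add: minus_eq_smult smult_add_right M.a_comm)
  then show ?thesis using assms by (simp add: nrm_smult)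
qed

lemma nrm_diff_triangle:
  assumes "x \<in> carrier A" "y \<in> carrier A" "z \<in> carrier A"
  shows "nrm A (x \<ominus> z) \<le> nrm A (x \<ominus> y) + nrm A (y \<ominus> z)"
  using nrm_triangle[of "x \<ominus> y" "y \<ominus> z"] assms by (simp flip: minus_split)

lemma nrm_minus_triangle:
  assumes "x \<in> carrier A" "y \<in> carrier A"
  shows "nrm A (x \<ominus> y) \<le> nrm A x + nrm A y"
  using nrm_triangle[of x "(-1) \<odot> y"] assms by (simp add: minus_eq_smult nrm_smult)

lemma nrm_le_diff:
  assumes "x \<in> carrier A" "y \<in> carrier A"
  shows "nrm A x \<le> nrm A y + nrm A (x \<ominus> y)"
  using nrm_triangle[of "x \<ominus> y" y] assms by (simp add: minus_add_cancel)

text \<open>The axioms do not state that the involution is isometric. The C*-identity and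
  submultiplicativity give one inequality, which applied to \<open>adj A x\<close> gives the
  other.\<close>

lemma nrm_adj [simp]: assumes "x \<in> carrier A" shows "nrm A (adj A x) = nrm A x"
proof -
  have "nrm A x \<le> nrm A (adj A x)" if "x \<in> carrier A" for x
  proof (cases "nrm A x = 0")
    case False
    have "(nrm A x)\<^sup>2 \<le> nrm A (adj A x) * nrm A x"
      using nrm_mult[of "adj A x" x] that by (simp add: cstar_identity)
    moreover have "nrm A x > 0" using False nrm_nonneg[OF that] by linarith
    ultimately show ?thesis by (simp add: power2_eq_square)
  qed (use that in auto)
  from this[of x] this[of "adj A x"] assms show ?thesis by simp
qed

lemma mult_adj_eq_zero:
  assumes "x \<in> carrier A" "adj A x \<otimes> x = \<zero>" shows "x = \<zero>"
  using cstar_identity[of x] assms nrm_eq_zero[of x] by simp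

lemma tends_to_const: "x \<in> carrier A \<Longrightarrow> tends_to A (\<lambda>_. x) x"
  by (simp add: tends_to_def M.minus_eq M.r_neg)

lemma tends_to_le:
  assumes "\<And>k. nrm A (\<sigma> k \<ominus> x) \<le> g k" "g \<longlonglongrightarrow> 0" "\<And>k. \<sigma> k \<in> carrier A" "x \<in> carrier A"
  shows "tends_to A \<sigma> x"
  unfolding tends_to_def
  by (rule tendsto_sandwich[OF _ _ tendsto_const assms(2)]) (use assms in \<open>auto intro!: always_eventually\<close>)

lemma tends_to_unique:
  assumes "tends_to A \<sigma> x" "tends_to A \<sigma> y" "\<And>k. \<sigma> k \<in> carrier A" "x \<in> carrier A" "y \<in> carrier A"
  shows "x = y"
proof -
  have "(\<lambda>k. nrm A (\<sigma> k \<ominus> x) + nrm A (\<sigma> k \<ominus> y)) \<longlonglongrightarrow> 0 + 0"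
    using assms(1,2) unfolding tends_to_def by (rule tendsto_add)
  moreover have "nrm A (x \<ominus> y) \<le> nrm A (\<sigma> k \<ominus> x) + nrm A (\<sigma> k \<ominus> y)" for k
    using nrm_diff_triangle[of x "\<sigma> k" y] nrm_minus_commute[of x "\<sigma> k"] assms by simp
  ultimately have "nrm A (x \<ominus> y) \<le> 0"
    by (intro LIMSEQ_le_const) auto
  then have "nrm A (x \<ominus> y) = 0" using assms(4,5) by (intro antisym) auto
  then show ?thesis using assms(4,5) nrm_eq_zero[of "x \<ominus> y"] by (simp add: minus_eq_zero_iff)
qed

lemma tends_to_add:
  assumes "tends_to A \<sigma> x" "tends_to A \<tau> y" "\<And>k. \<sigma> k \<in> carrier A" "\<And>k. \<tau> k \<in> carrier A"
    "x \<in> carrier A" "y \<in> carrier A"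
  shows "tends_to A (\<lambda>k. \<sigma> k \<oplus> \<tau> k) (x \<oplus> y)"
proof (rule tends_to_le)
  show "nrm A (\<sigma> k \<oplus> \<tau> k \<ominus> (x \<oplus> y)) \<le> nrm A (\<sigma> k \<ominus> x) + nrm A (\<tau> k \<ominus> y)" for k
    using nrm_triangle[of "\<sigma> k \<ominus> x" "\<tau> k \<ominus> y"] assms by (simp add: add_minus_add)
  show "(\<lambda>k. nrm A (\<sigma> k \<ominus> x) + nrm A (\<tau> k \<ominus> y)) \<longlonglongrightarrow> 0"
    using tendsto_add[of _ 0 _ _ 0] assms(1,2) unfolding tends_to_def by fastforce
qed (use assms in auto)

lemma tends_to_smult:
  assumes "tends_to A \<sigma> x" "\<And>k. \<sigma> k \<in> carrier A" "x \<in> carrier A"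
  shows "tends_to A (\<lambda>k. c \<odot> \<sigma> k) (c \<odot> x)"
  using tendsto_mult_left[of _ 0 sequentially "cmod c"] assms
  unfolding tends_to_def by (simp flip: smult_minus add: nrm_smult)

lemma tends_to_adj:
  assumes "tends_to A \<sigma> x" "\<And>k. \<sigma> k \<in> carrier A" "x \<in> carrier A"
  shows "tends_to A (\<lambda>k. adj A (\<sigma> k)) (adj A x)"
  using assms unfolding tends_to_def by (simp flip: adj_minus)

lemma tends_to_mult:
  assumes "tends_to A \<sigma> x" "tends_to A \<tau> y" "\<And>k. \<sigma> k \<in> carrier A" "\<And>k. \<tau> k \<in> carrier A"
    "x \<in> carrier A" "y \<in> carrier A"
  shows "tends_to A (\<lambda>k. \<sigma> k \<otimes> \<tau> k) (x \<otimes> y)"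
proof (rule tends_to_le)
  let ?s = "\<lambda>k. nrm A (\<sigma> k \<ominus> x)" and ?t = "\<lambda>k. nrm A (\<tau> k \<ominus> y)"
  show "nrm A (\<sigma> k \<otimes> \<tau> k \<ominus> x \<otimes> y) \<le> ?s k * (nrm A y + ?t k) + nrm A x * ?t k" for k
  proof -
    have "nrm A (\<sigma> k \<otimes> \<tau> k \<ominus> x \<otimes> y) \<le> ?s k * nrm A (\<tau> k) + nrm A x * ?t k"
      using nrm_triangle[of "(\<sigma> k \<ominus> x) \<otimes> \<tau> k" "x \<otimes> (\<tau> k \<ominus> y)"]
        nrm_mult[of "\<sigma> k \<ominus> x" "\<tau> k"] nrm_mult[of x "\<tau> k \<ominus> y"] assms
      by (simp add: mult_minus_mult)
    moreover have "?s k * nrm A (\<tau> k) \<le> ?s k * (nrm A y + ?t k)"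
      using assms by (intro mult_left_mono nrm_le_diff) auto
    ultimately show ?thesis by linarith
  qed
  show "(\<lambda>k. ?s k * (nrm A y + ?t k) + nrm A x * ?t k) \<longlonglongrightarrow> 0"
    using assms(1,2) unfolding tends_to_def by (auto intro!: tendsto_eq_intros)
qed (use assms in auto)

lemma tends_to_Suc: "tends_to A \<sigma> x \<Longrightarrow> tends_to A (\<lambda>k. \<sigma> (Suc k)) x"
  unfolding tends_to_def by (rule LIMSEQ_Suc)

text \<open>The operations are those of \<open>A\<close>, so only completeness needs an argument:
  limits exist in \<open>A\<close> and closedness brings them back to \<open>B\<close>. This makes
  the compacts, and the finite matrices on a fixed index set, C*-algebras in their own
  right.\<close>

lemma closed_star_subalgebra_cstar:
  assumes "closed_star_subalgebra B A"
  shows "cstar_algebra (A\<lparr>carrier := B\<rparr>)"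
proof -
  have c: "x \<in> carrier A" if "x \<in> B" for x
    using that assms unfolding closed_star_subalgebra_def by auto
  have B: "\<zero> \<in> B" "\<And>x y. \<lbrakk>x \<in> B; y \<in> B\<rbrakk> \<Longrightarrow> x \<oplus> y \<in> B"
    "\<And>x y. \<lbrakk>x \<in> B; y \<in> B\<rbrakk> \<Longrightarrow> x \<otimes> y \<in> B" "\<And>c x. x \<in> B \<Longrightarrow> c \<odot> x \<in> B" "\<And>x. x \<in> B \<Longrightarrow> adj A x \<in> B"
    using assms unfolding closed_star_subalgebra_def by auto
  show ?thesis
  proof (rule cstar_algebraI, goal_cases)
    case (29 \<sigma>)
    then have \<sigma>: "\<And>k. \<sigma> k \<in> B" "\<And>k. \<sigma> k \<in> carrier A" using c by auto
    have "\<exists>x\<in>carrier A. tends_to A \<sigma> x"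
      using 29 \<sigma> by (intro complete) (auto simp: minus_eq_smult)
    then obtain x where x: "x \<in> carrier A" "tends_to A \<sigma> x" by blast
    with assms \<sigma> have "x \<in> B" unfolding closed_star_subalgebra_def by blast
    then show ?case using x \<sigma> by (auto simp: tends_to_def minus_eq_smult)
  qed (simp_all add: B c M.a_ac smult_add_left smult_add_right mult_assoc
      mult_distr_left mult_distr_right smult_mult_left smult_mult_right adj_add adj_smult adj_mult
      nrm_eq_zero nrm_triangle nrm_smult nrm_mult cstar_identity)
qed

end

section \<open>Square roots, contractivity and positivity\<close>

context cstar_algebra begin

lemma Cauchy_tends_to:
  assumes "\<And>k. \<sigma> k \<in> carrier A" "\<And>k m. nrm A (\<sigma> (k + m) \<ominus> \<sigma> k) \<le> b k" "b \<longlonglongrightarrow> 0"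
  shows "\<exists>x\<in>carrier A. tends_to A \<sigma> x"
proof (rule complete)
  show "\<forall>e>0. \<exists>N. \<forall>k\<ge>N. \<forall>l\<ge>N. nrm A (\<sigma> k \<ominus> \<sigma> l) < e"
  proof (intro allI impI)
    fix e :: real assume "e > 0"
    then have "\<forall>\<^sub>F k in sequentially. b k < e / 2"
      using assms(3) by (intro order_tendstoD(2)) auto
    then obtain N where N: "b N < e / 2" by (auto simp: eventually_sequentially)
    have "nrm A (\<sigma> k \<ominus> \<sigma> l) < e" if "k \<ge> N" "l \<ge> N" for k l
    proof -
      have "nrm A (\<sigma> k \<ominus> \<sigma> N) \<le> b N" "nrm A (\<sigma> l \<ominus> \<sigma> N) \<le> b N"
        using assms(2)[of N "k - N"] assms(2)[of N "l - N"] that by simp_all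
      then show ?thesis
        using nrm_diff_triangle[of "\<sigma> k" "\<sigma> N" "\<sigma> l"] nrm_minus_commute[of "\<sigma> l" "\<sigma> N"] N assms(1) by simp
    qed
    then show "\<exists>N. \<forall>k\<ge>N. \<forall>l\<ge>N. nrm A (\<sigma> k \<ominus> \<sigma> l) < e" by blast
  qed
qed (use assms in auto)

text \<open>With a unit adjoined, \<open>1 - e\<close> is a square root of \<open>1 - f\<close>; \<open>e\<close> is the fixed point of the
  contraction \<open>x \<mapsto> (f + x\<^sup>2) / 2\<close>.\<close>

lemma square_root:
  assumes f: "f \<in> carrier A" "adj A f = f" "nrm A f < 1"
  obtains e where "e \<in> carrier A" "adj A e = e" "e \<oplus> e = f \<oplus> e \<otimes> e"
    "\<And>z. \<lbrakk>z \<in> carrier A; z \<otimes> f = f \<otimes> z\<rbrakk> \<Longrightarrow> z \<otimes> e = e \<otimes> z"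
proof -
  \<comment> \<open>\<open>r\<close> is the smaller root of \<open>(nrm A f + r^2) / 2 = r\<close>,
    so \<open>g\<close> maps the ball of radius \<open>r\<close> into itself and is Lipschitz with
    constant \<open>r < 1\<close> there.\<close>
  define r where "r = 1 - sqrt (1 - nrm A f)"
  have r: "0 \<le> r" "r < 1" "(nrm A f + r\<^sup>2) / 2 = r"
    using f by (auto simp: r_def power2_diff field_simps)
  define g where "g x = (1/2) \<odot> (f \<oplus> x \<otimes> x)" for x
  define s where "s k = (g ^^ k) \<zero>" for k
  have s_simps: "s 0 = \<zero>" "s (Suc k) = g (s k)" for k by (simp_all add: s_def)
  have g_in: "x \<in> carrier A \<Longrightarrow> g x \<in> carrier A" for x using f by (simp add: g_def)
  have s_in [simp]: "s k \<in> carrier A" for k by (induction k) (simp_all add: s_simps g_in)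
  have s_le: "nrm A (s k) \<le> r" for k
  proof (induction k)
    case (Suc k)
    have "nrm A (s (Suc k)) \<le> (nrm A f + nrm A (s k) * nrm A (s k)) / 2"
      using nrm_triangle[of f "s k \<otimes> s k"] nrm_mult[of "s k" "s k"] f by (simp add: s_simps g_def nrm_smult norm_divide)
    also have "\<dots> \<le> (nrm A f + r * r) / 2"
      using Suc r by (intro divide_right_mono add_left_mono mult_mono) auto
    finally show ?case using r by (simp add: power2_eq_square)
  qed (use r in \<open>simp add: s_simps\<close>)
  have g_diff: "nrm A (g x \<ominus> g y) \<le> r * nrm A (x \<ominus> y)"
    if "x \<in> carrier A" "y \<in> carrier A" "nrm A x \<le> r" "nrm A y \<le> r" for x y
  proof -
    have "g x \<ominus> g y = (1/2) \<odot> ((x \<ominus> y) \<otimes> x \<oplus> y \<otimes> (x \<ominus> y))"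
      using that f by (simp add: g_def add_minus_add mult_minus_mult M.minus_eq[of f f] M.r_neg flip: smult_minus)
    then have "nrm A (g x \<ominus> g y) \<le> (nrm A (x \<ominus> y) * nrm A x + nrm A y * nrm A (x \<ominus> y)) / 2"
      using nrm_triangle[of "(x \<ominus> y) \<otimes> x" "y \<otimes> (x \<ominus> y)"] nrm_mult[of "x \<ominus> y" x] nrm_mult[of y "x \<ominus> y"] that
      by (simp add: nrm_smult norm_divide)
    also have "\<dots> \<le> (nrm A (x \<ominus> y) * r + r * nrm A (x \<ominus> y)) / 2"
      using that by (intro divide_right_mono add_mono mult_left_mono mult_right_mono) auto
    finally show ?thesis by (simp add: mult.commute)
  qed
  have s_diff: "nrm A (s (Suc k) \<ominus> s k) \<le> r ^ k" for k
  proof (induction k)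
    case 0
    show ?case using nrm_minus_triangle[of "s 1" "s 0"] s_le[of 1] s_in[of 1] r by (simp add: s_simps del: s_in)
  next
    case (Suc k)
    have "nrm A (s (Suc (Suc k)) \<ominus> s (Suc k)) \<le> r * nrm A (s (Suc k) \<ominus> s k)"
      using g_diff[OF s_in s_in s_le s_le, of "Suc k" k] by (simp only: s_simps(2))
    also have "\<dots> \<le> r * r ^ k" using Suc r by (intro mult_left_mono) auto
    finally show ?case by simp
  qed
  \<comment> \<open>The geometric series bound, multiplied out by \<open>1 - r\<close> so that the
    induction telescopes.\<close>
  have "nrm A (s (k + m) \<ominus> s k) * (1 - r) \<le> r ^ k - r ^ (k + m)" for k m
  proof (induction m)
    case 0
    then show ?case by (simp add: M.minus_eq M.r_neg)
  next
    case (Suc m)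
    have "nrm A (s (k + Suc m) \<ominus> s k) * (1 - r) \<le> (r ^ (k + m) + nrm A (s (k + m) \<ominus> s k)) * (1 - r)"
      using nrm_diff_triangle[of "s (k + Suc m)" "s (k + m)" "s k"] s_diff[of "k + m"] r
      by (intro mult_right_mono) auto
    with Suc show ?case by (simp add: algebra_simps)
  qed
  then have "nrm A (s (k + m) \<ominus> s k) * (1 - r) \<le> r ^ k" for k m
    using r(1) zero_le_power[of r "k + m"] by (meson diff_le_eq le_add_same_cancel1 order_trans)
  then have bound: "nrm A (s (k + m) \<ominus> s k) \<le> r ^ k / (1 - r)" for k m
    using r by (simp add: pos_le_divide_eq)
  have "(\<lambda>k. r ^ k / (1 - r)) \<longlonglongrightarrow> 0 / (1 - r)"
    using r by (intro tendsto_divide LIMSEQ_realpow_zero tendsto_const) auto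
  then have "\<exists>e\<in>carrier A. tends_to A s e"
    using bound by (intro Cauchy_tends_to[where b = "\<lambda>k. r ^ k / (1 - r)"]) auto
  then obtain e where e: "e \<in> carrier A" "tends_to A s e" by blast
  have "tends_to A (\<lambda>k. s (Suc k)) (g e)"
    unfolding s_simps g_def using e f
    by (intro tends_to_smult tends_to_add tends_to_mult tends_to_const) auto
  with e tends_to_Suc have "e = g e" by (intro tends_to_unique[where \<sigma> = "\<lambda>k. s (Suc k)"]) (auto simp: g_in)
  then have "e \<oplus> e = f \<oplus> e \<otimes> e"
    using smult_add_left[of "f \<oplus> e \<otimes> e" "1/2" "1/2"] e f by (simp add: g_def)
  moreover have "adj A (s k) = s k" for k
    by (induction k) (use f in \<open>simp_all add: s_simps g_def adj_smult adj_add adj_mult\<close>)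
  then have "adj A e = e" using tends_to_adj[OF e(2)] e by (intro tends_to_unique[of s]) auto
  \<comment> \<open>Commutation with \<open>f\<close> passes to every iterate and then to the limit.
    This clause is what later makes roots commute with the elements they are paired with.\<close>
  moreover have "z \<otimes> e = e \<otimes> z" if z: "z \<in> carrier A" "z \<otimes> f = f \<otimes> z" for z
  proof -
    have "z \<otimes> s k = s k \<otimes> z" for k
    proof (induction k)
      case (Suc k)
      have "z \<otimes> (s k \<otimes> s k) = s k \<otimes> s k \<otimes> z"
        using Suc z by (metis mult_assoc s_in)
      then show ?case using z f
        by (simp add: s_simps g_def smult_mult_left smult_mult_right mult_distr_left mult_distr_right)
    qed (use z in \<open>simp add: s_simps\<close>)
    with tends_to_mult[OF tends_to_const e(2), of z] tends_to_mult[OF e(2) tends_to_const, of z] z e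
    show ?thesis by (intro tends_to_unique[of "\<lambda>k. z \<otimes> s k"]) auto
  qed
  ultimately show thesis using that e by blast
qed

end

locale unital_cstar_algebra = cstar_algebra +
  assumes unital: "unital A"

sublocale unital_cstar_algebra \<subseteq> ring A
proof (rule ringI)
  show "abelian_group A" by (rule M.abelian_group_axioms)
  show "Group.monoid A"
    by (rule monoidI) (use unital in \<open>auto simp: unital_def mult_assoc\<close>)
qed (simp_all add: mult_distr_left mult_distr_right)

context unital_cstar_algebra begin

lemma adj_one [simp]: "adj A \<one> = \<one>"
  by (metis adj_adj adj_closed adj_mult l_one one_closed)

lemma nrm_one_le: "nrm A \<one> \<le> 1"
  using cstar_identity[of \<one>] by (auto simp: power2_eq_square)

text \<open>\<open>a + ib\<close> is a multiple of an isometry.\<close>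

lemma nrm_le_of_sum_squares:
  assumes a: "a \<in> carrier A" "adj A a = a" and b: "b \<in> carrier A" "adj A b = b"
    and ab: "a \<otimes> b = b \<otimes> a" and sum: "a \<otimes> a \<oplus> b \<otimes> b = complex_of_real c \<odot> \<one>" and "c \<ge> 0"
  shows "(nrm A a)\<^sup>2 \<le> c"
proof -
  define u where "u = a \<oplus> \<i> \<odot> b"
  have u: "u \<in> carrier A" using a b by (simp add: u_def)
  have adj_u: "adj A u = a \<oplus> (-\<i>) \<odot> b" using a b by (simp add: u_def adj_add adj_smult)
  have "adj A u \<otimes> u = a \<otimes> a \<oplus> b \<otimes> b \<oplus> (\<i> \<odot> (a \<otimes> b) \<oplus> (-\<i>) \<odot> (a \<otimes> b))"
    unfolding adj_u using a b ab
    by (simp add: u_def mult_distr_left mult_distr_right smult_mult_left smult_mult_right smult_add_right M.a_ac)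
  also have "\<i> \<odot> (a \<otimes> b) \<oplus> (-\<i>) \<odot> (a \<otimes> b) = \<zero>"
    using smult_add_left[of "a \<otimes> b" \<i> "-\<i>"] a b by simp
  finally have "(nrm A u)\<^sup>2 = c * nrm A \<one>"
    using sum u a b \<open>c \<ge> 0\<close> by (simp add: nrm_smult flip: cstar_identity)
  also have "\<dots> \<le> c" using nrm_one_le \<open>c \<ge> 0\<close> by (simp add: mult_left_le)
  finally have u_le: "(nrm A u)\<^sup>2 \<le> c" .
  have "u \<oplus> adj A u = (a \<oplus> a) \<oplus> (\<i> \<odot> b \<oplus> (-\<i>) \<odot> b)"
    unfolding adj_u using a b by (simp add: u_def M.a_ac)
  also have "\<i> \<odot> b \<oplus> (-\<i>) \<odot> b = \<zero>"
    using smult_add_left[of b \<i> "-\<i>"] b by simp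
  also have "a \<oplus> a = 2 \<odot> a" using smult_add_left[of a 1 1] a by simp
  finally have "2 * nrm A a = nrm A (u \<oplus> adj A u)" using a by (simp add: nrm_smult)
  also have "\<dots> \<le> 2 * nrm A u" using nrm_triangle[of u "adj A u"] u by simp
  finally have "nrm A a \<le> nrm A u" by simp
  then have "(nrm A a)\<^sup>2 \<le> (nrm A u)\<^sup>2" using a by (intro power_mono) auto
  with u_le show ?thesis by simp
qed

end

section \<open>Star homomorphisms and their contractivity\<close>

lemma star_homD:
  assumes "star_hom A B \<phi>"
  shows "\<And>x. x \<in> carrier A \<Longrightarrow> \<phi> x \<in> carrier B"
    "\<And>x y. \<lbrakk>x \<in> carrier A; y \<in> carrier A\<rbrakk> \<Longrightarrow> \<phi> (x \<oplus>\<^bsub>A\<^esub> y) = \<phi> x \<oplus>\<^bsub>B\<^esub> \<phi> y"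
    "\<And>x y. \<lbrakk>x \<in> carrier A; y \<in> carrier A\<rbrakk> \<Longrightarrow> \<phi> (x \<otimes>\<^bsub>A\<^esub> y) = \<phi> x \<otimes>\<^bsub>B\<^esub> \<phi> y"
    "\<And>c x. x \<in> carrier A \<Longrightarrow> \<phi> (c \<odot>\<^bsub>A\<^esub> x) = c \<odot>\<^bsub>B\<^esub> \<phi> x"
    "\<And>x. x \<in> carrier A \<Longrightarrow> \<phi> (adj A x) = adj B (\<phi> x)"
  using assms unfolding star_hom_def by auto

lemma star_hom_zero:
  assumes "cstar_algebra A" "cstar_algebra B" "star_hom A B \<phi>"
  shows "\<phi> \<zero>\<^bsub>A\<^esub> = \<zero>\<^bsub>B\<^esub>"
proof -
  interpret A: cstar_algebra A by fact
  interpret B: cstar_algebra B by fact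
  show ?thesis
    using star_homD(4)[OF assms(3), of "\<zero>\<^bsub>A\<^esub>" 0] star_homD(1)[OF assms(3), of "\<zero>\<^bsub>A\<^esub>"] by simp
qed

lemma star_hom_minus:
  assumes "cstar_algebra A" "cstar_algebra B" "star_hom A B \<phi>" "x \<in> carrier A" "y \<in> carrier A"
  shows "\<phi> (x \<ominus>\<^bsub>A\<^esub> y) = \<phi> x \<ominus>\<^bsub>B\<^esub> \<phi> y"
proof -
  interpret A: cstar_algebra A by fact
  interpret B: cstar_algebra B by fact
  show ?thesis
    using assms(4,5) star_homD[OF assms(3)] by (simp add: A.minus_eq_smult B.minus_eq_smult)
qed

text \<open>If \<open>a = a\<^sup>*\<close> has norm less than 1, a square root of \<open>1 - a\<^sup>2\<close> is mapped to one of
  \<open>1 - (\<phi> a)\<^sup>2\<close>, so \<open>\<phi> a\<close> is the real part of an isometry; no spectral theory is needed.\<close>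

theorem star_hom_contractive:
  assumes D: "cstar_algebra D" and A: "unital_cstar_algebra A" and \<phi>: "star_hom D A \<phi>" and x: "x \<in> carrier D"
  shows "nrm A (\<phi> x) \<le> nrm D x"
proof -
  interpret D: cstar_algebra D by fact
  interpret A: unital_cstar_algebra A by fact
  note h = star_homD[OF \<phi>]
  have sa: "nrm A (\<phi> a) \<le> 1" if a: "a \<in> carrier D" "adj D a = a" "nrm D a < 1" for a
  proof -
    have "nrm D (a \<otimes>\<^bsub>D\<^esub> a) < 1"
      using D.nrm_mult[of a a] D.nrm_nonneg[of a] a mult_left_le[of "nrm D a" "nrm D a"] by simp
    then obtain e where e: "e \<in> carrier D" "adj D e = e" "e \<oplus>\<^bsub>D\<^esub> e = a \<otimes>\<^bsub>D\<^esub> a \<oplus>\<^bsub>D\<^esub> e \<otimes>\<^bsub>D\<^esub> e"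
      "a \<otimes>\<^bsub>D\<^esub> e = e \<otimes>\<^bsub>D\<^esub> a"
      using D.square_root[of "a \<otimes>\<^bsub>D\<^esub> a"] a by (metis D.adj_mult D.mult_assoc D.mult_closed)
    define b g where "b = \<phi> a" and "g = \<phi> e"
    have b: "b \<in> carrier A" "adj A b = b" and g: "g \<in> carrier A" "adj A g = g"
      using a e h(1) by (auto simp: b_def g_def simp flip: h(5))
    have bg: "b \<otimes>\<^bsub>A\<^esub> g = g \<otimes>\<^bsub>A\<^esub> b" "g \<oplus>\<^bsub>A\<^esub> g = b \<otimes>\<^bsub>A\<^esub> b \<oplus>\<^bsub>A\<^esub> g \<otimes>\<^bsub>A\<^esub> g"
      using e a h unfolding b_def g_def by (metis, metis D.mult_closed)
    \<comment> \<open>\<open>D\<close> may have no unit, so the root \<open>1 - e\<close> is formed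
      in \<open>A\<close>, after \<open>e\<close> has been mapped across. It commutes with
      \<open>b\<close> and completes \<open>b^2\<close> to a sum of squares equal to 1.\<close>
    define d where "d = \<one>\<^bsub>A\<^esub> \<ominus>\<^bsub>A\<^esub> g"
    have d: "d \<in> carrier A" "adj A d = d" using g by (simp_all add: d_def A.adj_minus)
    have "b \<otimes>\<^bsub>A\<^esub> b \<oplus>\<^bsub>A\<^esub> d \<otimes>\<^bsub>A\<^esub> d = b \<otimes>\<^bsub>A\<^esub> b \<oplus>\<^bsub>A\<^esub> g \<otimes>\<^bsub>A\<^esub> g \<ominus>\<^bsub>A\<^esub> (g \<oplus>\<^bsub>A\<^esub> g) \<oplus>\<^bsub>A\<^esub> \<one>\<^bsub>A\<^esub>"
      unfolding d_def using b g by (simp add: A.ring_simprules A.r_one)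
    also have "\<dots> = \<one>\<^bsub>A\<^esub>"
      unfolding bg(2) using b g by algebra
    finally have sum: "b \<otimes>\<^bsub>A\<^esub> b \<oplus>\<^bsub>A\<^esub> d \<otimes>\<^bsub>A\<^esub> d = complex_of_real 1 \<odot>\<^bsub>A\<^esub> \<one>\<^bsub>A\<^esub>" by simp
    have "b \<otimes>\<^bsub>A\<^esub> d = d \<otimes>\<^bsub>A\<^esub> b" unfolding d_def using b g bg(1) by (simp add: A.minus_mult A.mult_minus)
    from A.nrm_le_of_sum_squares[OF b d this sum] have "(nrm A b)\<^sup>2 \<le> 1" by simp
    then show ?thesis using abs_square_le_1[of "nrm A b"] b by (simp add: b_def)
  qed
  \<comment> \<open>The general case reduces to the self-adjoint \<open>y\<close> by the
    C*-identity; scaling by \<open>1 / t\<close> for every \<open>t\<close> above its norm provides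
    the strict bound that \<open>sa\<close> asks for.\<close>
  define y where "y = adj D x \<otimes>\<^bsub>D\<^esub> x"
  have y: "y \<in> carrier D" "adj D y = y" using x by (simp_all add: y_def D.adj_mult)
  have "nrm A (\<phi> y) \<le> t" if t: "t > nrm D y" for t
  proof -
    have "t > 0" using t D.nrm_nonneg[of y] y by linarith
    have "nrm A (\<phi> (complex_of_real (1 / t) \<odot>\<^bsub>D\<^esub> y)) \<le> 1"
      using y t \<open>t > 0\<close> by (intro sa) (auto simp: D.adj_smult D.nrm_smult norm_divide)
    then show ?thesis using y \<open>t > 0\<close> h by (simp add: A.nrm_smult norm_divide)
  qed
  then have "nrm A (\<phi> y) \<le> nrm D y" by (meson dense_ge)
  moreover have "nrm A (\<phi> y) = (nrm A (\<phi> x))\<^sup>2" "nrm D y = (nrm D x)\<^sup>2"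
    using x h by (simp_all add: y_def A.cstar_identity D.cstar_identity)
  ultimately show ?thesis using x by (simp add: power2_le_iff_abs_le)
qed

lemma star_hom_tends_to:
  assumes D: "cstar_algebra D" and A: "unital_cstar_algebra A" and \<phi>: "star_hom D A \<phi>"
    and \<sigma>: "tends_to D \<sigma> x" "\<And>k. \<sigma> k \<in> carrier D" "x \<in> carrier D"
  shows "tends_to A (\<lambda>k. \<phi> (\<sigma> k)) (\<phi> x)"
proof -
  interpret D: cstar_algebra D by fact
  interpret A: unital_cstar_algebra A by fact
  show ?thesis
  proof (rule A.tends_to_le)
    show "nrm A (\<phi> (\<sigma> k) \<ominus>\<^bsub>A\<^esub> \<phi> x) \<le> nrm D (\<sigma> k \<ominus>\<^bsub>D\<^esub> x)" for k
      using star_hom_contractive[OF D A \<phi>, of "\<sigma> k \<ominus>\<^bsub>D\<^esub> x"]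
        star_hom_minus[OF D A.cstar_algebra_axioms \<phi>, of "\<sigma> k" x] \<sigma> by simp
    show "(\<lambda>k. nrm D (\<sigma> k \<ominus>\<^bsub>D\<^esub> x)) \<longlonglongrightarrow> 0" using \<sigma> by (simp add: tends_to_def)
  qed (use \<sigma> star_homD(1)[OF \<phi>] in auto)
qed


section \<open>Positivity through norm estimates\<close>

context unital_cstar_algebra begin

definition sc :: "real \<Rightarrow> 'a" where "sc c = complex_of_real c \<odot> \<one>"

lemma sc_in [simp, intro]: "sc c \<in> carrier A" by (simp add: sc_def)
lemma adj_sc [simp]: "adj A (sc c) = sc c" by (simp add: sc_def adj_smult)
lemma sc_mult: "x \<in> carrier A \<Longrightarrow> sc c \<otimes> x = complex_of_real c \<odot> x" by (simp add: sc_def smult_mult_left)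
lemma sc_central: "x \<in> carrier A \<Longrightarrow> x \<otimes> sc c = sc c \<otimes> x"
  by (simp add: sc_def smult_mult_left smult_mult_right)
lemma sc_mult_sc: "sc c \<otimes> sc d = sc (c * d)" by (simp add: sc_mult) (simp add: sc_def)
lemma sc_add_sc: "sc c \<oplus> sc d = sc (c + d)" by (simp add: sc_def smult_add_left)
lemma sc_minus_sc: "sc c \<ominus> sc d = sc (c - d)"
  by (simp add: sc_def minus_eq_smult flip: smult_add_left)
lemma sc_one: "sc 1 = \<one>" by (simp add: sc_def)
lemma sc_zero: "sc 0 = \<zero>" by (simp add: sc_def)
lemma nrm_sc_mult: "x \<in> carrier A \<Longrightarrow> nrm A (sc c \<otimes> x) = \<bar>c\<bar> * nrm A x" by (simp add: sc_mult nrm_smult)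
lemma nrm_sc_le: "nrm A (sc c) \<le> \<bar>c\<bar>" using nrm_one_le by (simp add: sc_def nrm_smult mult_left_le)
lemma sc_mult_assoc: "x \<in> carrier A \<Longrightarrow> sc c \<otimes> (sc d \<otimes> x) = sc (c * d) \<otimes> x"
  by (simp flip: mult_assoc add: sc_mult_sc)

lemma sum_squares_le:
  assumes "a \<in> carrier A" "adj A a = a" "b \<in> carrier A" "adj A b = b"
    "a \<otimes> b = b \<otimes> a" "a \<otimes> a \<oplus> b \<otimes> b = sc c" "c \<ge> 0"
  shows "(nrm A a)\<^sup>2 \<le> c"
  using nrm_le_of_sum_squares[OF assms(1-5), of c] assms(6,7) by (simp add: sc_def)

lemma square_root_one_minus:
  assumes f: "f \<in> carrier A" "adj A f = f" "nrm A f < 1"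
  obtains w where "w \<in> carrier A" "adj A w = w" "w \<otimes> w = \<one> \<ominus> f"
    "\<And>z. \<lbrakk>z \<in> carrier A; z \<otimes> f = f \<otimes> z\<rbrakk> \<Longrightarrow> z \<otimes> w = w \<otimes> z"
proof -
  obtain e where e: "e \<in> carrier A" "adj A e = e" "e \<oplus> e = f \<oplus> e \<otimes> e"
    "\<And>z. \<lbrakk>z \<in> carrier A; z \<otimes> f = f \<otimes> z\<rbrakk> \<Longrightarrow> z \<otimes> e = e \<otimes> z"
    using square_root[OF f] by blast
  have "(\<one> \<ominus> e) \<otimes> (\<one> \<ominus> e) = \<one> \<ominus> (e \<oplus> e) \<oplus> e \<otimes> e"
    using e(1) by (simp add: ring_simprules r_one)
  also have "\<dots> = \<one> \<ominus> f"
    unfolding e(3) using e(1) f by (simp add: ring_simprules)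
  finally show thesis
    using e by (intro that[of "\<one> \<ominus> e"]) (auto simp: adj_minus minus_mult mult_minus)
qed

text \<open>Positivity in the guise of a norm estimate: if \<open>r \<ge> \<parallel>t\<parallel>\<close>, the spectrum of \<open>t\<close> is nonnegative
  iff \<open>\<parallel>r - t\<parallel> \<le> r\<close>.\<close>

definition pos :: "'a \<Rightarrow> bool" where
  "pos t \<longleftrightarrow> t \<in> carrier A \<and> adj A t = t \<and> (\<forall>\<epsilon>>0. \<exists>r\<ge>0. nrm A (sc r \<ominus> t) \<le> r + \<epsilon>)"

lemma posD: "pos t \<Longrightarrow> t \<in> carrier A" "pos t \<Longrightarrow> adj A t = t"
  by (simp_all add: pos_def)

lemma pos_add: assumes "pos t" "pos s" shows "pos (t \<oplus> s)"
  unfolding pos_def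
proof (intro conjI allI impI)
  fix \<epsilon> :: real assume "\<epsilon> > 0"
  then obtain r r' where r: "r \<ge> 0" "nrm A (sc r \<ominus> t) \<le> r + \<epsilon> / 2" "r' \<ge> 0" "nrm A (sc r' \<ominus> s) \<le> r' + \<epsilon> / 2"
    using assms unfolding pos_def by (metis half_gt_zero)
  have "nrm A (sc (r + r') \<ominus> (t \<oplus> s)) \<le> (r + r') + \<epsilon>"
    using nrm_triangle[of "sc r \<ominus> t" "sc r' \<ominus> s"] r posD[OF assms(1)] posD[OF assms(2)]
    by (simp flip: sc_add_sc add: add_minus_add)
  with r show "\<exists>r\<ge>0. nrm A (sc r \<ominus> (t \<oplus> s)) \<le> r + \<epsilon>" by (intro exI[of _ "r + r'"]) auto
qed (use posD assms in \<open>auto simp: adj_add\<close>)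

lemma pos_sc_mult: assumes "c \<ge> 0" "pos t" shows "pos (sc c \<otimes> t)"
proof (cases "c = 0")
  case True
  then show ?thesis using posD[OF assms(2)]
    by (auto simp: pos_def sc_zero M.minus_eq intro!: exI[of _ 0])
next
  case False
  then have "c > 0" using assms by simp
  show ?thesis unfolding pos_def
  proof (intro conjI allI impI)
    fix \<epsilon> :: real assume "\<epsilon> > 0"
    with \<open>c > 0\<close> have "\<epsilon> / c > 0" by simp
    then obtain r where r: "r \<ge> 0" "nrm A (sc r \<ominus> t) \<le> r + \<epsilon> / c"
      using assms(2) unfolding pos_def by blast
    have "nrm A (sc (c * r) \<ominus> sc c \<otimes> t) = c * nrm A (sc r \<ominus> t)"
      using nrm_sc_mult[of "sc r \<ominus> t" c] posD[OF assms(2)] \<open>c > 0\<close> by (simp add: mult_minus sc_mult_sc)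
    also have "\<dots> \<le> c * (r + \<epsilon> / c)" using r \<open>c > 0\<close> by (intro mult_left_mono) auto
    finally show "\<exists>r\<ge>0. nrm A (sc r \<ominus> sc c \<otimes> t) \<le> r + \<epsilon>"
      using r \<open>c > 0\<close> by (intro exI[of _ "c * r"]) (auto simp: algebra_simps)
  qed (use posD[OF assms(2)] in \<open>auto simp: adj_mult sc_central\<close>)
qed

text \<open>The contraction yields a root only after adding \<open>\<epsilon>\<close>: with
  \<open>R = r + \<epsilon>\<close> the element \<open>f = (r - t) / R\<close> has norm below 1, and
  \<open>R (1 - f) = t + \<epsilon>\<close>. The root of \<open>1 - f\<close> is rescaled by
  \<open>sqrt R\<close>.\<close>

lemma pos_square_root:
  assumes t: "pos t" and "\<epsilon> > 0"
  obtains w where "w \<in> carrier A" "adj A w = w" "w \<otimes> w = t \<oplus> sc \<epsilon>"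
    "\<And>z. \<lbrakk>z \<in> carrier A; z \<otimes> t = t \<otimes> z\<rbrakk> \<Longrightarrow> z \<otimes> w = w \<otimes> z"
proof -
  obtain r where r: "r \<ge> 0" "nrm A (sc r \<ominus> t) \<le> r + \<epsilon> / 2"
    using assms unfolding pos_def by (metis half_gt_zero)
  define R where "R = r + \<epsilon>"
  have R: "R > 0" "nrm A (sc r \<ominus> t) < R" using r \<open>\<epsilon> > 0\<close> by (auto simp: R_def)
  note [simp] = posD[OF t]
  define f where "f = sc (1 / R) \<otimes> (sc r \<ominus> t)"
  have f: "f \<in> carrier A" "adj A f = f" "nrm A f < 1"
    using R by (auto simp: f_def adj_mult adj_minus sc_central nrm_sc_mult)
  obtain w where w: "w \<in> carrier A" "adj A w = w" "w \<otimes> w = \<one> \<ominus> f"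
    "\<And>z. \<lbrakk>z \<in> carrier A; z \<otimes> f = f \<otimes> z\<rbrakk> \<Longrightarrow> z \<otimes> w = w \<otimes> z"
    using square_root_one_minus[OF f] by blast
  show thesis
  proof (rule that)
    have "sc (sqrt R) \<otimes> w \<otimes> (sc (sqrt R) \<otimes> w) = sc (sqrt R) \<otimes> (w \<otimes> sc (sqrt R)) \<otimes> w"
      using w(1) by (simp add: mult_assoc)
    also have "\<dots> = sc R \<otimes> (\<one> \<ominus> f)"
      using w(1) R by (simp add: sc_central mult_assoc sc_mult_assoc flip: w(3))
    also have "\<dots> = sc R \<ominus> sc R \<otimes> f" using f by (simp add: mult_minus r_one)
    also have "sc R \<otimes> f = sc r \<ominus> t" using R by (simp add: f_def sc_mult_assoc sc_one)
    also have "sc R \<ominus> (sc r \<ominus> t) = (sc R \<ominus> sc r) \<oplus> t" by (simp add: ring_simprules)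
    also have "\<dots> = t \<oplus> sc \<epsilon>" by (simp add: sc_minus_sc R_def M.a_comm)
    finally show "sc (sqrt R) \<otimes> w \<otimes> (sc (sqrt R) \<otimes> w) = t \<oplus> sc \<epsilon>" .
    fix z assume z: "z \<in> carrier A" "z \<otimes> t = t \<otimes> z"
    then have zt: "z \<otimes> (sc r \<ominus> t) = (sc r \<ominus> t) \<otimes> z" by (simp add: mult_minus minus_mult sc_central)
    have "z \<otimes> f = sc (1/R) \<otimes> z \<otimes> (sc r \<ominus> t)" using z by (simp add: f_def sc_central flip: mult_assoc)
    also have "\<dots> = f \<otimes> z" using z by (simp add: f_def mult_assoc zt)
    finally have "z \<otimes> w = w \<otimes> z" using w(4) z(1) by blast
    then show "z \<otimes> (sc (sqrt R) \<otimes> w) = sc (sqrt R) \<otimes> w \<otimes> z"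
      using z w(1) by (metis mult_assoc sc_central sc_in)
  qed (use w(1,2) in \<open>auto simp: adj_mult sc_central\<close>)
qed

text \<open>For \<open>r\<close> above the square of \<open>nrm A a\<close> put
  \<open>b = a / sqrt r\<close> and let \<open>w\<close> be the root of \<open>1 - b^2\<close>. Then
  \<open>w\<close> and \<open>b\<close> commute and \<open>w^2 + b^2 = 1\<close>, so
  \<open>sum_squares_le\<close> bounds \<open>nrm A w\<close> by 1, which says that
  \<open>r - a^2\<close> has norm at most \<open>r\<close>.\<close>

lemma pos_square: assumes a: "a \<in> carrier A" "adj A a = a" shows "pos (a \<otimes> a)"
proof -
  \<comment> \<open>The added 1 makes \<open>r\<close> strictly larger than the square of the norm,
    and positive also for \<open>a = 0\<close>.\<close>
  define r where "r = (nrm A a + 1)\<^sup>2"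
  have r: "r > 0" "(nrm A a)\<^sup>2 < r" using a nrm_nonneg[of a] by (auto simp: r_def power2_eq_square algebra_simps add_pos_nonneg)
  define f where "f = sc (1 / r) \<otimes> (a \<otimes> a)"
  have "nrm A f = (nrm A a)\<^sup>2 / r" using r a cstar_identity[of a] by (simp add: f_def nrm_sc_mult)
  also have "\<dots> < 1" using r by simp
  finally have f: "f \<in> carrier A" "adj A f = f" "nrm A f < 1"
    using a by (auto simp: f_def adj_mult sc_central)
  obtain w where w: "w \<in> carrier A" "adj A w = w" "w \<otimes> w = \<one> \<ominus> f"
    "\<And>z. \<lbrakk>z \<in> carrier A; z \<otimes> f = f \<otimes> z\<rbrakk> \<Longrightarrow> z \<otimes> w = w \<otimes> z"
    using square_root_one_minus[OF f] by blast
  define b where "b = sc (1 / sqrt r) \<otimes> a"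
  have b: "b \<in> carrier A" "adj A b = b" using a by (auto simp: b_def adj_mult sc_central)
  have "b \<otimes> b = sc (1 / sqrt r) \<otimes> (a \<otimes> sc (1 / sqrt r)) \<otimes> a" using a by (simp add: b_def mult_assoc)
  also have "\<dots> = f" using a r by (simp add: sc_central mult_assoc sc_mult_assoc f_def)
  finally have bb: "b \<otimes> b = f" .
  have "w \<otimes> b = b \<otimes> w" using w(4)[of b] b bb by (metis mult_assoc)
  moreover have "w \<otimes> w \<oplus> b \<otimes> b = sc 1" using f by (simp add: w bb minus_add_cancel sc_one)
  ultimately have "(nrm A w)\<^sup>2 \<le> 1" using w(1,2) b by (intro sum_squares_le) auto
  then have "nrm A (\<one> \<ominus> f) \<le> 1" using cstar_identity[of w] w(1-3) by simp
  moreover have "sc r \<ominus> a \<otimes> a = sc r \<otimes> (\<one> \<ominus> f)"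
    using r a by (simp add: f_def mult_minus sc_mult_assoc sc_one)
  ultimately have "nrm A (sc r \<ominus> a \<otimes> a) \<le> r"
    using r f by (simp add: nrm_sc_mult)
  then show ?thesis unfolding pos_def using r a
    by (auto simp: adj_mult intro!: exI[of _ r])
qed

lemma pos_sc_minus: assumes "b \<in> carrier A" "adj A b = b" "nrm A b \<le> M" shows "pos (sc M \<ominus> b)"
proof -
  have "sc M \<ominus> (sc M \<ominus> b) = b" using assms by (simp add: ring_simprules)
  moreover have "M \<ge> 0" using nrm_nonneg[OF assms(1)] assms(3) by linarith
  ultimately show ?thesis using assms by (auto simp: pos_def adj_minus intro!: exI[of _ M])
qed

text \<open>Square roots are available only up to \<open>\<epsilon>\<close>, so positivity is proved
  for \<open>t + \<epsilon>\<close> first; the slack in the definition of \<open>pos\<close> absorbs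
  the error.\<close>

lemma pos_add_sc: assumes "t \<in> carrier A" "\<And>\<epsilon>. \<epsilon> > 0 \<Longrightarrow> pos (t \<oplus> sc \<epsilon>)" shows "pos t"
  unfolding pos_def
proof (intro conjI allI impI)
  have "adj A t \<oplus> sc 1 = t \<oplus> sc 1" using posD(2)[OF assms(2)[of 1]] assms(1) by (simp add: adj_add)
  then show "adj A t = t" using assms(1) by simp
  fix \<epsilon> :: real assume "\<epsilon> > 0"
  then obtain r where r: "r \<ge> 0" "nrm A (sc r \<ominus> (t \<oplus> sc (\<epsilon> / 2))) \<le> r + \<epsilon> / 2"
    using assms(2)[of "\<epsilon> / 2"] unfolding pos_def by (metis half_gt_zero)
  have "sc r \<ominus> t = sc r \<ominus> (t \<oplus> sc (\<epsilon> / 2)) \<oplus> sc (\<epsilon> / 2)"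
    using assms(1) by (simp add: ring_simprules)
  then have "nrm A (sc r \<ominus> t) \<le> r + \<epsilon>"
    using nrm_triangle[of "sc r \<ominus> (t \<oplus> sc (\<epsilon> / 2))" "sc (\<epsilon> / 2)"] nrm_sc_le[of "\<epsilon> / 2"] r \<open>\<epsilon> > 0\<close> assms(1) by simp
  with r show "\<exists>r\<ge>0. nrm A (sc r \<ominus> t) \<le> r + \<epsilon>" by blast
qed (use assms in auto)

text \<open>If \<open>w^2 = c - a^2 + \<epsilon>\<close> with \<open>w\<close> commuting with
  \<open>a\<close>, then \<open>a^2 + w^2 = c + \<epsilon>\<close> and \<open>sum_squares_le\<close>
  applies.\<close>

lemma pos_sc_minus_square_nrm:
  assumes a: "a \<in> carrier A" "adj A a = a" and pos: "pos (sc c \<ominus> a \<otimes> a)" and "c \<ge> 0"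
  shows "(nrm A a)\<^sup>2 \<le> c"
proof (rule field_le_epsilon)
  fix \<epsilon> :: real assume "\<epsilon> > 0"
  obtain w where w: "w \<in> carrier A" "adj A w = w" "w \<otimes> w = sc c \<ominus> a \<otimes> a \<oplus> sc \<epsilon>"
    "\<And>z. \<lbrakk>z \<in> carrier A; z \<otimes> (sc c \<ominus> a \<otimes> a) = (sc c \<ominus> a \<otimes> a) \<otimes> z\<rbrakk> \<Longrightarrow> z \<otimes> w = w \<otimes> z"
    using pos_square_root[OF pos \<open>\<epsilon> > 0\<close>] by blast
  have "a \<otimes> w = w \<otimes> a"
    using a by (intro w(4)) (auto simp: mult_minus minus_mult sc_central mult_assoc)
  moreover have "a \<otimes> a \<oplus> w \<otimes> w = sc (c + \<epsilon>)"
  proof -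
    have "x \<oplus> (y \<ominus> x \<oplus> z) = y \<oplus> z" if "x \<in> carrier A" "y \<in> carrier A" "z \<in> carrier A" for x y z
    proof -
      have "x \<oplus> (y \<ominus> x \<oplus> z) = (x \<ominus> x) \<oplus> (y \<oplus> z)" using that by (simp add: M.minus_eq M.a_ac)
      then show ?thesis using that by (simp add: M.minus_eq M.r_neg)
    qed
    then show ?thesis using a by (simp add: w(3) sc_add_sc)
  qed
  ultimately show "(nrm A a)\<^sup>2 \<le> c + \<epsilon>"
    using a w(1,2) \<open>c \<ge> 0\<close> \<open>\<epsilon> > 0\<close> by (intro sum_squares_le[of a w]) auto
qed

text \<open>The sum \<open>c\<^sup>*c + cc\<^sup>*\<close> is, up to a factor, the sum of the squares of the real and imaginary parts of \<open>c\<close>.\<close>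

lemma pos_mult_adj:
  assumes c: "c \<in> carrier A" and pos: "pos (\<ominus> (adj A c \<otimes> c))"
  shows "pos (c \<otimes> adj A c)"
proof -
  define a b where "a = c \<oplus> adj A c" and "b = \<i> \<odot> (c \<ominus> adj A c)"
  have a: "a \<in> carrier A" "adj A a = a" using c by (simp_all add: a_def adj_add M.a_comm)
  have "adj A b = (-\<i>) \<odot> (adj A c \<ominus> c)" using c by (simp add: b_def adj_smult adj_minus)
  also have "\<dots> = b" using c by (simp add: b_def minus_eq_smult smult_add_right M.a_comm)
  finally have b: "b \<in> carrier A" "adj A b = b" using c by (simp_all add: b_def)
  have bb: "b \<otimes> b = \<ominus> ((c \<ominus> adj A c) \<otimes> (c \<ominus> adj A c))"
    using c by (simp add: b_def smult_mult_left smult_mult_right uminus_eq_smult)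
  define X Y where "X = c \<otimes> c \<oplus> adj A c \<otimes> adj A c" and "Y = c \<otimes> adj A c \<oplus> adj A c \<otimes> c"
  have XY: "X \<in> carrier A" "Y \<in> carrier A" using c by (simp_all add: X_def Y_def)
  have "a \<otimes> a = X \<oplus> Y" "b \<otimes> b = Y \<ominus> X"
    unfolding bb a_def X_def Y_def using c by (simp_all add: ring_simprules)
  moreover have "(X \<oplus> Y) \<oplus> (Y \<ominus> X) = (Y \<oplus> Y) \<oplus> (X \<ominus> X)"
    using XY by (simp add: M.minus_eq M.a_ac)
  moreover have "\<dots> = sc 2 \<otimes> Y"
    using XY smult_add_left[of Y 1 1] by (simp add: sc_mult M.minus_eq M.r_neg)
  moreover have "pos (a \<otimes> a \<oplus> b \<otimes> b)" using a b by (intro pos_add pos_square)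
  ultimately have "pos (sc 2 \<otimes> (c \<otimes> adj A c \<oplus> adj A c \<otimes> c))" unfolding Y_def by simp
  then have "pos (sc (1/2) \<otimes> (sc 2 \<otimes> (c \<otimes> adj A c \<oplus> adj A c \<otimes> c)))"
    by (intro pos_sc_mult[of "1/2"]) auto
  then have "pos (c \<otimes> adj A c \<oplus> adj A c \<otimes> c)" using c by (simp add: sc_mult_assoc sc_one)
  from pos_add[OF this pos] show ?thesis using c by (simp add: ring_simprules)
qed

text \<open>Needed because \<open>cstar_le\<close> is defined through elements \<open>c\<^sup>*c\<close>: if \<open>h = - c\<^sup>*c\<close> is positive and
  \<open>v\<^sup>2 = h + \<epsilon>\<close>, then \<open>z = cv\<close> has \<open>- z\<^sup>*z = h\<^sup>2 + \<epsilon>h\<close> positive as well, so \<open>zz\<^sup>* = \<epsilon> cc\<^sup>* - (cc\<^sup>*)\<^sup>2\<close>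
  is positive, which forces \<open>\<parallel>cc\<^sup>*\<parallel> \<le> \<epsilon>\<close>.\<close>

theorem pos_uminus_adj_mult_eq_zero:
  assumes c: "c \<in> carrier A" and pos: "pos (\<ominus> (adj A c \<otimes> c))"
  shows "c = \<zero>"
proof -
  define g where "g = c \<otimes> adj A c"
  define h where "h = \<ominus> (adj A c \<otimes> c)"
  have h: "h \<in> carrier A" "adj A h = h" "pos h" using pos posD[OF pos] by (simp_all add: h_def)
  have g: "g \<in> carrier A" "adj A g = g" using c by (simp_all add: g_def adj_mult)
  have "(nrm A g)\<^sup>2 \<le> \<epsilon> * nrm A g" if \<epsilon>: "\<epsilon> > 0" for \<epsilon> :: real
  proof -
    obtain v where v: "v \<in> carrier A" "adj A v = v" "v \<otimes> v = h \<oplus> sc \<epsilon>"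
      "\<And>z. \<lbrakk>z \<in> carrier A; z \<otimes> h = h \<otimes> z\<rbrakk> \<Longrightarrow> z \<otimes> v = v \<otimes> z"
      using pos_square_root[OF h(3) \<epsilon>] by blast
    define z where "z = c \<otimes> v"
    have z: "z \<in> carrier A" using c v(1) by (simp add: z_def)
    have "\<ominus> (adj A z \<otimes> z) = v \<otimes> h \<otimes> v"
      using c v(1,2) by (simp add: z_def adj_mult h_def mult_assoc l_minus r_minus)
    also have "\<dots> = h \<otimes> (v \<otimes> v)" using v(4)[of h] h(1) v(1) by (metis mult_assoc)
    also have "\<dots> = h \<otimes> h \<oplus> sc \<epsilon> \<otimes> h" using h by (simp add: v(3) mult_distr_right sc_central)
    finally have "pos (\<ominus> (adj A z \<otimes> z))"
      using h that by (auto intro!: pos_add pos_square pos_sc_mult)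
    then have "pos (z \<otimes> adj A z)" using z by (intro pos_mult_adj)
    also have "z \<otimes> adj A z = c \<otimes> (v \<otimes> v) \<otimes> adj A c" using c v(1,2) by (simp add: z_def adj_mult mult_assoc)
    also have "\<dots> = c \<otimes> h \<otimes> adj A c \<oplus> sc \<epsilon> \<otimes> g"
      using c h by (simp add: v(3) g_def mult_distr_right mult_distr_left sc_central mult_assoc)
    also have "c \<otimes> h \<otimes> adj A c = \<ominus> (g \<otimes> g)"
      using c by (simp add: h_def g_def mult_assoc l_minus r_minus)
    \<comment> \<open>The positive summand \<open>\<epsilon> (nrm A g - g)\<close> cancels the
      linear term and leaves \<open>\<epsilon> * nrm A g - g^2\<close>.\<close>
    finally have "pos ((\<ominus> (g \<otimes> g) \<oplus> sc \<epsilon> \<otimes> g) \<oplus> sc \<epsilon> \<otimes> (sc (nrm A g) \<ominus> g))"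
      using \<epsilon> g by (elim pos_add) (intro pos_sc_mult pos_sc_minus, auto)
    also have "(\<ominus> (g \<otimes> g) \<oplus> sc \<epsilon> \<otimes> g) \<oplus> sc \<epsilon> \<otimes> (sc (nrm A g) \<ominus> g) = sc (\<epsilon> * nrm A g) \<ominus> g \<otimes> g"
    proof -
      have "(\<ominus> x \<oplus> s \<otimes> g) \<oplus> s \<otimes> (t \<ominus> g) = s \<otimes> t \<ominus> x"
        if "x \<in> carrier A" "s \<in> carrier A" "t \<in> carrier A" for x s t
      proof -
        have "(\<ominus> x \<oplus> s \<otimes> g) \<oplus> s \<otimes> (t \<ominus> g) = (s \<otimes> g \<ominus> s \<otimes> g) \<oplus> (s \<otimes> t \<ominus> x)"
          using that g(1) by (simp add: mult_minus) (simp add: M.minus_eq M.a_ac)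
        then show ?thesis using that g(1) by (simp add: M.minus_eq M.r_neg)
      qed
      then show ?thesis using g(1) by (simp add: sc_mult_sc)
    qed
    finally show ?thesis using g \<epsilon> by (intro pos_sc_minus_square_nrm) auto
  qed
  then have le: "nrm A g * nrm A g \<le> \<epsilon> * nrm A g" if "\<epsilon> > 0" for \<epsilon>
    using that by (simp add: power2_eq_square)
  have "nrm A g = 0"
  proof (rule ccontr)
    assume "nrm A g \<noteq> 0"
    then have "nrm A g > 0" using nrm_nonneg[of g] g by linarith
    with le[of "nrm A g / 2"] show False by simp
  qed
  then have "adj A c = \<zero>"
    using g c nrm_eq_zero[of g] by - (rule mult_adj_eq_zero, simp_all add: g_def)
  then show ?thesis using adj_adj[OF c] by simp
qed

text \<open>For projections \<open>p\<close>, \<open>k\<close> the square of \<open>d = 1 - k - p\<close> commutes with \<open>k\<close> and \<open>kpk = kd\<^sup>2\<close>.\<close>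

lemma pos_projection_conjugate:
  assumes p: "projection A p" and k: "projection A k"
  shows "pos (k \<otimes> p \<otimes> k)"
proof -
  have [simp]: "p \<in> carrier A" "adj A p = p" "p \<otimes> p = p" "k \<in> carrier A" "adj A k = k" "k \<otimes> k = k"
    using p k by (auto simp: projection_def)
  have [simp]: "p \<otimes> (p \<otimes> x) = p \<otimes> x" "k \<otimes> (k \<otimes> x) = k \<otimes> x" if "x \<in> carrier A" for x
    using that by (simp_all flip: mult_assoc)
  define d where "d = \<one> \<ominus> k \<ominus> p"
  have d [simp]: "d \<in> carrier A" "adj A d = d" by (simp_all add: d_def adj_minus)
  have kd: "k \<otimes> (d \<otimes> d) = k \<otimes> p \<otimes> k" "d \<otimes> d \<otimes> k = k \<otimes> p \<otimes> k"
    unfolding d_def by (simp_all add: ring_simprules r_one)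
  show ?thesis
  proof (rule pos_add_sc)
    fix \<epsilon> :: real assume "\<epsilon> > 0"
    obtain w where w: "w \<in> carrier A" "adj A w = w" "w \<otimes> w = d \<otimes> d \<oplus> sc \<epsilon>"
      "\<And>z. \<lbrakk>z \<in> carrier A; z \<otimes> (d \<otimes> d) = d \<otimes> d \<otimes> z\<rbrakk> \<Longrightarrow> z \<otimes> w = w \<otimes> z"
      using pos_square_root[OF pos_square[OF d] \<open>\<epsilon> > 0\<close>] by blast
    have kw: "k \<otimes> w = w \<otimes> k" by (intro w(4)) (simp_all add: kd)
    \<comment> \<open>\<open>k \<otimes> w\<close> is self-adjoint because \<open>w\<close> commutes
      with \<open>k\<close>, and its square is \<open>kpk + \<epsilon> k\<close>; the second square
      supplies the missing \<open>\<epsilon> (1 - k)\<close>.\<close>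
    have "pos ((k \<otimes> w) \<otimes> (k \<otimes> w) \<oplus> sc \<epsilon> \<otimes> ((\<one> \<ominus> k) \<otimes> (\<one> \<ominus> k)))"
      using w(1,2) kw \<open>\<epsilon> > 0\<close> by (intro pos_add pos_sc_mult pos_square) (auto simp: adj_mult adj_minus)
    also have "(k \<otimes> w) \<otimes> (k \<otimes> w) = k \<otimes> (k \<otimes> w) \<otimes> w"
      using w(1) kw \<open>k \<in> carrier A\<close> by (metis mult_assoc mult_closed)
    also have "\<dots> = k \<otimes> p \<otimes> k \<oplus> sc \<epsilon> \<otimes> k"
      using w(1) by (simp add: mult_assoc w(3) mult_distr_right sc_central kd(1))
    also have "k \<otimes> p \<otimes> k \<oplus> sc \<epsilon> \<otimes> k \<oplus> sc \<epsilon> \<otimes> ((\<one> \<ominus> k) \<otimes> (\<one> \<ominus> k)) = k \<otimes> p \<otimes> k \<oplus> sc \<epsilon>"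
    proof -
      have "(\<one> \<ominus> k) \<otimes> (\<one> \<ominus> k) = \<one> \<ominus> k" by (simp add: ring_simprules r_one)
      moreover have "x \<oplus> y \<oplus> (s \<ominus> y) = (y \<ominus> y) \<oplus> (x \<oplus> s)"
        if "x \<in> carrier A" "y \<in> carrier A" "s \<in> carrier A" for x y s
        using that by (simp add: M.minus_eq M.a_ac)
      ultimately show ?thesis by (simp add: mult_minus r_one) (simp add: M.minus_eq M.r_neg)
    qed
    finally show "pos (k \<otimes> p \<otimes> k \<oplus> sc \<epsilon>)" .
  qed simp
qed

text \<open>With \<open>k = 1 - q\<close> and \<open>q - p = c*c\<close>, the element
  \<open>x = c \<otimes> k\<close> satisfies \<open>x*x = k(q - p)k = - kpk\<close>. Since
  \<open>kpk\<close> is positive, \<open>x\<close> vanishes and \<open>kpk = 0\<close>. But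
  \<open>kpk\<close> is \<open>y*y\<close> for \<open>y = p \<otimes> k\<close>, so
  \<open>pk = 0\<close>, and taking adjoints \<open>kp = 0\<close>.\<close>

theorem projection_le_mult:
  assumes p: "projection A p" and q: "projection A q" and le: "cstar_le A p q"
  shows "q \<otimes> p = p"
proof -
  have [simp]: "p \<in> carrier A" "adj A p = p" "p \<otimes> p = p" "q \<in> carrier A" "adj A q = q" "q \<otimes> q = q"
    using p q by (auto simp: projection_def)
  obtain c where c: "c \<in> carrier A" "q \<ominus> p = adj A c \<otimes> c"
    using le by (auto simp: cstar_le_def)
  define k where "k = \<one> \<ominus> q"
  have "k \<otimes> k = k" "adj A k = k"
    unfolding k_def by (simp_all add: ring_simprules r_one) (simp add: adj_add uminus_eq_smult adj_smult)
  then have k: "projection A k" by (simp add: projection_def k_def)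
  then have [simp]: "k \<in> carrier A" "adj A k = k" "k \<otimes> k = k" by (auto simp: projection_def)
  have kq: "k \<otimes> q = \<zero>" unfolding k_def by (simp add: minus_mult) (simp add: M.minus_eq M.r_neg)
  have "adj A (c \<otimes> k) \<otimes> (c \<otimes> k) = k \<otimes> (adj A c \<otimes> c) \<otimes> k"
    using c(1) by (simp add: adj_mult mult_assoc)
  also have "\<dots> = \<ominus> (k \<otimes> p \<otimes> k)"
    unfolding c(2)[symmetric] by (simp add: mult_minus minus_mult kq) (simp add: M.minus_eq)
  finally have "\<ominus> (adj A (c \<otimes> k) \<otimes> (c \<otimes> k)) = k \<otimes> p \<otimes> k" by simp
  with pos_projection_conjugate[OF p k] c have "c \<otimes> k = \<zero>"
    by (intro pos_uminus_adj_mult_eq_zero) auto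
  with \<open>\<ominus> (adj A (c \<otimes> k) \<otimes> (c \<otimes> k)) = _\<close> c have "k \<otimes> p \<otimes> k = \<zero>" by simp
  moreover have "adj A (p \<otimes> k) \<otimes> (p \<otimes> k) = k \<otimes> (p \<otimes> p) \<otimes> k"
    by (simp add: adj_mult mult_assoc del: \<open>p \<otimes> p = p\<close>)
  ultimately have "p \<otimes> k = \<zero>" by - (rule mult_adj_eq_zero, simp_all)
  then have "adj A (p \<otimes> k) = \<zero>" by simp
  then have "k \<otimes> p = \<zero>" by (simp add: adj_mult)
  then have "p \<ominus> q \<otimes> p = \<zero>" by (simp add: k_def minus_mult)
  then show ?thesis by (simp add: minus_eq_zero_iff)
qed

end

section \<open>Square-summable functions\<close>

text \<open>Bounds on finite partial sums give membership and the norm estimate at once, so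
  inequalities on \<open>ell2\<close> reduce to those for \<open>L2_set\<close>.\<close>

lemma ell2I:
  assumes "\<And>x. x \<notin> X \<Longrightarrow> f x = 0"
    "\<And>Y. \<lbrakk>finite Y; Y \<subseteq> X\<rbrakk> \<Longrightarrow> L2_set (\<lambda>x. cmod (f x)) Y \<le> M"
  shows "f \<in> ell2 X" "ell2_norm X f \<le> M"
proof -
  have M: "M \<ge> 0" using assms(2)[of "{}"] by simp
  have bound: "(\<Sum>x\<in>Y. (cmod (f x))\<^sup>2) \<le> M\<^sup>2" if "finite Y" "Y \<subseteq> X" for Y
    using assms(2)[OF that] M sqrt_le_D unfolding L2_set_def by blast
  have sum: "(\<lambda>x. (cmod (f x))\<^sup>2) summable_on X"
    using bound by (intro nonneg_bdd_above_summable_on) (auto intro!: bdd_aboveI[of _ "M\<^sup>2"])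
  then show "f \<in> ell2 X" using assms(1) by (auto simp: ell2_def)
  have "(\<Sum>\<^sub>\<infinity>x\<in>X. (cmod (f x))\<^sup>2) \<le> M\<^sup>2"
    using sum bound by (intro infsum_le_finite_sums)
  then show "ell2_norm X f \<le> M" unfolding ell2_norm_def using M by (intro real_le_lsqrt) (auto intro: infsum_nonneg)
qed

lemma ell2_outside: "f \<in> ell2 X \<Longrightarrow> x \<notin> X \<Longrightarrow> f x = 0"
  by (simp add: ell2_def)

lemma ell2_norm_nonneg [simp]: "0 \<le> ell2_norm X f"
  by (simp add: ell2_norm_def infsum_nonneg)

lemma L2_set_le_ell2_norm:
  assumes "f \<in> ell2 X" "finite Y" "Y \<subseteq> X"
  shows "L2_set (\<lambda>x. cmod (f x)) Y \<le> ell2_norm X f"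
  unfolding ell2_norm_def L2_set_def using assms
  by (intro real_sqrt_le_mono finite_sum_le_infsum) (auto simp: ell2_def)

lemma cmod_le_ell2_norm: assumes "f \<in> ell2 X" shows "cmod (f x) \<le> ell2_norm X f"
proof (cases "x \<in> X")
  case True
  then show ?thesis using L2_set_le_ell2_norm[OF assms, of "{x}"] by simp
qed (use assms in \<open>simp add: ell2_outside\<close>)

lemma ell2_add:
  assumes "f \<in> ell2 X" "g \<in> ell2 X"
  shows "(\<lambda>x. f x + g x) \<in> ell2 X" "ell2_norm X (\<lambda>x. f x + g x) \<le> ell2_norm X f + ell2_norm X g"
proof -
  have "L2_set (\<lambda>x. cmod (f x + g x)) Y \<le> ell2_norm X f + ell2_norm X g" if "finite Y" "Y \<subseteq> X" for Y
  proof -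
    have "L2_set (\<lambda>x. cmod (f x + g x)) Y \<le> L2_set (\<lambda>x. cmod (f x) + cmod (g x)) Y"
      by (intro L2_set_mono norm_triangle_ineq) auto
    also have "\<dots> \<le> L2_set (\<lambda>x. cmod (f x)) Y + L2_set (\<lambda>x. cmod (g x)) Y"
      by (rule L2_set_triangle_ineq)
    finally show ?thesis
      using L2_set_le_ell2_norm[OF assms(1) that] L2_set_le_ell2_norm[OF assms(2) that] by linarith
  qed
  moreover have "f x + g x = 0" if "x \<notin> X" for x
    using that assms by (simp add: ell2_outside)
  ultimately show "(\<lambda>x. f x + g x) \<in> ell2 X" "ell2_norm X (\<lambda>x. f x + g x) \<le> ell2_norm X f + ell2_norm X g"
    using ell2I[of X "\<lambda>x. f x + g x" "ell2_norm X f + ell2_norm X g"] by blast+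
qed

lemma ell2_scale: assumes "f \<in> ell2 X" shows "(\<lambda>x. c * f x) \<in> ell2 X"
proof (rule ell2I(1))
  show "L2_set (\<lambda>x. cmod (c * f x)) Y \<le> cmod c * ell2_norm X f" if "finite Y" "Y \<subseteq> X" for Y
    using L2_set_le_ell2_norm[OF assms that] by (simp add: norm_mult mult_left_mono flip: L2_set_right_distrib)
qed (use assms in \<open>simp add: ell2_outside\<close>)

lemma ell2_norm_scale: "ell2_norm X (\<lambda>x. c * f x) = cmod c * ell2_norm X f"
  by (simp add: ell2_norm_def norm_mult power_mult_distrib infsum_cmult_right' real_sqrt_mult)

lemma ell2_zero [simp]: "(\<lambda>x. 0) \<in> ell2 X" and ell2_norm_zero [simp]: "ell2_norm X (\<lambda>x. 0) = 0"
  by (simp_all add: ell2_def ell2_norm_def)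

lemma ell2_diff: assumes "f \<in> ell2 X" "g \<in> ell2 X" shows "(\<lambda>x. f x - g x) \<in> ell2 X"
  using ell2_add(1)[OF assms(1) ell2_scale[OF assms(2), of "-1"]] by simp

lemma ell2_norm_diff_commute: "ell2_norm X (\<lambda>x. f x - g x) = ell2_norm X (\<lambda>x. g x - f x)"
  by (simp add: ell2_norm_def norm_minus_commute)

lemma ell2_norm_diff_triangle:
  assumes "f \<in> ell2 X" "g \<in> ell2 X" "h \<in> ell2 X"
  shows "ell2_norm X (\<lambda>x. f x - h x) \<le> ell2_norm X (\<lambda>x. f x - g x) + ell2_norm X (\<lambda>x. g x - h x)"
  using ell2_add(2)[OF ell2_diff[OF assms(1,2)] ell2_diff[OF assms(2,3)]] by simp

lemma ell2_norm_eq_zero: assumes "f \<in> ell2 X" "ell2_norm X f = 0" shows "f = (\<lambda>x. 0)"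
  using cmod_le_ell2_norm[OF assms(1)] assms(2) by auto

lemma ell2_inner_abs_summable:
  assumes "f \<in> ell2 X" "g \<in> ell2 X"
  shows "(\<lambda>x. cmod (cnj (f x) * g x)) summable_on X"
    "(\<Sum>\<^sub>\<infinity>x\<in>X. cmod (cnj (f x) * g x)) \<le> ell2_norm X f * ell2_norm X g"
proof -
  have bound: "(\<Sum>x\<in>Y. cmod (cnj (f x) * g x)) \<le> ell2_norm X f * ell2_norm X g" if "finite Y" "Y \<subseteq> X" for Y
  proof -
    have "(\<Sum>x\<in>Y. cmod (cnj (f x) * g x)) \<le> L2_set (\<lambda>x. cmod (f x)) Y * L2_set (\<lambda>x. cmod (g x)) Y"
      using L2_set_mult_ineq[of "\<lambda>x. cmod (f x)" "\<lambda>x. cmod (g x)" Y] by (simp add: norm_mult)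
    also have "\<dots> \<le> ell2_norm X f * ell2_norm X g"
      using assms that by (intro mult_mono L2_set_le_ell2_norm) auto
    finally show ?thesis .
  qed
  then show s: "(\<lambda>x. cmod (cnj (f x) * g x)) summable_on X"
    by (intro nonneg_bdd_above_summable_on) (auto intro!: bdd_aboveI[of _ "ell2_norm X f * ell2_norm X g"])
  show "(\<Sum>\<^sub>\<infinity>x\<in>X. cmod (cnj (f x) * g x)) \<le> ell2_norm X f * ell2_norm X g"
    using s bound by (intro infsum_le_finite_sums)
qed

lemma ell2_inner_summable:
  "\<lbrakk>f \<in> ell2 X; g \<in> ell2 X\<rbrakk> \<Longrightarrow> (\<lambda>x. cnj (f x) * g x) summable_on X"
  by (rule abs_summable_summable[OF ell2_inner_abs_summable(1)])

lemma ell2_Cauchy_Schwarz: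
  "\<lbrakk>f \<in> ell2 X; g \<in> ell2 X\<rbrakk> \<Longrightarrow> cmod (ell2_inner X f g) \<le> ell2_norm X f * ell2_norm X g"
  unfolding ell2_inner_def
  using norm_infsum_bound[OF ell2_inner_abs_summable(1)] ell2_inner_abs_summable(2) order_trans by blast

lemma cnj_ell2_inner: "cnj (ell2_inner X f g) = ell2_inner X g f"
  by (simp add: ell2_inner_def mult.commute flip: infsum_cnj)

lemma ell2_inner_add_right:
  "\<lbrakk>f \<in> ell2 X; g \<in> ell2 X; h \<in> ell2 X\<rbrakk>
    \<Longrightarrow> ell2_inner X f (\<lambda>x. g x + h x) = ell2_inner X f g + ell2_inner X f h"
  by (simp add: ell2_inner_def ring_distribs infsum_add ell2_inner_summable)

lemma ell2_inner_scale_right: "ell2_inner X f (\<lambda>x. c * g x) = c * ell2_inner X f g"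
  by (simp add: ell2_inner_def mult.left_commute infsum_cmult_right')

lemma ell2_inner_add_left:
  "\<lbrakk>f \<in> ell2 X; g \<in> ell2 X; h \<in> ell2 X\<rbrakk>
    \<Longrightarrow> ell2_inner X (\<lambda>x. g x + h x) f = ell2_inner X g f + ell2_inner X h f"
  using ell2_inner_add_right[of f X g h] by (metis cnj_ell2_inner complex_cnj_add)

lemma ell2_inner_scale_left: "ell2_inner X (\<lambda>x. c * g x) f = cnj c * ell2_inner X g f"
  using ell2_inner_scale_right[of X f c g] by (metis cnj_ell2_inner complex_cnj_mult)

lemma ell2_inner_self:
  assumes "f \<in> ell2 X"
  shows "ell2_inner X f f = complex_of_real ((ell2_norm X f)\<^sup>2)"
proof -
  have "cnj (f x) * f x = complex_of_real ((cmod (f x))\<^sup>2)" for x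
    using complex_norm_square[of "f x"] by (simp add: mult.commute)
  moreover have "((\<lambda>x. (cmod (f x))\<^sup>2) has_sum (\<Sum>\<^sub>\<infinity>x\<in>X. (cmod (f x))\<^sup>2)) X"
    using assms by (intro has_sum_infsum) (simp add: ell2_def)
  then have "((\<lambda>x. complex_of_real ((cmod (f x))\<^sup>2)) has_sum
      complex_of_real (\<Sum>\<^sub>\<infinity>x\<in>X. (cmod (f x))\<^sup>2)) X"
    by (simp only: has_sum_of_real_iff)
  moreover have "(ell2_norm X f)\<^sup>2 = (\<Sum>\<^sub>\<infinity>x\<in>X. (cmod (f x))\<^sup>2)"
    by (simp add: ell2_norm_def infsum_nonneg)
  ultimately show ?thesis
    unfolding ell2_inner_def by (simp only: infsumI)
qed

definition basis_vector :: "'x \<Rightarrow> 'x \<Rightarrow> complex" where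
  "basis_vector x = (\<lambda>y. if y = x then 1 else 0)"

definition restrict_vector :: "'x set \<Rightarrow> ('x \<Rightarrow> complex) \<Rightarrow> 'x \<Rightarrow> complex" where
  "restrict_vector Y f = (\<lambda>x. if x \<in> Y then f x else 0)"

lemma basis_vector_ell2 [simp]: "x \<in> X \<Longrightarrow> basis_vector x \<in> ell2 X"
  by (rule ell2I(1)[of _ _ 1])
    (auto simp: basis_vector_def L2_set_def if_distrib[of cmod] if_distrib[of "\<lambda>x. x\<^sup>2"] sum.delta' cong: if_cong)

lemma ell2_inner_basis_left: "x \<in> X \<Longrightarrow> ell2_inner X (basis_vector x) f = f x"
  unfolding ell2_inner_def
  by (subst infsum_cong_neutral[where T = "{x}" and g = f]) (auto simp: basis_vector_def)

lemma ell2_inner_basis_right: "x \<in> X \<Longrightarrow> ell2_inner X f (basis_vector x) = cnj (f x)"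
  using ell2_inner_basis_left[of x X f] cnj_ell2_inner[of X "basis_vector x" f] by simp

lemma ell2_eqI:
  assumes "f \<in> ell2 X" "g \<in> ell2 X" "\<And>h. h \<in> ell2 X \<Longrightarrow> ell2_inner X f h = ell2_inner X g h"
  shows "f = g"
proof
  fix x show "f x = g x"
  proof (cases "x \<in> X")
    case True
    then show ?thesis using assms(3)[of "basis_vector x"] by (simp add: ell2_inner_basis_right)
  qed (use assms in \<open>simp add: ell2_outside\<close>)
qed

lemma restrict_vector_ell2:
  assumes "f \<in> ell2 X"
  shows "restrict_vector Y f \<in> ell2 X" "ell2_norm X (restrict_vector Y f) \<le> ell2_norm X f"
proof -
  have "L2_set (\<lambda>x. cmod (restrict_vector Y f x)) G \<le> ell2_norm X f" if "finite G" "G \<subseteq> X" for G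
    using L2_set_mono[of G "\<lambda>x. cmod (restrict_vector Y f x)" "\<lambda>x. cmod (f x)"] L2_set_le_ell2_norm[OF assms that]
    by (force simp: restrict_vector_def)
  moreover have "restrict_vector Y f x = 0" if "x \<notin> X" for x
    using that assms by (simp add: restrict_vector_def ell2_outside)
  ultimately show "restrict_vector Y f \<in> ell2 X" "ell2_norm X (restrict_vector Y f) \<le> ell2_norm X f"
    using ell2I[of X "restrict_vector Y f" "ell2_norm X f"] by blast+
qed

lemma ell2_norm_finite_support:
  assumes "finite Y" "Y \<subseteq> X" "\<And>x. x \<notin> Y \<Longrightarrow> f x = 0"
  shows "f \<in> ell2 X" "ell2_norm X f = L2_set (\<lambda>x. cmod (f x)) Y"
proof -
  have "L2_set (\<lambda>x. cmod (f x)) G \<le> L2_set (\<lambda>x. cmod (f x)) Y" if "finite G" for G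
  proof -
    have "(\<Sum>x\<in>G. (cmod (f x))\<^sup>2) = (\<Sum>x\<in>G \<inter> Y. (cmod (f x))\<^sup>2)"
      using assms that by (intro sum.mono_neutral_right) auto
    also have "\<dots> \<le> (\<Sum>x\<in>Y. (cmod (f x))\<^sup>2)" using assms by (intro sum_mono2) auto
    finally show ?thesis by (simp add: L2_set_def)
  qed
  moreover have "f x = 0" if "x \<notin> X" for x using assms that by blast
  ultimately have *: "f \<in> ell2 X" "ell2_norm X f \<le> L2_set (\<lambda>x. cmod (f x)) Y"
    using ell2I[of X f] by blast+
  then show "f \<in> ell2 X" "ell2_norm X f = L2_set (\<lambda>x. cmod (f x)) Y"
    using L2_set_le_ell2_norm[OF *(1) assms(1,2)] by auto
qed

text \<open>The estimate covers every \<open>G\<close> containing \<open>Y\<close>, because the sets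
  used later are larger: a finite union serving several vectors, or an initial piece of an
  enumeration.\<close>

lemma restrict_vector_approx:
  assumes f: "f \<in> ell2 X" and "\<epsilon> > 0"
  obtains Y where "finite Y" "Y \<subseteq> X"
    "\<And>G. Y \<subseteq> G \<Longrightarrow> ell2_norm X (\<lambda>x. f x - restrict_vector G f x) \<le> \<epsilon>"
proof -
  let ?g = "\<lambda>x. (cmod (f x))\<^sup>2"
  have sum: "?g summable_on X" using f by (simp add: ell2_def)
  then have has_sum: "(?g has_sum infsum ?g X) X" by (rule has_sum_infsum)
  obtain Y where Y: "finite Y" "Y \<subseteq> X" "dist (sum ?g Y) (infsum ?g X) \<le> \<epsilon>\<^sup>2"
    using has_sum_finite_approximation[OF has_sum, of "\<epsilon>\<^sup>2"] \<open>\<epsilon> > 0\<close> by auto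
  have "ell2_norm X (\<lambda>x. f x - restrict_vector G f x) \<le> \<epsilon>" if "Y \<subseteq> G" for G
  proof (rule ell2I(2))
    fix H assume H: "finite H" "H \<subseteq> X"
    have "(\<Sum>x\<in>H. (cmod (f x - restrict_vector G f x))\<^sup>2) \<le> (\<Sum>x\<in>H - Y. ?g x)"
      using H that by (subst sum.mono_neutral_right[of H "H - Y"]) (auto simp: restrict_vector_def intro!: sum_mono)
    also have "\<dots> = sum ?g (H \<union> Y) - sum ?g Y"
      using H Y by (subst sum_diff[symmetric]) (auto intro: sum.cong)
    also have "\<dots> \<le> infsum ?g X - sum ?g Y"
      using H Y sum by (intro diff_right_mono finite_sum_le_infsum) auto
    also have "\<dots> \<le> \<epsilon>\<^sup>2" using Y(3) by (simp add: dist_real_def)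
    finally show "L2_set (\<lambda>x. cmod (f x - restrict_vector G f x)) H \<le> \<epsilon>"
      using \<open>\<epsilon> > 0\<close> by (simp add: L2_set_def real_le_lsqrt sum_nonneg)
  qed (use f in \<open>simp add: restrict_vector_def ell2_outside\<close>)
  with Y that show thesis by blast
qed

text \<open>The candidate is the coordinatewise limit, and this is exported as well: linearity of a
  limit of operators is checked coordinate by coordinate.\<close>

lemma ell2_complete:
  assumes f: "\<And>k. f k \<in> ell2 X"
    and Cauchy: "\<And>e. e > 0 \<Longrightarrow> \<exists>N. \<forall>k\<ge>N. \<forall>l\<ge>N. ell2_norm X (\<lambda>x. f k x - f l x) \<le> e"
  obtains g where "g \<in> ell2 X" "(\<lambda>k. ell2_norm X (\<lambda>x. f k x - g x)) \<longlonglongrightarrow> 0"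
    "\<And>x. (\<lambda>k. f k x) \<longlonglongrightarrow> g x"
proof -
  have "convergent (\<lambda>k. f k x)" for x
  proof (rule Cauchy_convergent, rule CauchyI)
    fix e :: real assume "e > 0"
    then obtain N where N: "\<forall>k\<ge>N. \<forall>l\<ge>N. ell2_norm X (\<lambda>x. f k x - f l x) \<le> e / 2"
      using Cauchy[of "e / 2"] by auto
    have "cmod (f k x - f l x) < e" if "k \<ge> N" "l \<ge> N" for k l
      using cmod_le_ell2_norm[OF ell2_diff[OF f[of k] f[of l]], of x] N that \<open>e > 0\<close> by fastforce
    then show "\<exists>N. \<forall>k\<ge>N. \<forall>l\<ge>N. cmod (f k x - f l x) < e" by blast
  qed
  then obtain g where g: "\<And>x. (\<lambda>k. f k x) \<longlonglongrightarrow> g x"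
    unfolding convergent_def by metis
  have g0: "g x = 0" if "x \<notin> X" for x
    using g[of x] ell2_outside[OF f that] by (simp add: LIMSEQ_const_iff)
  have lim: "\<exists>N. \<forall>k\<ge>N. (\<lambda>x. f k x - g x) \<in> ell2 X \<and> ell2_norm X (\<lambda>x. f k x - g x) \<le> e" if e: "e > 0" for e
  proof -
    obtain N where N: "\<forall>k\<ge>N. \<forall>l\<ge>N. ell2_norm X (\<lambda>x. f k x - f l x) \<le> e" using Cauchy[OF e] by blast
    have "L2_set (\<lambda>x. cmod (f k x - g x)) Y \<le> e" if "k \<ge> N" "finite Y" "Y \<subseteq> X" for k Y
    proof (rule LIMSEQ_le_const2)
      show "(\<lambda>l. L2_set (\<lambda>x. cmod (f k x - f l x)) Y) \<longlonglongrightarrow> L2_set (\<lambda>x. cmod (f k x - g x)) Y"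
        unfolding L2_set_def by (intro tendsto_intros g)
      have "L2_set (\<lambda>x. cmod (f k x - f l x)) Y \<le> e" if "l \<ge> N" for l
        using L2_set_le_ell2_norm[OF ell2_diff[OF f[of k] f[of l]] \<open>finite Y\<close> \<open>Y \<subseteq> X\<close>] N that \<open>k \<ge> N\<close>
        by (meson order_trans)
      then show "\<exists>M. \<forall>l\<ge>M. L2_set (\<lambda>x. cmod (f k x - f l x)) Y \<le> e" by blast
    qed
    moreover have "f k x - g x = 0" if "x \<notin> X" for k x using that g0 ell2_outside[OF f] by simp
    ultimately have "(\<lambda>x. f k x - g x) \<in> ell2 X \<and> ell2_norm X (\<lambda>x. f k x - g x) \<le> e" if "k \<ge> N" for k
      using ell2I[of X "\<lambda>x. f k x - g x" e] that by blast
    then show ?thesis by blast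
  qed
  have "g \<in> ell2 X"
  proof -
    obtain N where "(\<lambda>x. f N x - g x) \<in> ell2 X" using lim[of 1] by auto
    from ell2_diff[OF f[of N] this] show ?thesis by simp
  qed
  moreover have "(\<lambda>k. ell2_norm X (\<lambda>x. f k x - g x)) \<longlonglongrightarrow> 0"
  proof (rule LIMSEQ_I)
    fix e :: real assume "e > 0"
    then obtain N where "\<forall>k\<ge>N. ell2_norm X (\<lambda>x. f k x - g x) \<le> e / 2" using lim[of "e / 2"] by auto
    then show "\<exists>N. \<forall>k\<ge>N. norm (ell2_norm X (\<lambda>x. f k x - g x) - 0) < e"
      using \<open>e > 0\<close> by (intro exI[of _ N]) fastforce
  qed
  ultimately show thesis using that g by blast
qed

section \<open>Bounded operators and the operator norm\<close>

lemma bounded_operatorsD: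
  assumes "T \<in> bounded_operators X"
  shows "\<And>f. f \<in> ell2 X \<Longrightarrow> T f \<in> ell2 X" "\<And>f. f \<notin> ell2 X \<Longrightarrow> T f = undefined"
    "\<And>f g. \<lbrakk>f \<in> ell2 X; g \<in> ell2 X\<rbrakk> \<Longrightarrow> T (\<lambda>x. f x + g x) = (\<lambda>x. T f x + T g x)"
    "\<And>c f. f \<in> ell2 X \<Longrightarrow> T (\<lambda>x. c * f x) = (\<lambda>x. c * T f x)"
  using assms by (auto simp: bounded_operators_def PiE_iff extensional_def)

lemma bounded_operators_diff:
  assumes "T \<in> bounded_operators X" "f \<in> ell2 X" "g \<in> ell2 X"
  shows "T (\<lambda>x. f x - g x) = (\<lambda>x. T f x - T g x)"
  using bounded_operatorsD(3)[OF assms(1,2) ell2_scale[OF assms(3), of "-1"]]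
    bounded_operatorsD(4)[OF assms(1,3), of "-1"] by simp

lemma bounded_operators_zero: assumes "T \<in> bounded_operators X" shows "T (\<lambda>x. 0) = (\<lambda>x. 0)"
  using bounded_operatorsD(4)[OF assms ell2_zero, of 0] by simp

lemma bounded_operators_eqI:
  assumes "T \<in> bounded_operators X" "U \<in> bounded_operators X" "\<And>f. f \<in> ell2 X \<Longrightarrow> T f = U f"
  shows "T = U"
  using assms bounded_operatorsD(2) by (metis ext)

lemma bounded_operatorsI:
  assumes "\<And>f. f \<in> ell2 X \<Longrightarrow> T f \<in> ell2 X" "T \<in> extensional (ell2 X)"
    "\<And>f g. \<lbrakk>f \<in> ell2 X; g \<in> ell2 X\<rbrakk> \<Longrightarrow> T (\<lambda>x. f x + g x) = (\<lambda>x. T f x + T g x)"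
    "\<And>c f. f \<in> ell2 X \<Longrightarrow> T (\<lambda>x. c * f x) = (\<lambda>x. c * T f x)"
    "\<And>f. f \<in> ell2 X \<Longrightarrow> ell2_norm X (T f) \<le> b * ell2_norm X f"
  shows "T \<in> bounded_operators X"
proof -
  have "\<exists>b. \<forall>f\<in>ell2 X. ell2_norm X (T f) \<le> b * ell2_norm X f" using assms(5) by blast
  with assms(1-4) show ?thesis unfolding bounded_operators_def by (simp add: PiE_iff)
qed

text \<open>The supremum in the norm field of \<open>compact_algebra\<close> makes sense for every
  bounded operator, so the same function is also the norm of \<open>bounded_algebra\<close>.\<close>

abbreviation op_norm :: "'x set \<Rightarrow> 'x operator \<Rightarrow> real" where
  "op_norm X \<equiv> nrm (compact_algebra X)"

lemma op_norm_def: "op_norm X T = (SUP f\<in>{f \<in> ell2 X. ell2_norm X f \<le> 1}. ell2_norm X (T f))"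
  by (simp add: compact_algebra_def)

lemma op_norm_le:
  assumes "b \<ge> 0" "\<And>f. f \<in> ell2 X \<Longrightarrow> ell2_norm X (T f) \<le> b * ell2_norm X f"
  shows "op_norm X T \<le> b"
  unfolding op_norm_def
proof (rule cSUP_least)
  show "{f \<in> ell2 X. ell2_norm X f \<le> 1} \<noteq> {}" by (auto intro!: exI[of _ "\<lambda>x. 0"])
  fix f assume "f \<in> {f \<in> ell2 X. ell2_norm X f \<le> 1}"
  then show "ell2_norm X (T f) \<le> b"
    using assms(2)[of f] mult_left_le[of "ell2_norm X f" b] assms(1) by auto
qed

lemma bdd_above_op_norm:
  assumes "T \<in> bounded_operators X"
  shows "bdd_above ((\<lambda>f. ell2_norm X (T f)) ` {f \<in> ell2 X. ell2_norm X f \<le> 1})"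
proof -
  obtain b where b: "\<forall>f\<in>ell2 X. ell2_norm X (T f) \<le> b * ell2_norm X f"
    using assms by (auto simp: bounded_operators_def)
  have "ell2_norm X (T g) \<le> \<bar>b\<bar>" if "g \<in> ell2 X" "ell2_norm X g \<le> 1" for g
  proof -
    have "ell2_norm X (T g) \<le> \<bar>b\<bar> * ell2_norm X g"
      using bspec[OF b that(1)] mult_right_mono[OF abs_ge_self, of "ell2_norm X g" b] by simp
    then show ?thesis using that(2) mult_left_le[of "ell2_norm X g" "\<bar>b\<bar>"] by simp
  qed
  then show ?thesis by (auto intro!: bdd_aboveI[of _ "\<bar>b\<bar>"])
qed

lemma op_norm_nonneg: assumes "T \<in> bounded_operators X" shows "0 \<le> op_norm X T"
  unfolding op_norm_def
  by (rule cSUP_upper2[OF bdd_above_op_norm[OF assms], of "\<lambda>x. 0"]) simp_all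

lemma op_norm_bound:
  assumes T: "T \<in> bounded_operators X" and f: "f \<in> ell2 X"
  shows "ell2_norm X (T f) \<le> op_norm X T * ell2_norm X f"
proof (cases "ell2_norm X f = 0")
  case True
  then have "T f = (\<lambda>x. 0)" using ell2_norm_eq_zero[OF f] bounded_operators_zero[OF T] by simp
  with True show ?thesis by simp
next
  case False
  then have pos: "ell2_norm X f > 0" using ell2_norm_nonneg[of X f] by linarith
  define c where "c = complex_of_real (1 / ell2_norm X f)"
  define g where "g = (\<lambda>x. c * f x)"
  have c: "cmod c = 1 / ell2_norm X f" using pos by (simp add: c_def norm_divide)
  have g: "g \<in> ell2 X" "ell2_norm X g \<le> 1" "ell2_norm X (T g) = ell2_norm X (T f) / ell2_norm X f"
    using ell2_scale[OF f] pos c by (simp_all add: g_def ell2_norm_scale bounded_operatorsD(4)[OF T f])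
  have "ell2_norm X (T g) \<le> op_norm X T"
    unfolding op_norm_def using g by (intro cSUP_upper bdd_above_op_norm[OF T]) auto
  then show ?thesis using g pos by (simp add: field_simps)
qed

section \<open>The algebra of bounded operators\<close>

text \<open>Only the carrier differs from \<open>compact_algebra\<close>, so the compacts become a
  subalgebra with literally the same operations.\<close>

definition bounded_algebra :: "'x set \<Rightarrow> 'x operator cstar" where
  "bounded_algebra X = (compact_algebra X)\<lparr>carrier := bounded_operators X\<rparr>"

lemma bounded_algebra_simps [simp]:
  "carrier (bounded_algebra X) = bounded_operators X"
  "mult (bounded_algebra X) T U = compose (ell2 X) T U"
  "one (bounded_algebra X) = (\<lambda>f\<in>ell2 X. f)"
  "zero (bounded_algebra X) = (\<lambda>f\<in>ell2 X. \<lambda>x. 0)"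
  "add (bounded_algebra X) T U = (\<lambda>f\<in>ell2 X. \<lambda>x. T f x + U f x)"
  "smult (bounded_algebra X) c T = (\<lambda>f\<in>ell2 X. \<lambda>x. c * T f x)"
  "nrm (bounded_algebra X) = op_norm X"
  "adj (bounded_algebra X) = adj (compact_algebra X)"
  by (simp_all add: bounded_algebra_def compact_algebra_def)

lemma bounded_operators_closed:
  assumes T: "T \<in> bounded_operators X" and U: "U \<in> bounded_operators X"
  shows "(\<lambda>f\<in>ell2 X. \<lambda>x. T f x + U f x) \<in> bounded_operators X" (is "?add \<in> _")
    and "op_norm X (\<lambda>f\<in>ell2 X. \<lambda>x. T f x + U f x) \<le> op_norm X T + op_norm X U"
    and "compose (ell2 X) T U \<in> bounded_operators X" (is "?mult \<in> _")
    and "op_norm X (compose (ell2 X) T U) \<le> op_norm X T * op_norm X U"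
proof -
  note t = bounded_operatorsD[OF T] and u = bounded_operatorsD[OF U]
  have add: "ell2_norm X (?add f) \<le> (op_norm X T + op_norm X U) * ell2_norm X f" if "f \<in> ell2 X" for f
    using ell2_add(2)[OF t(1)[OF that] u(1)[OF that]] op_norm_bound[OF T that] op_norm_bound[OF U that] that
    by (simp add: distrib_right)
  show "?add \<in> bounded_operators X"
    by (rule bounded_operatorsI[OF _ _ _ _ add])
      (simp_all add: ell2_add ell2_scale t u algebra_simps fun_eq_iff extensional_def)
  show "op_norm X ?add \<le> op_norm X T + op_norm X U"
    by (rule op_norm_le[OF _ add]) (simp_all add: op_norm_nonneg T U)
  have mult: "ell2_norm X (?mult f) \<le> (op_norm X T * op_norm X U) * ell2_norm X f" if f: "f \<in> ell2 X" for f
  proof -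
    have "ell2_norm X (?mult f) \<le> op_norm X T * ell2_norm X (U f)"
      using op_norm_bound[OF T u(1)[OF f]] f by (simp add: compose_def)
    also have "\<dots> \<le> op_norm X T * (op_norm X U * ell2_norm X f)"
      by (intro mult_left_mono op_norm_bound op_norm_nonneg U f T)
    finally show ?thesis by simp
  qed
  show "?mult \<in> bounded_operators X"
    by (rule bounded_operatorsI[OF _ _ _ _ mult])
      (simp_all add: ell2_add ell2_scale t u compose_def extensional_def)
  show "op_norm X ?mult \<le> op_norm X T * op_norm X U"
    by (rule op_norm_le[OF _ mult]) (simp_all add: op_norm_nonneg T U)
qed

lemma bounded_operators_scale:
  assumes T: "T \<in> bounded_operators X"
  shows "(\<lambda>f\<in>ell2 X. \<lambda>x. c * T f x) \<in> bounded_operators X" (is "?S \<in> _")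
    and "op_norm X (\<lambda>f\<in>ell2 X. \<lambda>x. c * T f x) = cmod c * op_norm X T"
proof -
  \<comment> \<open>The inequality is proved for all scalars and operators, since equality comes
    from applying it once more, to the scaled operator with the scalar
    \<open>inverse c\<close>.\<close>
  have S: "(\<lambda>f\<in>ell2 X. \<lambda>x. c * T f x) \<in> bounded_operators X"
    "op_norm X (\<lambda>f\<in>ell2 X. \<lambda>x. c * T f x) \<le> cmod c * op_norm X T"
    if T: "T \<in> bounded_operators X" for c and T :: "'a operator"
  proof -
    note t = bounded_operatorsD[OF T]
    have le: "ell2_norm X ((\<lambda>f\<in>ell2 X. \<lambda>x. c * T f x) f) \<le> cmod c * op_norm X T * ell2_norm X f"
      if "f \<in> ell2 X" for f
      using op_norm_bound[OF T that] that by (simp add: ell2_norm_scale mult.assoc mult_left_mono)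
    show "(\<lambda>f\<in>ell2 X. \<lambda>x. c * T f x) \<in> bounded_operators X"
      by (rule bounded_operatorsI[OF _ _ _ _ le])
        (simp_all add: ell2_add ell2_scale t algebra_simps fun_eq_iff extensional_def)
    show "op_norm X (\<lambda>f\<in>ell2 X. \<lambda>x. c * T f x) \<le> cmod c * op_norm X T"
      by (rule op_norm_le[OF _ le]) (simp_all add: op_norm_nonneg T)
  qed
  show "?S \<in> bounded_operators X" by (rule S[OF T])
  show "op_norm X ?S = cmod c * op_norm X T"
  proof (cases "c = 0")
    case True
    then show ?thesis using S(2)[OF T, of c] op_norm_nonneg[OF S(1)[OF T, of c]] by simp
  next
    case False
    then have "(\<lambda>f\<in>ell2 X. \<lambda>x. inverse c * ?S f x) = T"
      using bounded_operatorsD(2)[OF T] by (auto simp: fun_eq_iff restrict_def)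
    then have "op_norm X T \<le> cmod (inverse c) * op_norm X ?S"
      using S(2)[OF S(1)[OF T, of c], of "inverse c"] by simp
    with False S(2)[OF T, of c] show ?thesis by (simp add: norm_inverse norm_divide field_simps)
  qed
qed

lemma zero_bounded_operator: "(\<lambda>f\<in>ell2 X. \<lambda>x. 0) \<in> bounded_operators X"
  by (rule bounded_operatorsI[where b = 0]) (simp_all add: ell2_add ell2_scale)

lemma one_bounded_operator: "(\<lambda>f\<in>ell2 X. f) \<in> bounded_operators X"
  by (rule bounded_operatorsI[where b = 1]) (simp_all add: ell2_add ell2_scale)

lemma op_norm_eq_zero:
  assumes T: "T \<in> bounded_operators X"
  shows "op_norm X T = 0 \<longleftrightarrow> T = (\<lambda>f\<in>ell2 X. \<lambda>x. 0)"
proof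
  assume "op_norm X T = 0"
  then have "ell2_norm X (T f) = 0" if "f \<in> ell2 X" for f
    using op_norm_bound[OF T that] ell2_norm_nonneg[of X "T f"] by simp
  then have "T f = (\<lambda>x. 0)" if "f \<in> ell2 X" for f
    using ell2_norm_eq_zero[OF bounded_operatorsD(1)[OF T that]] that by blast
  then show "T = (\<lambda>f\<in>ell2 X. \<lambda>x. 0)"
    by (intro bounded_operators_eqI[OF T zero_bounded_operator]) simp
next
  assume "T = (\<lambda>f\<in>ell2 X. \<lambda>x. 0)"
  then have "op_norm X T \<le> 0" by (intro op_norm_le) auto
  then show "op_norm X T = 0" using op_norm_nonneg[OF T] by simp
qed

section \<open>Adjoints of bounded operators\<close>

lemma ell2_inner_zero [simp]: "ell2_inner X (\<lambda>x. 0) g = 0" "ell2_inner X g (\<lambda>x. 0) = 0"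
  by (simp_all add: ell2_inner_def)

lemma ell2_inner_finite_support:
  assumes T: "T \<in> bounded_operators X" and g: "g \<in> ell2 X"
    and "finite Y" "Y \<subseteq> X" "\<And>x. x \<notin> Y \<Longrightarrow> h x = 0"
  shows "ell2_inner X (T h) g = (\<Sum>x\<in>Y. cnj (h x) * ell2_inner X (T (basis_vector x)) g)"
  using assms(3-5)
proof (induction Y arbitrary: h)
  case empty
  then have "h = (\<lambda>x. 0)" by auto
  then show ?case using bounded_operators_zero[OF T] by simp
next
  case (insert a Y)
  note t = bounded_operatorsD[OF T]
  define h' where "h' = h(a := 0)"
  have h': "h' \<in> ell2 X" using insert by (intro ell2_norm_finite_support[of Y]) (auto simp: h'_def)
  have a: "a \<in> X" using insert by simp
  have "h = (\<lambda>x. h' x + h a * basis_vector a x)"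
    by (auto simp: h'_def basis_vector_def)
  then have "T h = (\<lambda>x. T h' x + h a * T (basis_vector a) x)"
    using t(3)[OF h' ell2_scale[OF basis_vector_ell2[OF a]]] t(4)[OF basis_vector_ell2[OF a]] by metis
  then have "ell2_inner X (T h) g = ell2_inner X (T h') g + cnj (h a) * ell2_inner X (T (basis_vector a)) g"
    using ell2_inner_add_left[OF g t(1)[OF h'] ell2_scale[OF t(1)[OF basis_vector_ell2[OF a]]]]
    by (simp add: ell2_inner_scale_left)
  also have "ell2_inner X (T h') g = (\<Sum>x\<in>Y. cnj (h' x) * ell2_inner X (T (basis_vector x)) g)"
    using insert by (intro insert.IH) (auto simp: h'_def)
  also have "\<dots> = (\<Sum>x\<in>Y. cnj (h x) * ell2_inner X (T (basis_vector x)) g)"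
    using insert by (intro sum.cong) (auto simp: h'_def)
  finally show ?case using insert by simp
qed

text \<open>The formula is forced: the coordinate of the adjoint at \<open>x\<close> is its inner
  product with \<open>basis_vector x\<close>. The operator is thus written down from matrix entries
  alone.\<close>

definition adjoint_operator :: "'x set \<Rightarrow> 'x operator \<Rightarrow> 'x operator" where
  "adjoint_operator X T =
    (\<lambda>g\<in>ell2 X. \<lambda>x. if x \<in> X then ell2_inner X (T (basis_vector x)) g else 0)"

text \<open>Duality against a finite truncation \<open>h\<close> of the candidate: the inner product
  of \<open>T h\<close> with \<open>g\<close> is the square of the norm \<open>L\<close> of
  \<open>h\<close>, and it is at most \<open>op_norm X T * L * ell2_norm X g\<close>. Cancelling
  \<open>L\<close> bounds every finite part.\<close>

lemma adjoint_operator_bound: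
  assumes T: "T \<in> bounded_operators X" and g: "g \<in> ell2 X"
  shows "adjoint_operator X T g \<in> ell2 X"
    "ell2_norm X (adjoint_operator X T g) \<le> op_norm X T * ell2_norm X g"
proof -
  define c where "c = adjoint_operator X T g"
  have c: "c x = (if x \<in> X then ell2_inner X (T (basis_vector x)) g else 0)" for x
    using g by (simp add: c_def adjoint_operator_def)
  have le: "L2_set (\<lambda>x. cmod (c x)) Y \<le> op_norm X T * ell2_norm X g" if Y: "finite Y" "Y \<subseteq> X" for Y
  proof -
    define L where "L = L2_set (\<lambda>x. cmod (c x)) Y"
    define h where "h = restrict_vector Y c"
    have h: "h \<in> ell2 X" "ell2_norm X h = L2_set (\<lambda>x. cmod (h x)) Y"
      using Y by (auto simp: h_def restrict_vector_def intro!: ell2_norm_finite_support)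
    then have hL: "ell2_norm X h = L" by (simp add: L_def h_def restrict_vector_def L2_set_def)
    have "ell2_inner X (T h) g = (\<Sum>x\<in>Y. cnj (h x) * ell2_inner X (T (basis_vector x)) g)"
      by (rule ell2_inner_finite_support[OF T g Y]) (simp add: h_def restrict_vector_def)
    also have "\<dots> = (\<Sum>x\<in>Y. complex_of_real ((cmod (c x))\<^sup>2))"
    proof (rule sum.cong)
      fix x assume "x \<in> Y"
      then have "cnj (h x) * ell2_inner X (T (basis_vector x)) g = cnj (c x) * c x"
        using Y by (auto simp: h_def restrict_vector_def c)
      then show "cnj (h x) * ell2_inner X (T (basis_vector x)) g = complex_of_real ((cmod (c x))\<^sup>2)"
        using complex_norm_square[of "c x"] by (simp add: mult.commute)
    qed simp
    also have "\<dots> = complex_of_real (L\<^sup>2)" by (simp add: L_def L2_set_def sum_nonneg)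
    finally have "L\<^sup>2 = cmod (ell2_inner X (T h) g)" by (simp only: norm_of_real) simp
    also have "\<dots> \<le> ell2_norm X (T h) * ell2_norm X g"
      by (intro ell2_Cauchy_Schwarz bounded_operatorsD(1)[OF T] h g)
    also have "\<dots> \<le> (op_norm X T * L) * ell2_norm X g"
      using op_norm_bound[OF T h(1)] hL by (intro mult_right_mono) auto
    finally have *: "L * L \<le> (op_norm X T * ell2_norm X g) * L" by (simp add: power2_eq_square mult_ac)
    have "L \<ge> 0" by (simp add: L_def L2_set_nonneg)
    with * op_norm_nonneg[OF T] have "L \<le> op_norm X T * ell2_norm X g"
      by (cases "L = 0") (auto simp: mult_le_cancel_right)
    then show ?thesis by (simp add: L_def)
  qed
  have "c x = 0" if "x \<notin> X" for x using that by (simp add: c)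
  with le ell2I[of X c] have "c \<in> ell2 X \<and> ell2_norm X c \<le> op_norm X T * ell2_norm X g" by blast
  then show "adjoint_operator X T g \<in> ell2 X"
    "ell2_norm X (adjoint_operator X T g) \<le> op_norm X T * ell2_norm X g"
    by (simp_all add: c_def)
qed

lemma adjoint_operator_bounded:
  assumes T: "T \<in> bounded_operators X"
  shows "adjoint_operator X T \<in> bounded_operators X" "op_norm X (adjoint_operator X T) \<le> op_norm X T"
proof -
  show "adjoint_operator X T \<in> bounded_operators X"
  proof (rule bounded_operatorsI[OF adjoint_operator_bound(1)[OF T] _ _ _ adjoint_operator_bound(2)[OF T]])
    fix f g assume "f \<in> ell2 X" "g \<in> ell2 X"
    then show "adjoint_operator X T (\<lambda>x. f x + g x) = (\<lambda>x. adjoint_operator X T f x + adjoint_operator X T g x)"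
      by (auto simp: adjoint_operator_def fun_eq_iff ell2_add ell2_inner_add_right bounded_operatorsD[OF T])
  qed (auto simp: adjoint_operator_def fun_eq_iff ell2_scale ell2_inner_scale_right extensional_def)
  show "op_norm X (adjoint_operator X T) \<le> op_norm X T"
    by (rule op_norm_le[OF op_norm_nonneg[OF T] adjoint_operator_bound(2)[OF T]])
qed

text \<open>On finitely supported vectors both sides have the same expansion. Cutting
  \<open>f\<close> off with error \<open>\<epsilon>\<close> changes their difference by at most
  \<open>C * \<epsilon>\<close>.\<close>

lemma adjoint_operator_inner:
  assumes T: "T \<in> bounded_operators X" and f: "f \<in> ell2 X" and g: "g \<in> ell2 X"
  shows "ell2_inner X (T f) g = ell2_inner X f (adjoint_operator X T g)"
proof -
  define u where "u = adjoint_operator X T g"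
  have u: "u \<in> ell2 X" using adjoint_operator_bound[OF T g] by (simp add: u_def)
  define C where "C = op_norm X T * ell2_norm X g + ell2_norm X u"
  have C: "C \<ge> 0" using op_norm_nonneg[OF T] by (simp add: C_def)
  have le: "cmod (ell2_inner X (T f) g - ell2_inner X f u) \<le> C * \<epsilon>" if \<epsilon>: "\<epsilon> > 0" for \<epsilon>
  proof -
    obtain Y where Y: "finite Y" "Y \<subseteq> X" "ell2_norm X (\<lambda>x. f x - restrict_vector Y f x) \<le> \<epsilon>"
      using restrict_vector_approx[OF f \<epsilon>] by (metis order_refl)
    define h where "h = restrict_vector Y f"
    define d where "d = (\<lambda>x. f x - h x)"
    have h: "h \<in> ell2 X" "\<And>x. x \<notin> Y \<Longrightarrow> h x = 0"
      using restrict_vector_ell2[OF f] by (auto simp: h_def restrict_vector_def)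
    have d: "d \<in> ell2 X" "ell2_norm X d \<le> \<epsilon>" using ell2_diff[OF f h(1)] Y(3) by (auto simp: d_def h_def)
    have f_eq: "f = (\<lambda>x. h x + d x)" by (simp add: d_def)
    have "ell2_inner X (T h) g = (\<Sum>x\<in>Y. cnj (h x) * ell2_inner X (T (basis_vector x)) g)"
      by (rule ell2_inner_finite_support[OF T g Y(1,2) h(2)])
    \<comment> \<open>Inserting the identity operator lets the same expansion lemma be used for the
      plain inner product of \<open>h\<close> and \<open>u\<close>.\<close>
    also have "\<dots> = (\<Sum>x\<in>Y. cnj (h x) * ell2_inner X ((\<lambda>f\<in>ell2 X. f) (basis_vector x)) u)"
      using Y(2) g by (intro sum.cong) (auto simp: u_def adjoint_operator_def ell2_inner_basis_left)
    also have "\<dots> = ell2_inner X ((\<lambda>f\<in>ell2 X. f) h) u"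
      by (rule ell2_inner_finite_support[OF one_bounded_operator u Y(1,2) h(2), symmetric])
    finally have *: "ell2_inner X (T h) g = ell2_inner X h u" using h by simp
    have "T f = (\<lambda>x. T h x + T d x)"
      using bounded_operatorsD(3)[OF T h(1) d(1)] by (simp only: f_eq[symmetric])
    then have "ell2_inner X (T f) g = ell2_inner X (T h) g + ell2_inner X (T d) g"
      using ell2_inner_add_left[OF g bounded_operatorsD(1)[OF T h(1)] bounded_operatorsD(1)[OF T d(1)]] by simp
    moreover have "ell2_inner X f u = ell2_inner X h u + ell2_inner X d u"
      using ell2_inner_add_left[OF u h(1) d(1)] by (simp only: f_eq[symmetric])
    ultimately have eq: "ell2_inner X (T f) g - ell2_inner X f u = ell2_inner X (T d) g - ell2_inner X d u"
      using * by simp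
    have "cmod (ell2_inner X (T d) g) \<le> (op_norm X T * \<epsilon>) * ell2_norm X g"
    proof -
      have "cmod (ell2_inner X (T d) g) \<le> ell2_norm X (T d) * ell2_norm X g"
        by (intro ell2_Cauchy_Schwarz bounded_operatorsD(1)[OF T] d g)
      also have "\<dots> \<le> (op_norm X T * ell2_norm X d) * ell2_norm X g"
        by (intro mult_right_mono op_norm_bound T d) auto
      also have "\<dots> \<le> (op_norm X T * \<epsilon>) * ell2_norm X g"
        by (intro mult_right_mono mult_left_mono d op_norm_nonneg T) auto
      finally show ?thesis .
    qed
    moreover have "cmod (ell2_inner X d u) \<le> \<epsilon> * ell2_norm X u"
      using ell2_Cauchy_Schwarz[OF d(1) u] mult_right_mono[OF d(2), of "ell2_norm X u"] by simp
    ultimately show ?thesis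
      unfolding eq using norm_triangle_ineq4[of "ell2_inner X (T d) g" "ell2_inner X d u"]
      by (simp add: C_def algebra_simps)
  qed
  have "cmod (ell2_inner X (T f) g - ell2_inner X f u) \<le> 0"
  proof (rule field_le_epsilon)
    fix e :: real assume e: "e > 0"
    \<comment> \<open>The denominator \<open>C + 1\<close> avoids dividing by zero when
      \<open>C\<close> vanishes.\<close>
    have "C * (e / (C + 1)) \<le> e" using C e by (simp add: field_simps)
    then show "cmod (ell2_inner X (T f) g - ell2_inner X f u) \<le> 0 + e"
      using le[of "e / (C + 1)"] C e by simp
  qed
  then show ?thesis by (simp add: u_def)
qed

lemma adjoint_operator_inner_left:
  assumes "T \<in> bounded_operators X" "f \<in> ell2 X" "g \<in> ell2 X"
  shows "ell2_inner X (adjoint_operator X T f) g = ell2_inner X f (T g)"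
  using adjoint_operator_inner[OF assms(1,3,2)] cnj_ell2_inner by metis

lemma adjoint_operator_unique:
  assumes T: "T \<in> bounded_operators X" and U: "U \<in> bounded_operators X"
    and "\<And>f g. \<lbrakk>f \<in> ell2 X; g \<in> ell2 X\<rbrakk> \<Longrightarrow> ell2_inner X (U f) g = ell2_inner X f (T g)"
  shows "U = adjoint_operator X T"
proof (rule bounded_operators_eqI[OF U adjoint_operator_bounded(1)[OF T]])
  fix f assume f: "f \<in> ell2 X"
  show "U f = adjoint_operator X T f"
    using assms(3)[OF f] adjoint_operator_inner_left[OF T f]
    by (intro ell2_eqI[OF bounded_operatorsD(1)[OF U f] adjoint_operator_bound(1)[OF T f]]) simp
qed

lemma adj_compact_algebra:
  assumes T: "T \<in> bounded_operators X"
  shows "adj (compact_algebra X) T = adjoint_operator X T"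
  unfolding compact_algebra_def cstar.simps
proof (rule the_equality)
  show "adjoint_operator X T \<in> bounded_operators X \<and> (\<forall>f\<in>ell2 X. \<forall>g\<in>ell2 X.
      ell2_inner X (adjoint_operator X T f) g = ell2_inner X f (T g))"
    using adjoint_operator_bounded(1)[OF T] adjoint_operator_inner_left[OF T] by simp
qed (use adjoint_operator_unique[OF T] in blast)

lemma cstar_algebra_bounded_algebra: "cstar_algebra (bounded_algebra X)"
proof (rule cstar_algebraI, goal_cases)
  \<comment> \<open>The case numbers follow the premises of \<open>cstar_algebraI\<close>: 19 to 22
    are the laws of the involution, 28 is the C*-identity and 29 is completeness.\<close>
  case (19 T)
  note T = this[simplified] and T' = adjoint_operator_bounded(1)[OF this[simplified]]
  have "T = adjoint_operator X (adjoint_operator X T)"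
    using adjoint_operator_inner[OF T] by (intro adjoint_operator_unique[OF T' T]) auto
  then show ?case using T T' by (simp add: adj_compact_algebra)
next
  case (20 T U)
  then have T: "T \<in> bounded_operators X" and U: "U \<in> bounded_operators X" by simp_all
  note T' = adjoint_operator_bounded(1)[OF T] and U' = adjoint_operator_bounded(1)[OF U]
  note b = bounded_operatorsD(1)[OF T] bounded_operatorsD(1)[OF U] bounded_operatorsD(1)[OF T'] bounded_operatorsD(1)[OF U']
  have "(\<lambda>f\<in>ell2 X. \<lambda>x. adjoint_operator X T f x + adjoint_operator X U f x) =
      adjoint_operator X (\<lambda>f\<in>ell2 X. \<lambda>x. T f x + U f x)"
    using T U T' U' b by (intro adjoint_operator_unique bounded_operators_closed)
      (auto simp: ell2_inner_add_left ell2_inner_add_right adjoint_operator_inner_left)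
  then show ?case using T U by (simp add: adj_compact_algebra bounded_operators_closed)
next
  case (21 c T)
  then have T: "T \<in> bounded_operators X" by simp
  note T' = adjoint_operator_bounded(1)[OF T]
  have "(\<lambda>f\<in>ell2 X. \<lambda>x. cnj c * adjoint_operator X T f x) =
      adjoint_operator X (\<lambda>f\<in>ell2 X. \<lambda>x. c * T f x)"
    using T T' by (intro adjoint_operator_unique bounded_operators_scale)
      (auto simp: ell2_inner_scale_left ell2_inner_scale_right adjoint_operator_inner_left)
  then show ?case using T by (simp add: adj_compact_algebra bounded_operators_scale)
next
  case (22 T U)
  then have T: "T \<in> bounded_operators X" and U: "U \<in> bounded_operators X" by simp_all
  note T' = adjoint_operator_bounded(1)[OF T] and U' = adjoint_operator_bounded(1)[OF U]
  note b = bounded_operatorsD(1)[OF T] bounded_operatorsD(1)[OF U] bounded_operatorsD(1)[OF T'] bounded_operatorsD(1)[OF U']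
  have "compose (ell2 X) (adjoint_operator X U) (adjoint_operator X T) =
      adjoint_operator X (compose (ell2 X) T U)"
    using T U T' U' b by (intro adjoint_operator_unique bounded_operators_closed)
      (auto simp: compose_def adjoint_operator_inner_left)
  then show ?case using T U by (simp add: adj_compact_algebra bounded_operators_closed)
next
  case (28 T)
  then have T: "T \<in> bounded_operators X" by simp
  let ?T' = "adjoint_operator X T"
  note T' = adjoint_operator_bounded[OF T]
  let ?S = "compose (ell2 X) ?T' T"
  have S: "?S \<in> bounded_operators X" using T T' by (intro bounded_operators_closed)
  have "op_norm X ?S \<le> op_norm X ?T' * op_norm X T" using T T' by (intro bounded_operators_closed)
  also have "\<dots> \<le> op_norm X T * op_norm X T" using T' op_norm_nonneg[OF T] by (intro mult_right_mono)
  finally have le: "op_norm X ?S \<le> (op_norm X T)\<^sup>2" by (simp add: power2_eq_square)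
  \<comment> \<open>The converse inequality: the square of \<open>ell2_norm X (T f)\<close> is the
    inner product of \<open>?S f\<close> with \<open>f\<close>, which Cauchy-Schwarz bounds.\<close>
  have "ell2_norm X (T f) \<le> sqrt (op_norm X ?S) * ell2_norm X f" if f: "f \<in> ell2 X" for f
  proof -
    have Tf: "T f \<in> ell2 X" by (rule bounded_operatorsD(1)[OF T f])
    have "complex_of_real ((ell2_norm X (T f))\<^sup>2) = ell2_inner X (?S f) f"
      using adjoint_operator_inner_left[OF T Tf f] f by (simp add: compose_def ell2_inner_self[OF Tf])
    then have "(ell2_norm X (T f))\<^sup>2 = cmod (ell2_inner X (?S f) f)"
      by (metis norm_of_real abs_power2)
    also have "\<dots> \<le> ell2_norm X (?S f) * ell2_norm X f"
      by (intro ell2_Cauchy_Schwarz bounded_operatorsD(1)[OF S] f)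
    also have "\<dots> \<le> (op_norm X ?S * ell2_norm X f) * ell2_norm X f"
      by (intro mult_right_mono op_norm_bound S f) simp
    also have "\<dots> = (sqrt (op_norm X ?S) * ell2_norm X f)\<^sup>2"
      using op_norm_nonneg[OF S] by (simp add: power_mult_distrib) (simp add: power2_eq_square)
    finally show ?thesis
      using op_norm_nonneg[OF S] by (simp add: power2_le_iff_abs_le)
  qed
  then have "op_norm X T \<le> sqrt (op_norm X ?S)" using op_norm_nonneg[OF S] by (intro op_norm_le) auto
  then have "(op_norm X T)\<^sup>2 \<le> op_norm X ?S"
    using op_norm_nonneg[OF S] op_norm_nonneg[OF T] real_le_rsqrt real_sqrt_ge_0_iff
    by (metis power_mono real_sqrt_pow2)
  with le show ?case using T by (simp add: adj_compact_algebra)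
next
  case (29 \<sigma>)
  then have \<sigma>: "\<And>k. \<sigma> k \<in> bounded_operators X" by simp
  have diff: "(\<lambda>f\<in>ell2 X. \<lambda>x. \<sigma> k f x + (\<lambda>f\<in>ell2 X. \<lambda>x. - 1 * T f x) f x) \<in> bounded_operators X"
    if "T \<in> bounded_operators X" for T k
    by (intro bounded_operators_closed bounded_operators_scale \<sigma> that)
  have Cauchy: "\<exists>N. \<forall>k\<ge>N. \<forall>l\<ge>N. \<forall>f\<in>ell2 X. ell2_norm X (\<lambda>x. \<sigma> k f x - \<sigma> l f x) \<le> e * ell2_norm X f"
    if e: "e > 0" for e
  proof -
    obtain N where N: "\<And>k l. \<lbrakk>k \<ge> N; l \<ge> N\<rbrakk> \<Longrightarrow>
        op_norm X (\<lambda>f\<in>ell2 X. \<lambda>x. \<sigma> k f x + (\<lambda>f\<in>ell2 X. \<lambda>x. - 1 * \<sigma> l f x) f x) \<le> e"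
      using 29(2)[OF e] by (fastforce intro: less_imp_le)
    have "ell2_norm X (\<lambda>x. \<sigma> k f x - \<sigma> l f x) \<le> e * ell2_norm X f"
      if "k \<ge> N" "l \<ge> N" and f: "f \<in> ell2 X" for k l f
      using op_norm_bound[OF diff[OF \<sigma>[of l], of k] f] N[OF that(1,2)] f
        mult_right_mono[OF N[OF that(1,2)], of "ell2_norm X f"] by simp
    then show ?thesis by blast
  qed
  have "\<exists>g. f \<in> ell2 X \<longrightarrow> g \<in> ell2 X \<and> (\<lambda>k. ell2_norm X (\<lambda>x. \<sigma> k f x - g x)) \<longlonglongrightarrow> 0 \<and> (\<forall>x. (\<lambda>k. \<sigma> k f x) \<longlonglongrightarrow> g x)" for f
  proof (cases "f \<in> ell2 X")
    case f: True
    have C: "\<exists>N. \<forall>k\<ge>N. \<forall>l\<ge>N. ell2_norm X (\<lambda>x. \<sigma> k f x - \<sigma> l f x) \<le> e" if e: "e > 0" for e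
    proof -
      have pos: "ell2_norm X f + 1 > 0" using ell2_norm_nonneg[of X f] by linarith
      then obtain N where N: "\<forall>k\<ge>N. \<forall>l\<ge>N. \<forall>f'\<in>ell2 X.
          ell2_norm X (\<lambda>x. \<sigma> k f' x - \<sigma> l f' x) \<le> e / (ell2_norm X f + 1) * ell2_norm X f'"
        using Cauchy[of "e / (ell2_norm X f + 1)"] e by auto
      moreover have "e / (ell2_norm X f + 1) * ell2_norm X f \<le> e"
        using pos e by (simp add: field_simps)
      ultimately show ?thesis using f by (meson order_trans)
    qed
    obtain g where "g \<in> ell2 X" "(\<lambda>k. ell2_norm X (\<lambda>x. \<sigma> k f x - g x)) \<longlonglongrightarrow> 0"
      "\<And>x. (\<lambda>k. \<sigma> k f x) \<longlonglongrightarrow> g x"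
      using ell2_complete[of "\<lambda>k. \<sigma> k f" X, OF bounded_operatorsD(1)[OF \<sigma> f] C] by blast
    then show ?thesis by blast
  qed auto
  then have "\<exists>L. \<forall>f. f \<in> ell2 X \<longrightarrow> L f \<in> ell2 X \<and> (\<lambda>k. ell2_norm X (\<lambda>x. \<sigma> k f x - L f x)) \<longlonglongrightarrow> 0 \<and>
      (\<forall>x. (\<lambda>k. \<sigma> k f x) \<longlonglongrightarrow> L f x)"
    by (intro choice) blast
  then obtain L where L: "\<And>f. f \<in> ell2 X \<Longrightarrow> L f \<in> ell2 X"
    "\<And>f. f \<in> ell2 X \<Longrightarrow> (\<lambda>k. ell2_norm X (\<lambda>x. \<sigma> k f x - L f x)) \<longlonglongrightarrow> 0"
    "\<And>f x. f \<in> ell2 X \<Longrightarrow> (\<lambda>k. \<sigma> k f x) \<longlonglongrightarrow> L f x" by blast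
  define T where "T = restrict L (ell2 X)"
  have T: "T f = L f" if "f \<in> ell2 X" for f using that by (simp add: T_def)
  have lim: "\<exists>N. \<forall>k\<ge>N. \<forall>f\<in>ell2 X. ell2_norm X (\<lambda>x. \<sigma> k f x - T f x) \<le> e * ell2_norm X f" if e: "e > 0" for e
  proof -
    obtain N where N: "\<forall>k\<ge>N. \<forall>l\<ge>N. \<forall>f\<in>ell2 X. ell2_norm X (\<lambda>x. \<sigma> k f x - \<sigma> l f x) \<le> e * ell2_norm X f"
      using Cauchy[OF e] by blast
    \<comment> \<open>Letting \<open>l\<close> tend to infinity in the Cauchy estimate keeps the
      bound \<open>e * ell2_norm X f\<close>, so convergence holds in operator norm and not merely
      pointwise.\<close>
    have "ell2_norm X (\<lambda>x. \<sigma> k f x - T f x) \<le> e * ell2_norm X f" if k: "k \<ge> N" and f: "f \<in> ell2 X" for k f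
    proof (rule LIMSEQ_le_const)
      show "(\<lambda>l. e * ell2_norm X f + ell2_norm X (\<lambda>x. \<sigma> l f x - L f x)) \<longlonglongrightarrow> e * ell2_norm X f"
        using tendsto_add[OF tendsto_const L(2)[OF f]] by simp
      have "ell2_norm X (\<lambda>x. \<sigma> k f x - T f x) \<le> e * ell2_norm X f + ell2_norm X (\<lambda>x. \<sigma> l f x - L f x)"
        if "l \<ge> N" for l
        using ell2_norm_diff_triangle[OF bounded_operatorsD(1)[OF \<sigma>[of k] f] bounded_operatorsD(1)[OF \<sigma>[of l] f] L(1)[OF f]]
          N[rule_format, OF k that f] T[OF f] by simp
      then show "\<exists>N. \<forall>l\<ge>N. ell2_norm X (\<lambda>x. \<sigma> k f x - T f x)
          \<le> e * ell2_norm X f + ell2_norm X (\<lambda>x. \<sigma> l f x - L f x)" by blast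
    qed
    then show ?thesis by blast
  qed
  have T_bounded: "T \<in> bounded_operators X"
  proof -
    obtain N where N: "\<forall>f\<in>ell2 X. ell2_norm X (\<lambda>x. \<sigma> N f x - T f x) \<le> 1 * ell2_norm X f"
      using lim[of 1] by auto
    show ?thesis
    proof (rule bounded_operatorsI)
      fix f assume f: "f \<in> ell2 X"
      have "ell2_norm X (T f) \<le> ell2_norm X (\<sigma> N f) + ell2_norm X (\<lambda>x. T f x - \<sigma> N f x)"
        using ell2_add(2)[OF bounded_operatorsD(1)[OF \<sigma>[of N] f] ell2_diff[OF _ bounded_operatorsD(1)[OF \<sigma>[of N] f]], of "T f"] L(1)[OF f]
        by (simp add: T[OF f])
      also have "\<dots> \<le> op_norm X (\<sigma> N) * ell2_norm X f + 1 * ell2_norm X f"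
        using N f by (intro add_mono op_norm_bound \<sigma>) (simp_all add: ell2_norm_diff_commute)
      finally show "ell2_norm X (T f) \<le> (op_norm X (\<sigma> N) + 1) * ell2_norm X f" by (simp add: algebra_simps)
    next
      fix f g assume fg: "f \<in> ell2 X" "g \<in> ell2 X"
      have "L (\<lambda>x. f x + g x) x = L f x + L g x" for x
      proof (rule LIMSEQ_unique[OF L(3)[OF ell2_add(1)[OF fg]]])
        show "(\<lambda>k. \<sigma> k (\<lambda>x. f x + g x) x) \<longlonglongrightarrow> L f x + L g x"
          unfolding bounded_operatorsD(3)[OF \<sigma> fg] by (intro tendsto_add L fg)
      qed
      then show "T (\<lambda>x. f x + g x) = (\<lambda>x. T f x + T g x)" by (simp add: T fg ell2_add fun_eq_iff)
    next
      fix c f assume f: "f \<in> ell2 X"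
      have "L (\<lambda>x. c * f x) x = c * L f x" for x
      proof (rule LIMSEQ_unique[OF L(3)[OF ell2_scale[OF f]]])
        show "(\<lambda>k. \<sigma> k (\<lambda>x. c * f x) x) \<longlonglongrightarrow> c * L f x"
          unfolding bounded_operatorsD(4)[OF \<sigma> f] by (intro tendsto_mult tendsto_const L f)
      qed
      then show "T (\<lambda>x. c * f x) = (\<lambda>x. c * T f x)" by (simp add: T f ell2_scale fun_eq_iff)
    qed (use L(1) T in \<open>auto simp: T_def\<close>)
  qed
  have "(\<lambda>k. op_norm X (\<lambda>f\<in>ell2 X. \<lambda>x. \<sigma> k f x + (\<lambda>f\<in>ell2 X. \<lambda>x. - 1 * T f x) f x)) \<longlonglongrightarrow> 0"
  proof (rule LIMSEQ_I)
    fix e :: real assume e: "e > 0"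
    obtain N where N: "\<forall>k\<ge>N. \<forall>f\<in>ell2 X. ell2_norm X (\<lambda>x. \<sigma> k f x - T f x) \<le> e / 2 * ell2_norm X f"
      using lim[of "e / 2"] e by auto
    have "op_norm X (\<lambda>f\<in>ell2 X. \<lambda>x. \<sigma> k f x + (\<lambda>f\<in>ell2 X. \<lambda>x. - 1 * T f x) f x) \<le> e / 2" if "k \<ge> N" for k
      using N that e by (intro op_norm_le) auto
    then show "\<exists>N. \<forall>k\<ge>N. norm (op_norm X (\<lambda>f\<in>ell2 X. \<lambda>x. \<sigma> k f x + (\<lambda>f\<in>ell2 X. \<lambda>x. - 1 * T f x) f x) - 0) < e"
      using e op_norm_nonneg[OF diff[OF T_bounded]] by (intro exI[of _ N]) fastforce
  qed
  with T_bounded show ?case by auto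
qed ((simp add: bounded_operators_closed bounded_operators_scale zero_bounded_operator adj_compact_algebra
      adjoint_operator_bounded op_norm_nonneg op_norm_eq_zero; fail) |
    (auto simp: compose_def restrict_def fun_eq_iff algebra_simps bounded_operatorsD)[1])+

lemma unital_bounded_algebra: "unital (bounded_algebra X)"
  by (auto simp: unital_def one_bounded_operator compose_def fun_eq_iff bounded_operatorsD)

section \<open>Compact operators\<close>

text \<open>For finite \<open>Y \<subseteq> X\<close> these are the matrices indexed by
  \<open>Y\<close>. One condition cuts off the domain, the other the range; both are pointwise,
  which makes them stable under limits.\<close>

definition finite_operators :: "'x set \<Rightarrow> 'x set \<Rightarrow> 'x operator set" where
  "finite_operators X Y = {T \<in> bounded_operators X.
    \<forall>f\<in>ell2 X. T (restrict_vector Y f) = T f \<and> (\<forall>x. x \<notin> Y \<longrightarrow> T f x = 0)}"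

lemma finite_operatorsD:
  assumes "T \<in> finite_operators X Y"
  shows "T \<in> bounded_operators X" "\<And>f. f \<in> ell2 X \<Longrightarrow> T (restrict_vector Y f) = T f"
    "\<And>f x. \<lbrakk>f \<in> ell2 X; x \<notin> Y\<rbrakk> \<Longrightarrow> T f x = 0"
  using assms by (auto simp: finite_operators_def)

lemma restrict_vector_restrict: "restrict_vector Y (restrict_vector Z f) = restrict_vector (Y \<inter> Z) f"
  by (auto simp: restrict_vector_def)

lemma restrict_vector_add: "restrict_vector Y (\<lambda>x. f x + g x) = (\<lambda>x. restrict_vector Y f x + restrict_vector Y g x)"
  by (auto simp: restrict_vector_def)

lemma restrict_vector_scale: "restrict_vector Y (\<lambda>x. c * f x) = (\<lambda>x. c * restrict_vector Y f x)"
  by (auto simp: restrict_vector_def)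

lemma finite_operators_mono:
  assumes "Y \<subseteq> Z" shows "finite_operators X Y \<subseteq> finite_operators X Z"
proof
  fix T assume T: "T \<in> finite_operators X Y"
  have "T (restrict_vector Z f) = T f" if "f \<in> ell2 X" for f
    using finite_operatorsD(2)[OF T, of "restrict_vector Z f"] finite_operatorsD(2)[OF T that]
      restrict_vector_ell2[OF that] assms by (simp add: restrict_vector_restrict Int_absorb2)
  with T assms show "T \<in> finite_operators X Z" by (auto simp: finite_operators_def)
qed

text \<open>With \<open>Q\<close> for coordinate projections this is \<open>Q_Y T Q_Z\<close>. Two
  sets occur because the range is truncated first and the domain afterwards, on a larger
  set.\<close>

definition corner :: "'x set \<Rightarrow> 'x set \<Rightarrow> 'x set \<Rightarrow> 'x operator \<Rightarrow> 'x operator" where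
  "corner X Y Z T = (\<lambda>f\<in>ell2 X. restrict_vector Y (T (restrict_vector Z f)))"

lemma corner_finite_operators:
  assumes T: "T \<in> bounded_operators X" and "Y \<subseteq> Z"
  shows "corner X Y Z T \<in> finite_operators X Z"
proof -
  note t = bounded_operatorsD[OF T]
  have "ell2_norm X (corner X Y Z T f) \<le> op_norm X T * ell2_norm X f" if f: "f \<in> ell2 X" for f
  proof -
    note r = restrict_vector_ell2[OF f, of Z]
    have "ell2_norm X (corner X Y Z T f) \<le> ell2_norm X (T (restrict_vector Z f))"
      using restrict_vector_ell2(2)[OF t(1)[OF r(1)]] f by (simp add: corner_def)
    also have "\<dots> \<le> op_norm X T * ell2_norm X (restrict_vector Z f)" by (rule op_norm_bound[OF T r(1)])
    also have "\<dots> \<le> op_norm X T * ell2_norm X f" by (intro mult_left_mono r op_norm_nonneg T)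
    finally show ?thesis .
  qed
  then have "corner X Y Z T \<in> bounded_operators X"
    by (rule bounded_operatorsI[rotated 4])
      (simp_all add: corner_def restrict_vector_ell2 t ell2_add ell2_scale restrict_vector_add restrict_vector_scale extensional_def)
  then show ?thesis
    using \<open>Y \<subseteq> Z\<close> by (auto simp: finite_operators_def corner_def restrict_vector_ell2 restrict_vector_restrict)
      (auto simp: restrict_vector_def)
qed

lemma adjoint_finite_operators:
  assumes T: "T \<in> finite_operators X Y"
  shows "adjoint_operator X T \<in> finite_operators X Y"
proof -
  note t = finite_operatorsD[OF T]
  have "adjoint_operator X T f x = 0" if "f \<in> ell2 X" "x \<notin> Y" for f x
  proof (cases "x \<in> X")
    case True
    have "restrict_vector Y (basis_vector x) = (\<lambda>_. 0)" using that by (auto simp: restrict_vector_def basis_vector_def)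
    then have "T (basis_vector x) = (\<lambda>_. 0)"
      using t(2)[OF basis_vector_ell2[OF True]] bounded_operators_zero[OF t(1)] by simp
    with that show ?thesis by (simp add: adjoint_operator_def)
  qed (use that in \<open>simp add: adjoint_operator_def\<close>)
  moreover have "adjoint_operator X T (restrict_vector Y f) = adjoint_operator X T f" if f: "f \<in> ell2 X" for f
  proof -
    have "ell2_inner X (T (basis_vector x)) (restrict_vector Y f) = ell2_inner X (T (basis_vector x)) f" if "x \<in> X" for x
      unfolding ell2_inner_def using t(3)[OF basis_vector_ell2[OF that]]
      by (intro infsum_cong) (auto simp: restrict_vector_def)
    then show ?thesis using f by (auto simp: adjoint_operator_def restrict_vector_ell2 fun_eq_iff)
  qed
  ultimately show ?thesis
    using adjoint_operator_bounded(1)[OF t(1)] by (auto simp: finite_operators_def)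
qed

lemma finite_operators_closed:
  assumes T: "T \<in> finite_operators X Y"
  shows "U \<in> finite_operators X Y \<Longrightarrow> T \<oplus>\<^bsub>bounded_algebra X\<^esub> U \<in> finite_operators X Y"
    "U \<in> finite_operators X Y \<Longrightarrow> T \<otimes>\<^bsub>bounded_algebra X\<^esub> U \<in> finite_operators X Y"
    "c \<odot>\<^bsub>bounded_algebra X\<^esub> T \<in> finite_operators X Y"
    "adj (bounded_algebra X) T \<in> finite_operators X Y"
  using finite_operatorsD[OF T] adjoint_finite_operators[OF T]
  by (auto simp: finite_operators_def bounded_operators_closed bounded_operators_scale
      restrict_vector_ell2 bounded_operatorsD compose_eq adj_compact_algebra)

lemma zero_finite_operators: "\<zero>\<^bsub>bounded_algebra X\<^esub> \<in> finite_operators X Y"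
  by (simp add: finite_operators_def zero_bounded_operator restrict_vector_ell2)

lemma bounded_algebra_diff:
  assumes "T \<in> bounded_operators X" "U \<in> bounded_operators X"
  shows "T \<ominus>\<^bsub>bounded_algebra X\<^esub> U = (\<lambda>f\<in>ell2 X. \<lambda>x. T f x - U f x)"
    "T \<ominus>\<^bsub>bounded_algebra X\<^esub> U \<in> bounded_operators X"
proof -
  interpret L: cstar_algebra "bounded_algebra X" by (rule cstar_algebra_bounded_algebra)
  show "T \<ominus>\<^bsub>bounded_algebra X\<^esub> U = (\<lambda>f\<in>ell2 X. \<lambda>x. T f x - U f x)"
    using assms by (auto simp: L.minus_eq_smult fun_eq_iff restrict_def)
  show "T \<ominus>\<^bsub>bounded_algebra X\<^esub> U \<in> bounded_operators X"
    using L.minus_closed[of T U] assms by simp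
qed

lemma op_norm_diff_le:
  assumes "\<And>f. f \<in> ell2 X \<Longrightarrow> ell2_norm X (\<lambda>x. T f x - U f x) \<le> b * ell2_norm X f" "b \<ge> 0"
    "T \<in> bounded_operators X" "U \<in> bounded_operators X"
  shows "op_norm X (T \<ominus>\<^bsub>bounded_algebra X\<^esub> U) \<le> b"
  using assms by (intro op_norm_le) (simp_all add: bounded_algebra_diff)

lemma op_norm_diff_bound:
  assumes "T \<in> bounded_operators X" "U \<in> bounded_operators X" "f \<in> ell2 X"
  shows "ell2_norm X (\<lambda>x. T f x - U f x) \<le> op_norm X (T \<ominus>\<^bsub>bounded_algebra X\<^esub> U) * ell2_norm X f"
  using op_norm_bound[OF bounded_algebra_diff(2)[OF assms(1,2)] assms(3)] assms
  by (simp add: bounded_algebra_diff)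

lemma tends_to_bounded_pointwise:
  assumes "tends_to (bounded_algebra X) \<sigma> T" "\<And>k. \<sigma> k \<in> bounded_operators X" "T \<in> bounded_operators X"
    "f \<in> ell2 X"
  shows "(\<lambda>k. \<sigma> k f x) \<longlonglongrightarrow> T f x"
proof -
  have "(\<lambda>k. op_norm X (\<sigma> k \<ominus>\<^bsub>bounded_algebra X\<^esub> T) * ell2_norm X f) \<longlonglongrightarrow> 0"
    using assms(1) tendsto_mult_left_zero by (auto simp: tends_to_def)
  moreover have "cmod (\<sigma> k f x - T f x) \<le> op_norm X (\<sigma> k \<ominus>\<^bsub>bounded_algebra X\<^esub> T) * ell2_norm X f" for k
    using cmod_le_ell2_norm[OF ell2_diff[OF bounded_operatorsD(1)[OF assms(2)[of k] assms(4)] bounded_operatorsD(1)[OF assms(3,4)]], of x]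
      op_norm_diff_bound[OF assms(2)[of k] assms(3,4)] by linarith
  ultimately have "(\<lambda>k. \<sigma> k f x - T f x) \<longlonglongrightarrow> 0"
    by - (rule Lim_null_comparison[OF always_eventually], auto)
  then show ?thesis by (simp add: LIM_zero_iff)
qed

text \<open>This makes a matrix block a C*-algebra, so that \<open>star_hom_contractive\<close> can
  be applied to maps known only on finite matrices.\<close>

lemma finite_operators_closed_star_subalgebra:
  "closed_star_subalgebra (finite_operators X Y) (bounded_algebra X)"
  unfolding closed_star_subalgebra_def
proof (intro conjI allI ballI impI)
  fix \<sigma> T assume *: "(\<forall>k. \<sigma> k \<in> finite_operators X Y) \<and> T \<in> carrier (bounded_algebra X) \<and> tends_to (bounded_algebra X) \<sigma> T"
  then have \<sigma>: "\<And>k. \<sigma> k \<in> finite_operators X Y" "\<And>k. \<sigma> k \<in> bounded_operators X" and T: "T \<in> bounded_operators X"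
    by (auto simp: finite_operators_def)
  note lim = tends_to_bounded_pointwise[of X \<sigma> T, OF _ \<sigma>(2) T]
  have "T (restrict_vector Y f) x = T f x" if "f \<in> ell2 X" for f x
    using lim[where f = "restrict_vector Y f" and x = x] lim[where f = f and x = x] * that finite_operatorsD(2)[OF \<sigma>(1) that]
      restrict_vector_ell2(1)[OF that] by (auto intro: LIMSEQ_unique)
  moreover have "T f x = 0" if "f \<in> ell2 X" "x \<notin> Y" for f x
    using lim[where f = f and x = x] that * finite_operatorsD(3)[OF \<sigma>(1) that] by (simp add: LIMSEQ_const_iff)
  ultimately show "T \<in> finite_operators X Y" using T by (auto simp: finite_operators_def)
qed (auto intro: finite_operators_closed zero_finite_operators finite_operatorsD(1) simp del: bounded_algebra_simps(2-6,8))

text \<open>Tychonoff replaces the diagonal argument: a product of closed discs over a countable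
  index type is compact and first countable, hence sequentially compact.\<close>

lemma countable_diagonal_subsequence:
  fixes f :: "nat \<Rightarrow> 'x::countable \<Rightarrow> complex"
  assumes "\<And>k x. cmod (f k x) \<le> 1"
  obtains r :: "nat \<Rightarrow> nat" where "strict_mono r" "\<And>x. convergent (\<lambda>k. f (r k) x)"
proof -
  have "compactin (product_topology (\<lambda>_::'x. euclidean :: complex topology) UNIV) (PiE UNIV (\<lambda>_. cball 0 1))"
    unfolding compactin_PiE by simp
  then have "compact (PiE UNIV (\<lambda>_::'x. cball (0::complex) 1))"
    by (metis compactin_euclidean_iff euclidean_product_topology)
  then have "seq_compact (PiE UNIV (\<lambda>_::'x. cball (0::complex) 1))" by (rule compact_imp_seq_compact)
  moreover have "\<forall>k. f k \<in> PiE UNIV (\<lambda>_::'x. cball (0::complex) 1)" using assms by auto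
  ultimately obtain l r where r: "strict_mono (r :: nat \<Rightarrow> nat)" "(f \<circ> r) \<longlonglongrightarrow> l"
    unfolding seq_compact_def by blast
  have "(\<lambda>k. f (r k) x) \<longlonglongrightarrow> l x" for x
    using continuous_on_tendsto_compose[OF continuous_on_product_coordinates[of x] r(2)] by (simp add: o_def)
  with r that show thesis by (auto simp: convergent_def)
qed

text \<open>Pass to a subsequence with convergent coordinates. A finite matrix \<open>U\<close> sees
  only finitely many coordinates, so it maps this subsequence to a Cauchy sequence, and
  \<open>T\<close> is within \<open>e / 3\<close> of such a \<open>U\<close>.\<close>

lemma approximable_imp_compact:
  fixes T :: "'x::countable operator"
  assumes T: "T \<in> bounded_operators X"
    and approx: "\<And>\<epsilon>. \<epsilon> > 0 \<Longrightarrow> \<exists>Y U. finite Y \<and> Y \<subseteq> X \<and> U \<in> finite_operators X Y \<and>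
      op_norm X (T \<ominus>\<^bsub>bounded_algebra X\<^esub> U) \<le> \<epsilon>"
  shows "T \<in> compact_operators X"
  unfolding compact_operators_def
proof (intro CollectI conjI allI impI T)
  fix f :: "nat \<Rightarrow> 'x \<Rightarrow> complex"
  assume "\<forall>k. f k \<in> ell2 X \<and> ell2_norm X (f k) \<le> 1"
  then have f: "\<And>k. f k \<in> ell2 X" "\<And>k. ell2_norm X (f k) \<le> 1" by auto
  have "cmod (f k x) \<le> 1" for k x using cmod_le_ell2_norm[OF f(1), of k x] f(2)[of k] by linarith
  then obtain r where r: "strict_mono (r :: nat \<Rightarrow> nat)" "\<And>x. convergent (\<lambda>k. f (r k) x)"
    using countable_diagonal_subsequence by blast
  have Cauchy: "\<exists>N. \<forall>k\<ge>N. \<forall>l\<ge>N. ell2_norm X (\<lambda>x. T (f (r k)) x - T (f (r l)) x) \<le> e" if "e > 0" for e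
  proof -
    have "e / 3 > 0" using that by simp
    from approx[OF this] obtain Y U where Y: "finite Y" "Y \<subseteq> X" and U: "U \<in> finite_operators X Y"
      and TU: "op_norm X (T \<ominus>\<^bsub>bounded_algebra X\<^esub> U) \<le> e / 3" by blast
    note u = finite_operatorsD[OF U]
    \<comment> \<open>\<open>M\<close> is positive even if \<open>U\<close> is zero, and the
      \<open>+ 1\<close> in \<open>d\<close> allows an empty \<open>Y\<close>. The
      \<open>card Y\<close> coordinates together contribute at most \<open>E\<close>, which
      \<open>U\<close> magnifies to at most \<open>e / 3\<close>.\<close>
    define M where "M = op_norm X U + 1"
    have M: "M > 0" "op_norm X U \<le> M" using op_norm_nonneg[OF u(1)] by (auto simp: M_def)
    define E where "E = e / (3 * M)"
    have E: "E > 0" using \<open>e > 0\<close> M by (simp add: E_def)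
    define d where "d = E / (card Y + 1)"
    have d: "d > 0" "card Y * d \<le> E" using E by (auto simp: d_def field_simps)
    have "\<forall>x. \<exists>N. \<forall>k\<ge>N. \<forall>l\<ge>N. cmod (f (r k) x - f (r l) x) < d"
      using convergent_Cauchy[OF r(2)] d(1) unfolding Cauchy_iff by blast
    then obtain N where N: "\<And>x k l. \<lbrakk>k \<ge> N x; l \<ge> N x\<rbrakk> \<Longrightarrow> cmod (f (r k) x - f (r l) x) < d" by metis
    define n where "n = Max (insert 0 (N ` Y))"
    have n: "N x \<le> n" if "x \<in> Y" for x using that Y by (auto simp: n_def)
    have "ell2_norm X (\<lambda>x. T (f (r k)) x - T (f (r l)) x) \<le> e" if kl: "k \<ge> n" "l \<ge> n" for k l
    proof -
      define g where "g = (\<lambda>x. f (r k) x - f (r l) x)"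
      have g: "g \<in> ell2 X" using ell2_diff[OF f(1) f(1)] by (simp add: g_def)
      have gY: "restrict_vector Y g \<in> ell2 X" "ell2_norm X (restrict_vector Y g) = L2_set (\<lambda>x. cmod (restrict_vector Y g x)) Y"
        using Y by (auto intro!: ell2_norm_finite_support simp: restrict_vector_def)
      have "ell2_norm X (restrict_vector Y g) \<le> (\<Sum>x\<in>Y. cmod (restrict_vector Y g x))"
        unfolding gY by (intro L2_set_le_sum) auto
      also have "\<dots> \<le> (\<Sum>x\<in>Y. d)"
      proof (rule sum_mono)
        fix x assume x: "x \<in> Y"
        show "cmod (restrict_vector Y g x) \<le> d"
          using N[OF order_trans[OF n[OF x] kl(1)] order_trans[OF n[OF x] kl(2)]] x
          by (simp add: restrict_vector_def g_def)
      qed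
      also have "\<dots> \<le> e / (3 * M)" using d(2) by (simp add: E_def)
      finally have gs: "ell2_norm X (restrict_vector Y g) \<le> e / (3 * M)" .
      have "ell2_norm X (U g) \<le> op_norm X U * ell2_norm X (restrict_vector Y g)"
        using op_norm_bound[OF u(1) gY(1)] u(2)[OF g] by simp
      also have "\<dots> \<le> M * (e / (3 * M))" using M gs op_norm_nonneg[OF u(1)] by (intro mult_mono) auto
      finally have Ug: "ell2_norm X (U g) \<le> e / 3" using M by simp
      have Ug_eq: "U g = (\<lambda>x. U (f (r k)) x - U (f (r l)) x)"
        unfolding g_def by (rule bounded_operators_diff[OF u(1) f(1) f(1)])
      have T_U: "ell2_norm X (\<lambda>x. T (f m) x - U (f m) x) \<le> e / 3" for m
      proof -
        have "ell2_norm X (\<lambda>x. T (f m) x - U (f m) x) \<le> op_norm X (T \<ominus>\<^bsub>bounded_algebra X\<^esub> U) * ell2_norm X (f m)"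
          by (rule op_norm_diff_bound[OF T u(1) f(1)])
        also have "\<dots> \<le> e / 3 * 1" using TU f(2)[of m] \<open>e > 0\<close> by (intro mult_mono) auto
        finally show ?thesis by simp
      qed
      note b = bounded_operatorsD(1)[OF T f(1)] bounded_operatorsD(1)[OF u(1) f(1)]
      have "ell2_norm X (\<lambda>x. T (f (r k)) x - T (f (r l)) x) \<le> e / 3 + (e / 3 + e / 3)"
        using ell2_norm_diff_triangle[OF b(1)[of "r k"] b(2)[of "r k"] b(1)[of "r l"]]
          ell2_norm_diff_triangle[OF b(2)[of "r k"] b(2)[of "r l"] b(1)[of "r l"]]
          T_U[of "r k"] T_U[of "r l"] Ug[unfolded Ug_eq]
        unfolding ell2_norm_diff_commute[of X "U (f (r l))" "T (f (r l))"] by linarith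
      then show ?thesis by simp
    qed
    then show ?thesis by blast
  qed
  obtain g where "g \<in> ell2 X" "(\<lambda>k. ell2_norm X (\<lambda>x. T (f (r k)) x - g x)) \<longlonglongrightarrow> 0"
    using ell2_complete[of "\<lambda>k. T (f (r k))" X, OF bounded_operatorsD(1)[OF T f(1)] Cauchy] by blast
  with r(1) show "\<exists>(r :: nat \<Rightarrow> nat) g. strict_mono r \<and> g \<in> ell2 X \<and>
      (\<lambda>k. ell2_norm X (\<lambda>x. T (f (r k)) x - g x)) \<longlonglongrightarrow> 0" by blast
qed

text \<open>If no finite cut-off works, then along the exhaustion \<open>Z k\<close> there are
  vectors in the unit ball whose images have norm more than \<open>\<epsilon>\<close> outside
  \<open>Z k\<close>. A convergent subsequence of the images contradicts the smallness of the tails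
  of its limit.\<close>

lemma compact_imp_restrict_approx:
  fixes T :: "'x::countable operator"
  assumes T: "T \<in> compact_operators X" and "\<epsilon> > 0"
  obtains Y where "finite Y" "Y \<subseteq> X"
    "\<And>f. f \<in> ell2 X \<Longrightarrow> ell2_norm X (\<lambda>x. T f x - restrict_vector Y (T f) x) \<le> \<epsilon> * ell2_norm X f"
proof (rule ccontr)
  assume "\<not> thesis"
  with that have no: "\<And>Y. \<lbrakk>finite Y; Y \<subseteq> X\<rbrakk> \<Longrightarrow> \<exists>f\<in>ell2 X. ell2_norm X (\<lambda>x. T f x - restrict_vector Y (T f) x) > \<epsilon> * ell2_norm X f"
    by (meson not_le)
  have Tb: "T \<in> bounded_operators X" using T by (simp add: compact_operators_def)
  define Z where "Z k = {x \<in> X. to_nat x < k}" for k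
  have Z: "finite (Z k)" "Z k \<subseteq> X" for k
  proof -
    have "Z k \<subseteq> to_nat -` {..<k}" by (auto simp: Z_def)
    then show "finite (Z k)" by (rule finite_subset) (intro finite_vimageI, auto)
  qed (auto simp: Z_def)
  have "\<exists>f\<in>ell2 X. ell2_norm X f \<le> 1 \<and> ell2_norm X (\<lambda>x. T f x - restrict_vector (Z k) (T f) x) > \<epsilon>" for k
  proof -
    obtain f where f: "f \<in> ell2 X" "ell2_norm X (\<lambda>x. T f x - restrict_vector (Z k) (T f) x) > \<epsilon> * ell2_norm X f"
      using no[OF Z] by blast
    have "ell2_norm X f \<noteq> 0"
    proof
      assume "ell2_norm X f = 0"
      then have "T f = (\<lambda>x. 0)" using ell2_norm_eq_zero[OF f(1)] bounded_operators_zero[OF Tb] by simp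
      with f(2) \<open>ell2_norm X f = 0\<close> show False by (simp add: restrict_vector_def)
    qed
    then have pos: "ell2_norm X f > 0" using ell2_norm_nonneg[of X f] by linarith
    define c where "c = complex_of_real (1 / ell2_norm X f)"
    have c: "cmod c = 1 / ell2_norm X f" using pos by (simp add: c_def norm_divide)
    have "ell2_norm X (\<lambda>x. c * (T f x - restrict_vector (Z k) (T f) x)) > \<epsilon>"
      unfolding ell2_norm_scale c using f(2) pos by (simp add: field_simps)
    moreover have "(\<lambda>x. c * (T f x - restrict_vector (Z k) (T f) x)) =
      (\<lambda>x. T (\<lambda>x. c * f x) x - restrict_vector (Z k) (T (\<lambda>x. c * f x)) x)"
      by (simp add: bounded_operatorsD(4)[OF Tb f(1)] restrict_vector_scale algebra_simps)
    ultimately show ?thesis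
      using pos by (intro bexI[of _ "\<lambda>x. c * f x"] ell2_scale[OF f(1)]) (simp add: ell2_norm_scale c)
  qed
  then obtain f where f: "\<And>k. f k \<in> ell2 X" "\<And>k. ell2_norm X (f k) \<le> 1"
    "\<And>k. ell2_norm X (\<lambda>x. T (f k) x - restrict_vector (Z k) (T (f k)) x) > \<epsilon>" by metis
  then obtain r g where r: "strict_mono (r :: nat \<Rightarrow> nat)" and g: "g \<in> ell2 X"
    and lim: "(\<lambda>k. ell2_norm X (\<lambda>x. T (f (r k)) x - g x)) \<longlonglongrightarrow> 0"
    using T unfolding compact_operators_def by blast
  have "\<epsilon> / 3 > 0" using \<open>\<epsilon> > 0\<close> by simp
  then obtain Y where Y: "finite Y" "Y \<subseteq> X"
    "\<And>G. Y \<subseteq> G \<Longrightarrow> ell2_norm X (\<lambda>x. g x - restrict_vector G g x) \<le> \<epsilon> / 3"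
    using restrict_vector_approx[OF g] by blast
  obtain N where N: "\<And>k. k \<ge> N \<Longrightarrow> ell2_norm X (\<lambda>x. T (f (r k)) x - g x) < \<epsilon> / 3"
    using order_tendstoD(2)[OF lim \<open>\<epsilon> / 3 > 0\<close>] by (auto simp: eventually_sequentially)
  \<comment> \<open>\<open>k\<close> is at least \<open>N\<close> and exceeds the codes of all
    elements of \<open>Y\<close>; as \<open>r k \<ge> k\<close>, the set \<open>Z (r k)\<close>
    contains \<open>Y\<close>.\<close>
  define k where "k = max N (Max (insert 0 (Suc ` to_nat ` Y)))"
  have "Suc (to_nat x) \<le> k" if "x \<in> Y" for x
    using that Y(1) by (auto simp: k_def le_max_iff_disj intro!: disjI2 Max_ge)
  then have "Suc (to_nat x) \<le> r k" if "x \<in> Y" for x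
    using that seq_suble[OF r, of k] order_trans by blast
  then have YZ: "Y \<subseteq> Z (r k)" using Y(2) by (auto simp: Z_def Suc_le_eq)
  let ?h = "T (f (r k))" and ?R = "restrict_vector (Z (r k))"
  have h: "?h \<in> ell2 X" by (rule bounded_operatorsD(1)[OF Tb f(1)])
  define u where "u = (\<lambda>x. ?h x - g x)"
  have u: "u \<in> ell2 X" using ell2_diff[OF h g] by (simp add: u_def)
  have "(\<lambda>x. ?h x - ?R ?h x) = (\<lambda>x. restrict_vector (- Z (r k)) u x + (g x - ?R g x))"
    by (auto simp: u_def restrict_vector_def)
  then have "ell2_norm X (\<lambda>x. ?h x - ?R ?h x) \<le> ell2_norm X (restrict_vector (- Z (r k)) u) + ell2_norm X (\<lambda>x. g x - ?R g x)"
    using ell2_add(2)[OF restrict_vector_ell2(1)[OF u] ell2_diff[OF g restrict_vector_ell2(1)[OF g]]] by metis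
  also have "\<dots> \<le> ell2_norm X u + \<epsilon> / 3"
    using restrict_vector_ell2(2)[OF u] Y(3)[OF YZ] by (intro add_mono) auto
  also have "\<dots> \<le> \<epsilon> / 3 + \<epsilon> / 3" using N[of k] by (simp add: u_def k_def)
  finally show False using f(3)[of "r k"] \<open>\<epsilon> > 0\<close> by simp
qed

text \<open>After the range is cut to a finite \<open>Y\<close>, the remaining coordinates of
  \<open>T\<close> are the functionals given by the vectors \<open>u \<alpha>\<close>, the images of
  basis vectors under the adjoint. These finitely many vectors have small tails outside a common
  finite \<open>W\<close>, to which the domain is cut.\<close>

lemma compact_imp_approximable:
  fixes T :: "'x::countable operator"
  assumes T: "T \<in> compact_operators X" and "\<epsilon> > 0"
  obtains Y U where "finite Y" "Y \<subseteq> X" "U \<in> finite_operators X Y"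
    "op_norm X (T \<ominus>\<^bsub>bounded_algebra X\<^esub> U) \<le> \<epsilon>"
proof -
  have Tb: "T \<in> bounded_operators X" using T by (simp add: compact_operators_def)
  note t = bounded_operatorsD[OF Tb]
  have "\<epsilon> / 2 > 0" using \<open>\<epsilon> > 0\<close> by simp
  from compact_imp_restrict_approx[OF T this] obtain Y where Y: "finite Y" "Y \<subseteq> X"
    "\<And>f. f \<in> ell2 X \<Longrightarrow> ell2_norm X (\<lambda>x. T f x - restrict_vector Y (T f) x) \<le> \<epsilon> / 2 * ell2_norm X f" by blast
  define d where "d = \<epsilon> / (2 * (card Y + 1))"
  have d: "d > 0" "card Y * d \<le> \<epsilon> / 2" using \<open>\<epsilon> > 0\<close> by (auto simp: d_def field_simps)
  define u where "u \<alpha> = adjoint_operator X T (basis_vector \<alpha>)" for \<alpha>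
  have u: "u \<alpha> \<in> ell2 X" if "\<alpha> \<in> X" for \<alpha>
    using adjoint_operator_bound(1)[OF Tb basis_vector_ell2[OF that]] by (simp add: u_def)
  have "\<exists>Z. finite Z \<and> Z \<subseteq> X \<and> (\<forall>G. Z \<subseteq> G \<longrightarrow> ell2_norm X (\<lambda>x. u \<alpha> x - restrict_vector G (u \<alpha>) x) \<le> d)"
    if "\<alpha> \<in> X" for \<alpha>
    using restrict_vector_approx[OF u[OF that] d(1)] by metis
  then obtain Z where Z: "\<And>\<alpha>. \<alpha> \<in> X \<Longrightarrow> finite (Z \<alpha>)" "\<And>\<alpha>. \<alpha> \<in> X \<Longrightarrow> Z \<alpha> \<subseteq> X"
    "\<And>\<alpha> G. \<lbrakk>\<alpha> \<in> X; Z \<alpha> \<subseteq> G\<rbrakk> \<Longrightarrow> ell2_norm X (\<lambda>x. u \<alpha> x - restrict_vector G (u \<alpha>) x) \<le> d" by metis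
  define W where "W = Y \<union> (\<Union>\<alpha>\<in>Y. Z \<alpha>)"
  have W: "finite W" "W \<subseteq> X" "Y \<subseteq> W"
    using Y(1,2) Z(1,2) unfolding W_def by (blast, blast, blast)
  let ?U = "corner X Y W T"
  have U: "?U \<in> finite_operators X W" by (rule corner_finite_operators[OF Tb W(3)])
  have small: "ell2_norm X (\<lambda>x. T f x - ?U f x) \<le> \<epsilon> * ell2_norm X f" if f: "f \<in> ell2 X" for f
  proof -
    define g where "g = (\<lambda>x. f x - restrict_vector W f x)"
    have fW: "restrict_vector W f \<in> ell2 X" by (rule restrict_vector_ell2(1)[OF f])
    have g: "g \<in> ell2 X" using ell2_diff[OF f fW] by (simp add: g_def)
    have Tg: "T g = (\<lambda>x. T f x - T (restrict_vector W f) x)"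
      unfolding g_def by (rule bounded_operators_diff[OF Tb f fW])
    have coord: "cmod (T g \<alpha>) \<le> d * ell2_norm X f" if "\<alpha> \<in> Y" for \<alpha>
    proof -
      have \<alpha>: "\<alpha> \<in> X" using that Y by auto
      have "T g \<alpha> = ell2_inner X (u \<alpha>) g"
        using adjoint_operator_inner_left[OF Tb basis_vector_ell2[OF \<alpha>] g] ell2_inner_basis_left[OF \<alpha>]
        by (simp add: u_def)
      also have "\<dots> = ell2_inner X (\<lambda>x. u \<alpha> x - restrict_vector W (u \<alpha>) x) f"
        unfolding ell2_inner_def by (intro infsum_cong) (auto simp: g_def restrict_vector_def)
      finally have "cmod (T g \<alpha>) \<le> ell2_norm X (\<lambda>x. u \<alpha> x - restrict_vector W (u \<alpha>) x) * ell2_norm X f"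
        using ell2_Cauchy_Schwarz[OF ell2_diff[OF u[OF \<alpha>] restrict_vector_ell2(1)[OF u[OF \<alpha>]]] f] by simp
      also have "\<dots> \<le> d * ell2_norm X f"
        using Z(3)[OF \<alpha>, of W] that by (intro mult_right_mono) (auto simp: W_def)
      finally show ?thesis .
    qed
    have "ell2_norm X (restrict_vector Y (T g)) = L2_set (\<lambda>x. cmod (restrict_vector Y (T g) x)) Y"
      using Y by (intro ell2_norm_finite_support) (auto simp: restrict_vector_def)
    also have "\<dots> \<le> (\<Sum>x\<in>Y. cmod (restrict_vector Y (T g) x))" by (intro L2_set_le_sum) auto
    also have "\<dots> \<le> (\<Sum>x\<in>Y. d * ell2_norm X f)" using coord by (intro sum_mono) (auto simp: restrict_vector_def)
    also have "\<dots> = card Y * d * ell2_norm X f" by simp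
    also have "\<dots> \<le> \<epsilon> / 2 * ell2_norm X f" using d(2) by (intro mult_right_mono) auto
    finally have 2: "ell2_norm X (restrict_vector Y (T g)) \<le> \<epsilon> / 2 * ell2_norm X f" .
    \<comment> \<open>With \<open>Q\<close> for coordinate projections, the error is
      \<open>T f - Q_Y T f\<close> plus \<open>Q_Y T g\<close>, where \<open>g = f - Q_W f\<close>;
      each part accounts for \<open>\<epsilon> / 2\<close>.\<close>
    have "(\<lambda>x. T f x - ?U f x) = (\<lambda>x. (T f x - restrict_vector Y (T f) x) + restrict_vector Y (T g) x)"
      using f by (auto simp: corner_def Tg restrict_vector_def)
    then have "ell2_norm X (\<lambda>x. T f x - ?U f x) \<le>
      ell2_norm X (\<lambda>x. T f x - restrict_vector Y (T f) x) + ell2_norm X (restrict_vector Y (T g))"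
      using ell2_add(2)[OF ell2_diff[OF t(1)[OF f] restrict_vector_ell2(1)[OF t(1)[OF f]]] restrict_vector_ell2(1)[OF t(1)[OF g]]]
      by metis
    also have "\<dots> \<le> \<epsilon> / 2 * ell2_norm X f + \<epsilon> / 2 * ell2_norm X f" by (intro add_mono Y(3) f 2)
    finally show ?thesis by simp
  qed
  have "op_norm X (T \<ominus>\<^bsub>bounded_algebra X\<^esub> ?U) \<le> \<epsilon>"
    using small \<open>\<epsilon> > 0\<close> finite_operatorsD(1)[OF U] Tb by (intro op_norm_diff_le) auto
  with W U that show thesis by blast
qed

lemma finite_operators_compact:
  fixes T :: "'x::countable operator"
  assumes "finite Y" "Y \<subseteq> X" "T \<in> finite_operators X Y"
  shows "T \<in> compact_operators X"
proof (rule approximable_imp_compact[OF finite_operatorsD(1)[OF assms(3)]])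
  fix \<epsilon> :: real assume "\<epsilon> > 0"
  moreover have "op_norm X (T \<ominus>\<^bsub>bounded_algebra X\<^esub> T) \<le> 0"
    using finite_operatorsD(1)[OF assms(3)] by (intro op_norm_diff_le) simp_all
  ultimately show "\<exists>Y U. finite Y \<and> Y \<subseteq> X \<and> U \<in> finite_operators X Y \<and>
      op_norm X (T \<ominus>\<^bsub>bounded_algebra X\<^esub> U) \<le> \<epsilon>" using assms by (intro exI[of _ Y] exI[of _ T]) auto
qed

section \<open>Dense subalgebras\<close>

context cstar_algebra begin

lemma approximable_iff_tends_to:
  assumes "D \<subseteq> carrier A" "x \<in> carrier A"
  shows "(\<forall>\<epsilon>>0. \<exists>d\<in>D. nrm A (x \<ominus> d) \<le> \<epsilon>) \<longleftrightarrow> (\<exists>\<sigma>. (\<forall>k. \<sigma> k \<in> D) \<and> tends_to A \<sigma> x)"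
proof
  assume *: "\<forall>\<epsilon>>0. \<exists>d\<in>D. nrm A (x \<ominus> d) \<le> \<epsilon>"
  have "\<forall>k. \<exists>d. d \<in> D \<and> nrm A (x \<ominus> d) \<le> inverse (real (Suc k))"
    using * by (metis inverse_positive_iff_positive of_nat_0_less_iff zero_less_Suc)
  then obtain \<sigma> where \<sigma>: "\<And>k. \<sigma> k \<in> D" "\<And>k. nrm A (x \<ominus> \<sigma> k) \<le> inverse (real (Suc k))" by metis
  have "tends_to A \<sigma> x"
  proof (rule tends_to_le)
    show "nrm A (\<sigma> k \<ominus> x) \<le> inverse (real (Suc k))" for k
      using \<sigma>[of k] assms nrm_minus_commute[of x "\<sigma> k"] by auto
  qed (use \<sigma>(1) assms LIMSEQ_inverse_real_of_nat in auto)
  with \<sigma>(1) show "\<exists>\<sigma>. (\<forall>k. \<sigma> k \<in> D) \<and> tends_to A \<sigma> x" by blast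
next
  assume "\<exists>\<sigma>. (\<forall>k. \<sigma> k \<in> D) \<and> tends_to A \<sigma> x"
  then obtain \<sigma> where \<sigma>: "\<And>k. \<sigma> k \<in> D" "tends_to A \<sigma> x" by blast
  show "\<forall>\<epsilon>>0. \<exists>d\<in>D. nrm A (x \<ominus> d) \<le> \<epsilon>"
  proof (intro allI impI)
    fix \<epsilon> :: real assume "\<epsilon> > 0"
    then obtain k where "nrm A (\<sigma> k \<ominus> x) < \<epsilon>"
      using order_tendstoD(2)[OF \<sigma>(2)[unfolded tends_to_def]] by (auto simp: eventually_sequentially)
    moreover have "\<sigma> k \<in> carrier A" using \<sigma>(1) assms(1) by blast
    ultimately have "nrm A (x \<ominus> \<sigma> k) \<le> \<epsilon>" using nrm_minus_commute[of x "\<sigma> k"] assms(2) by simp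
    with \<sigma>(1) show "\<exists>d\<in>D. nrm A (x \<ominus> d) \<le> \<epsilon>" by blast
  qed
qed

lemma closure_closed_star_subalgebra:
  assumes D: "D \<subseteq> carrier A" "\<zero> \<in> D" "\<And>x y. \<lbrakk>x \<in> D; y \<in> D\<rbrakk> \<Longrightarrow> x \<oplus> y \<in> D"
    "\<And>x y. \<lbrakk>x \<in> D; y \<in> D\<rbrakk> \<Longrightarrow> x \<otimes> y \<in> D" "\<And>c x. x \<in> D \<Longrightarrow> c \<odot> x \<in> D" "\<And>x. x \<in> D \<Longrightarrow> adj A x \<in> D"
  shows "closed_star_subalgebra {x \<in> carrier A. \<forall>\<epsilon>>0. \<exists>d\<in>D. nrm A (x \<ominus> d) \<le> \<epsilon>} A" (is "closed_star_subalgebra ?C A")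
proof -
  have C: "x \<in> ?C \<longleftrightarrow> x \<in> carrier A \<and> (\<exists>\<sigma>. (\<forall>k. \<sigma> k \<in> D) \<and> tends_to A \<sigma> x)" for x
    using approximable_iff_tends_to[OF D(1), of x] by auto
  have CI: "x \<in> ?C" if "x \<in> carrier A" "tends_to A \<sigma> x" "\<And>k. \<sigma> k \<in> D" for x \<sigma>
    unfolding C using that by blast
  have CE: "\<exists>\<sigma>. (\<forall>k. \<sigma> k \<in> D) \<and> (\<forall>k. \<sigma> k \<in> carrier A) \<and> tends_to A \<sigma> x \<and> x \<in> carrier A" if "x \<in> ?C" for x
    using that D(1) unfolding C by blast
  show ?thesis
    unfolding closed_star_subalgebra_def
  proof (intro conjI ballI allI impI)
    show "?C \<subseteq> carrier A" by blast
    show "\<zero> \<in> ?C" using D(2) tends_to_const[of \<zero>] by (intro CI[of _ "\<lambda>_. \<zero>"]) auto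
  next
    fix x y assume "x \<in> ?C" "y \<in> ?C"
    then obtain \<sigma> \<tau> where *: "\<And>k. \<sigma> k \<in> D" "\<And>k. \<sigma> k \<in> carrier A" "tends_to A \<sigma> x" "x \<in> carrier A"
      "\<And>k. \<tau> k \<in> D" "\<And>k. \<tau> k \<in> carrier A" "tends_to A \<tau> y" "y \<in> carrier A"
      using CE[of x] CE[of y] by blast
    show "x \<oplus> y \<in> ?C" by (rule CI[OF _ tends_to_add[OF *(3,7,2,6,4,8)]]) (use * D in auto)
    show "x \<otimes> y \<in> ?C" by (rule CI[OF _ tends_to_mult[OF *(3,7,2,6,4,8)]]) (use * D in auto)
  next
    fix c x assume "x \<in> ?C"
    then obtain \<sigma> where *: "\<And>k. \<sigma> k \<in> D" "\<And>k. \<sigma> k \<in> carrier A" "tends_to A \<sigma> x" "x \<in> carrier A" using CE by blast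
    show "c \<odot> x \<in> ?C" by (rule CI[OF _ tends_to_smult[OF *(3,2,4)]]) (use * D in auto)
  next
    fix x assume "x \<in> ?C"
    then obtain \<sigma> where *: "\<And>k. \<sigma> k \<in> D" "\<And>k. \<sigma> k \<in> carrier A" "tends_to A \<sigma> x" "x \<in> carrier A" using CE by blast
    show "adj A x \<in> ?C" by (rule CI[OF _ tends_to_adj[OF *(3,2,4)]]) (use * D in auto)
  next
    fix \<sigma> x assume *: "(\<forall>k. \<sigma> k \<in> ?C) \<and> x \<in> carrier A \<and> tends_to A \<sigma> x"
    then have \<sigma>: "\<And>k. \<sigma> k \<in> carrier A" by blast
    have "\<exists>d\<in>D. nrm A (x \<ominus> d) \<le> \<epsilon>" if "\<epsilon> > 0" for \<epsilon>
    proof -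
      have "\<epsilon> / 2 > 0" using that by simp
      moreover have "\<exists>d\<in>?C. nrm A (x \<ominus> d) \<le> \<epsilon> / 2"
        using * \<open>\<epsilon> / 2 > 0\<close> approximable_iff_tends_to[of ?C x] by blast
      ultimately obtain y d where "y \<in> ?C" "nrm A (x \<ominus> y) \<le> \<epsilon> / 2" "d \<in> D" "nrm A (y \<ominus> d) \<le> \<epsilon> / 2" by blast
      moreover from this have "nrm A (x \<ominus> d) \<le> nrm A (x \<ominus> y) + nrm A (y \<ominus> d)"
        using * D(1) by (intro nrm_diff_triangle) auto
      ultimately show ?thesis by (intro bexI[of _ d]) auto
    qed
    with * show "x \<in> ?C" by blast
  qed
qed

lemma finsum_smult:
  assumes "finite I" "f \<in> I \<rightarrow> carrier A"
  shows "c \<odot> (\<Oplus>i\<in>I. f i) = (\<Oplus>i\<in>I. c \<odot> f i)"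
  using assms
proof (induction I)
  case (insert i I)
  then have "f \<in> I \<rightarrow> carrier A" "f i \<in> carrier A" "(\<lambda>i. c \<odot> f i) \<in> I \<rightarrow> carrier A" by auto
  with insert show ?case by (simp add: smult_add_right)
qed simp

end

lemma star_hom_finsum:
  assumes A: "cstar_algebra A" and B: "cstar_algebra B" and \<phi>: "star_hom A B \<phi>"
    and "finite I" "f \<in> I \<rightarrow> carrier A"
  shows "\<phi> (\<Oplus>\<^bsub>A\<^esub>i\<in>I. f i) = (\<Oplus>\<^bsub>B\<^esub>i\<in>I. \<phi> (f i))"
  using assms(4,5)
proof (induction I)
  case empty
  interpret A: cstar_algebra A by fact
  interpret B: cstar_algebra B by fact
  show ?case by (simp add: star_hom_zero[OF A B \<phi>])
next
  case (insert i I)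
  interpret A: cstar_algebra A by fact
  interpret B: cstar_algebra B by fact
  have "f \<in> I \<rightarrow> carrier A" "f i \<in> carrier A" "(\<lambda>i. \<phi> (f i)) \<in> I \<rightarrow> carrier B" "\<phi> (f i) \<in> carrier B"
    using insert star_homD(1)[OF \<phi>] by auto
  with insert show ?case by (simp add: star_homD(2)[OF \<phi>])
qed

text \<open>\<open>D\<close> is only dense, in general not complete, so
  \<open>star_hom_contractive\<close> does not apply to it and contractivity is a premise. It makes
  images of approximating sequences Cauchy.\<close>

lemma star_hom_extension:
  assumes K: "cstar_algebra K" and A: "cstar_algebra A" and D: "D \<subseteq> carrier K"
    and closed: "\<And>x y. \<lbrakk>x \<in> D; y \<in> D\<rbrakk> \<Longrightarrow> x \<oplus>\<^bsub>K\<^esub> y \<in> D" "\<And>x y. \<lbrakk>x \<in> D; y \<in> D\<rbrakk> \<Longrightarrow> x \<otimes>\<^bsub>K\<^esub> y \<in> D"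
      "\<And>c x. x \<in> D \<Longrightarrow> c \<odot>\<^bsub>K\<^esub> x \<in> D" "\<And>x. x \<in> D \<Longrightarrow> adj K x \<in> D"
    and dense: "\<And>x. x \<in> carrier K \<Longrightarrow> \<exists>\<sigma>. (\<forall>k. \<sigma> k \<in> D) \<and> tends_to K \<sigma> x"
    and in_A: "\<And>x. x \<in> D \<Longrightarrow> \<phi> x \<in> carrier A"
    and hom: "\<And>x y. \<lbrakk>x \<in> D; y \<in> D\<rbrakk> \<Longrightarrow> \<phi> (x \<oplus>\<^bsub>K\<^esub> y) = \<phi> x \<oplus>\<^bsub>A\<^esub> \<phi> y"
      "\<And>x y. \<lbrakk>x \<in> D; y \<in> D\<rbrakk> \<Longrightarrow> \<phi> (x \<otimes>\<^bsub>K\<^esub> y) = \<phi> x \<otimes>\<^bsub>A\<^esub> \<phi> y"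
      "\<And>c x. x \<in> D \<Longrightarrow> \<phi> (c \<odot>\<^bsub>K\<^esub> x) = c \<odot>\<^bsub>A\<^esub> \<phi> x" "\<And>x. x \<in> D \<Longrightarrow> \<phi> (adj K x) = adj A (\<phi> x)"
    and contractive: "\<And>x. x \<in> D \<Longrightarrow> nrm A (\<phi> x) \<le> nrm K x"
  obtains \<psi> where "star_hom K A \<psi>" "\<And>x. x \<in> D \<Longrightarrow> \<psi> x = \<phi> x"
proof -
  interpret K: cstar_algebra K by fact
  interpret A: cstar_algebra A by fact
  have DK: "x \<in> carrier K" if "x \<in> D" for x using D that by blast
  have diff: "nrm A (\<phi> x \<ominus>\<^bsub>A\<^esub> \<phi> y) \<le> nrm K (x \<ominus>\<^bsub>K\<^esub> y)" if "x \<in> D" "y \<in> D" for x y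
    using contractive[of "x \<oplus>\<^bsub>K\<^esub> (-1) \<odot>\<^bsub>K\<^esub> y"] that hom(1)[of x "(-1) \<odot>\<^bsub>K\<^esub> y"] hom(3)[of y "-1"]
    by (simp add: closed DK in_A A.minus_eq_smult K.minus_eq_smult)
  define approx where "approx x = (SOME \<sigma>. (\<forall>k. \<sigma> k \<in> D) \<and> tends_to K \<sigma> x)" for x
  have approx: "approx x k \<in> D" "tends_to K (approx x) x" if "x \<in> carrier K" for x k
    using someI_ex[OF dense[OF that]] unfolding approx_def by auto
  have "\<exists>y\<in>carrier A. tends_to A (\<lambda>k. \<phi> (approx x k)) y" if x: "x \<in> carrier K" for x
  proof (rule A.complete)
    show "\<forall>e>0. \<exists>N. \<forall>k\<ge>N. \<forall>l\<ge>N. nrm A (\<phi> (approx x k) \<ominus>\<^bsub>A\<^esub> \<phi> (approx x l)) < e"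
    proof (intro allI impI)
      fix e :: real assume "e > 0"
      then have "e / 2 > 0" by simp
      then obtain N where N: "\<And>k. k \<ge> N \<Longrightarrow> nrm K (approx x k \<ominus>\<^bsub>K\<^esub> x) < e / 2"
        using order_tendstoD(2)[OF approx(2)[OF x, unfolded tends_to_def] \<open>e / 2 > 0\<close>]
        unfolding eventually_sequentially by blast
      have "nrm A (\<phi> (approx x k) \<ominus>\<^bsub>A\<^esub> \<phi> (approx x l)) < e" if "k \<ge> N" "l \<ge> N" for k l
      proof -
        note a = approx(1)[OF x]
        have "nrm A (\<phi> (approx x k) \<ominus>\<^bsub>A\<^esub> \<phi> (approx x l)) \<le> nrm K (approx x k \<ominus>\<^bsub>K\<^esub> approx x l)"
          by (rule diff[OF a a])
        also have "\<dots> \<le> nrm K (approx x k \<ominus>\<^bsub>K\<^esub> x) + nrm K (approx x l \<ominus>\<^bsub>K\<^esub> x)"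
          using K.nrm_diff_triangle[OF DK[OF a[of k]] x DK[OF a[of l]]] K.nrm_minus_commute[OF x DK[OF a[of l]]] by simp
        finally show ?thesis using N[OF that(1)] N[OF that(2)] by simp
      qed
      then show "\<exists>N. \<forall>k\<ge>N. \<forall>l\<ge>N. nrm A (\<phi> (approx x k) \<ominus>\<^bsub>A\<^esub> \<phi> (approx x l)) < e" by blast
    qed
  qed (use approx x in_A in auto)
  then obtain \<psi> where \<psi>: "\<And>x. x \<in> carrier K \<Longrightarrow> \<psi> x \<in> carrier A"
    "\<And>x. x \<in> carrier K \<Longrightarrow> tends_to A (\<lambda>k. \<phi> (approx x k)) (\<psi> x)" by metis
  \<comment> \<open>The value of \<open>\<psi>\<close> can be computed along any approximating
    sequence in \<open>D\<close>, not just the chosen one; each algebraic law is then read off from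
    a suitable sequence.\<close>
  have lim: "tends_to A (\<lambda>k. \<phi> (\<tau> k)) (\<psi> x)" if \<tau>: "\<And>k. \<tau> k \<in> D" "tends_to K \<tau> x" and x: "x \<in> carrier K" for \<tau> x
  proof (rule A.tends_to_le)
    let ?b = "\<lambda>k. (nrm K (\<tau> k \<ominus>\<^bsub>K\<^esub> x) + nrm K (approx x k \<ominus>\<^bsub>K\<^esub> x)) + nrm A (\<phi> (approx x k) \<ominus>\<^bsub>A\<^esub> \<psi> x)"
    note a = approx(1)[OF x]
    show "nrm A (\<phi> (\<tau> k) \<ominus>\<^bsub>A\<^esub> \<psi> x) \<le> ?b k" for k
      using A.nrm_diff_triangle[OF in_A[OF \<tau>(1)[of k]] in_A[OF a[of k]] \<psi>(1)[OF x]] diff[OF \<tau>(1)[of k] a[of k]]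
        K.nrm_diff_triangle[OF DK[OF \<tau>(1)[of k]] x DK[OF a[of k]]] K.nrm_minus_commute[OF x DK[OF a[of k]]] by linarith
    have "?b \<longlonglongrightarrow> (0 + 0) + 0"
      using \<tau>(2) approx(2)[OF x] \<psi>(2)[OF x] unfolding tends_to_def by (intro tendsto_add)
    then show "?b \<longlonglongrightarrow> 0" by simp
  qed (use \<tau> in_A \<psi> x in auto)
  have eq: "\<psi> x = y" if "\<And>k. \<tau> k \<in> D" "tends_to K \<tau> x" "x \<in> carrier K" "tends_to A (\<lambda>k. \<phi> (\<tau> k)) y" "y \<in> carrier A" for \<tau> x y
    using A.tends_to_unique[OF lim[OF that(1-3)] that(4)] that(1,3,5) in_A \<psi>(1) by blast
  have "star_hom K A \<psi>"
    unfolding star_hom_def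
  proof (intro conjI ballI allI)
    show "\<psi> \<in> carrier K \<rightarrow> carrier A" using \<psi>(1) by auto
  next
    fix x y assume x: "x \<in> carrier K" and y: "y \<in> carrier K"
    note a = approx(1)[OF x] approx(1)[OF y]
    note ak = DK[OF a(1)] DK[OF a(2)]
    note p = in_A[OF a(1)] in_A[OF a(2)]
    have "tends_to A (\<lambda>k. \<phi> (approx x k) \<oplus>\<^bsub>A\<^esub> \<phi> (approx y k)) (\<psi> x \<oplus>\<^bsub>A\<^esub> \<psi> y)"
      by (rule A.tends_to_add[OF \<psi>(2)[OF x] \<psi>(2)[OF y] p \<psi>(1)[OF x] \<psi>(1)[OF y]])
    then show "\<psi> (x \<oplus>\<^bsub>K\<^esub> y) = \<psi> x \<oplus>\<^bsub>A\<^esub> \<psi> y"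
      using x y a \<psi>(1) by (intro eq[OF _ K.tends_to_add[OF approx(2)[OF x] approx(2)[OF y] ak x y]]) (simp_all add: closed hom)
    have "tends_to A (\<lambda>k. \<phi> (approx x k) \<otimes>\<^bsub>A\<^esub> \<phi> (approx y k)) (\<psi> x \<otimes>\<^bsub>A\<^esub> \<psi> y)"
      by (rule A.tends_to_mult[OF \<psi>(2)[OF x] \<psi>(2)[OF y] p \<psi>(1)[OF x] \<psi>(1)[OF y]])
    then show "\<psi> (x \<otimes>\<^bsub>K\<^esub> y) = \<psi> x \<otimes>\<^bsub>A\<^esub> \<psi> y"
      using x y a \<psi>(1) by (intro eq[OF _ K.tends_to_mult[OF approx(2)[OF x] approx(2)[OF y] ak x y]]) (simp_all add: closed hom)
  next
    fix c x assume x: "x \<in> carrier K"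
    note a = approx(1)[OF x]
    have "tends_to A (\<lambda>k. c \<odot>\<^bsub>A\<^esub> \<phi> (approx x k)) (c \<odot>\<^bsub>A\<^esub> \<psi> x)"
      by (rule A.tends_to_smult[OF \<psi>(2)[OF x] in_A[OF a] \<psi>(1)[OF x]])
    then show "\<psi> (c \<odot>\<^bsub>K\<^esub> x) = c \<odot>\<^bsub>A\<^esub> \<psi> x"
      using x a \<psi>(1) by (intro eq[OF _ K.tends_to_smult[OF approx(2)[OF x] DK[OF a] x]]) (simp_all add: closed hom)
  next
    fix x assume x: "x \<in> carrier K"
    note a = approx(1)[OF x]
    have "tends_to A (\<lambda>k. adj A (\<phi> (approx x k))) (adj A (\<psi> x))"
      by (rule A.tends_to_adj[OF \<psi>(2)[OF x] in_A[OF a] \<psi>(1)[OF x]])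
    then show "\<psi> (adj K x) = adj A (\<psi> x)"
      using x a \<psi>(1) by (intro eq[OF _ K.tends_to_adj[OF approx(2)[OF x] DK[OF a] x]]) (simp_all add: closed hom)
  qed
  moreover have "\<psi> x = \<phi> x" if "x \<in> D" for x
    using that by (intro eq[of "\<lambda>_. x"] K.tends_to_const A.tends_to_const DK in_A)
  ultimately show thesis using that by blast
qed

section \<open>The compact operators as the closure of the finite matrices\<close>

lemma compact_algebra_eq: "compact_algebra X = (bounded_algebra X)\<lparr>carrier := compact_operators X\<rparr>"
  by (simp add: bounded_algebra_def compact_algebra_def)

text \<open>Finite matrices in the given basis, for infinite \<open>X\<close> only a part of the
  operators of finite rank. They form the dense *-subalgebra on which maps out of the compacts are
  defined.\<close>

definition finite_rank :: "'x set \<Rightarrow> 'x operator set" where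
  "finite_rank X = \<Union> (finite_operators X ` {Y. finite Y \<and> Y \<subseteq> X})"

lemma finite_rankI: "\<lbrakk>T \<in> finite_operators X Y; finite Y; Y \<subseteq> X\<rbrakk> \<Longrightarrow> T \<in> finite_rank X"
  by (auto simp: finite_rank_def)

lemma finite_rank_common:
  assumes "T \<in> finite_rank X" "U \<in> finite_rank X"
  obtains Y where "finite Y" "Y \<subseteq> X" "T \<in> finite_operators X Y" "U \<in> finite_operators X Y"
proof -
  obtain Y Z where Y: "finite Y" "Y \<subseteq> X" "T \<in> finite_operators X Y"
    and Z: "finite Z" "Z \<subseteq> X" "U \<in> finite_operators X Z"
    using assms unfolding finite_rank_def by blast
  show thesis
    by (rule that[of "Y \<union> Z"]) (use Y Z finite_operators_mono[of Y "Y \<union> Z" X] finite_operators_mono[of Z "Y \<union> Z" X] in auto)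
qed

lemma finite_rank_bounded: "finite_rank X \<subseteq> bounded_operators X"
  by (auto simp: finite_rank_def finite_operators_def)

lemma finite_rank_closed:
  assumes T: "T \<in> finite_rank X"
  shows "U \<in> finite_rank X \<Longrightarrow> T \<oplus>\<^bsub>bounded_algebra X\<^esub> U \<in> finite_rank X"
    "U \<in> finite_rank X \<Longrightarrow> T \<otimes>\<^bsub>bounded_algebra X\<^esub> U \<in> finite_rank X"
    "c \<odot>\<^bsub>bounded_algebra X\<^esub> T \<in> finite_rank X"
    "adj (bounded_algebra X) T \<in> finite_rank X"
  by (meson T finite_rank_common finite_rankI finite_operators_closed)+

lemma zero_finite_rank: "\<zero>\<^bsub>bounded_algebra X\<^esub> \<in> finite_rank X"
  by (rule finite_rankI[OF zero_finite_operators[where Y = "{}"]]) auto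

text \<open>Replaces subsequences by approximation in norm; closure under the operations and under
  limits then follows from \<open>closure_closed_star_subalgebra\<close>.\<close>

lemma compact_operators_eq_closure:
  "compact_operators (X :: 'x::countable set) =
    {T \<in> carrier (bounded_algebra X). \<forall>\<epsilon>>0. \<exists>U\<in>finite_rank X. op_norm X (T \<ominus>\<^bsub>bounded_algebra X\<^esub> U) \<le> \<epsilon>}"
proof (intro equalityI subsetI)
  fix T assume T: "T \<in> compact_operators X"
  have "\<exists>U\<in>finite_rank X. op_norm X (T \<ominus>\<^bsub>bounded_algebra X\<^esub> U) \<le> \<epsilon>" if "\<epsilon> > 0" for \<epsilon>
    using compact_imp_approximable[OF T that] finite_rankI by metis
  then show "T \<in> {T \<in> carrier (bounded_algebra X). \<forall>\<epsilon>>0. \<exists>U\<in>finite_rank X. op_norm X (T \<ominus>\<^bsub>bounded_algebra X\<^esub> U) \<le> \<epsilon>}"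
    using T by (simp add: compact_operators_def)
next
  fix T assume "T \<in> {T \<in> carrier (bounded_algebra X). \<forall>\<epsilon>>0. \<exists>U\<in>finite_rank X. op_norm X (T \<ominus>\<^bsub>bounded_algebra X\<^esub> U) \<le> \<epsilon>}"
  then have T: "T \<in> bounded_operators X"
    and ap: "\<And>\<epsilon>. \<epsilon> > 0 \<Longrightarrow> \<exists>U\<in>finite_rank X. op_norm X (T \<ominus>\<^bsub>bounded_algebra X\<^esub> U) \<le> \<epsilon>" by auto
  show "T \<in> compact_operators X"
  proof (rule approximable_imp_compact[OF T])
    fix \<epsilon> :: real assume "\<epsilon> > 0"
    then obtain U where U: "U \<in> finite_rank X" "op_norm X (T \<ominus>\<^bsub>bounded_algebra X\<^esub> U) \<le> \<epsilon>" using ap by blast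
    from U(1) obtain Y where "finite Y" "Y \<subseteq> X" "U \<in> finite_operators X Y" unfolding finite_rank_def by blast
    with U(2) show "\<exists>Y U. finite Y \<and> Y \<subseteq> X \<and> U \<in> finite_operators X Y \<and>
      op_norm X (T \<ominus>\<^bsub>bounded_algebra X\<^esub> U) \<le> \<epsilon>" by blast
  qed
qed

lemma compact_closed_star_subalgebra:
  "closed_star_subalgebra (compact_operators (X :: 'x::countable set)) (bounded_algebra X)"
  unfolding compact_operators_eq_closure bounded_algebra_simps(7)[symmetric]
  by (rule cstar_algebra.closure_closed_star_subalgebra[OF cstar_algebra_bounded_algebra])
    (use finite_rank_bounded[of X] in \<open>auto intro: finite_rank_closed zero_finite_rank simp del: bounded_algebra_simps(2-8)\<close>)

lemma cstar_algebra_compact: "cstar_algebra (compact_algebra (X :: 'x::countable set))"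
  unfolding compact_algebra_eq
  by (rule cstar_algebra.closed_star_subalgebra_cstar[OF cstar_algebra_bounded_algebra compact_closed_star_subalgebra])

lemma compact_algebra_carrier [simp]: "carrier (compact_algebra X) = compact_operators X"
  by (simp add: compact_algebra_def)

lemma compact_bounded: "compact_operators X \<subseteq> bounded_operators X"
  by (auto simp: compact_operators_def)

lemma finite_rank_compact: "finite_rank (X :: 'x::countable set) \<subseteq> compact_operators X"
  using finite_operators_compact by (auto simp: finite_rank_def)

lemma compact_algebra_ops:
  "add (compact_algebra X) = add (bounded_algebra X)" "mult (compact_algebra X) = mult (bounded_algebra X)"
  "smult (compact_algebra X) = smult (bounded_algebra X)" "zero (compact_algebra X) = zero (bounded_algebra X)"
  "adj (compact_algebra X) = adj (bounded_algebra X)" "nrm (compact_algebra X) = nrm (bounded_algebra X)"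
  by (simp_all add: bounded_algebra_def)

lemma finite_rank_dense:
  assumes T: "T \<in> compact_operators (X :: 'x::countable set)"
  shows "\<exists>\<sigma>. (\<forall>k. \<sigma> k \<in> finite_rank X) \<and> tends_to (compact_algebra X) \<sigma> T"
proof -
  interpret L: cstar_algebra "bounded_algebra X" by (rule cstar_algebra_bounded_algebra)
  interpret K: cstar_algebra "compact_algebra X" by (rule cstar_algebra_compact)
  have Tb: "T \<in> bounded_operators X" using T compact_bounded by auto
  obtain \<sigma> where \<sigma>: "\<forall>k. \<sigma> k \<in> finite_rank X" "tends_to (bounded_algebra X) \<sigma> T"
    using L.approximable_iff_tends_to[of "finite_rank X" T] T Tb finite_rank_bounded[of X]
    unfolding compact_operators_eq_closure by auto
  \<comment> \<open>Additive inverses depend on the carrier of the record, so the two differences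
    are compared through \<open>(-1) \<odot>\<close>.\<close>
  have "\<sigma> k \<ominus>\<^bsub>compact_algebra X\<^esub> T = \<sigma> k \<ominus>\<^bsub>bounded_algebra X\<^esub> T" for k
  proof -
    have "\<sigma> k \<in> compact_operators X" "\<sigma> k \<in> bounded_operators X"
      using \<sigma>(1) finite_rank_compact[of X] finite_rank_bounded[of X] by auto
    with T Tb show ?thesis
      using K.minus_eq_smult[of "\<sigma> k" T] L.minus_eq_smult[of "\<sigma> k" T] by (simp only: compact_algebra_ops compact_algebra_carrier bounded_algebra_simps(1))
  qed
  then have "tends_to (compact_algebra X) \<sigma> T" using \<sigma>(2) by (simp add: tends_to_def)
  with \<sigma>(1) show ?thesis by blast
qed

section \<open>Matrix units\<close>

lemma matrix_unit_finite_operators: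
  assumes "\<alpha> \<in> Y" "\<beta> \<in> Y" "Y \<subseteq> X"
  shows "matrix_unit X \<alpha> \<beta> \<in> finite_operators X Y"
proof -
  have vec: "(\<lambda>x. if x = \<alpha> then f \<beta> else 0) \<in> ell2 X" "ell2_norm X (\<lambda>x. if x = \<alpha> then f \<beta> else 0) = cmod (f \<beta>)" for f :: "'a \<Rightarrow> complex"
    using ell2_norm_finite_support[of "{\<alpha>}" X "\<lambda>x. if x = \<alpha> then f \<beta> else 0"] assms by auto
  have "matrix_unit X \<alpha> \<beta> \<in> bounded_operators X"
    by (rule bounded_operatorsI[where b = 1])
      (auto simp: matrix_unit_def vec cmod_le_ell2_norm ell2_add ell2_scale)
  then show ?thesis
    using assms by (auto simp: finite_operators_def matrix_unit_def restrict_vector_ell2)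
      (auto simp: restrict_vector_def)
qed

lemma matrix_unit_bounded: "\<lbrakk>\<alpha> \<in> X; \<beta> \<in> X\<rbrakk> \<Longrightarrow> matrix_unit X \<alpha> \<beta> \<in> bounded_operators X"
  by (rule finite_operatorsD(1)[OF matrix_unit_finite_operators]) auto

lemma matrix_unit_finite_rank: "\<lbrakk>\<alpha> \<in> X; \<beta> \<in> X\<rbrakk> \<Longrightarrow> matrix_unit X \<alpha> \<beta> \<in> finite_rank X"
  by (rule finite_rankI[OF matrix_unit_finite_operators[of \<alpha> "{\<alpha>, \<beta>}" \<beta>]]) auto

lemma matrix_unit_mult:
  assumes "\<alpha> \<in> X" "\<beta> \<in> X" "\<gamma> \<in> X" "\<delta> \<in> X"
  shows "matrix_unit X \<alpha> \<beta> \<otimes>\<^bsub>bounded_algebra X\<^esub> matrix_unit X \<gamma> \<delta> =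
    (if \<beta> = \<gamma> then matrix_unit X \<alpha> \<delta> else \<zero>\<^bsub>bounded_algebra X\<^esub>)"
proof -
  have "(\<lambda>x. if x = \<gamma> then f \<delta> else 0) \<in> ell2 X" if "f \<in> ell2 X" for f
    using bounded_operatorsD(1)[OF matrix_unit_bounded[OF assms(3,4)] that] that by (simp add: matrix_unit_def)
  then show ?thesis by (auto simp: matrix_unit_def compose_def fun_eq_iff)
qed

lemma matrix_unit_basis_vector:
  "\<beta>' \<in> X \<Longrightarrow> matrix_unit X \<alpha> \<beta> (basis_vector \<beta>') = (if \<beta>' = \<beta> then basis_vector \<alpha> else (\<lambda>x. 0))"
  by (auto simp: matrix_unit_def) (auto simp: basis_vector_def)

lemma matrix_unit_adj:
  assumes "\<alpha> \<in> X" "\<beta> \<in> X"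
  shows "adj (bounded_algebra X) (matrix_unit X \<alpha> \<beta>) = matrix_unit X \<beta> \<alpha>"
  using assms by (auto simp: adj_compact_algebra matrix_unit_bounded adjoint_operator_def matrix_unit_basis_vector
      ell2_inner_basis_left matrix_unit_def[of X \<beta> \<alpha>] fun_eq_iff)

lemma finite_support_apply:
  assumes T: "T \<in> bounded_operators X" and Y: "finite Y" "Y \<subseteq> X" "\<And>x. x \<notin> Y \<Longrightarrow> h x = 0" and "\<alpha> \<in> X"
  shows "T h \<alpha> = (\<Sum>\<beta>\<in>Y. h \<beta> * T (basis_vector \<beta>) \<alpha>)"
proof -
  have "cnj (T h \<alpha>) = (\<Sum>\<beta>\<in>Y. cnj (h \<beta>) * cnj (T (basis_vector \<beta>) \<alpha>))"
    using ell2_inner_finite_support[OF T basis_vector_ell2[OF \<open>\<alpha> \<in> X\<close>] Y] \<open>\<alpha> \<in> X\<close>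
    by (simp add: ell2_inner_basis_right)
  then have "cnj (cnj (T h \<alpha>)) = cnj (\<Sum>\<beta>\<in>Y. cnj (h \<beta>) * cnj (T (basis_vector \<beta>) \<alpha>))" by simp
  then show ?thesis by (simp add: cnj_sum)
qed

text \<open>An induction principle in place of explicit double sums: properties that pass to sums
  need checking only on multiples of matrix units.\<close>

lemma finite_operators_induct [consumes 3, case_names zero add unit]:
  assumes Y: "finite Y" "Y \<subseteq> X" and T: "T \<in> finite_operators X Y"
    and zero: "P \<zero>\<^bsub>bounded_algebra X\<^esub>"
    and add: "\<And>T U. \<lbrakk>T \<in> finite_operators X Y; U \<in> finite_operators X Y; P T; P U\<rbrakk> \<Longrightarrow> P (T \<oplus>\<^bsub>bounded_algebra X\<^esub> U)"
    and unit: "\<And>c \<alpha> \<beta>. \<lbrakk>\<alpha> \<in> Y; \<beta> \<in> Y\<rbrakk> \<Longrightarrow> P (c \<odot>\<^bsub>bounded_algebra X\<^esub> matrix_unit X \<alpha> \<beta>)"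
  shows "P T"
proof -
  \<comment> \<open>\<open>R Z\<close> keeps the matrix entries of \<open>T\<close> with index pair
    in \<open>Z\<close>; it is built up entry by entry until
    \<open>R (Y \<times> Y) = T\<close>.\<close>
  define R where "R Z = (\<lambda>f\<in>ell2 X. \<lambda>x. \<Sum>p\<in>Z. if x = fst p then T (basis_vector (snd p)) (fst p) * f (snd p) else 0)"
    for Z :: "('a \<times> 'a) set"
  have "R Z \<in> finite_operators X Y \<and> P (R Z)" if "finite Z" "Z \<subseteq> Y \<times> Y" for Z
    using that
  proof (induction Z)
    case empty
    have "R {} = \<zero>\<^bsub>bounded_algebra X\<^esub>" by (simp add: R_def)
    then show ?case using zero zero_finite_operators by metis
  next
    case (insert p Z)
    obtain \<alpha> \<beta> where p: "p = (\<alpha>, \<beta>)" "\<alpha> \<in> Y" "\<beta> \<in> Y" using insert by auto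
    define c where "c = T (basis_vector \<beta>) \<alpha>"
    have "R (insert p Z) = (c \<odot>\<^bsub>bounded_algebra X\<^esub> matrix_unit X \<alpha> \<beta>) \<oplus>\<^bsub>bounded_algebra X\<^esub> R Z"
      using insert by (auto simp: R_def p c_def matrix_unit_def fun_eq_iff)
    moreover have "c \<odot>\<^bsub>bounded_algebra X\<^esub> matrix_unit X \<alpha> \<beta> \<in> finite_operators X Y"
      by (rule finite_operators_closed(3)[OF matrix_unit_finite_operators[OF p(2,3) Y(2)]])
    ultimately show ?case
      using insert add unit[OF p(2,3)] finite_operators_closed(1) by (metis insert_subset)
  qed
  from this[of "Y \<times> Y"] have "P (R (Y \<times> Y))" and R: "R (Y \<times> Y) \<in> bounded_operators X"
    using Y by (auto dest: finite_operatorsD(1))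
  moreover have "R (Y \<times> Y) = T"
  proof (rule bounded_operators_eqI[OF R finite_operatorsD(1)[OF T]], rule ext)
    fix f x assume f: "f \<in> ell2 X"
    have "R (Y \<times> Y) f x = (\<Sum>\<alpha>\<in>Y. \<Sum>\<beta>\<in>Y. if x = \<alpha> then T (basis_vector \<beta>) \<alpha> * f \<beta> else 0)"
      using f by (simp add: R_def sum.cartesian_product case_prod_unfold)
    also have "\<dots> = (\<Sum>\<alpha>\<in>Y. if x = \<alpha> then (\<Sum>\<beta>\<in>Y. T (basis_vector \<beta>) \<alpha> * f \<beta>) else 0)"
      by (intro sum.cong) auto
    also have "\<dots> = (if x \<in> Y then (\<Sum>\<beta>\<in>Y. T (basis_vector \<beta>) x * f \<beta>) else 0)"
      using Y by (simp add: sum.delta)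
    also have "\<dots> = T f x"
    proof (cases "x \<in> Y")
      case True
      have "T f x = T (restrict_vector Y f) x" using finite_operatorsD(2)[OF T f] by simp
      also have "\<dots> = (\<Sum>\<beta>\<in>Y. restrict_vector Y f \<beta> * T (basis_vector \<beta>) x)"
        by (rule finite_support_apply[OF finite_operatorsD(1)[OF T] Y]) (use True Y in \<open>auto simp: restrict_vector_def\<close>)
      also have "\<dots> = (\<Sum>\<beta>\<in>Y. T (basis_vector \<beta>) x * f \<beta>)"
        by (intro sum.cong) (auto simp: restrict_vector_def)
      finally show ?thesis using True by simp
    qed (simp add: finite_operatorsD(3)[OF T f])
    finally show "R (Y \<times> Y) f x = T f x" .
  qed
  ultimately show ?thesis by simp
qed

text \<open>Agreement on matrix units spreads to finite matrices by linearity and to all compacts by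
  density; continuity comes from contractivity into the unital algebra \<open>A\<close>.\<close>

lemma compact_star_hom_unique:
  fixes X :: "'x::countable set"
  assumes A: "unital_cstar_algebra A"
    and h: "star_hom (compact_algebra X) A \<psi>" "star_hom (compact_algebra X) A \<psi>'"
    and eq: "\<And>\<alpha> \<beta>. \<lbrakk>\<alpha> \<in> X; \<beta> \<in> X\<rbrakk> \<Longrightarrow> \<psi> (matrix_unit X \<alpha> \<beta>) = \<psi>' (matrix_unit X \<alpha> \<beta>)"
    and T: "T \<in> compact_operators X"
  shows "\<psi> T = \<psi>' T"
proof -
  interpret A: unital_cstar_algebra A by fact
  note K = cstar_algebra_compact[of X]
  note d = star_homD[OF h(1), unfolded compact_algebra_carrier compact_algebra_ops]
    and d' = star_homD[OF h(2), unfolded compact_algebra_carrier compact_algebra_ops]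
  have fr: "\<psi> T = \<psi>' T" if T: "T \<in> finite_rank X" for T
  proof -
    obtain Y where Y: "finite Y" "Y \<subseteq> X" "T \<in> finite_operators X Y"
      using T unfolding finite_rank_def by blast
    have c: "U \<in> compact_operators X" if "U \<in> finite_operators X Y" for U
      using finite_operators_compact[OF Y(1,2) that] .
    show ?thesis using Y
    proof (induction rule: finite_operators_induct)
      case zero
      show ?case using star_hom_zero[OF K A.cstar_algebra_axioms h(1)] star_hom_zero[OF K A.cstar_algebra_axioms h(2)]
        by (simp only: compact_algebra_ops)
    next
      case (add T U)
      then show ?case using d(2)[OF c c] d'(2)[OF c c] by metis
    next
      case (unit k \<alpha> \<beta>)
      have "matrix_unit X \<alpha> \<beta> \<in> compact_operators X"
        using unit Y by (intro c matrix_unit_finite_operators)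
      then show ?case using d(4) d'(4) eq[of \<alpha> \<beta>] unit Y by (metis subsetD)
    qed
  qed
  obtain \<sigma> where \<sigma>: "\<And>k. \<sigma> k \<in> finite_rank X" "tends_to (compact_algebra X) \<sigma> T"
    using finite_rank_dense[OF T] by blast
  have \<sigma>c: "\<sigma> k \<in> carrier (compact_algebra X)" for k using \<sigma>(1)[of k] finite_rank_compact[of X] by auto
  have Tc: "T \<in> carrier (compact_algebra X)" using T by simp
  have "tends_to A (\<lambda>k. \<psi> (\<sigma> k)) (\<psi> T)" "tends_to A (\<lambda>k. \<psi>' (\<sigma> k)) (\<psi>' T)"
    using star_hom_tends_to[OF K A _ \<sigma>(2) \<sigma>c Tc] h by auto
  then show ?thesis
    using A.tends_to_unique[of "\<lambda>k. \<psi> (\<sigma> k)" "\<psi> T" "\<psi>' T"] fr[OF \<sigma>(1)]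
      star_homD(1)[OF h(1)] star_homD(1)[OF h(2)] \<sigma>c Tc by simp
qed

text \<open>The map is the sum of the matrix entries times the given units. It respects the
  operations on each block, is automatically contractive there, and the blocks exhaust a dense
  *-subalgebra.\<close>

lemma compact_star_hom_exists:
  fixes X :: "'x::countable set"
  assumes A: "unital_cstar_algebra A"
    and M: "\<And>\<alpha> \<beta>. \<lbrakk>\<alpha> \<in> X; \<beta> \<in> X\<rbrakk> \<Longrightarrow> M \<alpha> \<beta> \<in> carrier A"
    and M_mult: "\<And>\<alpha> \<beta> \<gamma> \<delta>. \<lbrakk>\<alpha> \<in> X; \<beta> \<in> X; \<gamma> \<in> X; \<delta> \<in> X\<rbrakk> \<Longrightarrow>
      M \<alpha> \<beta> \<otimes>\<^bsub>A\<^esub> M \<gamma> \<delta> = (if \<beta> = \<gamma> then M \<alpha> \<delta> else \<zero>\<^bsub>A\<^esub>)"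
    and M_adj: "\<And>\<alpha> \<beta>. \<lbrakk>\<alpha> \<in> X; \<beta> \<in> X\<rbrakk> \<Longrightarrow> adj A (M \<alpha> \<beta>) = M \<beta> \<alpha>"
  obtains \<psi> where "star_hom (compact_algebra X) A \<psi>"
    "\<And>\<alpha> \<beta>. \<lbrakk>\<alpha> \<in> X; \<beta> \<in> X\<rbrakk> \<Longrightarrow> \<psi> (matrix_unit X \<alpha> \<beta>) = M \<alpha> \<beta>"
proof -
  interpret A: unital_cstar_algebra A by fact
  interpret L: cstar_algebra "bounded_algebra X" by (rule cstar_algebra_bounded_algebra)
  let ?L = "bounded_algebra X"
  define t where "t T p = T (basis_vector (snd p)) (fst p) \<odot>\<^bsub>A\<^esub> M (fst p) (snd p)" for T p
  \<comment> \<open>Summing over the support of the matrix gives a single map for all blocks;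
    \<open>\<phi>_eq\<close> then replaces the support by any finite block that contains it.\<close>
  define supp where "supp T = {p \<in> X \<times> X. T (basis_vector (snd p)) (fst p) \<noteq> 0}" for T :: "'x operator"
  define \<phi> where "\<phi> T = finsum A (t T) (supp T)" for T
  have t_in: "t T \<in> Z \<rightarrow> carrier A" if "Z \<subseteq> X \<times> X" for T Z using that M by (auto simp: t_def)
  have \<phi>_eq: "\<phi> T = finsum A (t T) (Y \<times> Y)" if Y: "finite Y" "Y \<subseteq> X" "T \<in> finite_operators X Y" for T Y
  proof -
    have "T (basis_vector \<beta>) \<alpha> = 0" if "\<alpha> \<in> X" "\<beta> \<in> X" "\<alpha> \<notin> Y \<or> \<beta> \<notin> Y" for \<alpha> \<beta>
    proof (cases "\<alpha> \<in> Y")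
      case True
      then have "restrict_vector Y (basis_vector \<beta>) = (\<lambda>_. 0)" using that by (auto simp: restrict_vector_def basis_vector_def)
      then have "T (basis_vector \<beta>) = (\<lambda>_. 0)" using finite_operatorsD(2)[OF Y(3) basis_vector_ell2[OF that(2)]]
          bounded_operators_zero[OF finite_operatorsD(1)[OF Y(3)]] by metis
      then show ?thesis by simp
    qed (use finite_operatorsD(3)[OF Y(3) basis_vector_ell2[OF that(2)]] in blast)
    then have sub: "supp T \<subseteq> Y \<times> Y" unfolding supp_def by clarsimp blast
    have zero: "t T p = \<zero>\<^bsub>A\<^esub>" if "p \<in> Y \<times> Y - supp T" for p
    proof -
      have "M (fst p) (snd p) \<in> carrier A" "T (basis_vector (snd p)) (fst p) = 0"
        using that Y M by (auto simp: supp_def subset_iff)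
      then show ?thesis by (simp add: t_def)
    qed
    have YY: "Y \<times> Y \<subseteq> X \<times> X" using Y by auto
    show ?thesis unfolding \<phi>_def
      by (rule A.add.finprod_mono_neutral_cong_left[OF _ sub zero refl t_in[OF YY]]) (use Y(1) in auto)
  qed
  \<comment> \<open>For an infinite support \<open>finsum\<close> is zero by convention, so
    \<open>\<phi>\<close> takes values in \<open>A\<close> on every operator.\<close>
  have \<phi>_in: "\<phi> T \<in> carrier A" for T
    unfolding \<phi>_def using t_in[of "supp T" T] by (intro A.finsum_closed) (auto simp: supp_def)
  have \<phi>_zero: "\<phi> \<zero>\<^bsub>?L\<^esub> = \<zero>\<^bsub>A\<^esub>"
  proof -
    have "supp \<zero>\<^bsub>?L\<^esub> = {}" by (auto simp: supp_def)
    then show ?thesis by (simp only: \<phi>_def A.finsum_empty)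
  qed
  have \<phi>_add: "\<phi> (T \<oplus>\<^bsub>?L\<^esub> U) = \<phi> T \<oplus>\<^bsub>A\<^esub> \<phi> U"
    if Y: "finite Y" "Y \<subseteq> X" and T: "T \<in> finite_operators X Y" and U: "U \<in> finite_operators X Y" for T U Y
  proof -
    have YY: "Y \<times> Y \<subseteq> X \<times> X" using Y by auto
    have "\<phi> (T \<oplus>\<^bsub>?L\<^esub> U) = finsum A (t (T \<oplus>\<^bsub>?L\<^esub> U)) (Y \<times> Y)"
      by (rule \<phi>_eq[OF Y finite_operators_closed(1)[OF T U]])
    also have "\<dots> = finsum A (\<lambda>p. t T p \<oplus>\<^bsub>A\<^esub> t U p) (Y \<times> Y)"
      using t_in[OF YY, of T] t_in[OF YY, of U] Y M
      by (intro A.finsum_cong') (auto simp: t_def Pi_iff subset_iff A.smult_add_left)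
    also have "\<dots> = \<phi> T \<oplus>\<^bsub>A\<^esub> \<phi> U"
      unfolding \<phi>_eq[OF Y T] \<phi>_eq[OF Y U] by (intro A.finsum_addf t_in YY)
    finally show ?thesis .
  qed
  have \<phi>_smult: "\<phi> (c \<odot>\<^bsub>?L\<^esub> T) = c \<odot>\<^bsub>A\<^esub> \<phi> T"
    if Y: "finite Y" "Y \<subseteq> X" and T: "T \<in> finite_operators X Y" for c T Y
  proof -
    have YY: "Y \<times> Y \<subseteq> X \<times> X" "finite (Y \<times> Y)" using Y by auto
    have "\<phi> (c \<odot>\<^bsub>?L\<^esub> T) = finsum A (t (c \<odot>\<^bsub>?L\<^esub> T)) (Y \<times> Y)"
      by (rule \<phi>_eq[OF Y finite_operators_closed(3)[OF T]])
    also have "\<dots> = finsum A (\<lambda>p. c \<odot>\<^bsub>A\<^esub> t T p) (Y \<times> Y)"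
      using t_in[OF YY(1), of T] Y M by (intro A.finsum_cong') (auto simp: t_def Pi_iff subset_iff)
    also have "\<dots> = c \<odot>\<^bsub>A\<^esub> \<phi> T"
      unfolding \<phi>_eq[OF Y T] by (rule A.finsum_smult[OF YY(2) t_in[OF YY(1)], symmetric])
    finally show ?thesis .
  qed
  have \<phi>_unit: "\<phi> (matrix_unit X \<alpha> \<beta>) = M \<alpha> \<beta>" if "\<alpha> \<in> X" "\<beta> \<in> X" for \<alpha> \<beta>
  proof -
    have "supp (matrix_unit X \<alpha> \<beta>) = {(\<alpha>, \<beta>)}"
      using that by (auto simp: supp_def matrix_unit_basis_vector) (auto simp: basis_vector_def split: if_splits)
    moreover have "t (matrix_unit X \<alpha> \<beta>) (\<alpha>, \<beta>) = M \<alpha> \<beta>"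
      using that M by (simp add: t_def matrix_unit_basis_vector) (simp add: basis_vector_def)
    ultimately show ?thesis using M[OF that] unfolding \<phi>_def by (simp add: A.finsum_insert)
  qed
  have \<phi>_mult: "\<phi> (T \<otimes>\<^bsub>?L\<^esub> U) = \<phi> T \<otimes>\<^bsub>A\<^esub> \<phi> U" and \<phi>_adj: "\<phi> (adj ?L T) = adj A (\<phi> T)"
    if Y: "finite Y" "Y \<subseteq> X" and T: "T \<in> finite_operators X Y" and U: "U \<in> finite_operators X Y" for T U Y
  proof -
    have c: "V \<in> carrier ?L" if "V \<in> finite_operators X Y" for V using finite_operatorsD(1)[OF that] by simp
    note closed = finite_operators_closed[where X = X and Y = Y]
    note mu = matrix_unit_finite_operators[OF _ _ Y(2)]
    have um: "matrix_unit X \<alpha> \<beta> \<otimes>\<^bsub>?L\<^esub> matrix_unit X \<gamma> \<delta> \<in> finite_operators X Y \<and>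
       \<phi> (matrix_unit X \<alpha> \<beta> \<otimes>\<^bsub>?L\<^esub> matrix_unit X \<gamma> \<delta>) = M \<alpha> \<beta> \<otimes>\<^bsub>A\<^esub> M \<gamma> \<delta>"
      if "\<alpha> \<in> Y" "\<beta> \<in> Y" "\<gamma> \<in> Y" "\<delta> \<in> Y" for \<alpha> \<beta> \<gamma> \<delta>
      using that Y M_mult[of \<alpha> \<beta> \<gamma> \<delta>] \<phi>_unit[of \<alpha> \<delta>] \<phi>_zero mu closed(2) zero_finite_operators[of X Y] by (auto simp: matrix_unit_mult subset_iff simp del: bounded_algebra_simps(2-8))
    have 1: "\<phi> ((k \<odot>\<^bsub>?L\<^esub> matrix_unit X \<alpha> \<beta>) \<otimes>\<^bsub>?L\<^esub> U) = \<phi> (k \<odot>\<^bsub>?L\<^esub> matrix_unit X \<alpha> \<beta>) \<otimes>\<^bsub>A\<^esub> \<phi> U"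
      \<comment> \<open>Multiplicativity takes two inductions: this one on the right factor, with a
        multiple of a matrix unit on the left, and a second one on the left factor.\<close>
      if ab: "\<alpha> \<in> Y" "\<beta> \<in> Y" and U: "U \<in> finite_operators X Y" for k \<alpha> \<beta> U
      using Y U
    proof (induction rule: finite_operators_induct)
      case zero
      then show ?case using mu[OF ab] c \<phi>_zero \<phi>_in by (simp del: bounded_algebra_simps)
    next
      case (add U V)
      then show ?case
        using \<phi>_add[OF Y closed(2)[OF closed(3)[OF mu[OF ab]] add(1)] closed(2)[OF closed(3)[OF mu[OF ab]] add(2)], of k k]
          \<phi>_add[OF Y add(1,2)] c[OF closed(3)[OF mu[OF ab]]] c \<phi>_in
        by (simp add: L.mult_distr_right A.mult_distr_right del: bounded_algebra_simps)
    next
      case (unit l \<gamma> \<delta>)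
      have "\<phi> ((k \<odot>\<^bsub>?L\<^esub> matrix_unit X \<alpha> \<beta>) \<otimes>\<^bsub>?L\<^esub> (l \<odot>\<^bsub>?L\<^esub> matrix_unit X \<gamma> \<delta>)) =
        \<phi> ((k * l) \<odot>\<^bsub>?L\<^esub> (matrix_unit X \<alpha> \<beta> \<otimes>\<^bsub>?L\<^esub> matrix_unit X \<gamma> \<delta>))"
        using c[OF mu[OF ab]] c[OF mu[OF unit]] by (simp add: L.smult_mult_left L.smult_mult_right mult.commute del: bounded_algebra_simps)
      also have "\<dots> = (k * l) \<odot>\<^bsub>A\<^esub> (M \<alpha> \<beta> \<otimes>\<^bsub>A\<^esub> M \<gamma> \<delta>)"
        using um[OF ab unit] \<phi>_smult[OF Y] by simp
      also have "\<dots> = \<phi> (k \<odot>\<^bsub>?L\<^esub> matrix_unit X \<alpha> \<beta>) \<otimes>\<^bsub>A\<^esub> \<phi> (l \<odot>\<^bsub>?L\<^esub> matrix_unit X \<gamma> \<delta>)"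
        using \<phi>_smult[OF Y mu[OF ab], of k] \<phi>_smult[OF Y mu[OF unit], of l] ab unit Y M \<phi>_unit
        by (simp add: A.smult_mult_left A.smult_mult_right subset_iff mult.commute del: bounded_algebra_simps)
      finally show ?case .
    qed
    show "\<phi> (T \<otimes>\<^bsub>?L\<^esub> U) = \<phi> T \<otimes>\<^bsub>A\<^esub> \<phi> U"
      using Y T
    proof (induction rule: finite_operators_induct)
      case zero
      then show ?case using c[OF U] \<phi>_zero \<phi>_in by (simp del: bounded_algebra_simps)
    next
      case (add T V)
      then show ?case
        using \<phi>_add[OF Y closed(2)[OF add(1) U] closed(2)[OF add(2) U]] \<phi>_add[OF Y add(1,2)] c[OF U] c \<phi>_in
        by (simp add: L.mult_distr_left A.mult_distr_left del: bounded_algebra_simps)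
    next
      case (unit k \<alpha> \<beta>)
      then show ?case by (rule 1[OF _ _ U])
    qed
    show "\<phi> (adj ?L T) = adj A (\<phi> T)"
      using Y T
    proof (induction rule: finite_operators_induct)
      case zero
      then show ?case by (simp only: L.adj_zero A.adj_zero \<phi>_zero)
    next
      case (add T V)
      then show ?case
        using \<phi>_add[OF Y closed(4)[OF add(1)] closed(4)[OF add(2)]] \<phi>_add[OF Y add(1,2)] c \<phi>_in
        by (simp add: L.adj_add A.adj_add del: bounded_algebra_simps)
    next
      case (unit k \<alpha> \<beta>)
      then have X: "\<alpha> \<in> X" "\<beta> \<in> X" using Y by auto
      have "\<phi> (adj ?L (k \<odot>\<^bsub>?L\<^esub> matrix_unit X \<alpha> \<beta>)) = \<phi> (cnj k \<odot>\<^bsub>?L\<^esub> matrix_unit X \<beta> \<alpha>)"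
        using c[OF mu[OF unit]] matrix_unit_adj[OF X] by (simp add: L.adj_smult del: bounded_algebra_simps)
      also have "\<dots> = cnj k \<odot>\<^bsub>A\<^esub> M \<beta> \<alpha>" using \<phi>_smult[OF Y mu[OF unit(2,1)]] \<phi>_unit[OF X(2,1)] by simp
      also have "\<dots> = adj A (\<phi> (k \<odot>\<^bsub>?L\<^esub> matrix_unit X \<alpha> \<beta>))"
        using \<phi>_smult[OF Y mu[OF unit]] \<phi>_unit[OF X] M[OF X] M_adj[OF X] by (simp add: A.adj_smult del: bounded_algebra_simps)
      finally show ?case .
    qed
  qed
  have contractive: "nrm A (\<phi> T) \<le> op_norm X T" if T: "T \<in> finite_rank X" for T
  proof -
    obtain Y where Y: "finite Y" "Y \<subseteq> X" "T \<in> finite_operators X Y" using T unfolding finite_rank_def by blast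
    \<comment> \<open>The block is a C*-algebra, so contractivity needs no estimate of the
      sums.\<close>
    have "star_hom (?L\<lparr>carrier := finite_operators X Y\<rparr>) A \<phi>"
      unfolding star_hom_def using \<phi>_in \<phi>_add[OF Y(1,2)] \<phi>_mult[OF Y(1,2)] \<phi>_smult[OF Y(1,2)] \<phi>_adj[OF Y(1,2)]
      by (simp del: bounded_algebra_simps(2-8))
    from star_hom_contractive[OF L.closed_star_subalgebra_cstar[OF finite_operators_closed_star_subalgebra] A this, of T] Y(3)
    show ?thesis by simp
  qed
  have hom_fr: "\<phi> (T \<oplus>\<^bsub>?L\<^esub> U) = \<phi> T \<oplus>\<^bsub>A\<^esub> \<phi> U" "\<phi> (T \<otimes>\<^bsub>?L\<^esub> U) = \<phi> T \<otimes>\<^bsub>A\<^esub> \<phi> U"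
    "\<phi> (k \<odot>\<^bsub>?L\<^esub> T) = k \<odot>\<^bsub>A\<^esub> \<phi> T" "\<phi> (adj ?L T) = adj A (\<phi> T)"
    if T: "T \<in> finite_rank X" and U: "U \<in> finite_rank X" for T U k
  proof -
    obtain Y where Y: "finite Y" "Y \<subseteq> X" and TY: "T \<in> finite_operators X Y" "U \<in> finite_operators X Y"
      using finite_rank_common[OF T U] by blast
    show "\<phi> (T \<oplus>\<^bsub>?L\<^esub> U) = \<phi> T \<oplus>\<^bsub>A\<^esub> \<phi> U" by (rule \<phi>_add[OF Y TY])
    show "\<phi> (T \<otimes>\<^bsub>?L\<^esub> U) = \<phi> T \<otimes>\<^bsub>A\<^esub> \<phi> U" by (rule \<phi>_mult[OF Y TY])
    show "\<phi> (k \<odot>\<^bsub>?L\<^esub> T) = k \<odot>\<^bsub>A\<^esub> \<phi> T" by (rule \<phi>_smult[OF Y TY(1)])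
    show "\<phi> (adj ?L T) = adj A (\<phi> T)" by (rule \<phi>_adj[OF Y TY])
  qed
  have "\<exists>\<psi>. star_hom (compact_algebra X) A \<psi> \<and> (\<forall>T\<in>finite_rank X. \<psi> T = \<phi> T)"
  proof (rule star_hom_extension[OF cstar_algebra_compact[of X] A.cstar_algebra_axioms, where D = "finite_rank X" and \<phi> = \<phi>],
      unfold compact_algebra_ops compact_algebra_carrier)
    show "finite_rank X \<subseteq> compact_operators X" by (rule finite_rank_compact)
    show "T \<oplus>\<^bsub>?L\<^esub> U \<in> finite_rank X" "T \<otimes>\<^bsub>?L\<^esub> U \<in> finite_rank X"
      if "T \<in> finite_rank X" "U \<in> finite_rank X" for T U
      using finite_rank_closed(1,2)[OF that] .
    show "k \<odot>\<^bsub>?L\<^esub> T \<in> finite_rank X" "adj ?L T \<in> finite_rank X" if "T \<in> finite_rank X" for k T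
      using finite_rank_closed(3,4)[OF that] .
    show "\<exists>\<sigma>. (\<forall>k. \<sigma> k \<in> finite_rank X) \<and> tends_to (compact_algebra X) \<sigma> T" if "T \<in> compact_operators X" for T
      by (rule finite_rank_dense[OF that])
    show "\<phi> T \<in> carrier A" for T by (rule \<phi>_in)
    show "\<phi> (T \<oplus>\<^bsub>?L\<^esub> U) = \<phi> T \<oplus>\<^bsub>A\<^esub> \<phi> U" "\<phi> (T \<otimes>\<^bsub>?L\<^esub> U) = \<phi> T \<otimes>\<^bsub>A\<^esub> \<phi> U"
      if "T \<in> finite_rank X" "U \<in> finite_rank X" for T U
      using hom_fr(1,2)[OF that] .
    show "\<phi> (k \<odot>\<^bsub>?L\<^esub> T) = k \<odot>\<^bsub>A\<^esub> \<phi> T" "\<phi> (adj ?L T) = adj A (\<phi> T)" if "T \<in> finite_rank X" for k T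
      using hom_fr(3,4)[OF that that] .
    show "nrm A (\<phi> T) \<le> nrm ?L T" if "T \<in> finite_rank X" for T using contractive[OF that] by simp
  qed blast
  then obtain \<psi> where \<psi>: "star_hom (compact_algebra X) A \<psi>" "\<And>T. T \<in> finite_rank X \<Longrightarrow> \<psi> T = \<phi> T" by blast
  show thesis
    by (rule that[OF \<psi>(1)]) (simp add: \<psi>(2) matrix_unit_finite_rank \<phi>_unit)
qed

section \<open>Graph algebras\<close>

text \<open>The universal property in \<open>graph_cstar\<close> tests only algebras carried by one
  type, so an algebra on another type is copied along a map that is injective on its
  carrier.\<close>

definition transport_cstar :: "'a cstar \<Rightarrow> ('a \<Rightarrow> 'b) \<Rightarrow> 'b cstar" where
  "transport_cstar A \<tau> = (let i = the_inv_into (carrier A) \<tau> in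
    \<lparr>carrier = \<tau> ` carrier A, mult = (\<lambda>x y. \<tau> (i x \<otimes>\<^bsub>A\<^esub> i y)), one = \<tau> \<one>\<^bsub>A\<^esub>, zero = \<tau> \<zero>\<^bsub>A\<^esub>,
     add = (\<lambda>x y. \<tau> (i x \<oplus>\<^bsub>A\<^esub> i y)), smult = (\<lambda>c x. \<tau> (c \<odot>\<^bsub>A\<^esub> i x)),
     adj = (\<lambda>x. \<tau> (adj A (i x))), nrm = (\<lambda>x. nrm A (i x))\<rparr>)"

context
  fixes A :: "'a cstar" and \<tau> :: "'a \<Rightarrow> 'b"
  assumes A: "cstar_algebra A" and inj: "inj_on \<tau> (carrier A)"
begin

interpretation A: cstar_algebra A by (rule A)

lemma transport_cstar_simps:
  "carrier (transport_cstar A \<tau>) = \<tau> ` carrier A"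
  "\<zero>\<^bsub>transport_cstar A \<tau>\<^esub> = \<tau> \<zero>\<^bsub>A\<^esub>"
  "\<lbrakk>x \<in> carrier A; y \<in> carrier A\<rbrakk> \<Longrightarrow> \<tau> x \<otimes>\<^bsub>transport_cstar A \<tau>\<^esub> \<tau> y = \<tau> (x \<otimes>\<^bsub>A\<^esub> y)"
  "\<lbrakk>x \<in> carrier A; y \<in> carrier A\<rbrakk> \<Longrightarrow> \<tau> x \<oplus>\<^bsub>transport_cstar A \<tau>\<^esub> \<tau> y = \<tau> (x \<oplus>\<^bsub>A\<^esub> y)"
  "x \<in> carrier A \<Longrightarrow> c \<odot>\<^bsub>transport_cstar A \<tau>\<^esub> \<tau> x = \<tau> (c \<odot>\<^bsub>A\<^esub> x)"
  "x \<in> carrier A \<Longrightarrow> adj (transport_cstar A \<tau>) (\<tau> x) = \<tau> (adj A x)"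
  "x \<in> carrier A \<Longrightarrow> nrm (transport_cstar A \<tau>) (\<tau> x) = nrm A x"
  using inj by (simp_all add: transport_cstar_def Let_def the_inv_into_f_f)

lemma cstar_algebra_transport: "cstar_algebra (transport_cstar A \<tau>)"
proof (rule cstar_algebraI, goal_cases)
  case (29 \<sigma>)
  have "\<forall>k. \<exists>x\<in>carrier A. \<sigma> k = \<tau> x" using 29(1) by (auto simp: transport_cstar_simps)
  then obtain \<rho> where \<rho>: "\<And>k. \<rho> k \<in> carrier A" "\<And>k. \<sigma> k = \<tau> (\<rho> k)" by metis
  have nrm: "nrm (transport_cstar A \<tau>) (\<tau> x \<oplus>\<^bsub>transport_cstar A \<tau>\<^esub> - 1 \<odot>\<^bsub>transport_cstar A \<tau>\<^esub> \<tau> y) = nrm A (x \<ominus>\<^bsub>A\<^esub> y)"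
    if "x \<in> carrier A" "y \<in> carrier A" for x y
    using that by (simp add: transport_cstar_simps A.minus_eq_smult)
  have "\<exists>x\<in>carrier A. tends_to A \<rho> x"
    using 29(2) \<rho> by (intro A.complete) (auto simp: nrm)
  then obtain x where x: "x \<in> carrier A" "tends_to A \<rho> x" by blast
  then have "(\<lambda>k. nrm (transport_cstar A \<tau>)
      (\<sigma> k \<oplus>\<^bsub>transport_cstar A \<tau>\<^esub> - 1 \<odot>\<^bsub>transport_cstar A \<tau>\<^esub> \<tau> x)) \<longlonglongrightarrow> 0"
    using \<rho> by (simp add: nrm tends_to_def)
  then show ?case using x(1) unfolding transport_cstar_simps(1) by blast
qed (auto simp: transport_cstar_simps A.M.a_ac A.smult_add_left A.smult_add_right A.mult_assoc
      A.mult_distr_left A.mult_distr_right A.smult_mult_left A.smult_mult_right A.adj_add A.adj_smult A.adj_mult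
      A.nrm_eq_zero A.nrm_triangle A.nrm_smult A.nrm_mult A.cstar_identity inj_on_eq_iff[OF inj])

lemma star_hom_transport: "star_hom A (transport_cstar A \<tau>) \<tau>"
  by (auto simp: star_hom_def transport_cstar_simps)

lemma star_hom_transport_inv: "star_hom (transport_cstar A \<tau>) A (the_inv_into (carrier A) \<tau>)"
  by (auto simp: star_hom_def transport_cstar_simps the_inv_into_f_f[OF inj])

end

lemma star_hom_comp:
  assumes "star_hom A B \<phi>" "star_hom B C \<psi>"
  shows "star_hom A C (\<lambda>x. \<psi> (\<phi> x))"
  using star_homD[OF assms(1)] star_homD[OF assms(2)] by (simp add: star_hom_def)

section \<open>Cuntz-Krieger families and the universal property\<close>

lemma star_hom_ck_family:
  assumes A: "cstar_algebra A" and B: "cstar_algebra B" and \<phi>: "star_hom A B \<phi>" and ck: "ck_family E A P S"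
  shows "ck_family E B (\<lambda>v. \<phi> (P v)) (\<lambda>e. \<phi> (S e))"
proof -
  interpret A: cstar_algebra A by fact
  interpret B: cstar_algebra B by fact
  note h = star_homD[OF \<phi>]
  have S: "S e \<in> carrier A" if "e \<in> arcs E" for e using ck that by (auto simp: ck_family_def partial_isometry_def)
  have P: "P v \<in> carrier A" if "v \<in> verts E" for v using ck that by (auto simp: ck_family_def projection_def)
  have le: "cstar_le B (\<phi> x) (\<phi> y)" if le: "cstar_le A x y" for x y
  proof -
    obtain c where c: "c \<in> carrier A" "y \<ominus>\<^bsub>A\<^esub> x = adj A c \<otimes>\<^bsub>A\<^esub> c" and xy: "x \<in> carrier A" "y \<in> carrier A" "adj A x = x" "adj A y = y"
      using le by (auto simp: cstar_le_def)
    have "\<phi> y \<ominus>\<^bsub>B\<^esub> \<phi> x = adj B (\<phi> c) \<otimes>\<^bsub>B\<^esub> \<phi> c"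
      using star_hom_minus[OF A B \<phi> xy(2,1)] c h by simp
    then show ?thesis using c xy h(1) h(5)[OF xy(1)] h(5)[OF xy(2)] unfolding cstar_le_def by auto
  qed
  show ?thesis
    unfolding ck_family_def
  proof (intro conjI ballI impI)
    fix v assume v: "v \<in> verts E"
    then show "projection B (\<phi> (P v))" using ck P h by (auto simp: ck_family_def projection_def simp flip: h(3,5))
  next
    fix e assume e: "e \<in> arcs E"
    then have "S e \<otimes>\<^bsub>A\<^esub> adj A (S e) \<otimes>\<^bsub>A\<^esub> S e = S e" using ck by (auto simp: ck_family_def partial_isometry_def)
    then show "partial_isometry B (\<phi> (S e))" using S[OF e] h by (simp add: partial_isometry_def flip: h(3,5))
  next
    fix v w assume "v \<in> verts E" "w \<in> verts E" "v \<noteq> w"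
    then have "P v \<otimes>\<^bsub>A\<^esub> P w = \<zero>\<^bsub>A\<^esub>" using ck by (auto simp: ck_family_def)
    then show "\<phi> (P v) \<otimes>\<^bsub>B\<^esub> \<phi> (P w) = \<zero>\<^bsub>B\<^esub>"
      using h(3)[OF P P] star_hom_zero[OF A B \<phi>] \<open>v \<in> verts E\<close> \<open>w \<in> verts E\<close> by metis
  next
    fix e f assume "e \<in> arcs E" "f \<in> arcs E" "e \<noteq> f"
    then have "adj A (S e) \<otimes>\<^bsub>A\<^esub> S f = \<zero>\<^bsub>A\<^esub>" "S e \<in> carrier A" "S f \<in> carrier A" using ck S by (auto simp: ck_family_def)
    then show "adj B (\<phi> (S e)) \<otimes>\<^bsub>B\<^esub> \<phi> (S f) = \<zero>\<^bsub>B\<^esub>"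
      using star_hom_zero[OF A B \<phi>] by (simp flip: h(3,5))
  next
    fix e assume "e \<in> arcs E"
    then have "adj A (S e) \<otimes>\<^bsub>A\<^esub> S e = P (head E e)" "S e \<in> carrier A" using ck S by (auto simp: ck_family_def)
    then show "adj B (\<phi> (S e)) \<otimes>\<^bsub>B\<^esub> \<phi> (S e) = \<phi> (P (head E e))" by (simp flip: h(3,5))
  next
    fix e assume "e \<in> arcs E"
    then have "cstar_le A (S e \<otimes>\<^bsub>A\<^esub> adj A (S e)) (P (tail E e))" "S e \<in> carrier A" using ck S by (auto simp: ck_family_def)
    then show "cstar_le B (\<phi> (S e) \<otimes>\<^bsub>B\<^esub> adj B (\<phi> (S e))) (\<phi> (P (tail E e)))"
      using le by (simp flip: h(3,5))
  next
    fix v assume v: "v \<in> verts E" and fin: "finite (out_arcs E v) \<and> out_arcs E v \<noteq> {}"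
    have out: "S e \<in> carrier A" if "e \<in> out_arcs E v" for e using that S by (auto simp: out_arcs_def)
    have eq: "\<phi> (S e \<otimes>\<^bsub>A\<^esub> adj A (S e)) = \<phi> (S e) \<otimes>\<^bsub>B\<^esub> adj B (\<phi> (S e))" if "e \<in> out_arcs E v" for e
      using out[OF that] by (simp add: h)
    have "P v = (\<Oplus>\<^bsub>A\<^esub>e\<in>out_arcs E v. S e \<otimes>\<^bsub>A\<^esub> adj A (S e))" using ck v fin by (auto simp: ck_family_def)
    then have "\<phi> (P v) = (\<Oplus>\<^bsub>B\<^esub>e\<in>out_arcs E v. \<phi> (S e \<otimes>\<^bsub>A\<^esub> adj A (S e)))"
      using star_hom_finsum[OF A B \<phi>, of "out_arcs E v" "\<lambda>e. S e \<otimes>\<^bsub>A\<^esub> adj A (S e)"] fin out by auto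
    also have "\<dots> = (\<Oplus>\<^bsub>B\<^esub>e\<in>out_arcs E v. \<phi> (S e) \<otimes>\<^bsub>B\<^esub> adj B (\<phi> (S e)))"
      using eq out h(1) by (intro B.finsum_cong') auto
    finally show "\<phi> (P v) = (\<Oplus>\<^bsub>B\<^esub>e\<in>out_arcs E v. \<phi> (S e) \<otimes>\<^bsub>B\<^esub> adj B (\<phi> (S e)))" .
  qed
qed

lemma graph_cstarD:
  assumes "graph_cstar E A P S"
  shows "cstar_algebra A" "ck_family E A P S" "generated_by A (P ` verts E \<union> S ` arcs E)"
    "case_sum P S ` (verts E <+> arcs E) = P ` verts E \<union> S ` arcs E"
proof -
  show eq: "case_sum P S ` (verts E <+> arcs E) = P ` verts E \<union> S ` arcs E"
    by (simp add: Plus_def image_Un image_image)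
  show "cstar_algebra A" "ck_family E A P S" "generated_by A (P ` verts E \<union> S ` arcs E)"
    using assms unfolding graph_cstar_def universal_cstar_def eq by auto
qed

lemma graph_cstar_unique_hom:
  fixes D :: "'u cstar" and A :: "'u cstar"
  assumes A: "graph_cstar E A P S" and D: "cstar_algebra D" "ck_family E D P' S'"
  obtains \<phi> where "unique_star_hom A D (\<lambda>\<phi>. (\<forall>v\<in>verts E. \<phi> (P v) = P' v) \<and> (\<forall>e\<in>arcs E. \<phi> (S e) = S' e)) \<phi>"
proof -
  define h where "h = case_sum P' S'"
  have "h ` (verts E <+> arcs E) \<subseteq> carrier D"
    using D(2) by (auto simp: h_def Plus_def ck_family_def projection_def partial_isometry_def)
  moreover have "ck_family E D (\<lambda>v. h (Inl v)) (\<lambda>e. h (Inr e))" using D(2) by (simp add: h_def)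
  ultimately obtain \<phi> where "unique_star_hom A D (\<lambda>\<phi>. \<forall>x\<in>verts E <+> arcs E. \<phi> (case_sum P S x) = h x) \<phi>"
    using A D(1) unfolding graph_cstar_def universal_cstar_def by blast
  moreover have "(\<forall>x\<in>verts E <+> arcs E. \<phi> (case_sum P S x) = h x) \<longleftrightarrow>
      (\<forall>v\<in>verts E. \<phi> (P v) = P' v) \<and> (\<forall>e\<in>arcs E. \<phi> (S e) = S' e)" for \<phi>
    by (simp add: h_def Plus_def ball_Un)
  ultimately show thesis using that by auto
qed

text \<open>The copy of \<open>D\<close> along \<open>\<tau>\<close> is an admissible test algebra;
  composing with the inverse of \<open>\<tau>\<close> brings the resulting map back to
  \<open>D\<close>.\<close>

lemma graph_cstar_hom:
  fixes D :: "'b cstar" and A :: "'u cstar" and \<tau> :: "'b \<Rightarrow> 'u"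
  assumes A: "graph_cstar E A P S" and D: "cstar_algebra D" "ck_family E D P' S'" and \<tau>: "inj_on \<tau> (carrier D)"
  obtains \<phi> where "star_hom A D \<phi>" "\<And>v. v \<in> verts E \<Longrightarrow> \<phi> (P v) = P' v" "\<And>e. e \<in> arcs E \<Longrightarrow> \<phi> (S e) = S' e"
proof -
  let ?D = "transport_cstar D \<tau>" and ?i = "the_inv_into (carrier D) \<tau>"
  note D' = cstar_algebra_transport[OF D(1) \<tau>]
  have "ck_family E ?D (\<lambda>v. \<tau> (P' v)) (\<lambda>e. \<tau> (S' e))"
    by (rule star_hom_ck_family[OF D(1) D' star_hom_transport[OF D(1) \<tau>] D(2)])
  from graph_cstar_unique_hom[OF A D' this] obtain \<phi> where \<phi>: "star_hom A ?D \<phi>"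
    "\<forall>v\<in>verts E. \<phi> (P v) = \<tau> (P' v)" "\<forall>e\<in>arcs E. \<phi> (S e) = \<tau> (S' e)"
    unfolding unique_star_hom_def by metis
  have c: "P' v \<in> carrier D" if "v \<in> verts E" for v using D(2) that by (auto simp: ck_family_def projection_def)
  have c': "S' e \<in> carrier D" if "e \<in> arcs E" for e using D(2) that by (auto simp: ck_family_def partial_isometry_def)
  show thesis
    by (rule that[OF star_hom_comp[OF \<phi>(1) star_hom_transport_inv[OF D(1) \<tau>]]])
      (use \<phi> c c' the_inv_into_f_f[OF \<tau>] in auto)
qed

text \<open>The unit of the sphere algebra is the sum of the products of \<open>z j\<close> with its
  adjoint, and a phase \<open>w\<close> of modulus 1 cancels in each summand. So the unit lies in
  the fixed point algebra.\<close>

lemma quantum_projective_space_unital: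
  assumes "quantum_projective_space q n A"
  shows "unital A"
proof -
  obtain X z where X: "quantum_sphere q n X z" and A: "A = circle_fixed n X z"
    using assms by (auto simp: quantum_projective_space_def)
  then have c: "cstar_algebra X" and rel: "sphere_relations q n X z"
    by (auto simp: quantum_sphere_def universal_cstar_def)
  interpret X: cstar_algebra X by (rule c)
  have uX: "unital X" and z: "\<And>i. i \<le> n \<Longrightarrow> z i \<in> carrier X"
    and one: "(\<Oplus>\<^bsub>X\<^esub>j\<in>{0..n}. z j \<otimes>\<^bsub>X\<^esub> adj X (z j)) = \<one>\<^bsub>X\<^esub>"
    using rel by (auto simp: sphere_relations_def)
  have "\<gamma> \<one>\<^bsub>X\<^esub> = \<one>\<^bsub>X\<^esub>"
    if w: "cmod w = 1" and \<gamma>: "unique_star_hom X X (\<lambda>\<gamma>. \<forall>i\<in>{0..n}. \<gamma> (z i) = w \<odot>\<^bsub>X\<^esub> z i) \<gamma>" for w \<gamma>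
  proof -
    have h: "star_hom X X \<gamma>" and \<gamma>z: "\<And>i. i \<le> n \<Longrightarrow> \<gamma> (z i) = w \<odot>\<^bsub>X\<^esub> z i"
      using \<gamma> by (auto simp: unique_star_hom_def)
    have "w * cnj w = 1" using w complex_norm_square[of w] by simp
    then have "\<gamma> (z j \<otimes>\<^bsub>X\<^esub> adj X (z j)) = z j \<otimes>\<^bsub>X\<^esub> adj X (z j)" if "j \<in> {0..n}" for j
      using that z[of j] \<gamma>z[of j] star_homD[OF h]
      by (simp add: X.adj_smult X.smult_mult_left X.smult_mult_right mult.commute)
    then have "(\<Oplus>\<^bsub>X\<^esub>j\<in>{0..n}. \<gamma> (z j \<otimes>\<^bsub>X\<^esub> adj X (z j))) = (\<Oplus>\<^bsub>X\<^esub>j\<in>{0..n}. z j \<otimes>\<^bsub>X\<^esub> adj X (z j))"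
      using z by (intro X.finsum_cong') auto
    then have "\<gamma> (\<Oplus>\<^bsub>X\<^esub>j\<in>{0..n}. z j \<otimes>\<^bsub>X\<^esub> adj X (z j)) = (\<Oplus>\<^bsub>X\<^esub>j\<in>{0..n}. z j \<otimes>\<^bsub>X\<^esub> adj X (z j))"
      using star_hom_finsum[OF c c h, of "{0..n}" "\<lambda>j. z j \<otimes>\<^bsub>X\<^esub> adj X (z j)"] z
      by auto
    then show ?thesis by (simp add: one)
  qed
  then show ?thesis using uX by (auto simp: unital_def A circle_fixed_def)
qed

text \<open>Real and imaginary parts are encoded by the rationals below them, the boolean telling
  which part is meant. A function thus becomes a subset of a countable set, hence a set of naturals,
  hence a real.\<close>

lemma inj_real_functions:
  assumes "inj (\<iota> :: real \<Rightarrow> 'u)"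
  shows "\<exists>g :: ('i::countable \<Rightarrow> complex) \<Rightarrow> 'u. inj g"
proof -
  define cut where "cut f = {(i, b, q :: rat). real_of_rat q < (if b then Re (f i) else Im (f i))}" for f :: "'i \<Rightarrow> complex"
  have "inj cut"
  proof (rule injI, rule ext)
    fix f g :: "'i \<Rightarrow> complex" and i assume eq: "cut f = cut g"
    have "(real_of_rat q < (if b then Re (f i) else Im (f i))) \<longleftrightarrow> (real_of_rat q < (if b then Re (g i) else Im (g i)))" for b q
      using eq by (auto simp: cut_def set_eq_iff)
    from this[of _ True] this[of _ False]
    have *: "real_of_rat q < Re (f i) \<longleftrightarrow> real_of_rat q < Re (g i)" "real_of_rat q < Im (f i) \<longleftrightarrow> real_of_rat q < Im (g i)" for q
      by auto
    have rat: "x = y" if "\<And>q. real_of_rat q < x \<longleftrightarrow> real_of_rat q < y" for x y :: real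
      using that of_rat_dense[of x y] of_rat_dense[of y x] by (metis less_asym linorder_neqE_linordered_idom)
    show "f i = g i" by (intro complex_eqI rat *)
  qed
  moreover have "inj (image (to_nat :: 'i \<times> bool \<times> rat \<Rightarrow> nat))" by (simp add: inj_def inj_image_eq_iff)
  moreover obtain r :: "nat set \<Rightarrow> real" where "inj r"
    using nat_sets_eqpoll_reals unfolding eqpoll_def bij_betw_def by blast
  ultimately have "inj (\<iota> \<circ> r \<circ> image to_nat \<circ> cut)" using assms by (intro inj_compose)
  then show ?thesis by blast
qed

text \<open>A bounded operator is determined by its matrix entries, which form a complex function on
  a countable index type.\<close>

lemma inj_on_bounded_operators:
  assumes "inj (\<iota> :: real \<Rightarrow> 'u)"
  obtains \<tau> :: "'x::countable operator \<Rightarrow> 'u" where "inj_on \<tau> (bounded_operators X)"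
proof -
  obtain g :: "('x \<times> 'x \<Rightarrow> complex) \<Rightarrow> 'u" where g: "inj g" using inj_real_functions[OF assms] by blast
  define m where "m T = (\<lambda>(\<alpha>, \<beta>). T (basis_vector \<beta>) \<alpha>)" for T :: "'x operator"
  have "inj_on m (bounded_operators X)"
  proof (rule inj_onI)
    fix T U assume T: "T \<in> bounded_operators X" and U: "U \<in> bounded_operators X" and eq: "m T = m U"
    have TU: "T (basis_vector \<beta>) = U (basis_vector \<beta>)" for \<beta>
      using fun_cong[OF eq, of "(_, \<beta>)"] by (auto simp: m_def)
    \<comment> \<open>The adjoint is defined from matrix entries alone, so the adjoints agree, and
      \<open>T\<close> is recovered as a double adjoint.\<close>
    have "adjoint_operator X T = adjoint_operator X U" by (simp only: adjoint_operator_def TU)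
    then show "T = U"
      using cstar_algebra.adj_adj[OF cstar_algebra_bounded_algebra, of T X] cstar_algebra.adj_adj[OF cstar_algebra_bounded_algebra, of U X]
        T U by (simp add: adj_compact_algebra adjoint_operator_bounded)
  qed
  then have "inj_on (\<lambda>T. g (m T)) (bounded_operators X)" using g by (auto simp: inj_on_def)
  then show thesis using that by blast
qed

text \<open>Composition with \<open>t\<close>, set to zero off \<open>Z\<close>. Functions are
  pulled back, so basis vectors move against \<open>t\<close>: prepending an edge to a path is the
  operator with \<open>t = tl\<close>. With the identity as \<open>t\<close> it is a coordinate
  projection.\<close>

definition shift_operator :: "'x set \<Rightarrow> 'x set \<Rightarrow> ('x \<Rightarrow> 'x) \<Rightarrow> 'x operator" where
  "shift_operator X Z t = (\<lambda>f\<in>ell2 X. \<lambda>x. if x \<in> Z then f (t x) else 0)"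

lemma shift_operator_bounded:
  assumes "Z \<subseteq> X" "inj_on t Z" "t ` Z \<subseteq> X"
  shows "shift_operator X Z t \<in> bounded_operators X"
proof -
  have sh: "(\<lambda>x. if x \<in> Z then f (t x) else 0) \<in> ell2 X \<and>
      ell2_norm X (\<lambda>x. if x \<in> Z then f (t x) else 0) \<le> ell2_norm X f" if f: "f \<in> ell2 X" for f
  proof -
    have "L2_set (\<lambda>x. cmod (if x \<in> Z then f (t x) else 0)) Y \<le> ell2_norm X f" if Y: "finite Y" "Y \<subseteq> X" for Y
    proof -
      have "(\<Sum>x\<in>Y. (cmod (if x \<in> Z then f (t x) else 0))\<^sup>2) = (\<Sum>x\<in>Y \<inter> Z. (cmod (f (t x)))\<^sup>2)"
        using Y by (intro sum.mono_neutral_cong_right) auto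
      also have "\<dots> = (\<Sum>y\<in>t ` (Y \<inter> Z). (cmod (f y))\<^sup>2)"
        using assms(2) by (subst sum.reindex) (auto intro: inj_on_subset)
      finally have "L2_set (\<lambda>x. cmod (if x \<in> Z then f (t x) else 0)) Y = L2_set (\<lambda>y. cmod (f y)) (t ` (Y \<inter> Z))"
        by (simp add: L2_set_def)
      also have "\<dots> \<le> ell2_norm X f" using Y assms by (intro L2_set_le_ell2_norm f) auto
      finally show ?thesis .
    qed
    moreover have "(if x \<in> Z then f (t x) else 0) = 0" if "x \<notin> X" for x using that assms by auto
    ultimately show ?thesis using ell2I[of X "\<lambda>x. if x \<in> Z then f (t x) else 0" "ell2_norm X f"] by blast
  qed
  show ?thesis
    by (rule bounded_operatorsI[where b = 1])
      (use sh in \<open>auto simp: shift_operator_def ell2_add ell2_scale fun_eq_iff\<close>)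
qed

text \<open>\<open>t\<close> and \<open>t'\<close> are inverse bijections between \<open>Z\<close>
  and \<open>Z'\<close>, so the adjoint relation is a reindexing of the sum.\<close>

lemma shift_operator_adj:
  assumes "Z \<subseteq> X" "Z' \<subseteq> X" "\<And>x. x \<in> Z \<Longrightarrow> t x \<in> Z'" "\<And>x. x \<in> Z' \<Longrightarrow> t' x \<in> Z"
    "\<And>x. x \<in> Z \<Longrightarrow> t' (t x) = x" "\<And>x. x \<in> Z' \<Longrightarrow> t (t' x) = x"
  shows "shift_operator X Z t \<in> bounded_operators X"
    "adj (bounded_algebra X) (shift_operator X Z t) = shift_operator X Z' t'"
proof -
  have "inj_on t Z" "inj_on t' Z'" using assms(5,6) by (auto intro: inj_on_inverseI)
  then have b: "shift_operator X Z t \<in> bounded_operators X" "shift_operator X Z' t' \<in> bounded_operators X"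
    using assms(1-4) by (auto intro!: shift_operator_bounded)
  have bij: "bij_betw t' Z' Z" by (rule bij_betwI[where g = t]) (use assms in auto)
  have "shift_operator X Z' t' = adjoint_operator X (shift_operator X Z t)"
  proof (rule adjoint_operator_unique[OF b])
    fix f g assume fg: "f \<in> ell2 X" "g \<in> ell2 X"
    have "ell2_inner X (shift_operator X Z' t' f) g = (\<Sum>\<^sub>\<infinity>x\<in>Z'. cnj (f (t' x)) * g x)"
      unfolding ell2_inner_def using assms(2) fg by (intro infsum_cong_neutral) (auto simp: shift_operator_def)
    also have "\<dots> = (\<Sum>\<^sub>\<infinity>x\<in>Z'. cnj (f (t' x)) * g (t (t' x)))"
      using assms(6) by (intro infsum_cong) auto
    also have "\<dots> = (\<Sum>\<^sub>\<infinity>y\<in>Z. cnj (f y) * g (t y))"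
      by (rule infsum_reindex_bij_betw[OF bij])
    also have "\<dots> = ell2_inner X f (shift_operator X Z t g)"
      unfolding ell2_inner_def using assms(1) fg by (intro infsum_cong_neutral) (auto simp: shift_operator_def)
    finally show "ell2_inner X (shift_operator X Z' t' f) g = ell2_inner X f (shift_operator X Z t g)" .
  qed
  then show "adj (bounded_algebra X) (shift_operator X Z t) = shift_operator X Z' t'"
    using b by (simp add: adj_compact_algebra)
  show "shift_operator X Z t \<in> bounded_operators X" by (rule b(1))
qed

lemma shift_operator_mult:
  assumes "shift_operator X Z' t' \<in> bounded_operators X"
  shows "shift_operator X Z t \<otimes>\<^bsub>bounded_algebra X\<^esub> shift_operator X Z' t' =
    shift_operator X {x \<in> Z. t x \<in> Z'} (\<lambda>x. t' (t x))"
proof -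
  have "(\<lambda>x. if x \<in> Z' then f (t' x) else 0) \<in> ell2 X" if "f \<in> ell2 X" for f
    using bounded_operatorsD(1)[OF assms that] that by (simp add: shift_operator_def)
  then show ?thesis by (auto simp: shift_operator_def compose_def fun_eq_iff)
qed

lemma shift_operator_cong:
  "\<lbrakk>Z = Z'; \<And>x. x \<in> Z' \<Longrightarrow> t x = t' x\<rbrakk> \<Longrightarrow> shift_operator X Z t = shift_operator X Z' t'"
  by (auto simp: shift_operator_def fun_eq_iff)

lemma shift_operator_empty: "shift_operator X {} t = \<zero>\<^bsub>bounded_algebra X\<^esub>"
  by (simp add: shift_operator_def)

section \<open>Paths to the sink\<close>

lemma F_simps:
  "verts (F n) = {1..Suc n}" "(i, j, m) \<in> arcs (F n) \<longleftrightarrow> 1 \<le> i \<and> i < j \<and> j \<le> Suc n"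
  "tail (F n) (i, j, m) = i" "head (F n) (i, j, m) = j"
  by (auto simp: F_def)

lemma F_arcs:
  assumes "e \<in> arcs (F n)"
  shows "head (F n) e \<in> verts (F n)" "tail (F n) e \<in> verts (F n)" "tail (F n) e \<noteq> Suc n"
  using assms by (auto simp: F_def)

text \<open>Each vertex before the sink emits infinitely many edges and the sink emits none, so the
  summation relation of a Cuntz-Krieger family is vacuous here.\<close>

lemma F_out_arcs: assumes "v \<in> verts (F n)" shows "\<not> (finite (out_arcs (F n) v) \<and> out_arcs (F n) v \<noteq> {})"
proof
  assume *: "finite (out_arcs (F n) v) \<and> out_arcs (F n) v \<noteq> {}"
  then obtain j m where "(v, j, m) \<in> arcs (F n)" by (auto simp: out_arcs_def F_def)
  then have "range (\<lambda>m. (v, j, m)) \<subseteq> out_arcs (F n) v" by (auto simp: out_arcs_def F_def)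
  then have "finite (range (\<lambda>m::nat. (v, j, m)))" using * finite_subset by blast
  then have "finite (UNIV :: nat set)" by (rule finite_imageD) (auto simp: inj_on_def)
  then show False by simp
qed

definition sink_paths :: "nat \<Rightarrow> (nat \<times> nat \<times> nat) list set" where
  "sink_paths n = paths_to (F n) (n + 1)"

definition source :: "nat \<Rightarrow> (nat \<times> nat \<times> nat) list \<Rightarrow> nat" where
  "source n \<alpha> = (if \<alpha> = [] then Suc n else tail (F n) (hd \<alpha>))"

lemma awalk_source:
  "pre_digraph.awalk (F n) u \<alpha> (Suc n) \<longleftrightarrow> \<alpha> \<in> sink_paths n \<and> u = source n \<alpha>"
  unfolding sink_paths_def paths_to_def by (cases \<alpha>) (auto simp: pre_digraph.awalk_def pre_digraph.cas.simps source_def)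

lemma Nil_sink_path: "[] \<in> sink_paths n"
  by (auto simp: sink_paths_def paths_to_def pre_digraph.awalk_def pre_digraph.cas.simps F_simps)

lemma Cons_sink_path:
  "e # \<alpha> \<in> sink_paths n \<longleftrightarrow> e \<in> arcs (F n) \<and> \<alpha> \<in> sink_paths n \<and> head (F n) e = source n \<alpha>"
proof -
  have "e # \<alpha> \<in> sink_paths n \<longleftrightarrow> e \<in> arcs (F n) \<and> pre_digraph.awalk (F n) (head (F n) e) \<alpha> (Suc n)"
    unfolding sink_paths_def paths_to_def using F_arcs[of e n] by (auto simp: pre_digraph.awalk_def pre_digraph.cas.simps)
  then show ?thesis by (simp add: awalk_source)
qed

lemma source_in: "\<alpha> \<in> sink_paths n \<Longrightarrow> source n \<alpha> \<in> verts (F n)"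
  using F_arcs(2)[of "hd \<alpha>" n] by (cases \<alpha>) (simp_all add: source_def F_simps(1) Cons_sink_path)

lemma source_eq_sink: "\<alpha> \<in> sink_paths n \<Longrightarrow> source n \<alpha> = Suc n \<longleftrightarrow> \<alpha> = []"
  by (cases \<alpha>) (auto simp: source_def Cons_sink_path dest: F_arcs)

lemma source_Cons: "source n (e # \<alpha>) = tail (F n) e"
  by (simp add: source_def)

lemma sink_path_induct [consumes 1, case_names Nil Cons]:
  assumes "\<alpha> \<in> sink_paths n" "Q []"
    "\<And>e \<alpha>. \<lbrakk>e \<in> arcs (F n); \<alpha> \<in> sink_paths n; head (F n) e = source n \<alpha>; Q \<alpha>\<rbrakk> \<Longrightarrow> Q (e # \<alpha>)"
  shows "Q \<alpha>"
  using assms(1) by (induction \<alpha>) (auto simp: assms(2,3) Cons_sink_path)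

text \<open>The relations are used in three unital algebras: in \<open>A\<close>, in
  \<open>B\<close> with \<open>n - 1\<close> for \<open>n\<close>, and in the bounded operators on
  the path space. Hence only a Cuntz-Krieger family is assumed, not universality.\<close>

locale projective_ck = unital_cstar_algebra A for A :: "'a cstar" (structure) +
  fixes n :: nat and P :: "nat \<Rightarrow> 'a" and S :: "nat \<times> nat \<times> nat \<Rightarrow> 'a"
  assumes ck: "ck_family (F n) A P S"
begin

lemma P_simps:
  assumes "v \<in> verts (F n)"
  shows "P v \<in> carrier A" "adj A (P v) = P v" "P v \<otimes> P v = P v"
  using ck assms by (auto simp: ck_family_def projection_def)

lemma P_mult_P: "\<lbrakk>v \<in> verts (F n); w \<in> verts (F n)\<rbrakk> \<Longrightarrow> P v \<otimes> P w = (if v = w then P v else \<zero>)"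
  using ck by (auto simp: ck_family_def projection_def)

lemma S_in: "e \<in> arcs (F n) \<Longrightarrow> S e \<in> carrier A"
  using ck by (auto simp: ck_family_def partial_isometry_def)

lemma adj_S_mult_S: "\<lbrakk>e \<in> arcs (F n); f \<in> arcs (F n)\<rbrakk> \<Longrightarrow> adj A (S e) \<otimes> S f = (if e = f then P (head (F n) e) else \<zero>)"
  using ck by (auto simp: ck_family_def)

lemma S_mult_P:
  assumes "e \<in> arcs (F n)" "v \<in> verts (F n)"
  shows "S e \<otimes> P v = (if v = head (F n) e then S e else \<zero>)"
proof -
  note e = S_in[OF assms(1)] F_arcs(1)[OF assms(1)]
  have "S e \<otimes> (adj A (S e) \<otimes> S e) = S e"
    using ck assms(1) e by (auto simp: ck_family_def partial_isometry_def mult_assoc)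
  then have *: "S e \<otimes> P (head (F n) e) = S e" using assms by (simp add: adj_S_mult_S)
  have "S e \<otimes> P v = S e \<otimes> (P (head (F n) e) \<otimes> P v)"
    using * e P_simps(1) assms(2) by (simp flip: mult_assoc)
  with * e assms(2) show ?thesis by (auto simp: P_mult_P)
qed

text \<open>The order relation enters through \<open>projection_le_mult\<close>: both sides of it
  are projections, so the source projection fixes the range projection of \<open>S e\<close> and
  therefore \<open>S e\<close> itself.\<close>

lemma P_mult_S:
  assumes "e \<in> arcs (F n)" "v \<in> verts (F n)"
  shows "P v \<otimes> S e = (if v = tail (F n) e then S e else \<zero>)"
proof -
  note e = S_in[OF assms(1)] F_arcs(1,2)[OF assms(1)]
  have SSS: "S e \<otimes> adj A (S e) \<otimes> S e = S e" and le: "cstar_le A (S e \<otimes> adj A (S e)) (P (tail (F n) e))"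
    using ck assms(1) by (auto simp: ck_family_def partial_isometry_def)
  have "projection A (S e \<otimes> adj A (S e))"
    unfolding projection_def using e SSS by (simp add: adj_mult flip: mult_assoc)
  moreover have "projection A (P (tail (F n) e))" using e(3) P_simps by (simp add: projection_def)
  ultimately have "P (tail (F n) e) \<otimes> (S e \<otimes> adj A (S e)) = S e \<otimes> adj A (S e)"
    using le by (intro projection_le_mult)
  then have "P (tail (F n) e) \<otimes> (S e \<otimes> adj A (S e)) \<otimes> S e = S e" using SSS by simp
  then have *: "P (tail (F n) e) \<otimes> S e = S e" using SSS e P_simps(1) by (simp add: mult_assoc)
  have "P v \<otimes> S e = P v \<otimes> P (tail (F n) e) \<otimes> S e"
    using * e P_simps(1) assms(2) by (simp add: mult_assoc)
  with * e assms(2) show ?thesis by (auto simp: P_mult_P)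
qed

lemma adj_S_mult_P:
  assumes "e \<in> arcs (F n)" "v \<in> verts (F n)"
  shows "adj A (S e) \<otimes> P v = (if v = tail (F n) e then adj A (S e) else \<zero>)"
proof -
  have "adj A (P v \<otimes> S e) = adj A (S e) \<otimes> P v" using S_in[OF assms(1)] P_simps[OF assms(2)] by (simp add: adj_mult)
  then show ?thesis using P_mult_S[OF assms] by (auto split: if_splits)
qed

definition path :: "(nat \<times> nat \<times> nat) list \<Rightarrow> 'a" where
  "path \<alpha> = path_elt A P S (n + 1) \<alpha>"

lemma path_Nil [simp]: "path [] = P (Suc n)" by (simp add: path_def)

lemma sink_vert: "Suc n \<in> verts (F n)" by (simp add: F_simps)

text \<open>For a single edge \<open>path_elt\<close> is just \<open>S e\<close>; the recursion
  holds there too because \<open>S e\<close> absorbs the sink projection on the right.\<close>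

lemma path_Cons: assumes "e # \<alpha> \<in> sink_paths n" shows "path (e # \<alpha>) = S e \<otimes> path \<alpha>"
proof (cases \<alpha>)
  case Nil
  with assms have "e \<in> arcs (F n)" "head (F n) e = Suc n" by (simp_all add: Cons_sink_path source_def)
  then show ?thesis using Nil S_mult_P[of e "Suc n"] sink_vert by (simp add: path_def)
qed (simp add: path_def)

lemma path_in: "\<alpha> \<in> sink_paths n \<Longrightarrow> path \<alpha> \<in> carrier A"
proof (induction rule: sink_path_induct)
  case Nil
  then show ?case using P_simps(1)[OF sink_vert] by simp
next
  case (Cons e \<alpha>)
  then show ?case using path_Cons[of e \<alpha>] S_in by (simp add: Cons_sink_path)
qed

lemma P_mult_path:
  assumes "\<alpha> \<in> sink_paths n" "v \<in> verts (F n)"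
  shows "P v \<otimes> path \<alpha> = (if v = source n \<alpha> then path \<alpha> else \<zero>)"
proof (cases \<alpha>)
  case Nil
  then show ?thesis using P_mult_P[OF assms(2) sink_vert] by (simp add: source_def)
next
  case (Cons e \<beta>)
  then have "e \<in> arcs (F n)" "\<beta> \<in> sink_paths n" using assms by (simp_all add: Cons_sink_path)
  then show ?thesis
    using path_Cons[of e \<beta>] Cons assms P_mult_S[of e v] path_in[of \<beta>] S_in P_simps(1)
      mult_assoc[of "P v" "S e" "path \<beta>"] by (auto simp: source_Cons)
qed

lemma path_mult_P: "\<alpha> \<in> sink_paths n \<Longrightarrow> path \<alpha> \<otimes> P (Suc n) = path \<alpha>"
proof (induction rule: sink_path_induct)
  case Nil
  then show ?case using P_simps(3)[OF sink_vert] by simp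
next
  case (Cons e \<alpha>)
  then show ?case using path_Cons[of e \<alpha>] S_in path_in P_simps(1)[OF sink_vert] by (simp add: Cons_sink_path mult_assoc)
qed

lemma S_mult_path:
  assumes "e \<in> arcs (F n)" "\<alpha> \<in> sink_paths n"
  shows "S e \<otimes> path \<alpha> = (if head (F n) e = source n \<alpha> then path (e # \<alpha>) else \<zero>)"
proof (cases "head (F n) e = source n \<alpha>")
  case True
  then show ?thesis using assms path_Cons[of e \<alpha>] by (simp add: Cons_sink_path)
next
  case False
  have "S e \<otimes> path \<alpha> = S e \<otimes> P (source n \<alpha>) \<otimes> path \<alpha>"
    using assms P_mult_path[OF assms(2) source_in[OF assms(2)]] S_in path_in P_simps(1)[OF source_in[OF assms(2)]]
    by (simp add: mult_assoc)
  then show ?thesis using False assms S_mult_P[OF assms(1) source_in[OF assms(2)]] path_in by auto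
qed

lemma adj_S_mult_path:
  assumes "e \<in> arcs (F n)" "\<alpha> \<in> sink_paths n"
  shows "adj A (S e) \<otimes> path \<alpha> = (if \<alpha> \<noteq> [] \<and> hd \<alpha> = e then path (tl \<alpha>) else \<zero>)"
proof (cases \<alpha>)
  case Nil
  then show ?thesis using adj_S_mult_P[OF assms(1) sink_vert] F_arcs(3)[OF assms(1)] by auto
next
  case (Cons f \<beta>)
  then have f: "f \<in> arcs (F n)" "\<beta> \<in> sink_paths n" "head (F n) f = source n \<beta>" using assms by (simp_all add: Cons_sink_path)
  have "adj A (S e) \<otimes> path \<alpha> = (adj A (S e) \<otimes> S f) \<otimes> path \<beta>"
    using Cons assms path_Cons[of f \<beta>] S_in f path_in by (simp add: mult_assoc)
  then show ?thesis
    using Cons f assms adj_S_mult_S[OF assms(1) f(1)] P_mult_path[OF f(2) source_in[OF f(2)]] path_in by auto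
qed

text \<open>Two paths into the sink never properly extend one another, since no edge leaves the
  sink. So the product is either the sink projection or zero, and the elements
  \<open>path_unit\<close> are exact matrix units.\<close>

lemma adj_path_mult_path:
  assumes "\<alpha> \<in> sink_paths n" "\<beta> \<in> sink_paths n"
  shows "adj A (path \<alpha>) \<otimes> path \<beta> = (if \<alpha> = \<beta> then P (Suc n) else \<zero>)"
  using assms
proof (induction arbitrary: \<beta> rule: sink_path_induct)
  case Nil
  then show ?case
    using P_mult_path[OF Nil sink_vert] source_eq_sink[OF Nil] P_simps(2)[OF sink_vert] by auto
next
  case (Cons e \<alpha>)
  then have "e # \<alpha> \<in> sink_paths n" by (simp add: Cons_sink_path)
  then have "adj A (path (e # \<alpha>)) \<otimes> path \<beta> = adj A (path \<alpha>) \<otimes> (adj A (S e) \<otimes> path \<beta>)"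
    using path_Cons[of e \<alpha>] Cons S_in path_in by (simp add: adj_mult mult_assoc)
  also have "\<dots> = (if \<beta> \<noteq> [] \<and> hd \<beta> = e then adj A (path \<alpha>) \<otimes> path (tl \<beta>) else \<zero>)"
    using adj_S_mult_path[OF Cons(1) Cons(5)] path_in[OF Cons(2)] by auto
  also have "\<dots> = (if e # \<alpha> = \<beta> then P (Suc n) else \<zero>)"
    using Cons by (cases \<beta>) (auto simp: Cons_sink_path)
  finally show ?case .
qed

definition path_unit :: "(nat \<times> nat \<times> nat) list \<Rightarrow> (nat \<times> nat \<times> nat) list \<Rightarrow> 'a" where
  "path_unit \<alpha> \<beta> = path \<alpha> \<otimes> adj A (path \<beta>)"

lemma path_unit_in: "\<lbrakk>\<alpha> \<in> sink_paths n; \<beta> \<in> sink_paths n\<rbrakk> \<Longrightarrow> path_unit \<alpha> \<beta> \<in> carrier A"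
  by (simp add: path_unit_def path_in)

lemma path_unit_adj: "\<lbrakk>\<alpha> \<in> sink_paths n; \<beta> \<in> sink_paths n\<rbrakk> \<Longrightarrow> adj A (path_unit \<alpha> \<beta>) = path_unit \<beta> \<alpha>"
  by (simp add: path_unit_def path_in adj_mult)

lemma path_unit_mult:
  assumes "\<alpha> \<in> sink_paths n" "\<beta> \<in> sink_paths n" "\<gamma> \<in> sink_paths n" "\<delta> \<in> sink_paths n"
  shows "path_unit \<alpha> \<beta> \<otimes> path_unit \<gamma> \<delta> = (if \<beta> = \<gamma> then path_unit \<alpha> \<delta> else \<zero>)"
proof -
  note in' = path_in[OF assms(1)] path_in[OF assms(2)] path_in[OF assms(3)] path_in[OF assms(4)]
  have "path_unit \<alpha> \<beta> \<otimes> path_unit \<gamma> \<delta> = path \<alpha> \<otimes> (adj A (path \<beta>) \<otimes> path \<gamma>) \<otimes> adj A (path \<delta>)"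
    using in' by (simp add: path_unit_def mult_assoc)
  then show ?thesis
    using in' assms path_mult_P[OF assms(1)] by (auto simp: adj_path_mult_path path_unit_def)
qed

end

section \<open>The representation on square-summable functions of paths\<close>

lemma star_hom_path_elt:
  assumes \<phi>: "star_hom A B \<phi>" and ck: "ck_family (F n) A P S" and A: "cstar_algebra A"
    and eq: "\<And>v. v \<in> verts (F n) \<Longrightarrow> \<phi> (P v) = P' v" "\<And>e. e \<in> arcs (F n) \<Longrightarrow> \<phi> (S e) = S' e"
    and "set \<alpha> \<subseteq> arcs (F n)" "w \<in> verts (F n)"
  shows "path_elt A P S w \<alpha> \<in> carrier A \<and> \<phi> (path_elt A P S w \<alpha>) = path_elt B P' S' w \<alpha>"
  using assms(6,7)
proof (induction \<alpha>)
  case Nil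
  then show ?case using ck eq by (auto simp: ck_family_def projection_def)
next
  case (Cons e \<alpha>)
  interpret A: cstar_algebra A by (rule A)
  note IH = Cons.IH[OF _ Cons.prems(2)] and prems = Cons.prems
  have e: "S e \<in> carrier A" "\<phi> (S e) = S' e"
    using prems ck eq by (auto simp: ck_family_def partial_isometry_def)
  show ?case
  proof (cases \<alpha>)
    case Nil
    then show ?thesis using e by simp
  next
    case (Cons f \<beta>)
    then show ?thesis using e IH prems star_homD(3)[OF \<phi>] by simp
  qed
qed

lemma sink_path_arcs: "\<alpha> \<in> sink_paths n \<Longrightarrow> set \<alpha> \<subseteq> arcs (F n)"
  by (auto simp: sink_paths_def paths_to_def pre_digraph.awalk_def)

text \<open>\<open>S e\<close> prepends the edge \<open>e\<close> and \<open>P v\<close> projects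
  onto the paths starting at \<open>v\<close>. A path element then sends the basis vector of the
  empty path to that of the path and kills all others, so products with adjoints yield all matrix
  units.\<close>

lemma sink_path_representation:
  fixes n :: nat
  defines "X \<equiv> sink_paths n"
  defines "P \<equiv> \<lambda>v. shift_operator X {x \<in> X. source n x = v} (\<lambda>x. x)"
    and "S \<equiv> \<lambda>e. shift_operator X {x \<in> X. x \<noteq> [] \<and> hd x = e} tl"
  shows "ck_family (F n) (bounded_algebra X) P S"
    "\<And>\<alpha>. \<alpha> \<in> X \<Longrightarrow> path_elt (bounded_algebra X) P S (n + 1) \<alpha> = matrix_unit X \<alpha> []"
proof -
  let ?L = "bounded_algebra X"
  interpret L: cstar_algebra ?L by (rule cstar_algebra_bounded_algebra)
  define S' where "S' e = shift_operator X {x \<in> X. e # x \<in> X} (Cons e)" for e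
  define Q where "Q Z = shift_operator X Z (\<lambda>x. x)" for Z
  have Q: "Q Z \<in> bounded_operators X" "adj ?L (Q Z) = Q Z" if "Z \<subseteq> X" for Z
    using shift_operator_adj[of Z X Z "\<lambda>x. x" "\<lambda>x. x"] that by (auto simp: Q_def)
  have QQ: "Q Z \<otimes>\<^bsub>?L\<^esub> Q Z' = Q (Z \<inter> Z')" if "Z \<subseteq> X" "Z' \<subseteq> X" for Z Z'
    unfolding Q_def by (subst shift_operator_mult) (use Q(1)[OF that(2)] in \<open>auto simp: Q_def Int_def\<close>)
  have Q_empty: "Q {} = \<zero>\<^bsub>?L\<^esub>" by (simp only: Q_def shift_operator_empty)
  have P: "P v = Q {x \<in> X. source n x = v}" for v by (simp add: P_def Q_def)
  have tl: "tl x \<in> X" if "x \<in> X" "x \<noteq> []" for x using that by (cases x) (auto simp: X_def Cons_sink_path)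
  have S: "S e \<in> bounded_operators X" "adj ?L (S e) = S' e" for e
  proof -
    let ?Z = "{x \<in> X. x \<noteq> [] \<and> hd x = e}" and ?Z' = "{x \<in> X. e # x \<in> X}"
    have *: "?Z \<subseteq> X" "?Z' \<subseteq> X" "\<And>x. x \<in> ?Z \<Longrightarrow> tl x \<in> ?Z'" "\<And>x. x \<in> ?Z' \<Longrightarrow> e # x \<in> ?Z"
      "\<And>x. x \<in> ?Z \<Longrightarrow> e # tl x = x" "\<And>x. x \<in> ?Z' \<Longrightarrow> tl (e # x) = x"
      using tl by auto
    show "S e \<in> bounded_operators X" unfolding S_def by (rule shift_operator_adj(1)[OF *])
    show "adj ?L (S e) = S' e" unfolding S_def S'_def by (rule shift_operator_adj(2)[OF *])
  qed
  have S': "S' e \<in> bounded_operators X" for e using L.adj_closed[of "S e"] S[of e] by simp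
  have SS': "S e \<otimes>\<^bsub>?L\<^esub> S' e = Q {x \<in> X. x \<noteq> [] \<and> hd x = e}" for e
    unfolding S_def S'_def Q_def
    by (subst shift_operator_mult[OF S'[of e, unfolded S'_def]], rule shift_operator_cong) (use tl in auto)
  have S'S: "S' e \<otimes>\<^bsub>?L\<^esub> S f = (if e = f then P (head (F n) e) else \<zero>\<^bsub>?L\<^esub>)" if "e \<in> arcs (F n)" "f \<in> arcs (F n)" for e f
  proof -
    have "S' e \<otimes>\<^bsub>?L\<^esub> S f = shift_operator X {x \<in> {x \<in> X. e # x \<in> X}. e # x \<in> {x \<in> X. x \<noteq> [] \<and> hd x = f}} (\<lambda>x. tl (e # x))"
      unfolding S_def S'_def by (rule shift_operator_mult[OF S(1)[of f, unfolded S_def]])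
    also have "\<dots> = (if e = f then P (head (F n) e) else \<zero>\<^bsub>?L\<^esub>)"
      unfolding P_def shift_operator_empty[of X "\<lambda>x. x", symmetric]
      using that by (auto simp: X_def Cons_sink_path intro!: shift_operator_cong)
    finally show ?thesis .
  qed
  show ck: "ck_family (F n) ?L P S"
    unfolding ck_family_def
  proof (intro conjI ballI impI)
    fix v show "projection ?L (P v)"
      using Q[of "{x \<in> X. source n x = v}"] QQ[of "{x \<in> X. source n x = v}" "{x \<in> X. source n x = v}"]
      by (auto simp: projection_def P simp del: bounded_algebra_simps(2-8))
  next
    fix e show "partial_isometry ?L (S e)"
    proof -
      have "S e \<otimes>\<^bsub>?L\<^esub> S' e \<otimes>\<^bsub>?L\<^esub> S e = S e"
        unfolding SS' unfolding Q_def S_def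
        by (subst shift_operator_mult[OF S(1)[of e, unfolded S_def]], rule shift_operator_cong) auto
      then show ?thesis using S[of e] by (simp add: partial_isometry_def del: bounded_algebra_simps(2-8))
    qed
  next
    fix v w :: nat assume "v \<noteq> w"
    then have "{x \<in> X. source n x = v} \<inter> {x \<in> X. source n x = w} = {}" by auto
    then show "P v \<otimes>\<^bsub>?L\<^esub> P w = \<zero>\<^bsub>?L\<^esub>" unfolding P by (subst QQ) (auto simp: Q_empty simp del: bounded_algebra_simps)
  next
    fix e f assume "e \<in> arcs (F n)" "f \<in> arcs (F n)" "e \<noteq> f"
    then show "adj ?L (S e) \<otimes>\<^bsub>?L\<^esub> S f = \<zero>\<^bsub>?L\<^esub>" using S'S[of e f] S(2)[of e] by simp
  next
    fix e assume "e \<in> arcs (F n)"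
    then show "adj ?L (S e) \<otimes>\<^bsub>?L\<^esub> S e = P (head (F n) e)" using S'S[of e e] S(2)[of e] by simp
  next
    fix e assume e: "e \<in> arcs (F n)"
    define v where "v = tail (F n) e"
    define Z where "Z = {x \<in> X. x \<noteq> [] \<and> hd x = e}"
    define Y where "Y = {x \<in> X. source n x = v}"
    have Z: "Z \<subseteq> Y" "Z \<subseteq> X" "Y \<subseteq> X" "Y - Z \<subseteq> X" by (auto simp: Z_def Y_def v_def source_def)
    \<comment> \<open>The difference of nested coordinate projections is again one, and a projection
      is its own witness \<open>c\<close> for the order relation.\<close>
    have "Q Y \<ominus>\<^bsub>?L\<^esub> Q Z = Q (Y - Z)"
      using Q(1)[OF Z(3)] Q(1)[OF Z(2)] Z(1) by (auto simp: bounded_algebra_diff) (auto simp: Q_def shift_operator_def fun_eq_iff)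
    also have "\<dots> = adj ?L (Q (Y - Z)) \<otimes>\<^bsub>?L\<^esub> Q (Y - Z)" using Q(2)[OF Z(4)] QQ[OF Z(4,4)] by simp
    finally have "Q Y \<ominus>\<^bsub>?L\<^esub> Q Z = adj ?L (Q (Y - Z)) \<otimes>\<^bsub>?L\<^esub> Q (Y - Z)" .
    then show "cstar_le ?L (S e \<otimes>\<^bsub>?L\<^esub> adj ?L (S e)) (P (tail (F n) e))"
      unfolding cstar_le_def S(2) SS' P v_def[symmetric] Z_def[symmetric] Y_def[symmetric]
      using Q[OF Z(2)] Q[OF Z(3)] Q[OF Z(4)]
      by (intro conjI bexI[of _ "Q (Y - Z)"]) (simp_all del: bounded_algebra_simps(2-8))
  qed (use F_out_arcs in blast)
  interpret projective_ck ?L n P S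
    using ck unital_bounded_algebra by unfold_locales
  fix \<alpha> assume "\<alpha> \<in> X"
  then have "\<alpha> \<in> sink_paths n" by (simp add: X_def)
  then have "path \<alpha> = matrix_unit X \<alpha> []"
  proof (induction rule: sink_path_induct)
    case Nil
    have "{x \<in> X. source n x = Suc n} = {[]}" using source_eq_sink[of _ n] Nil_sink_path[of n] by (auto simp: X_def)
    then have "P (Suc n) = shift_operator X {[]} (\<lambda>x. x)" by (simp add: P_def)
    then show ?case unfolding path_Nil by (auto simp: shift_operator_def matrix_unit_def fun_eq_iff)
  next
    case (Cons e \<alpha>)
    then have e: "e # \<alpha> \<in> X" "\<alpha> \<in> X" "[] \<in> X" by (simp_all add: X_def Cons_sink_path Nil_sink_path)
    have "path (e # \<alpha>) = S e \<otimes>\<^bsub>?L\<^esub> path \<alpha>" using path_Cons[of e \<alpha>] e(1) unfolding X_def .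
    also have "\<dots> = S e \<otimes>\<^bsub>?L\<^esub> matrix_unit X \<alpha> []" using Cons by (simp only:)
    also have "\<dots> = matrix_unit X (e # \<alpha>) []"
    proof -
      have "matrix_unit X \<alpha> [] f \<in> ell2 X" if "f \<in> ell2 X" for f
        by (rule bounded_operatorsD(1)[OF matrix_unit_bounded[OF e(2,3)] that])
      moreover have "x \<noteq> [] \<and> hd x = e \<and> tl x = \<alpha> \<longleftrightarrow> x = e # \<alpha>" for x by (cases x) auto
      ultimately show ?thesis using e
        by (auto simp: S_def shift_operator_def matrix_unit_def compose_def fun_eq_iff)
    qed
    finally show ?case .
  qed
  then show "path_elt ?L P S (n + 1) \<alpha> = matrix_unit X \<alpha> []" by (simp only: path_def)
qed

section \<open>The ideal of the sink\<close>

context projective_ck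
begin

context
  fixes j :: "(nat \<times> nat \<times> nat) list operator \<Rightarrow> 'a"
  assumes gen: "generated_by A (P ` verts (F n) \<union> S ` arcs (F n))"
    and j: "star_hom (compact_algebra (sink_paths n)) A j"
    and j_unit: "\<And>\<alpha> \<beta>. \<lbrakk>\<alpha> \<in> sink_paths n; \<beta> \<in> sink_paths n\<rbrakk> \<Longrightarrow> j (matrix_unit (sink_paths n) \<alpha> \<beta>) = path_unit \<alpha> \<beta>"
    and isometric: "\<And>T. T \<in> compact_operators (sink_paths n) \<Longrightarrow> nrm A (j T) = op_norm (sink_paths n) T"
begin

abbreviation "compacts \<equiv> compact_algebra (sink_paths n)"
abbreviation "J \<equiv> j ` compact_operators (sink_paths n)"

interpretation K: cstar_algebra compacts by (rule cstar_algebra_compact)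

lemma unital_A: "unital_cstar_algebra A" by (rule unital_cstar_algebra_axioms)

lemma j_in: "T \<in> compact_operators (sink_paths n) \<Longrightarrow> j T \<in> carrier A"
  using star_homD(1)[OF j, of T] by simp

lemma J_sub: "J \<subseteq> carrier A" using j_in by auto

lemma J_zero: "\<zero> \<in> J"
  using star_hom_zero[OF K.cstar_algebra_axioms cstar_algebra_axioms j] K.zero_closed
  by (metis compact_algebra_carrier imageI)

lemma J_add: "\<lbrakk>x \<in> J; y \<in> J\<rbrakk> \<Longrightarrow> x \<oplus> y \<in> J"
  using star_homD(2)[OF j] K.M.a_closed by (auto simp del: K.add.m_closed) (metis compact_algebra_carrier imageI)

lemma J_smult: "x \<in> J \<Longrightarrow> c \<odot> x \<in> J"
  using star_homD(4)[OF j] K.smult_in by auto (metis compact_algebra_carrier imageI)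

lemma J_adj: "x \<in> J \<Longrightarrow> adj A x \<in> J"
  using star_homD(5)[OF j] K.adj_closed by auto (metis compact_algebra_carrier imageI)

text \<open>Isometry is the point: a convergent sequence in the image pulls back to a Cauchy
  sequence of compacts, and \<open>j\<close> maps its limit to the given one.\<close>

lemma J_closed:
  assumes "\<And>k. \<sigma> k \<in> J" "x \<in> carrier A" "tends_to A \<sigma> x"
  shows "x \<in> J"
proof -
  have "\<forall>k. \<exists>T\<in>compact_operators (sink_paths n). \<sigma> k = j T" using assms(1) by blast
  then obtain T where T: "\<And>k. T k \<in> compact_operators (sink_paths n)" "\<And>k. \<sigma> k = j (T k)" by metis
  have Tc: "T k \<in> carrier compacts" for k using T by simp
  have \<sigma>: "\<sigma> k \<in> carrier A" for k using assms(1) J_sub by blast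
  have "\<exists>U\<in>carrier compacts. tends_to compacts T U"
  proof (rule K.complete[OF Tc], intro allI impI)
    fix e :: real assume "e > 0"
    then have "e / 2 > 0" by simp
    then obtain N where N: "\<And>k. k \<ge> N \<Longrightarrow> nrm A (\<sigma> k \<ominus> x) < e / 2"
      using order_tendstoD(2)[OF assms(3)[unfolded tends_to_def] \<open>e / 2 > 0\<close>] unfolding eventually_sequentially by blast
    have "nrm compacts (T k \<ominus>\<^bsub>compacts\<^esub> T l) < e" if "k \<ge> N" "l \<ge> N" for k l
    proof -
      have "T k \<ominus>\<^bsub>compacts\<^esub> T l \<in> compact_operators (sink_paths n)" using K.M.minus_closed[OF Tc Tc] by simp
      then have "nrm compacts (T k \<ominus>\<^bsub>compacts\<^esub> T l) = nrm A (\<sigma> k \<ominus> \<sigma> l)"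
        using isometric[of "T k \<ominus>\<^bsub>compacts\<^esub> T l"]
          star_hom_minus[OF K.cstar_algebra_axioms cstar_algebra_axioms j Tc[of k] Tc[of l]] by (simp only: T(2))
      also have "\<dots> \<le> nrm A (\<sigma> k \<ominus> x) + nrm A (\<sigma> l \<ominus> x)"
        using nrm_diff_triangle[OF \<sigma>[of k] assms(2) \<sigma>[of l]] nrm_minus_commute[OF assms(2) \<sigma>[of l]] by simp
      finally show ?thesis using N[OF that(1)] N[OF that(2)] by simp
    qed
    then show "\<exists>N. \<forall>k\<ge>N. \<forall>l\<ge>N. nrm compacts (T k \<ominus>\<^bsub>compacts\<^esub> T l) < e" by blast
  qed
  then obtain U where U: "U \<in> carrier compacts" "tends_to compacts T U" by blast
  moreover have "\<sigma> = (\<lambda>k. j (T k))" by (rule ext) (rule T(2))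
  ultimately have "tends_to A \<sigma> (j U)"
    using star_hom_tends_to[OF K.cstar_algebra_axioms unital_A j U(2) Tc U(1)] by simp
  then have "x = j U" using tends_to_unique[OF assms(3) _ \<sigma> assms(2)] j_in U(1) by simp
  then show ?thesis using U(1) by simp
qed

text \<open>Density of the span of the path units in the image of \<open>j\<close>, in the form of
  an induction rule for closed subspaces.\<close>

lemma J_induct:
  assumes C: "C \<subseteq> carrier A" "\<zero> \<in> C" "\<And>x y. \<lbrakk>x \<in> C; y \<in> C\<rbrakk> \<Longrightarrow> x \<oplus> y \<in> C" "\<And>c x. x \<in> C \<Longrightarrow> c \<odot> x \<in> C"
    and closed: "\<And>\<sigma> x. \<lbrakk>\<And>k. \<sigma> k \<in> C; x \<in> carrier A; tends_to A \<sigma> x\<rbrakk> \<Longrightarrow> x \<in> C"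
    and unit: "\<And>\<alpha> \<beta>. \<lbrakk>\<alpha> \<in> sink_paths n; \<beta> \<in> sink_paths n\<rbrakk> \<Longrightarrow> path_unit \<alpha> \<beta> \<in> C"
  shows "J \<subseteq> C"
proof -
  have fin: "j T \<in> C" if T: "T \<in> finite_rank (sink_paths n)" for T
  proof -
    obtain Y where Y: "finite Y" "Y \<subseteq> sink_paths n" "T \<in> finite_operators (sink_paths n) Y"
      using T unfolding finite_rank_def by blast
    note c = finite_operators_compact[OF Y(1,2)]
    note h = star_homD[OF j, unfolded compact_algebra_carrier compact_algebra_ops]
    show ?thesis using Y
    proof (induction rule: finite_operators_induct)
      case zero
      then show ?case using star_hom_zero[OF K.cstar_algebra_axioms cstar_algebra_axioms j] C(2)
        unfolding compact_algebra_ops by metis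
    next
      case (add T U)
      then show ?case using h(2)[OF c c] C(3) by metis
    next
      case (unit k \<alpha> \<beta>)
      then have ab: "\<alpha> \<in> sink_paths n" "\<beta> \<in> sink_paths n" using Y by auto
      have "matrix_unit (sink_paths n) \<alpha> \<beta> \<in> compact_operators (sink_paths n)"
        by (rule c[OF matrix_unit_finite_operators[OF unit Y(2)]])
      then have "j (k \<odot>\<^bsub>bounded_algebra (sink_paths n)\<^esub> matrix_unit (sink_paths n) \<alpha> \<beta>) = k \<odot> path_unit \<alpha> \<beta>"
        using h(4) j_unit[OF ab] by metis
      then show ?case using C(4) assms(6)[OF ab] by metis
    qed
  qed
  show ?thesis
  proof
    fix x assume "x \<in> J"
    then obtain T where T: "T \<in> compact_operators (sink_paths n)" "x = j T" by blast
    obtain \<sigma> where \<sigma>: "\<And>k. \<sigma> k \<in> finite_rank (sink_paths n)" "tends_to compacts \<sigma> T"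
      using finite_rank_dense[OF T(1)] by blast
    have \<sigma>c: "\<sigma> k \<in> carrier compacts" for k using \<sigma>(1)[of k] finite_rank_compact[of "sink_paths n"] by auto
    have "tends_to A (\<lambda>k. j (\<sigma> k)) (j T)"
      using star_hom_tends_to[OF K.cstar_algebra_axioms unital_A j \<sigma>(2) \<sigma>c] T(1) by simp
    then show "x \<in> C" using closed[of "\<lambda>k. j (\<sigma> k)" x] fin[OF \<sigma>(1)] T j_in by simp
  qed
qed

lemma path_unit_J: "\<lbrakk>\<alpha> \<in> sink_paths n; \<beta> \<in> sink_paths n\<rbrakk> \<Longrightarrow> path_unit \<alpha> \<beta> \<in> J"
  using j_unit[of \<alpha> \<beta>] matrix_unit_finite_rank[of \<alpha> "sink_paths n" \<beta>] finite_rank_compact[of "sink_paths n"]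
  by (metis imageI subsetD)

lemma J_left_mult:
  assumes a: "a \<in> carrier A"
    and unit: "\<And>\<alpha> \<beta>. \<lbrakk>\<alpha> \<in> sink_paths n; \<beta> \<in> sink_paths n\<rbrakk> \<Longrightarrow> a \<otimes> path_unit \<alpha> \<beta> \<in> J"
    and x: "x \<in> J"
  shows "a \<otimes> x \<in> J"
proof -
  let ?C = "{x \<in> carrier A. a \<otimes> x \<in> J}"
  have "J \<subseteq> ?C"
  proof (rule J_induct)
    fix \<sigma> x assume *: "\<And>k. \<sigma> k \<in> ?C" "x \<in> carrier A" "tends_to A \<sigma> x"
    have "tends_to A (\<lambda>k. a \<otimes> \<sigma> k) (a \<otimes> x)" using * a by (intro tends_to_mult tends_to_const) auto
    then show "x \<in> ?C" using J_closed[of "\<lambda>k. a \<otimes> \<sigma> k" "a \<otimes> x"] * a by auto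
  next
    show "\<zero> \<in> ?C" using a J_zero by simp
  next
    fix x y assume "x \<in> ?C" "y \<in> ?C"
    then show "x \<oplus> y \<in> ?C" using a J_add[of "a \<otimes> x" "a \<otimes> y"] by (simp add: mult_distr_right)
  next
    fix c x assume "x \<in> ?C"
    then show "c \<odot> x \<in> ?C" using a J_smult[of "a \<otimes> x" c] by (simp add: smult_mult_right)
  qed (use unit path_unit_in in auto)
  with x show ?thesis by blast
qed

text \<open>The elements that, together with their adjoints, map \<open>J\<close> into itself by
  left multiplication form a closed *-subalgebra; the clause on adjoints is what closes it under the
  involution. So only generators times path units remain to be checked.\<close>

lemma J_left_ideal:
  assumes "a \<in> carrier A" "x \<in> J"
  shows "a \<otimes> x \<in> J"
proof -
  define B where "B = {a \<in> carrier A. \<forall>x\<in>J. a \<otimes> x \<in> J \<and> adj A a \<otimes> x \<in> J}"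
  have Jc: "x \<in> carrier A" if "x \<in> J" for x using that J_sub by blast
  have B: "a \<in> carrier A" "x \<in> J \<Longrightarrow> a \<otimes> x \<in> J" "x \<in> J \<Longrightarrow> adj A a \<otimes> x \<in> J" if "a \<in> B" for a x
    using that unfolding B_def by blast+
  have BI: "a \<in> B" if "a \<in> carrier A" "\<And>x. x \<in> J \<Longrightarrow> a \<otimes> x \<in> J \<and> adj A a \<otimes> x \<in> J" for a
    using that unfolding B_def by blast
  have "closed_star_subalgebra B A"
    unfolding closed_star_subalgebra_def
  proof (intro conjI ballI allI impI)
    show "B \<subseteq> carrier A" by (auto simp: B_def)
    show "\<zero> \<in> B" using J_zero Jc by (auto simp: B_def)
  next
    fix a b assume ab: "a \<in> B" "b \<in> B"
    then have c: "a \<in> carrier A" "b \<in> carrier A" by (auto simp: B_def)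
    have "(a \<oplus> b) \<otimes> x \<in> J \<and> adj A (a \<oplus> b) \<otimes> x \<in> J" if x: "x \<in> J" for x
      using c Jc[OF x] J_add[OF B(2)[OF ab(1) x] B(2)[OF ab(2) x]] J_add[OF B(3)[OF ab(1) x] B(3)[OF ab(2) x]]
      by (simp add: adj_add mult_distr_left)
    then show "a \<oplus> b \<in> B" using c by (intro BI) auto
    have "(a \<otimes> b) \<otimes> x \<in> J \<and> adj A (a \<otimes> b) \<otimes> x \<in> J" if x: "x \<in> J" for x
      using B(2)[OF ab(1) B(2)[OF ab(2) x]] B(3)[OF ab(2) B(3)[OF ab(1) x]] c Jc[OF x] by (simp add: adj_mult mult_assoc)
    then show "a \<otimes> b \<in> B" using c by (intro BI) auto
  next
    fix c a assume a: "a \<in> B"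
    have "(c \<odot> a) \<otimes> x \<in> J \<and> adj A (c \<odot> a) \<otimes> x \<in> J" if x: "x \<in> J" for x
      using B(1)[OF a] Jc[OF x] J_smult[OF B(2)[OF a x], of c] J_smult[OF B(3)[OF a x], of "cnj c"]
      by (simp add: adj_smult smult_mult_left)
    then show "c \<odot> a \<in> B" using B(1)[OF a] by (intro BI) auto
  next
    fix a assume a: "a \<in> B" then show "adj A a \<in> B" using B[OF a] by (intro BI) simp_all
  next
    fix \<sigma> a assume *: "(\<forall>k. \<sigma> k \<in> B) \<and> a \<in> carrier A \<and> tends_to A \<sigma> a"
    then have \<sigma>: "\<sigma> k \<in> carrier A" for k by (auto simp: B_def)
    have "a \<otimes> x \<in> J \<and> adj A a \<otimes> x \<in> J" if x: "x \<in> J" for x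
    proof
      have "tends_to A (\<lambda>k. \<sigma> k \<otimes> x) (a \<otimes> x)" using * \<sigma> Jc[OF x] by (intro tends_to_mult tends_to_const) auto
      then show "a \<otimes> x \<in> J" using J_closed[of "\<lambda>k. \<sigma> k \<otimes> x" "a \<otimes> x"] * B(2)[OF _ x] Jc[OF x] by blast
      have "tends_to A (\<lambda>k. adj A (\<sigma> k) \<otimes> x) (adj A a \<otimes> x)"
        using * \<sigma> Jc[OF x] by (intro tends_to_mult tends_to_const tends_to_adj) auto
      then show "adj A a \<otimes> x \<in> J" using J_closed[of "\<lambda>k. adj A (\<sigma> k) \<otimes> x" "adj A a \<otimes> x"] * B(3)[OF _ x] Jc[OF x] by blast
    qed
    then show "a \<in> B" using * by (intro BI) auto
  qed
  moreover have "P v \<in> B" if v: "v \<in> verts (F n)" for v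
  proof -
    have "P v \<otimes> path_unit \<alpha> \<beta> \<in> J" if ab: "\<alpha> \<in> sink_paths n" "\<beta> \<in> sink_paths n" for \<alpha> \<beta>
    proof -
      have "P v \<otimes> path_unit \<alpha> \<beta> = (P v \<otimes> path \<alpha>) \<otimes> adj A (path \<beta>)"
        using ab P_simps(1)[OF v] path_in by (simp add: path_unit_def mult_assoc)
      also have "\<dots> = (if v = source n \<alpha> then path_unit \<alpha> \<beta> else \<zero>)"
        using P_mult_path[OF ab(1) v] ab path_in by (simp add: path_unit_def)
      finally show ?thesis using path_unit_J[OF ab] J_zero by simp
    qed
    then have "P v \<otimes> x \<in> J" if "x \<in> J" for x using J_left_mult[OF P_simps(1)[OF v] _ that] by blast
    then show ?thesis using P_simps[OF v] by (intro BI) auto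
  qed
  moreover have "S e \<in> B" if e: "e \<in> arcs (F n)" for e
  proof -
    have "S e \<otimes> path_unit \<alpha> \<beta> \<in> J \<and> adj A (S e) \<otimes> path_unit \<alpha> \<beta> \<in> J"
      if ab: "\<alpha> \<in> sink_paths n" "\<beta> \<in> sink_paths n" for \<alpha> \<beta>
    proof
      have "S e \<otimes> path_unit \<alpha> \<beta> = (S e \<otimes> path \<alpha>) \<otimes> adj A (path \<beta>)"
        using ab S_in[OF e] path_in by (simp add: path_unit_def mult_assoc)
      also have "\<dots> = (if head (F n) e = source n \<alpha> then path_unit (e # \<alpha>) \<beta> else \<zero>)"
        using S_mult_path[OF e ab(1)] ab path_in by (simp add: path_unit_def)
      finally show "S e \<otimes> path_unit \<alpha> \<beta> \<in> J" using path_unit_J[of "e # \<alpha>" \<beta>] J_zero e ab by (simp add: Cons_sink_path)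
      have "adj A (S e) \<otimes> path_unit \<alpha> \<beta> = (adj A (S e) \<otimes> path \<alpha>) \<otimes> adj A (path \<beta>)"
        using ab S_in[OF e] path_in by (simp add: path_unit_def mult_assoc)
      also have "\<dots> = (if \<alpha> \<noteq> [] \<and> hd \<alpha> = e then path_unit (tl \<alpha>) \<beta> else \<zero>)"
        using adj_S_mult_path[OF e ab(1)] ab path_in by (auto simp: path_unit_def)
      finally have *: "adj A (S e) \<otimes> path_unit \<alpha> \<beta> = (if \<alpha> \<noteq> [] \<and> hd \<alpha> = e then path_unit (tl \<alpha>) \<beta> else \<zero>)" .
      have "tl \<alpha> \<in> sink_paths n" using ab(1) by (cases \<alpha>) (auto simp: Cons_sink_path)
      then show "adj A (S e) \<otimes> path_unit \<alpha> \<beta> \<in> J" unfolding * using path_unit_J[of "tl \<alpha>" \<beta>] J_zero ab by auto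
    qed
    then have "S e \<otimes> x \<in> J \<and> adj A (S e) \<otimes> x \<in> J" if "x \<in> J" for x
      using J_left_mult[OF S_in[OF e] _ that] J_left_mult[OF adj_closed[OF S_in[OF e]] _ that] by blast
    then show ?thesis using S_in[OF e] by (intro BI) auto
  qed
  ultimately have "B = carrier A" using gen unfolding generated_by_def by blast
  with assms B(2) show ?thesis by blast
qed

lemma J_closed_ideal: "closed_ideal J A"
  unfolding closed_ideal_def
proof (intro conjI ballI allI impI)
  fix a x assume a: "a \<in> carrier A" and x: "x \<in> J"
  then show "a \<otimes> x \<in> J" by (rule J_left_ideal)
  \<comment> \<open>Right multiplication by \<open>a\<close> is left multiplication by its adjoint,
    seen through the involution.\<close>
  have "adj A (adj A a \<otimes> adj A x) \<in> J" by (intro J_adj J_left_ideal adj_closed a x)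
  then show "x \<otimes> a \<in> J" using a x J_sub by (simp add: adj_mult subset_iff del: image_iff)
qed (use J_sub J_zero J_add J_smult J_closed in blast)+

text \<open>The sink projection is the path unit of the empty path with itself. Conversely each path
  unit is that projection multiplied by a path element on the left and the adjoint of one on the
  right.\<close>

lemma J_eq_ideal_generated: "J = ideal_generated A {P (n + 1)}"
proof
  have "path_unit [] [] = P (n + 1)" using P_simps[OF sink_vert] by (simp add: path_unit_def)
  then have "P (n + 1) \<in> J" using path_unit_J[OF Nil_sink_path Nil_sink_path] by simp
  then show "ideal_generated A {P (n + 1)} \<subseteq> J"
    unfolding ideal_generated_def using J_closed_ideal by blast
  show "J \<subseteq> ideal_generated A {P (n + 1)}"
    unfolding ideal_generated_def
  proof (rule Inter_greatest)
    fix I assume "I \<in> {I. closed_ideal I A \<and> {P (n + 1)} \<subseteq> I}"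
    then have I: "closed_ideal I A" "P (n + 1) \<in> I" by auto
    note I' = I(1)[unfolded closed_ideal_def]
    show "J \<subseteq> I"
    proof (rule J_induct)
      show "I \<subseteq> carrier A" "\<zero> \<in> I" using I' by auto
      show "x \<oplus> y \<in> I" if "x \<in> I" "y \<in> I" for x y using I' that by blast
      show "c \<odot> x \<in> I" if "x \<in> I" for c x using I' that by blast
      show "x \<in> I" if "\<And>k. \<sigma> k \<in> I" "x \<in> carrier A" "tends_to A \<sigma> x" for \<sigma> x using I' that by blast
      fix \<alpha> \<beta> assume ab: "\<alpha> \<in> sink_paths n" "\<beta> \<in> sink_paths n"
      have "path \<alpha> \<otimes> P (n + 1) \<in> I" using I' I(2) path_in[OF ab(1)] by blast
      then have "path \<alpha> \<otimes> P (n + 1) \<otimes> adj A (path \<beta>) \<in> I" using I' adj_closed[OF path_in[OF ab(2)]] by blast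
      then show "path_unit \<alpha> \<beta> \<in> I" using path_mult_P[OF ab(1)] by (simp add: path_unit_def)
    qed
  qed
qed

end

end

text \<open>The composite of \<open>j\<close> with the path representation \<open>\<pi>\<close> is
  the identity on matrix units, hence on all compacts. As \<open>j\<close> and \<open>\<pi>\<close>
  are both contractive, \<open>op_norm X T \<le> nrm A (j T) \<le> op_norm X T\<close>.\<close>

lemma compact_hom_exists:
  fixes A :: "'u cstar"
  assumes universe: "\<exists>\<iota> :: real \<Rightarrow> 'u. inj \<iota>" and A: "graph_cstar (F n) A P S" "unital A"
  obtains j where "star_hom (compact_algebra (sink_paths n)) A j"
    "\<And>\<alpha> \<beta>. \<lbrakk>\<alpha> \<in> sink_paths n; \<beta> \<in> sink_paths n\<rbrakk> \<Longrightarrow>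
      j (matrix_unit (sink_paths n) \<alpha> \<beta>) = projective_ck.path_unit A n P S \<alpha> \<beta>"
    "\<And>T. T \<in> compact_operators (sink_paths n) \<Longrightarrow> nrm A (j T) = op_norm (sink_paths n) T"
proof -
  define X where "X = sink_paths n"
  note gA = graph_cstarD[OF A(1)]
  have uA: "unital_cstar_algebra A"
    using gA(1) A(2) by (intro unital_cstar_algebra.intro unital_cstar_algebra_axioms.intro)
  interpret projective_ck A n P S
    by (intro projective_ck.intro uA projective_ck_axioms.intro gA(2))
  obtain j where j: "star_hom (compact_algebra X) A j"
    "\<And>\<alpha> \<beta>. \<lbrakk>\<alpha> \<in> X; \<beta> \<in> X\<rbrakk> \<Longrightarrow> j (matrix_unit X \<alpha> \<beta>) = path_unit \<alpha> \<beta>"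
    using compact_star_hom_exists[OF uA path_unit_in path_unit_mult path_unit_adj] unfolding X_def by blast
  let ?L = "bounded_algebra X"
  have uL: "unital_cstar_algebra ?L"
    by (intro unital_cstar_algebra.intro unital_cstar_algebra_axioms.intro cstar_algebra_bounded_algebra unital_bounded_algebra)
  interpret L: unital_cstar_algebra ?L by (rule uL)
  define P0 S0 where "P0 = (\<lambda>v. shift_operator X {x \<in> X. source n x = v} (\<lambda>x. x))"
    and "S0 = (\<lambda>e. shift_operator X {x \<in> X. x \<noteq> [] \<and> hd x = e} tl)"
  have rep: "ck_family (F n) ?L P0 S0" "\<And>\<alpha>. \<alpha> \<in> X \<Longrightarrow> path_elt ?L P0 S0 (n + 1) \<alpha> = matrix_unit X \<alpha> []"
    using sink_path_representation[where n = n] unfolding X_def P0_def S0_def by auto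
  obtain \<tau> :: "(nat \<times> nat \<times> nat) list operator \<Rightarrow> 'u" where \<tau>: "inj_on \<tau> (carrier ?L)"
    using universe inj_on_bounded_operators bounded_algebra_simps(1) by metis
  obtain \<pi> where \<pi>: "star_hom A ?L \<pi>" "\<And>v. v \<in> verts (F n) \<Longrightarrow> \<pi> (P v) = P0 v" "\<And>e. e \<in> arcs (F n) \<Longrightarrow> \<pi> (S e) = S0 e"
    using graph_cstar_hom[OF A(1) cstar_algebra_bounded_algebra rep(1) \<tau>] by metis
  have \<pi>_path: "\<pi> (path \<alpha>) = matrix_unit X \<alpha> []" if "\<alpha> \<in> X" for \<alpha>
    using star_hom_path_elt[OF \<pi>(1) gA(2,1) \<pi>(2,3), where \<alpha> = \<alpha> and w = "n + 1"] sink_path_arcs[where \<alpha> = \<alpha> and n = n] that rep(2)[OF that] sink_vert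
    unfolding path_def X_def by simp
  have Nil: "[] \<in> X" by (simp add: X_def Nil_sink_path)
  have \<pi>_unit: "\<pi> (path_unit \<alpha> \<beta>) = matrix_unit X \<alpha> \<beta>" if "\<alpha> \<in> X" "\<beta> \<in> X" for \<alpha> \<beta>
  proof -
    have "\<pi> (path_unit \<alpha> \<beta>) = matrix_unit X \<alpha> [] \<otimes>\<^bsub>?L\<^esub> adj ?L (matrix_unit X \<beta> [])"
      using that path_in star_homD[OF \<pi>(1)] \<pi>_path unfolding path_unit_def X_def by (metis adj_closed)
    then show ?thesis using matrix_unit_adj[OF that(2) Nil] matrix_unit_mult[OF that(1) Nil Nil that(2)] by metis
  qed
  have \<pi>j: "\<pi> (j T) = T" if T: "T \<in> compact_operators X" for T
  proof (rule compact_star_hom_unique[OF uL star_hom_comp[OF j(1) \<pi>(1)] _ _ T, of "\<lambda>T. T"])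
    show "star_hom (compact_algebra X) ?L (\<lambda>T. T)"
      unfolding star_hom_def compact_algebra_ops compact_algebra_carrier using compact_bounded[of X] by auto
  qed (use j(2) \<pi>_unit in simp)
  have "nrm A (j T) = op_norm X T" if T: "T \<in> compact_operators X" for T
  proof (rule antisym)
    show "nrm A (j T) \<le> op_norm X T"
      using star_hom_contractive[OF cstar_algebra_compact uA j(1), of T] T by simp
    have "j T \<in> carrier A" using star_homD(1)[OF j(1), of T] T by simp
    then show "op_norm X T \<le> nrm A (j T)"
      using star_hom_contractive[OF gA(1) uL \<pi>(1), of "j T"] \<pi>j[OF T] by simp
  qed
  with j that show thesis unfolding X_def by blast
qed

text \<open>Sending the sink and all edges into it to zero leaves exactly the graph
  \<open>F (n - 1)\<close>; zero is a projection and a partial isometry, so the relations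
  survive.\<close>

lemma ck_family_quotient:
  assumes B: "projective_ck B (n - 1) P' S'" and n: "1 \<le> n"
  shows "ck_family (F n) B (\<lambda>v. if v = n + 1 then \<zero>\<^bsub>B\<^esub> else P' v) (\<lambda>e. if head (F n) e = n + 1 then \<zero>\<^bsub>B\<^esub> else S' e)"
proof -
  interpret B: projective_ck B "n - 1" P' S' by (rule B)
  have v: "v \<in> verts (F (n - 1))" if "v \<in> verts (F n)" "v \<noteq> n + 1" for v using that n by (auto simp: F_simps)
  have e: "e \<in> arcs (F (n - 1))" "tail (F (n - 1)) e = tail (F n) e" "head (F (n - 1)) e = head (F n) e"
    if "e \<in> arcs (F n)" "head (F n) e \<noteq> n + 1" for e using that n by (auto simp: F_def)
  have ck: "partial_isometry B (S' e)" "cstar_le B (S' e \<otimes>\<^bsub>B\<^esub> adj B (S' e)) (P' (tail (F (n - 1)) e))"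
    if "e \<in> arcs (F (n - 1))" for e using B.ck that by (auto simp: ck_family_def)
  \<comment> \<open>A projection is its own witness \<open>c\<close> for being above zero.\<close>
  have zero_le: "cstar_le B \<zero>\<^bsub>B\<^esub> (P' w)" if "w \<in> verts (F (n - 1))" for w
    using B.P_simps[OF that] by (auto simp: cstar_le_def B.M.minus_eq intro!: bexI[of _ "P' w"])
  show ?thesis
    unfolding ck_family_def
  proof (intro conjI ballI impI)
    fix e assume "e \<in> arcs (F n)"
    then show "partial_isometry B (if head (F n) e = n + 1 then \<zero>\<^bsub>B\<^esub> else S' e)"
      using ck(1) e by (auto simp: partial_isometry_def)
  next
    fix e assume a: "e \<in> arcs (F n)"
    let ?S = "if head (F n) e = n + 1 then \<zero>\<^bsub>B\<^esub> else S' e"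
    note t = F_arcs[OF a]
    show "cstar_le B (?S \<otimes>\<^bsub>B\<^esub> adj B ?S) (if tail (F n) e = n + 1 then \<zero>\<^bsub>B\<^esub> else P' (tail (F n) e))"
    proof (cases "head (F n) e = n + 1")
      case True
      then show ?thesis using t(3) zero_le[OF v[OF t(2)]] by simp
    next
      case False
      then show ?thesis using t(3) ck(2)[OF e(1)[OF a False]] e(2)[OF a False] by simp
    qed
  next
    fix v assume "v \<in> verts (F n)" "finite (out_arcs (F n) v) \<and> out_arcs (F n) v \<noteq> {}"
    then show "(if v = n + 1 then \<zero>\<^bsub>B\<^esub> else P' v) = (\<Oplus>\<^bsub>B\<^esub>e\<in>out_arcs (F n) v.
      (if head (F n) e = n + 1 then \<zero>\<^bsub>B\<^esub> else S' e) \<otimes>\<^bsub>B\<^esub> adj B (if head (F n) e = n + 1 then \<zero>\<^bsub>B\<^esub> else S' e))"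
      using F_out_arcs by blast
  qed (use v e B.P_simps B.S_in in \<open>auto simp: projection_def B.P_mult_P B.adj_S_mult_S\<close>)
qed


text \<open>Edges into \<open>n\<close> and into \<open>n + 1\<close> are distinct, so the cross
  terms vanish when \<open>S (i, n, m) \<oplus> S (i, n + 1, m)\<close> is multiplied by its adjoint
  on the left, and the initial projection is \<open>P n \<oplus> P (n + 1)\<close>. No edge of
  \<open>F (n - 1)\<close> leaves \<open>n\<close>, so the projections at the sources are
  unchanged.\<close>

lemma ck_family_section:
  assumes A: "projective_ck A n P S" and n: "1 \<le> n"
  shows "ck_family (F (n - 1)) A (\<lambda>v. if v = n then P n \<oplus>\<^bsub>A\<^esub> P (n + 1) else P v)
    (\<lambda>(i, k, m). if k = n then S (i, n, m) \<oplus>\<^bsub>A\<^esub> S (i, n + 1, m) else S (i, k, m))"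
    (is "ck_family _ _ ?P ?S")
proof -
  interpret projective_ck A n P S by (rule A)
  have verts: "v \<in> verts (F n)" if "v \<in> verts (F (n - 1))" for v using that n by (auto simp: F_simps)
  have vn: "n \<in> verts (F n)" "n + 1 \<in> verts (F n)" using n by (auto simp: F_simps)
  note p = P_simps[OF vn(1)] P_simps[OF vn(2)]
  have PP: "P n \<otimes>\<^bsub>A\<^esub> P (n + 1) = \<zero>\<^bsub>A\<^esub>" "P (n + 1) \<otimes>\<^bsub>A\<^esub> P n = \<zero>\<^bsub>A\<^esub>"
    using P_mult_P[OF vn] P_mult_P[OF vn(2,1)] by auto
  have proj: "projection A (?P v)" if "v \<in> verts (F (n - 1))" for v
    using P_simps[OF verts[OF that]] p PP
    by (auto simp: projection_def adj_add mult_distr_left mult_distr_right)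
  have P_in: "?P v \<in> carrier A" if "v \<in> verts (F (n - 1))" for v using proj[OF that] by (simp add: projection_def)
  have orth: "?P v \<otimes>\<^bsub>A\<^esub> ?P w = \<zero>\<^bsub>A\<^esub>" if "v \<in> verts (F (n - 1))" "w \<in> verts (F (n - 1))" "v \<noteq> w" for v w
  proof -
    have "v \<noteq> n + 1" "w \<noteq> n + 1" using that n by (auto simp: F_simps)
    then show ?thesis
      using that(3) verts[OF that(1)] verts[OF that(2)] vn P_simps(1)[OF verts[OF that(1)]] P_simps(1)[OF verts[OF that(2)]] p
      by (auto simp: mult_distr_left mult_distr_right P_mult_P)
  qed
  have arcs: "(i, k, m) \<in> arcs (F n)" "k = n \<Longrightarrow> (i, n + 1, m) \<in> arcs (F n)" "i \<in> verts (F n)" "i \<noteq> n" "k \<noteq> n + 1"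
    "k \<in> verts (F (n - 1))" "i \<in> verts (F (n - 1))"
    if "(i, k, m) \<in> arcs (F (n - 1))" for i k m
    using that n by (auto simp: F_simps)
  have S_in': "?S e \<in> carrier A" if "e \<in> arcs (F (n - 1))" for e
    using that arcs S_in by (cases e) auto
  have SS: "adj A (?S e) \<otimes>\<^bsub>A\<^esub> ?S f = (if e = f then ?P (head (F (n - 1)) e) else \<zero>\<^bsub>A\<^esub>)"
    if e: "e \<in> arcs (F (n - 1))" and f: "f \<in> arcs (F (n - 1))" for e f
  proof -
    obtain i k m where e_eq: "e = (i, k, m)" by (cases e)
    obtain i' k' m' where f_eq: "f = (i', k', m')" by (cases f)
    note ae = arcs[OF e[unfolded e_eq]] and af = arcs[OF f[unfolded f_eq]]
    note s = S_in[OF ae(1)] S_in[OF ae(2)] S_in[OF af(1)] S_in[OF af(2)]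
    note ss = adj_S_mult_S[OF ae(1) af(1)] adj_S_mult_S[OF ae(1) af(2)] adj_S_mult_S[OF ae(2) af(1)] adj_S_mult_S[OF ae(2) af(2)]
    show ?thesis
      using s ss ae(5) af(5) p(1,4) unfolding e_eq f_eq
      by (cases "k = n"; cases "k' = n") (auto simp: adj_add mult_distr_left mult_distr_right F_simps(4))
  qed
  have SP: "?S e \<otimes>\<^bsub>A\<^esub> ?P (head (F (n - 1)) e) = ?S e" if e: "e \<in> arcs (F (n - 1))" for e
  proof -
    obtain i k m where e_eq: "e = (i, k, m)" by (cases e)
    note ae = arcs[OF e[unfolded e_eq]]
    show ?thesis
      using S_in[OF ae(1)] S_in[OF ae(2)] S_mult_P[OF ae(1)] S_mult_P[OF ae(2)] vn p(1,4) verts[OF ae(6)] unfolding e_eq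
      by (cases "k = n") (auto simp: mult_distr_left mult_distr_right F_simps(4))
  qed
  have PS: "?P (tail (F (n - 1)) e) \<otimes>\<^bsub>A\<^esub> ?S e = ?S e" if e: "e \<in> arcs (F (n - 1))" for e
  proof -
    obtain i k m where e_eq: "e = (i, k, m)" by (cases e)
    note ae = arcs[OF e[unfolded e_eq]]
    show ?thesis
      using S_in[OF ae(1)] S_in[OF ae(2)] P_mult_S[OF ae(1) ae(3)] P_mult_S[OF ae(2) ae(3)] P_simps(1)[OF ae(3)] ae(4) unfolding e_eq
      by (cases "k = n") (auto simp: mult_distr_right F_simps(3))
  qed
  show ?thesis
    unfolding ck_family_def
  proof (intro conjI ballI impI)
    fix v assume "v \<in> verts (F (n - 1))" then show "projection A (?P v)" by (rule proj)
  next
    fix e assume e: "e \<in> arcs (F (n - 1))"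
    have "?S e \<otimes>\<^bsub>A\<^esub> (adj A (?S e) \<otimes>\<^bsub>A\<^esub> ?S e) = ?S e" using SS[OF e e] SP[OF e] by simp
    then show "partial_isometry A (?S e)" using S_in'[OF e] by (simp add: partial_isometry_def mult_assoc)
  next
    fix v w assume "v \<in> verts (F (n - 1))" "w \<in> verts (F (n - 1))" "v \<noteq> w"
    then show "?P v \<otimes>\<^bsub>A\<^esub> ?P w = \<zero>\<^bsub>A\<^esub>" by (rule orth)
  next
    fix e f assume "e \<in> arcs (F (n - 1))" "f \<in> arcs (F (n - 1))" "e \<noteq> f"
    then show "adj A (?S e) \<otimes>\<^bsub>A\<^esub> ?S f = \<zero>\<^bsub>A\<^esub>" using SS[of e f] by simp
  next
    fix e assume e: "e \<in> arcs (F (n - 1))"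
    then show "adj A (?S e) \<otimes>\<^bsub>A\<^esub> ?S e = ?P (head (F (n - 1)) e)" using SS[of e e] by simp
  next
    fix e assume e: "e \<in> arcs (F (n - 1))"
    \<comment> \<open>From \<open>q \<otimes> s = s\<close> it follows that the range projection
      \<open>r\<close> of \<open>s\<close> lies below \<open>q\<close>: the difference
      \<open>q - r\<close> is a projection and so its own witness for the order relation.\<close>
    define s q where "s = ?S e" and "q = ?P (tail (F (n - 1)) e)"
    have s: "s \<in> carrier A" "s \<otimes>\<^bsub>A\<^esub> (adj A s \<otimes>\<^bsub>A\<^esub> s) = s"
      using S_in'[OF e] SS[OF e e] SP[OF e] by (simp_all add: s_def)
    have q: "q \<in> carrier A" "adj A q = q" "q \<otimes>\<^bsub>A\<^esub> q = q"
      using proj[OF F_arcs(2)[OF e]] by (simp_all add: projection_def q_def)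
    have qs: "q \<otimes>\<^bsub>A\<^esub> s = s" using PS[OF e] by (simp add: s_def q_def)
    define r where "r = s \<otimes>\<^bsub>A\<^esub> adj A s"
    have r: "r \<in> carrier A" "adj A r = r" "r \<otimes>\<^bsub>A\<^esub> r = r" "q \<otimes>\<^bsub>A\<^esub> r = r"
      using s q(1) qs by (simp_all add: r_def adj_mult flip: mult_assoc)
    have "adj A (q \<otimes>\<^bsub>A\<^esub> r) = adj A r" using r(4) by simp
    then have rq: "r \<otimes>\<^bsub>A\<^esub> q = r" using r(1,2) q(1,2) by (simp add: adj_mult)
    have "(q \<ominus>\<^bsub>A\<^esub> r) \<otimes>\<^bsub>A\<^esub> (q \<ominus>\<^bsub>A\<^esub> r) = q \<ominus>\<^bsub>A\<^esub> r"
    proof -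
      have "(q \<ominus>\<^bsub>A\<^esub> r) \<otimes>\<^bsub>A\<^esub> (q \<ominus>\<^bsub>A\<^esub> r) = (q \<ominus>\<^bsub>A\<^esub> r) \<ominus>\<^bsub>A\<^esub> (r \<ominus>\<^bsub>A\<^esub> r)"
        using r q(1,3) rq by (simp add: minus_mult mult_minus)
      then show ?thesis using r(1) q(1) by (simp add: M.minus_eq M.r_neg)
    qed
    then have "q \<ominus>\<^bsub>A\<^esub> r = adj A (q \<ominus>\<^bsub>A\<^esub> r) \<otimes>\<^bsub>A\<^esub> (q \<ominus>\<^bsub>A\<^esub> r)"
      using r(1,2) q(1,2) by (simp add: adj_minus)
    then have "cstar_le A r q" using r(1,2) q(1,2) unfolding cstar_le_def by auto
    then show "cstar_le A (?S e \<otimes>\<^bsub>A\<^esub> adj A (?S e)) (?P (tail (F (n - 1)) e))" by (simp only: r_def s_def q_def)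
  next
    fix v assume "v \<in> verts (F (n - 1))" "finite (out_arcs (F (n - 1)) v) \<and> out_arcs (F (n - 1)) v \<noteq> {}"
    then show "?P v = (\<Oplus>\<^bsub>A\<^esub>e\<in>out_arcs (F (n - 1)) v. ?S e \<otimes>\<^bsub>A\<^esub> adj A (?S e))"
      using F_out_arcs by blast
  qed
qed

text \<open>Puts the prescribed values into the shape of the universal property, one equation per
  vertex and edge, so that uniqueness transfers along with existence.\<close>

lemma q_values_iff:
  assumes "1 \<le> n"
  shows "q_values n P S B P' S' p \<longleftrightarrow>
    (\<forall>v\<in>verts (F n). p (P v) = (if v = n + 1 then \<zero>\<^bsub>B\<^esub> else P' v)) \<and>
    (\<forall>e\<in>arcs (F n). p (S e) = (if head (F n) e = n + 1 then \<zero>\<^bsub>B\<^esub> else S' e))"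
proof -
  have "(\<forall>v\<in>verts (F n). p (P v) = (if v = n + 1 then \<zero>\<^bsub>B\<^esub> else P' v)) \<longleftrightarrow>
      p (P (n + 1)) = \<zero>\<^bsub>B\<^esub> \<and> (\<forall>i. 1 \<le> i \<and> i \<le> n \<longrightarrow> p (P i) = P' i)"
  proof -
    have "verts (F n) = insert (n + 1) {1..n}" by (auto simp: F_simps)
    then show ?thesis by auto
  qed
  moreover have "(\<forall>e\<in>arcs (F n). p (S e) = (if head (F n) e = n + 1 then \<zero>\<^bsub>B\<^esub> else S' e)) \<longleftrightarrow>
      (\<forall>i m. 1 \<le> i \<and> i \<le> n \<longrightarrow> p (S (i, n + 1, m)) = \<zero>\<^bsub>B\<^esub>) \<and>
      (\<forall>i j m. 1 \<le> i \<and> i < j \<and> j \<le> n \<longrightarrow> p (S (i, j, m)) = S' (i, j, m))"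
    by (fastforce simp: F_def le_Suc_eq)
  ultimately show ?thesis by (auto simp: q_values_def)
qed

text \<open>The counterpart of \<open>q_values_iff\<close> for \<open>s\<close>. The assumption
  \<open>1 \<le> n\<close> identifies \<open>n - 1 + 1\<close>, the last vertex of
  \<open>F (n - 1)\<close>, with \<open>n\<close>.\<close>

lemma s_values_iff:
  assumes "1 \<le> n"
  shows "s_values n P' S' A P S s \<longleftrightarrow>
    (\<forall>v\<in>verts (F (n - 1)). s (P' v) = (if v = n then P n \<oplus>\<^bsub>A\<^esub> P (n + 1) else P v)) \<and>
    (\<forall>e\<in>arcs (F (n - 1)). s (S' e) =
      (case e of (i, k, m) \<Rightarrow> if k = n then S (i, n, m) \<oplus>\<^bsub>A\<^esub> S (i, n + 1, m) else S (i, k, m)))"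
proof -
  have n: "n - 1 + 1 = n" using assms by simp
  have "(\<forall>v\<in>verts (F (n - 1)). s (P' v) = (if v = n then P n \<oplus>\<^bsub>A\<^esub> P (n + 1) else P v)) \<longleftrightarrow>
      (\<forall>i. 1 \<le> i \<and> i \<le> n - 1 \<longrightarrow> s (P' i) = P i) \<and> s (P' n) = P n \<oplus>\<^bsub>A\<^esub> P (n + 1)"
    using assms by (auto simp: F_def n)
  moreover have "(\<forall>e\<in>arcs (F (n - 1)). s (S' e) =
      (case e of (i, k, m) \<Rightarrow> if k = n then S (i, n, m) \<oplus>\<^bsub>A\<^esub> S (i, n + 1, m) else S (i, k, m))) \<longleftrightarrow>
      (\<forall>i j m. 1 \<le> i \<and> i < j \<and> j \<le> n \<and> j \<noteq> n \<longrightarrow> s (S' (i, j, m)) = S (i, j, m)) \<and>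
      (\<forall>i m. 1 \<le> i \<and> i \<le> n - 1 \<longrightarrow> s (S' (i, n, m)) = S (i, n, m) \<oplus>\<^bsub>A\<^esub> S (i, n + 1, m))"
    using assms by (fastforce simp: F_def n)
  ultimately show ?thesis by (auto simp: s_values_def)
qed

section \<open>The split exact sequence\<close>

theorem theorem4p2:
  fixes q :: real and n :: nat
    and A B :: "'u cstar"
    and P P' :: "nat \<Rightarrow> 'u" and S S' :: "nat \<times> nat \<times> nat \<Rightarrow> 'u"
  assumes universe: "\<exists>\<iota> :: real \<Rightarrow> 'u. inj \<iota>"
    and q: "0 < q" "q < 1" and n: "1 \<le> n"
    and A: "quantum_projective_space q n A" "graph_cstar (F n) A P S"
    and B: "quantum_projective_space q (n - 1) B" "graph_cstar (F (n - 1)) B P' S'"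
  defines "K \<equiv> compact_algebra (paths_to (F n) (n + 1))"
  shows "\<exists>j p s.
    unique_star_hom K A (j_values n A P S) j \<and>
    j ` carrier K = ideal_generated A {P (n + 1)} \<and>
    unique_star_hom A B (q_values n P S B P' S') p \<and>
    short_exact K j A p B \<and>
    unique_star_hom B A (s_values n P' S' A P S) s \<and>
    (\<forall>x\<in>carrier B. p (s x) = x)"
proof -
  note gA = graph_cstarD[OF A(2)] and gB = graph_cstarD[OF B(2)]
  have uA: "unital_cstar_algebra A" and uB: "unital_cstar_algebra B"
    using gA(1) gB(1) quantum_projective_space_unital[OF A(1)] quantum_projective_space_unital[OF B(1)]
    by (simp_all add: unital_cstar_algebra_def unital_cstar_algebra_axioms_def)
  have pA: "projective_ck A n P S" and pB: "projective_ck B (n - 1) P' S'"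
    using uA uB gA(2) gB(2) by (simp_all add: projective_ck_def projective_ck_axioms_def)
  interpret A: projective_ck A n P S by (rule pA)
  interpret B: projective_ck B "n - 1" P' S' by (rule pB)
  have K: "K = compact_algebra (sink_paths n)" by (simp add: K_def sink_paths_def)

  \<comment> \<open>The inclusion \<open>j\<close> and the ideal of the sink\<close>
  obtain j where j: "star_hom (compact_algebra (sink_paths n)) A j"
    "\<And>\<alpha> \<beta>. \<lbrakk>\<alpha> \<in> sink_paths n; \<beta> \<in> sink_paths n\<rbrakk> \<Longrightarrow> j (matrix_unit (sink_paths n) \<alpha> \<beta>) = A.path_unit \<alpha> \<beta>"
    "\<And>T. T \<in> compact_operators (sink_paths n) \<Longrightarrow> nrm A (j T) = op_norm (sink_paths n) T"
    using compact_hom_exists[OF universe A(2) A.unital] by blast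
  have j_values_iff: "j_values n A P S \<psi> \<longleftrightarrow>
      (\<forall>\<alpha>\<in>sink_paths n. \<forall>\<beta>\<in>sink_paths n. \<psi> (matrix_unit (sink_paths n) \<alpha> \<beta>) = A.path_unit \<alpha> \<beta>)" for \<psi>
    by (simp add: j_values_def sink_paths_def A.path_unit_def A.path_def)
  have j_unique: "unique_star_hom K A (j_values n A P S) j"
    unfolding unique_star_hom_def j_values_iff K compact_algebra_carrier
  proof (intro conjI allI impI ballI)
    fix \<psi> T
    assume \<psi>: "star_hom (compact_algebra (sink_paths n)) A \<psi> \<and>
      (\<forall>\<alpha>\<in>sink_paths n. \<forall>\<beta>\<in>sink_paths n. \<psi> (matrix_unit (sink_paths n) \<alpha> \<beta>) = A.path_unit \<alpha> \<beta>)"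
      and T: "T \<in> compact_operators (sink_paths n)"
    show "\<psi> T = j T"
      by (rule compact_star_hom_unique[OF uA _ j(1) _ T]) (use \<psi> j(2) in simp_all)
  qed (use j(1,2) in simp_all)
  define I where "I = j ` compact_operators (sink_paths n)"
  have I_eq: "I = ideal_generated A {P (n + 1)}"
    unfolding I_def by (rule A.J_eq_ideal_generated[OF gA(3) j])
  have I: "closed_ideal I A" unfolding I_def by (rule A.J_closed_ideal[OF gA(3) j])
  have I_sub: "I \<subseteq> carrier A" and I_zero: "\<zero>\<^bsub>A\<^esub> \<in> I"
    using I by (simp_all add: closed_ideal_def)
  have I_add: "x \<oplus>\<^bsub>A\<^esub> y \<in> I" if "x \<in> I" "y \<in> I" for x y
    using I that by (simp add: closed_ideal_def)
  have I_smult: "c \<odot>\<^bsub>A\<^esub> x \<in> I" if "x \<in> I" for c x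
    using I that by (simp add: closed_ideal_def)
  have I_mult: "a \<otimes>\<^bsub>A\<^esub> x \<in> I" "x \<otimes>\<^bsub>A\<^esub> a \<in> I" if "a \<in> carrier A" "x \<in> I" for a x
    using I that by (simp_all add: closed_ideal_def)
  have I_closed: "x \<in> I" if "\<And>k. \<sigma> k \<in> I" "x \<in> carrier A" "tends_to A \<sigma> x" for \<sigma> x
    using I that unfolding closed_ideal_def by blast
  have I_adj: "adj A x \<in> I" if "x \<in> I" for x
    unfolding I_def by (rule A.J_adj[OF gA(3) j that[unfolded I_def]])
  have Pw: "P (n + 1) \<in> I" using I_eq by (auto simp: ideal_generated_def)

  \<comment> \<open>The maps \<open>p\<close> and \<open>s\<close> and the splitting\<close>
  obtain p where p: "unique_star_hom A B (q_values n P S B P' S') p"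
    using graph_cstar_unique_hom[OF A(2) gB(1) ck_family_quotient[OF pB n]]
    unfolding q_values_iff[OF n, symmetric] by blast
  obtain s where s: "unique_star_hom B A (s_values n P' S' A P S) s"
    using graph_cstar_unique_hom[OF B(2) gA(1) ck_family_section[OF pA n]]
    unfolding s_values_iff[OF n, symmetric] by blast
  have hp: "star_hom A B p" and hs: "star_hom B A s" using p s by (auto simp: unique_star_hom_def)
  have qv: "q_values n P S B P' S' p" and sv: "s_values n P' S' A P S s" using p s by (auto simp: unique_star_hom_def)
  note p_val = qv[unfolded q_values_iff[OF n]] and s_val = sv[unfolded s_values_iff[OF n]]
  note dp = star_homD[OF hp] and ds = star_homD[OF hs]
  have vn: "n \<in> verts (F n)" "n + 1 \<in> verts (F n)" "n \<in> verts (F (n - 1))" using n by (auto simp: F_simps)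
  have p_Pn: "p (P (n + 1)) = \<zero>\<^bsub>B\<^esub>" "p (P n) = P' n" using p_val vn by auto
  have ps_P: "p (s (P' v)) = P' v" if v: "v \<in> verts (F (n - 1))" for v
  proof (cases "v = n")
    case True
    then show ?thesis
      using s_val v dp(2)[OF A.P_simps(1)[OF vn(1)] A.P_simps(1)[OF vn(2)]] p_Pn B.P_simps(1)[OF vn(3)] by simp
  next
    case False
    then have "v \<in> verts (F n)" "v \<noteq> n + 1" using v n by (auto simp: F_simps)
    then show ?thesis using s_val p_val v False by simp
  qed
  have arc: "(i, k, m) \<in> arcs (F n)" "k = n \<Longrightarrow> (i, n + 1, m) \<in> arcs (F n)" "k \<noteq> n + 1"
    if "(i, k, m) \<in> arcs (F (n - 1))" for i k m
    using that n by (auto simp: F_simps)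
  have p_S: "p (S (i, k, m)) = S' (i, k, m)" "k = n \<Longrightarrow> p (S (i, n + 1, m)) = \<zero>\<^bsub>B\<^esub>"
    if "(i, k, m) \<in> arcs (F (n - 1))" for i k m
    using p_val arc[OF that] by (auto simp: F_simps(4))
  have s_S: "s (S' (i, k, m)) = (if k = n then S (i, n, m) \<oplus>\<^bsub>A\<^esub> S (i, n + 1, m) else S (i, k, m))"
    if "(i, k, m) \<in> arcs (F (n - 1))" for i k m
    using s_val that by fastforce
  have ps_S: "p (s (S' e)) = S' e" if e: "e \<in> arcs (F (n - 1))" for e
  proof -
    obtain i k m where e_eq: "e = (i, k, m)" by (cases e)
    note e' = e[unfolded e_eq]
    show ?thesis
      using s_S[OF e'] p_S[OF e'] dp(2)[OF A.S_in[OF arc(1)[OF e']] A.S_in[OF arc(2)[OF e']]] B.S_in[OF e']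
      unfolding e_eq by (cases "k = n") auto
  qed
  have ps: "p (s x) = x" if x: "x \<in> carrier B" for x
  proof -
    \<comment> \<open>The composite of \<open>s\<close> with \<open>p\<close> and the identity are
      both endomorphisms of \<open>B\<close> fixing the generators, so both coincide with the unique
      one.\<close>
    obtain \<phi> where \<phi>: "unique_star_hom B B (\<lambda>\<phi>. (\<forall>v\<in>verts (F (n - 1)). \<phi> (P' v) = P' v) \<and> (\<forall>e\<in>arcs (F (n - 1)). \<phi> (S' e) = S' e)) \<phi>"
      using graph_cstar_unique_hom[OF B(2) gB(1,2)] .
    have "star_hom B B (\<lambda>x. p (s x))" by (rule star_hom_comp[OF hs hp])
    moreover have "star_hom B B (\<lambda>x. x)" by (simp add: star_hom_def)
    ultimately show ?thesis using \<phi> x ps_P ps_S unfolding unique_star_hom_def by metis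
  qed

  \<comment> \<open>Exactness\<close>
  have sp: "x \<ominus>\<^bsub>A\<^esub> s (p x) \<in> I" if x: "x \<in> carrier A" for x
  proof -
    define C where "C = {x \<in> carrier A. x \<ominus>\<^bsub>A\<^esub> s (p x) \<in> I}"
    have spc: "s (p x) \<in> carrier A" if "x \<in> carrier A" for x using that dp(1) ds(1) by simp
    note dsp = star_homD[OF star_hom_comp[OF hp hs]]
    have I_minus: "\<ominus>\<^bsub>A\<^esub> x \<in> I" if "x \<in> I" for x
      using I_smult[OF that, of "-1"] that I_sub A.uminus_eq_smult[of x] by auto
    have "closed_star_subalgebra C A"
      unfolding closed_star_subalgebra_def
    proof (intro conjI ballI allI impI)
      show "C \<subseteq> carrier A" by (auto simp: C_def)
      have "p \<zero>\<^bsub>A\<^esub> = \<zero>\<^bsub>B\<^esub>" "s \<zero>\<^bsub>B\<^esub> = \<zero>\<^bsub>A\<^esub>"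
        using star_hom_zero[OF gA(1) gB(1) hp] star_hom_zero[OF gB(1) gA(1) hs] .
      then show "\<zero>\<^bsub>A\<^esub> \<in> C" using I_zero by (simp add: C_def A.M.minus_eq)
    next
      fix x y assume "x \<in> C" "y \<in> C"
      then have x: "x \<in> carrier A" "x \<ominus>\<^bsub>A\<^esub> s (p x) \<in> I" and y: "y \<in> carrier A" "y \<ominus>\<^bsub>A\<^esub> s (p y) \<in> I"
        by (auto simp: C_def)
      have "(x \<ominus>\<^bsub>A\<^esub> s (p x)) \<oplus>\<^bsub>A\<^esub> (y \<ominus>\<^bsub>A\<^esub> s (p y)) \<in> I" by (rule I_add[OF x(2) y(2)])
      then show "x \<oplus>\<^bsub>A\<^esub> y \<in> C"
        using x(1) y(1) dsp spc by (simp add: C_def A.add_minus_add)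
      \<comment> \<open>By \<open>mult_minus_mult\<close> the product differs from its image under
        \<open>p\<close> followed by \<open>s\<close> by the sum of these two elements of the
        ideal.\<close>
      have "(x \<ominus>\<^bsub>A\<^esub> s (p x)) \<otimes>\<^bsub>A\<^esub> y \<in> I" "s (p x) \<otimes>\<^bsub>A\<^esub> (y \<ominus>\<^bsub>A\<^esub> s (p y)) \<in> I"
        by (rule I_mult(2)[OF y(1) x(2)], rule I_mult(1)[OF spc[OF x(1)] y(2)])
      then have "(x \<ominus>\<^bsub>A\<^esub> s (p x)) \<otimes>\<^bsub>A\<^esub> y \<oplus>\<^bsub>A\<^esub> s (p x) \<otimes>\<^bsub>A\<^esub> (y \<ominus>\<^bsub>A\<^esub> s (p y)) \<in> I" by (rule I_add)
      then show "x \<otimes>\<^bsub>A\<^esub> y \<in> C"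
        using x(1) y(1) dsp spc by (simp add: C_def A.mult_minus_mult)
    next
      fix c x assume "x \<in> C"
      then have x: "x \<in> carrier A" "x \<ominus>\<^bsub>A\<^esub> s (p x) \<in> I" by (auto simp: C_def)
      have "c \<odot>\<^bsub>A\<^esub> (x \<ominus>\<^bsub>A\<^esub> s (p x)) \<in> I" by (rule I_smult[OF x(2)])
      then show "c \<odot>\<^bsub>A\<^esub> x \<in> C" using x(1) dsp spc by (simp add: C_def A.smult_minus)
    next
      fix x assume "x \<in> C"
      then have x: "x \<in> carrier A" "x \<ominus>\<^bsub>A\<^esub> s (p x) \<in> I" by (auto simp: C_def)
      have "adj A (x \<ominus>\<^bsub>A\<^esub> s (p x)) \<in> I" using I_adj x(2) .
      then show "adj A x \<in> C" using x(1) dsp spc by (simp add: C_def A.adj_minus)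
    next
      fix \<sigma> x assume *: "(\<forall>k. \<sigma> k \<in> C) \<and> x \<in> carrier A \<and> tends_to A \<sigma> x"
      then have \<sigma>: "\<And>k. \<sigma> k \<in> carrier A" "\<And>k. \<sigma> k \<ominus>\<^bsub>A\<^esub> s (p (\<sigma> k)) \<in> I" and x: "x \<in> carrier A" and lim: "tends_to A \<sigma> x"
        by (auto simp: C_def)
      have "tends_to A (\<lambda>k. s (p (\<sigma> k))) (s (p x))"
        by (rule star_hom_tends_to[OF gA(1) uA star_hom_comp[OF hp hs] lim \<sigma>(1) x])
      then have "tends_to A (\<lambda>k. \<sigma> k \<oplus>\<^bsub>A\<^esub> (-1) \<odot>\<^bsub>A\<^esub> s (p (\<sigma> k))) (x \<oplus>\<^bsub>A\<^esub> (-1) \<odot>\<^bsub>A\<^esub> s (p x))"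
        using lim \<sigma>(1) x spc by (intro A.tends_to_add A.tends_to_smult) auto
      then have "tends_to A (\<lambda>k. \<sigma> k \<ominus>\<^bsub>A\<^esub> s (p (\<sigma> k))) (x \<ominus>\<^bsub>A\<^esub> s (p x))"
        using \<sigma>(1) x spc by (simp add: A.minus_eq_smult)
      moreover have "x \<ominus>\<^bsub>A\<^esub> s (p x) \<in> carrier A" using x spc[OF x] by simp
      ultimately have "x \<ominus>\<^bsub>A\<^esub> s (p x) \<in> I" by (intro I_closed[OF \<sigma>(2)])
      then show "x \<in> C" using x by (simp add: C_def)
    qed
    moreover have "P v \<in> C" if v: "v \<in> verts (F n)" for v
    proof -
      \<comment> \<open>The sink projection lies in the ideal and is killed by \<open>p\<close>; at
        \<open>n\<close> the difference is the negative of the sink projection; all other vertex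
        projections are fixed.\<close>
      consider "v = n + 1" | "v = n" | "v \<noteq> n" "v \<in> verts (F (n - 1))" "v \<noteq> n + 1" using v n by (fastforce simp: F_simps)
      then have "P v \<ominus>\<^bsub>A\<^esub> s (p (P v)) \<in> I"
      proof cases
        case 1
        then show ?thesis using Pw p_Pn(1) star_hom_zero[OF gB(1) gA(1) hs] A.P_simps(1)[OF vn(2)] by (simp add: A.M.minus_eq)
      next
        case 2
        have "P n \<ominus>\<^bsub>A\<^esub> (P n \<oplus>\<^bsub>A\<^esub> P (n + 1)) = \<ominus>\<^bsub>A\<^esub> P (n + 1)"
          using A.P_simps(1)[OF vn(1)] A.P_simps(1)[OF vn(2)] by (simp add: A.M.minus_eq A.M.minus_add A.M.r_neg1 A.M.r_neg2)
        moreover have "s (P' n) = P n \<oplus>\<^bsub>A\<^esub> P (n + 1)" using s_val vn(3) by simp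
        ultimately show ?thesis using 2 p_Pn(2) I_minus[OF Pw] by simp
      next
        case 3
        then show ?thesis using p_val s_val v I_zero A.P_simps(1)[OF v] by (simp add: A.M.minus_eq A.M.r_neg)
      qed
      then show ?thesis using A.P_simps(1)[OF v] by (simp add: C_def)
    qed
    moreover have "S e \<in> C" if e: "e \<in> arcs (F n)" for e
    proof -
      \<comment> \<open>An edge into the sink equals its product with the sink projection, so it
        lies in the ideal.\<close>
      have last_in: "S (i, n + 1, m) \<in> I" if "(i, n + 1, m) \<in> arcs (F n)" for i m
      proof -
        have "S (i, n + 1, m) \<otimes>\<^bsub>A\<^esub> P (n + 1) \<in> I" by (rule I_mult(1)[OF A.S_in[OF that] Pw])
        then show ?thesis using A.S_mult_P[OF that vn(2)] by (simp add: F_simps(4))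
      qed
      obtain i k m where e_eq: "e = (i, k, m)" by (cases e)
      note e' = e[unfolded e_eq]
      have "S (i, k, m) \<ominus>\<^bsub>A\<^esub> s (p (S (i, k, m))) \<in> I"
      proof (cases "k = n + 1")
        case True
        then show ?thesis
          using last_in e' p_val star_hom_zero[OF gB(1) gA(1) hs] A.S_in[OF e'] by (simp add: A.M.minus_eq F_simps(4))
      next
        case False
        then have e1: "(i, k, m) \<in> arcs (F (n - 1))" using e' n by (auto simp: F_simps)
        show ?thesis
        proof (cases "k = n")
          case True
          note a = A.S_in[OF e'] A.S_in[OF arc(2)[OF e1 True]]
          have "S (i, n, m) \<ominus>\<^bsub>A\<^esub> (S (i, n, m) \<oplus>\<^bsub>A\<^esub> S (i, n + 1, m)) = \<ominus>\<^bsub>A\<^esub> S (i, n + 1, m)"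
            using a True by (simp add: A.M.minus_eq A.M.minus_add A.M.r_neg1 A.M.r_neg2)
          then show ?thesis using True p_S[OF e1] s_S[OF e1] I_minus[OF last_in[OF arc(2)[OF e1 True]]] by simp
        next
          case False
          then show ?thesis using p_S[OF e1] s_S[OF e1] I_zero A.S_in[OF e'] by (simp add: A.M.minus_eq A.M.r_neg)
        qed
      qed
      then show ?thesis using A.S_in[OF e] by (simp add: C_def e_eq)
    qed
    ultimately have "C = carrier A" using gA(3) unfolding generated_by_def by blast
    then show ?thesis using x by (auto simp: C_def)
  qed

  \<comment> \<open>The kernel is a closed ideal containing the sink projection, which gives one
    inclusion. For the other, \<open>x - s (p x)\<close> is \<open>x\<close> itself when
    \<open>p x\<close> is zero.\<close>
  have ker: "I = {x \<in> carrier A. p x = \<zero>\<^bsub>B\<^esub>}"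
  proof
    have "closed_ideal {x \<in> carrier A. p x = \<zero>\<^bsub>B\<^esub>} A"
      unfolding closed_ideal_def
    proof (intro conjI ballI allI impI)
      fix \<sigma> x assume *: "(\<forall>k. \<sigma> k \<in> {x \<in> carrier A. p x = \<zero>\<^bsub>B\<^esub>}) \<and> x \<in> carrier A \<and> tends_to A \<sigma> x"
      then have "tends_to B (\<lambda>k. p (\<sigma> k)) (p x)" by (intro star_hom_tends_to[OF gA(1) uB hp]) auto
      then have "tends_to B (\<lambda>k. \<zero>\<^bsub>B\<^esub>) (p x)" using * by simp
      then have "p x = \<zero>\<^bsub>B\<^esub>"
        using B.tends_to_unique[OF _ B.tends_to_const[OF B.M.zero_closed], of "p x"] dp(1) * by simp
      then show "x \<in> {x \<in> carrier A. p x = \<zero>\<^bsub>B\<^esub>}" using * by simp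
    qed (use dp star_hom_zero[OF gA(1) gB(1) hp] in auto)
    then show "I \<subseteq> {x \<in> carrier A. p x = \<zero>\<^bsub>B\<^esub>}"
      unfolding I_eq ideal_generated_def using p_Pn(1) A.P_simps(1)[OF vn(2)] by auto
    show "{x \<in> carrier A. p x = \<zero>\<^bsub>B\<^esub>} \<subseteq> I"
    proof clarify
      fix x assume "x \<in> carrier A" "p x = \<zero>\<^bsub>B\<^esub>"
      then show "x \<in> I"
        using sp[of x] star_hom_zero[OF gB(1) gA(1) hs] by (simp add: A.minus_eq A.minus_zero)
    qed
  qed

  have j_inj: "inj_on j (compact_operators (sink_paths n))"
  proof (rule inj_onI)
    interpret K: cstar_algebra "compact_algebra (sink_paths n)" by (rule cstar_algebra_compact)
    fix T U assume T: "T \<in> compact_operators (sink_paths n)" and U: "U \<in> compact_operators (sink_paths n)" and eq: "j T = j U"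
    let ?D = "T \<ominus>\<^bsub>compact_algebra (sink_paths n)\<^esub> U"
    have D: "?D \<in> compact_operators (sink_paths n)" using K.M.minus_closed[of T U] T U by simp
    have "j ?D = \<zero>\<^bsub>A\<^esub>"
      using star_hom_minus[OF K.cstar_algebra_axioms gA(1) j(1), of T U] T U eq star_homD(1)[OF j(1), of U]
      by (simp add: A.M.minus_eq A.M.r_neg)
    then have "nrm (compact_algebra (sink_paths n)) ?D = 0" using j(3)[OF D] by simp
    then show "T = U" using K.nrm_eq_zero[of ?D] D K.minus_eq_zero_iff[of T U] T U by simp
  qed
  have "p ` carrier A = carrier B"
  proof
    show "p ` carrier A \<subseteq> carrier B" using dp(1) by auto
    show "carrier B \<subseteq> p ` carrier A" using ps ds(1) by (metis image_eqI subsetI)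
  qed
  then have "short_exact K j A p B"
    unfolding short_exact_def K compact_algebra_carrier using j(1) hp j_inj ker by (simp add: I_def)
  moreover have "j ` carrier K = ideal_generated A {P (n + 1)}" using I_eq by (simp add: I_def K)
  ultimately show ?thesis using j_unique p s ps by blast
qed

end
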